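(* Let $K$ be a field and let $A=\sigma(K)\langle x_1,\dots,x_n\rangle$ be a skew $PBW$ extension of the field $K$ that is a Koszul algebra. Then the Poincaré series of $A$ is well-defined (i.e. each $\dim_K Ext_A^i(K,K)$ is finite and the Hilbert series of the Yoneda algebra $E(A)$ is the same for every grading making the $K$-algebra $E(A)$ a connected $\mathbb{N}$-graded algebra finitely generated in degree $1$) and is given by $$P_A(t)=(1+t)^n.$$
   Context: Skew $PBW$ extension: let $R\subseteq A$ be rings. $A=\sigma(R)\langle x_1,\dots,x_n\rangle$ is a skew $PBW$ extension of $R$ if there are finitely many $x_1,\dots,x_n\in A$ such that $A$ is a free left $R$-module with basis $\{x_1^{\alpha_1}\cdots x_n^{\alpha_n}\mid\alpha\in\mathbb{N}^n\}$; for every $1\le i\le n$ and $r\in R\setminus\{0\}$ there is $c_{i,r}\in R\setminus\{0\}$ with $x_ir-c_{i,r}x_i\in R$; and for all $1\le i,j\le n$ there is $c_{i,j}\in R\setminus\{0\}$ with $x_jx_i-c_{i,j}x_ix_j\in R+Rx_1+\cdots+Rx_n$. A $K$-algebra $B\cong K\{x_1,\dots,x_n\}/I$ is Koszul if (a) $B$ is $\mathbb{N}$-graded, connected (i.e. $B_0=K$) and finitely generated in degree one; (b) $B$ is quadratic, i.e. the two-sided ideal $I$ is finitely generated by homogeneous elements of degree $2$; (c) the lattice $L(B)$ is distributive. Here, with $F:=K\{x_1,\dots,x_n\}$ the free algebra graded by word length and $F_{\ge 1}=\bigoplus_{j\ge 1}F_j$, $L(B)$ is the sublattice, of the lattice of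 linear subspaces of $F$ with operations $+$ and $\cap$, generated by $\{F_{\ge 1}^sI^gF_{\ge 1}^h\mid s,g,h\ge 0\}$ (zeroth powers being $F$); distributive means $a\wedge(b\vee c)=(a\wedge b)\vee(a\wedge c)$. $K$ is an $A$-module via the augmentation $A\to A_0=K$ with kernel $\bigoplus_{p\ge 1}A_p$. The Yoneda algebra is $E(A)=\bigoplus_{i\ge 0}Ext_A^i(K,K)$ with the Yoneda product, a connected $\mathbb{N}$-graded $K$-algebra with $i$-th component $Ext_A^i(K,K)$, and the Poincaré series is $P_A(t)=\sum_{i\ge 0}(\dim_K Ext_A^i(K,K))t^i$. *)

theory Defs
  imports
    "Jordan_Normal_Form.VS_Connect"
    "HOL-Algebra.Generated_Rings"
    "HOL-Algebra.AbelCoset"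
    "HOL-Computational_Algebra.Formal_Power_Series"
    "HOL-Library.Poly_Mapping"
    "HOL-Library.Set_Algebras"
begin

section \<open>Skew PBW extensions\<close>

text \<open>An extension of rings \<open>R \<subseteq> A\<close> is given by an injective ring homomorphism \<open>\<iota>\<close>.\<close>

definition ring_hom_1 :: "('r::ring_1 \<Rightarrow> 'a::ring_1) \<Rightarrow> bool" where
  "ring_hom_1 \<iota> \<longleftrightarrow>
     \<iota> 1 = 1 \<and> (\<forall>r s. \<iota> (r + s) = \<iota> r + \<iota> s) \<and> (\<forall>r s. \<iota> (r * s) = \<iota> r * \<iota> s)"

definition monomial :: "(nat \<Rightarrow> 'a::ring_1) \<Rightarrow> nat list \<Rightarrow> 'a" where
  "monomial x \<alpha> = prod_list (map (\<lambda>i. x i ^ (\<alpha> ! i)) [0..<length \<alpha>])"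

text \<open>
  The variables are \<open>x 0, \<dots>, x (n - 1)\<close>.  The standard monomials are required to be a basis as
  a family indexed by the exponents in \<open>\<nat>\<^sup>n\<close>, here the lists of length \<open>n\<close>.
\<close>

definition skew_PBW ::
  "('r::ring_1 \<Rightarrow> 'a::ring_1) \<Rightarrow> nat \<Rightarrow> (nat \<Rightarrow> 'a) \<Rightarrow> bool" where
  "skew_PBW \<iota> n x \<longleftrightarrow>
     ring_hom_1 \<iota> \<and> inj \<iota> \<and>
     (\<forall>a. \<exists>!c :: nat list \<Rightarrow>\<^sub>0 'r. Poly_Mapping.keys c \<subseteq> {\<alpha>. length \<alpha> = n} \<and>
        a = (\<Sum>\<alpha>\<in>Poly_Mapping.keys c. \<iota> (Poly_Mapping.lookup c \<alpha>) * monomial x \<alpha>)) \<and>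
     (\<forall>i<n. \<forall>r. r \<noteq> 0 \<longrightarrow> (\<exists>c. c \<noteq> 0 \<and> x i * \<iota> r - \<iota> c * x i \<in> range \<iota>)) \<and>
     (\<forall>i<n. \<forall>j<n. \<exists>c. c \<noteq> 0 \<and>
        x j * x i - \<iota> c * (x i * x j) \<in> {\<iota> r + (\<Sum>k<n. \<iota> (s k) * x k) | r s. True})"


section \<open>Connected graded algebras over a field\<close>

text \<open>
  A \<open>K\<close>-algebra is a record of type \<^typ>\<open>('k, 'e) module\<close>, whose fields \<open>mult\<close> and \<open>one\<close> are its
  ring structure.  The locale \<^locale>\<open>algebra\<close> is not used: it is restricted to commutative algebras.
\<close>

definition algebra_over :: "('k::field \<Rightarrow> 'a::ring_1) \<Rightarrow> ('k, 'a) module" where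
  "algebra_over \<iota> = \<lparr>carrier = UNIV, monoid.mult = (*), one = 1, zero = 0, add = (+),
     smult = (\<lambda>c a. \<iota> c * a)\<rparr>"

definition connected_graded :: "('k::field, 'e) module \<Rightarrow> (nat \<Rightarrow> 'e set) \<Rightarrow> bool" where
  "connected_graded E H \<longleftrightarrow>
     (\<forall>i. VectorSpace.subspace class_ring (H i) E) \<and>
     (\<forall>e\<in>carrier E. \<exists>!h. (\<forall>i. h i \<in> H i) \<and> finite {i. h i \<noteq> \<zero>\<^bsub>E\<^esub>} \<and>
        e = (\<Oplus>\<^bsub>E\<^esub>i\<in>{i. h i \<noteq> \<zero>\<^bsub>E\<^esub>}. h i)) \<and>
     (\<forall>i j. \<forall>a\<in>H i. \<forall>b\<in>H j. a \<otimes>\<^bsub>E\<^esub> b \<in> H (i + j)) \<and>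
     H 0 = range (\<lambda>c. c \<odot>\<^bsub>E\<^esub> \<one>\<^bsub>E\<^esub>)"

definition fin_gen_degree_one :: "('k::field, 'e) module \<Rightarrow> (nat \<Rightarrow> 'e set) \<Rightarrow> bool" where
  "fin_gen_degree_one E H \<longleftrightarrow>
     (\<exists>X \<subseteq> H 1. finite X \<and> generate_ring E (range (\<lambda>c. c \<odot>\<^bsub>E\<^esub> \<one>\<^bsub>E\<^esub>) \<union> X) = carrier E)"

definition hilbert_series :: "('k::field, 'e) module \<Rightarrow> (nat \<Rightarrow> 'e set) \<Rightarrow> int fps" where
  "hilbert_series E H = Abs_fps (\<lambda>i. int (vectorspace.dim class_ring (E\<lparr>carrier := H i\<rparr>)))"


section \<open>The free associative algebra\<close>

text \<open>
  The free algebra is the monoid algebra of the free monoid, written additively so that the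
  multiplication of \<^typ>\<open>'w \<Rightarrow>\<^sub>0 'k\<close> is the concatenation product.  The algebra on \<open>m\<close> generators
  consists of the elements supported on words in the letters \<open>0, \<dots>, m - 1\<close>.
\<close>

datatype 'x free_monoid = Word (letters: "'x list")

instantiation free_monoid :: (type) monoid_add
begin

definition zero_free_monoid :: "'x free_monoid" where
  "zero_free_monoid = Word []"

definition plus_free_monoid :: "'x free_monoid \<Rightarrow> 'x free_monoid \<Rightarrow> 'x free_monoid" where
  "plus_free_monoid u v = Word (letters u @ letters v)"

instance
  by standard (simp_all add: zero_free_monoid_def plus_free_monoid_def)

end

type_synonym 'k free_algebra = "nat free_monoid \<Rightarrow>\<^sub>0 'k"

definition free_scalar :: "'k \<Rightarrow> 'k::field free_algebra" where
  "free_scalar c = Poly_Mapping.single 0 c"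

definition free_gen :: "nat \<Rightarrow> 'k::field free_algebra" where
  "free_gen i = Poly_Mapping.single (Word [i]) 1"

definition free_alg :: "nat \<Rightarrow> 'k::field free_algebra set" where
  "free_alg m = {p. \<forall>w\<in>Poly_Mapping.keys p. set (letters w) \<subseteq> {..<m}}"

definition free_homogeneous :: "nat \<Rightarrow> nat \<Rightarrow> 'k::field free_algebra set" where
  "free_homogeneous m j =
     {p \<in> free_alg m. \<forall>w\<in>Poly_Mapping.keys p. length (letters w) = j}"

definition free_positive :: "nat \<Rightarrow> 'k::field free_algebra set" where
  "free_positive m = {p \<in> free_alg m. \<forall>w\<in>Poly_Mapping.keys p. 1 \<le> length (letters w)}"

definition free_ideal :: "nat \<Rightarrow> 'k::field free_algebra set \<Rightarrow> bool" where
  "free_ideal m I \<longleftrightarrow> I \<subseteq> free_alg m \<and> 0 \<in> I \<and> (\<forall>p\<in>I. \<forall>q\<in>I. p + q \<in> I) \<and>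
     (\<forall>f\<in>free_alg m. \<forall>p\<in>I. f * p \<in> I \<and> p * f \<in> I)"


section \<open>Koszul algebras\<close>

definition subspace_prod ::
  "'k::field free_algebra set \<Rightarrow> 'k free_algebra set \<Rightarrow> 'k free_algebra set" where
  "subspace_prod U V =
     {(\<Sum>k<N. u k * v k) | (N::nat) u v. (\<forall>k<N. u k \<in> U) \<and> (\<forall>k<N. v k \<in> V)}"

fun subspace_power :: "nat \<Rightarrow> 'k::field free_algebra set \<Rightarrow> nat \<Rightarrow> 'k free_algebra set" where
  "subspace_power m U 0 = free_alg m"
| "subspace_power m U (Suc s) = subspace_prod (subspace_power m U s) U"

text \<open>The sum of subspaces is the elementwise \<open>+\<close> of sets.\<close>

inductive_set koszul_lattice :: "nat \<Rightarrow> 'k::field free_algebra set \<Rightarrow> 'k free_algebra set set"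
  for m :: nat and I :: "'k free_algebra set"
where
  generator: "subspace_prod
      (subspace_prod (subspace_power m (free_positive m) s) (subspace_power m I g))
      (subspace_power m (free_positive m) h) \<in> koszul_lattice m I"
| sum: "\<lbrakk>U \<in> koszul_lattice m I; V \<in> koszul_lattice m I\<rbrakk> \<Longrightarrow> U + V \<in> koszul_lattice m I"
| inter: "\<lbrakk>U \<in> koszul_lattice m I; V \<in> koszul_lattice m I\<rbrakk> \<Longrightarrow> U \<inter> V \<in> koszul_lattice m I"

definition distributive_lattice :: "'k::field free_algebra set set \<Rightarrow> bool" where
  "distributive_lattice L \<longleftrightarrow>
     (\<forall>U\<in>L. \<forall>V\<in>L. \<forall>W\<in>L. U \<inter> (V + W) = (U \<inter> V) + (U \<inter> W))"

definition presentation ::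
  "('k::field \<Rightarrow> 'a::ring_1) \<Rightarrow> nat \<Rightarrow> ('k free_algebra \<Rightarrow> 'a) \<Rightarrow> bool" where
  "presentation \<iota> m \<phi> \<longleftrightarrow>
     (\<forall>c. \<phi> (free_scalar c) = \<iota> c) \<and>
     (\<forall>p\<in>free_alg m. \<forall>q\<in>free_alg m. \<phi> (p + q) = \<phi> p + \<phi> q \<and> \<phi> (p * q) = \<phi> p * \<phi> q) \<and>
     \<phi> ` free_alg m = UNIV"

definition quadratic_ideal :: "nat \<Rightarrow> 'k::field free_algebra set \<Rightarrow> bool" where
  "quadratic_ideal m I \<longleftrightarrow> (\<exists>S. finite S \<and> S \<subseteq> free_homogeneous m 2 \<and> I = free_ideal m hull S)"

text \<open>
  The algebra \<open>A\<close> (with structure map \<open>\<iota>\<close>) is Koszul with respect to the grading \<open>G\<close>.  The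
  presentation is homogeneous and otherwise arbitrary: the number \<open>m\<close> of generators and their
  images are not tied to a given set of variables of \<open>A\<close>.
\<close>

definition koszul_algebra :: "('k::field \<Rightarrow> 'a::ring_1) \<Rightarrow> (nat \<Rightarrow> 'a set) \<Rightarrow> bool" where
  "koszul_algebra \<iota> G \<longleftrightarrow>
     ring_hom_1 \<iota> \<and> (\<forall>c a. \<iota> c * a = a * \<iota> c) \<and>
     connected_graded (algebra_over \<iota>) G \<and>
     fin_gen_degree_one (algebra_over \<iota>) G \<and>
     (\<exists>m \<phi>. presentation \<iota> m \<phi> \<and> (\<forall>i<m. \<phi> (free_gen i) \<in> G 1) \<and>
        quadratic_ideal m {p \<in> free_alg m. \<phi> p = 0} \<and>
        distributive_lattice (koszul_lattice m {p \<in> free_alg m. \<phi> p = 0}))"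

text \<open>The augmentation \<open>A \<rightarrow> A\<^sub>0 = K\<close> with kernel \<open>\<Oplus>\<^sub>p\<^sub>\<ge>\<^sub>1 A\<^sub>p\<close>.\<close>

definition augmentation :: "('k::field \<Rightarrow> 'a::ring_1) \<Rightarrow> (nat \<Rightarrow> 'a set) \<Rightarrow> 'a \<Rightarrow> 'k" where
  "augmentation \<iota> G a =
     (THE c. a - \<iota> c \<in> {(\<Sum>p=1..N. h p) | (N::nat) h. \<forall>p. h p \<in> G p})"


section \<open>Resolutions of the trivial module\<close>

locale left_module =
  fixes act :: "'a::ring_1 \<Rightarrow> 'p::ab_group_add \<Rightarrow> 'p"
  assumes act_add_right: "act a (u + v) = act a u + act a v"
    and act_add_left: "act (a + b) u = act a u + act b u"
    and act_assoc: "act (a * b) u = act a (act b u)"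
    and act_one: "act 1 u = u"

definition linear_on ::
  "('a::ring_1 \<Rightarrow> 'p::ab_group_add \<Rightarrow> 'p) \<Rightarrow> 'p set \<Rightarrow>
   ('a \<Rightarrow> 'q::ab_group_add \<Rightarrow> 'q) \<Rightarrow> ('p \<Rightarrow> 'q) \<Rightarrow> bool" where
  "linear_on act S act' f \<longleftrightarrow>
     (\<forall>u\<in>S. \<forall>v\<in>S. f (u + v) = f u + f v) \<and> (\<forall>a. \<forall>u\<in>S. f (act a u) = act' a (f u))"

definition free_submodule ::
  "('a::ring_1 \<Rightarrow> 'p::ab_group_add \<Rightarrow> 'p) \<Rightarrow> 'p set \<Rightarrow> bool" where
  "free_submodule act S \<longleftrightarrow>
     0 \<in> S \<and> (\<forall>u\<in>S. \<forall>v\<in>S. u + v \<in> S) \<and> (\<forall>a. \<forall>u\<in>S. act a u \<in> S) \<and>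
     (\<exists>B\<subseteq>S. \<forall>u\<in>S. \<exists>!c :: 'p \<Rightarrow>\<^sub>0 'a. Poly_Mapping.keys c \<subseteq> B \<and>
        u = (\<Sum>b\<in>Poly_Mapping.keys c. act (Poly_Mapping.lookup c b) b))"

text \<open>
  The modules \<open>P\<^sub>0, P\<^sub>1, \<dots>\<close> of a resolution are submodules of one ambient module (which is no
  restriction, since they embed into their direct sum); \<open>bd Q i\<close> is the map
  \<open>P\<^sub>i\<^sub>+\<^sub>1 \<rightarrow> P\<^sub>i\<close> and \<open>aug Q\<close> the map \<open>P\<^sub>0 \<rightarrow> K\<close>.
\<close>

record ('a, 'k, 'p) resolution =
  act :: "'a \<Rightarrow> 'p \<Rightarrow> 'p"
  obj :: "nat \<Rightarrow> 'p set"
  bd :: "nat \<Rightarrow> 'p \<Rightarrow> 'p"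
  aug :: "'p \<Rightarrow> 'k"

definition trivial_act :: "('a::ring_1 \<Rightarrow> 'k::field) \<Rightarrow> 'a \<Rightarrow> 'k \<Rightarrow> 'k" where
  "trivial_act \<epsilon> a c = \<epsilon> a * c"

definition free_resolution ::
  "('a::ring_1 \<Rightarrow> 'k::field) \<Rightarrow> ('a, 'k, 'p::ab_group_add) resolution \<Rightarrow> bool" where
  "free_resolution \<epsilon> Q \<longleftrightarrow>
     left_module (act Q) \<and>
     (\<forall>i. free_submodule (act Q) (obj Q i)) \<and>
     (\<forall>i. linear_on (act Q) (obj Q (Suc i)) (act Q) (bd Q i)) \<and>
     linear_on (act Q) (obj Q 0) (trivial_act \<epsilon>) (aug Q) \<and>
     aug Q ` obj Q 0 = UNIV \<and>
     bd Q 0 ` obj Q (Suc 0) = {u \<in> obj Q 0. aug Q u = 0} \<and>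
     (\<forall>i. bd Q (Suc i) ` obj Q (Suc (Suc i)) = {u \<in> obj Q (Suc i). bd Q i u = 0})"


section \<open>Ext and the Yoneda algebra\<close>

definition quotient_space :: "('k::field, 'm) module \<Rightarrow> 'm set \<Rightarrow> ('k, 'm set) module" where
  "quotient_space M N = \<lparr>carrier = a_rcosets\<^bsub>M\<^esub> N, monoid.mult = undefined, one = undefined,
     zero = N, add = set_add M,
     smult = (\<lambda>c X. \<Union>u\<in>X. N +>\<^bsub>M\<^esub> (c \<odot>\<^bsub>M\<^esub> u))\<rparr>"

definition extend_zero :: "'p set \<Rightarrow> ('p \<Rightarrow> 'k::field) \<Rightarrow> 'p \<Rightarrow> 'k" where
  "extend_zero S f = (\<lambda>u. if u \<in> S then f u else 0)"

text \<open>
  \<open>cochains \<epsilon> Q i\<close> is the \<open>K\<close>-space \<open>Hom\<^sub>A(P\<^sub>i, K)\<close>; its elements vanish outside \<open>P\<^sub>i\<close> so that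
  equality of functions is equality of homomorphisms.
\<close>

definition cochains ::
  "('a::ring_1 \<Rightarrow> 'k::field) \<Rightarrow> ('a, 'k, 'p::ab_group_add) resolution \<Rightarrow> nat \<Rightarrow>
   ('k, 'p \<Rightarrow> 'k) module" where
  "cochains \<epsilon> Q i =
     \<lparr>carrier = {f. linear_on (act Q) (obj Q i) (trivial_act \<epsilon>) f \<and> (\<forall>u. u \<notin> obj Q i \<longrightarrow> f u = 0)},
      monoid.mult = undefined, one = undefined, zero = (\<lambda>u. 0), add = (\<lambda>f g u. f u + g u),
      smult = (\<lambda>c f u. c * f u)\<rparr>"

definition cocycles ::
  "('a::ring_1 \<Rightarrow> 'k::field) \<Rightarrow> ('a, 'k, 'p::ab_group_add) resolution \<Rightarrow> nat \<Rightarrow>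
   ('p \<Rightarrow> 'k) set" where
  "cocycles \<epsilon> Q i = {f \<in> carrier (cochains \<epsilon> Q i). \<forall>u\<in>obj Q (Suc i). f (bd Q i u) = 0}"

fun coboundaries ::
  "('a::ring_1 \<Rightarrow> 'k::field) \<Rightarrow> ('a, 'k, 'p::ab_group_add) resolution \<Rightarrow> nat \<Rightarrow>
   ('p \<Rightarrow> 'k) set" where
  "coboundaries \<epsilon> Q 0 = {\<lambda>u. 0}"
| "coboundaries \<epsilon> Q (Suc i) =
     (\<lambda>g. extend_zero (obj Q (Suc i)) (g \<circ> bd Q i)) ` carrier (cochains \<epsilon> Q i)"

definition Ext ::
  "('a::ring_1 \<Rightarrow> 'k::field) \<Rightarrow> ('a, 'k, 'p::ab_group_add) resolution \<Rightarrow> nat \<Rightarrow>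
   ('k, ('p \<Rightarrow> 'k) set) module" where
  "Ext \<epsilon> Q i = quotient_space ((cochains \<epsilon> Q i)\<lparr>carrier := cocycles \<epsilon> Q i\<rparr>) (coboundaries \<epsilon> Q i)"

text \<open>\<open>F\<close> is a chain map of degree \<open>-j\<close> lifting \<open>f : P\<^sub>j \<rightarrow> K\<close>.\<close>

definition chain_lift ::
  "('a::ring_1, 'k::field, 'p::ab_group_add) resolution \<Rightarrow> nat \<Rightarrow> ('p \<Rightarrow> 'k) \<Rightarrow>
   (nat \<Rightarrow> 'p \<Rightarrow> 'p) \<Rightarrow> bool" where
  "chain_lift Q j f F \<longleftrightarrow>
     (\<forall>i. linear_on (act Q) (obj Q (j + i)) (act Q) (F i) \<and> F i ` obj Q (j + i) \<subseteq> obj Q i) \<and>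
     (\<forall>u\<in>obj Q j. aug Q (F 0 u) = f u) \<and>
     (\<forall>i. \<forall>u\<in>obj Q (Suc (j + i)). F i (bd Q (j + i) u) = bd Q i (F (Suc i) u))"

text \<open>
  The product of \<open>X = [g] \<in> Ext\<^sup>i\<close> and \<open>Y = [f] \<in> Ext\<^sup>j\<close> is the class of \<open>g \<circ> F i\<close>, for any lift
  \<open>F\<close> of \<open>f\<close>.  This class does not depend on the choices of \<open>g\<close>, \<open>f\<close> and \<open>F\<close>, so the union below
  is over a single coset.
\<close>

definition yoneda_product ::
  "('a::ring_1 \<Rightarrow> 'k::field) \<Rightarrow> ('a, 'k, 'p::ab_group_add) resolution \<Rightarrow> nat \<Rightarrow> nat \<Rightarrow>
   ('p \<Rightarrow> 'k) set \<Rightarrow> ('p \<Rightarrow> 'k) set \<Rightarrow> ('p \<Rightarrow> 'k) set" where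
  "yoneda_product \<epsilon> Q i j X Y =
     \<Union>{coboundaries \<epsilon> Q (i + j) +>\<^bsub>cochains \<epsilon> Q (i + j)\<^esub> extend_zero (obj Q (i + j)) (g \<circ> F i) | g f F.
         g \<in> X \<and> f \<in> Y \<and> chain_lift Q j f F}"

definition yoneda_algebra ::
  "('a::ring_1 \<Rightarrow> 'k::field) \<Rightarrow> ('a, 'k, 'p::ab_group_add) resolution \<Rightarrow>
   ('k, nat \<Rightarrow> ('p \<Rightarrow> 'k) set) module" where
  "yoneda_algebra \<epsilon> Q =
     \<lparr>carrier = {e. (\<forall>i. e i \<in> carrier (Ext \<epsilon> Q i)) \<and> finite {i. e i \<noteq> \<zero>\<^bsub>Ext \<epsilon> Q i\<^esub>}},
      monoid.mult = (\<lambda>e e' k. \<Oplus>\<^bsub>Ext \<epsilon> Q k\<^esub>i\<in>{..k}. yoneda_product \<epsilon> Q i (k - i) (e i) (e' (k - i))),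
      one = (\<lambda>i. if i = 0
        then coboundaries \<epsilon> Q 0 +>\<^bsub>cochains \<epsilon> Q 0\<^esub> extend_zero (obj Q 0) (aug Q)
        else \<zero>\<^bsub>Ext \<epsilon> Q i\<^esub>),
      zero = (\<lambda>i. \<zero>\<^bsub>Ext \<epsilon> Q i\<^esub>),
      add = (\<lambda>e e' i. e i \<oplus>\<^bsub>Ext \<epsilon> Q i\<^esub> e' i),
      smult = (\<lambda>c e i. c \<odot>\<^bsub>Ext \<epsilon> Q i\<^esub> e i)\<rparr>"

definition poincare_series ::
  "('a::ring_1 \<Rightarrow> 'k::field) \<Rightarrow> ('a, 'k, 'p::ab_group_add) resolution \<Rightarrow> int fps" where
  "poincare_series \<epsilon> Q = Abs_fps (\<lambda>i. int (vectorspace.dim class_ring (Ext \<epsilon> Q i)))"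

end

theory Submission
  imports
    Defs
    "HOL-Library.Function_Algebras"
    "HOL-Library.Multiset"
    "HOL-Computational_Algebra.Polynomial"
begin

text \<open>
  Distributivity of the lattice makes the Koszul complex \<open>A \<otimes> W\<^sub>i\<close>, where \<open>W\<^sub>i\<close> is the
  intersection of the spaces \<open>V\<^sup>a R V\<^sup>b\<close> with \<open>a + b + 2 = i\<close>, a minimal free resolution of \<open>K\<close>.
  Hence \<open>dim Ext\<^sup>i = dim W\<^sub>i\<close> is finite and the Hilbert series \<open>h\<close> of \<open>A\<close> satisfies
  \<open>h(t) P\<^sub>A(- t) = 1\<close>.

  The relations of a skew PBW extension form a Groebner basis, so that \<open>K\<close> also has a free resolution
  with basis indexed by the subsets of \<open>{0, \<dots>, n - 1}\<close>.  It need not be graded, but it has length \<open>n\<close>,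
  so \<open>P\<^sub>A\<close> is a polynomial of degree at most \<open>n\<close>.  Counting standard monomials shows that
  \<open>dim (A\<^sub>0 + \<dots> + A\<^sub>N)\<close> grows like \<open>N\<^sup>n\<close>, whence \<open>P\<^sub>A(- t)\<close> has a zero of order \<open>n\<close>
  at \<open>1\<close> and equals \<open>(1 - t)\<^sup>n\<close>.

  For the independence of the grading: \<open>E(A)\<close> is finite dimensional, so the elements of positive degree
  are nilpotent and the augmentation ideal is the same for all connected gradings.  If the algebra is
  generated in degree 1, the powers of this ideal determine the dimensions of the graded pieces.
\<close>

subsection \<open>Linear maps out of free modules\<close>

text \<open>The obstacle is that the two structures on \<open>A\<close> need not match: the
  variables \<open>x i\<close> need not be homogeneous for the Koszul grading, let alone of degree
  1, and the number of Koszul generators is not tied to \<open>n\<close>. So the Hilbert series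
  cannot be read off from the standard monomials. Only data that survive such a mismatch pass from
  one side to the other: the length of a resolution, and growth up to a linear change of scale. The
  latter is sharp enough because it is tested at the points \<open>1 - 1 / k\<close>, where the
  terms up to degree \<open>C * k\<close> of the series are damped by no more than a constant
  factor. Distributivity serves to split a cycle of the Koszul complex into a part that vanishes in
  \<open>A\<close> and a part that is a boundary. On the other side the augmentation may be nonzero
  on the variables, and straightening creates terms of lower degree. The boundary maps are therefore
  not written down but found by induction, with only their leading terms prescribed.\<close>

lemma left_module_zero:
  assumes "left_module ac"
  shows "ac a 0 = 0" "ac 0 u = 0"
proof -
  interpret left_module ac by fact
  show "ac a 0 = 0" using act_add_right[of a 0 0] by simp
  show "ac 0 u = 0" using act_add_left[of 0 0 u] by simp
qed

lemma left_module_sum: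
  assumes "left_module ac"
  shows "ac a (sum f A) = (\<Sum>i\<in>A. ac a (f i))"
proof -
  interpret left_module ac by fact
  show ?thesis
    by (induction A rule: infinite_finite_induct) (simp_all add: left_module_zero[OF assms] act_add_right)
qed

definition submodule_on :: "('a::ring_1 \<Rightarrow> 'p::ab_group_add \<Rightarrow> 'p) \<Rightarrow> 'p set \<Rightarrow> bool" where
  "submodule_on ac S \<longleftrightarrow> 0 \<in> S \<and> (\<forall>u\<in>S. \<forall>v\<in>S. u + v \<in> S) \<and> (\<forall>a. \<forall>u\<in>S. ac a u \<in> S)"

lemma submodule_onD:
  assumes "submodule_on ac S"
  shows "0 \<in> S" "\<And>u v. \<lbrakk>u \<in> S; v \<in> S\<rbrakk> \<Longrightarrow> u + v \<in> S" "\<And>a u. u \<in> S \<Longrightarrow> ac a u \<in> S"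
  using assms unfolding submodule_on_def by auto

lemma submodule_on_sum:
  assumes "submodule_on ac S" "\<And>i. i \<in> A \<Longrightarrow> f i \<in> S"
  shows "sum f A \<in> S"
  using assms(2)
  by (induction A rule: infinite_finite_induct) (auto intro: submodule_onD[OF assms(1)])

lemma left_module_uminus:
  assumes "left_module ac"
  shows "ac (- 1) u = - u"
proof -
  interpret left_module ac by fact
  have "ac (- 1) u + ac 1 u = 0"
    using act_add_left[of "-1" 1 u] by (simp add: left_module_zero[OF assms])
  thus ?thesis by (simp add: act_one eq_neg_iff_add_eq_0)
qed

lemma submodule_on_diff:
  assumes "left_module ac" "submodule_on ac S" "u \<in> S" "v \<in> S"
  shows "u - v \<in> S" "- v \<in> S"
  using submodule_onD(2)[OF assms(2,3), of "- v"] submodule_onD(3)[OF assms(2,4), of "- 1"]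
  by (simp_all add: left_module_uminus[OF assms(1)])

lemma free_submodule_submodule_on: "free_submodule ac S \<Longrightarrow> submodule_on ac S"
  unfolding free_submodule_def submodule_on_def by blast

lemma linear_on_add: "linear_on ac S ac' f \<Longrightarrow> u \<in> S \<Longrightarrow> v \<in> S \<Longrightarrow> f (u + v) = f u + f v"
  and linear_on_act: "linear_on ac S ac' f \<Longrightarrow> u \<in> S \<Longrightarrow> f (ac a u) = ac' a (f u)"
  unfolding linear_on_def by blast+

lemma linear_on_zero:
  assumes "linear_on ac S ac' f" "submodule_on ac S"
  shows "f 0 = 0"
  using linear_on_add[OF assms(1), of 0 0] submodule_onD(1)[OF assms(2)] by simp

lemma linear_on_sum:
  assumes "linear_on ac S ac' f" "submodule_on ac S" "\<And>i. i \<in> A \<Longrightarrow> g i \<in> S"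
  shows "f (sum g A) = (\<Sum>i\<in>A. f (g i))"
  using assms(3)
proof (induction A rule: infinite_finite_induct)
  case (insert x A)
  have "sum g A \<in> S" by (intro submodule_on_sum[OF assms(2)] insert.prems) simp
  thus ?case using insert by (simp add: linear_on_add[OF assms(1)])
qed (simp_all add: linear_on_zero[OF assms(1,2)])

lemma linear_on_diff:
  assumes "linear_on ac S ac' f" "left_module ac" "submodule_on ac S" "u \<in> S" "v \<in> S"
  shows "f (u - v) = f u - f v"
proof -
  have "u - v \<in> S" by (rule submodule_on_diff[OF assms(2-5)])
  from linear_on_add[OF assms(1) this assms(5)] show ?thesis by simp
qed

lemma linear_on_compose:
  assumes "linear_on ac S ac' f" "linear_on ac' T ac'' g" "f ` S \<subseteq> T"
  shows "linear_on ac S ac'' (\<lambda>u. g (f u))"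
  using assms unfolding linear_on_def by (simp add: image_subset_iff)

lemma linear_on_plus:
  assumes "linear_on ac S ac' f" "linear_on ac S ac' g" "left_module ac'"
  shows "linear_on ac S ac' (\<lambda>u. f u + g u)"
  using assms(1,2) left_module.act_add_right[OF assms(3)] unfolding linear_on_def
  by (simp add: algebra_simps)

lemma linear_on_minus:
  assumes "linear_on ac S ac' f" "linear_on ac S ac' g" "left_module ac'"
  shows "linear_on ac S ac' (\<lambda>u. f u - g u)"
proof -
  have "ac' a (x - y) = ac' a x - ac' a y" for a x y
    using left_module.act_add_right[OF assms(3), of a "x - y" y] by simp
  thus ?thesis
    using assms(1,2) unfolding linear_on_def by (simp add: algebra_simps)
qed

lemma linear_on_cong:
  assumes "linear_on ac S ac' f" "submodule_on ac S" "\<And>u. u \<in> S \<Longrightarrow> f u = g u"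
  shows "linear_on ac S ac' g"
  using assms unfolding linear_on_def submodule_on_def by metis

section \<open>Free bases: extending and lifting linear maps\<close>

definition free_basis :: "('a::ring_1 \<Rightarrow> 'p::ab_group_add \<Rightarrow> 'p) \<Rightarrow> 'p set \<Rightarrow> 'p set \<Rightarrow> bool" where
  "free_basis ac S B \<longleftrightarrow> submodule_on ac S \<and> B \<subseteq> S \<and>
     (\<forall>u\<in>S. \<exists>!c :: 'p \<Rightarrow>\<^sub>0 'a. Poly_Mapping.keys c \<subseteq> B \<and>
        u = (\<Sum>b\<in>Poly_Mapping.keys c. ac (Poly_Mapping.lookup c b) b))"

lemma free_submodule_iff: "free_submodule ac S \<longleftrightarrow> (\<exists>B. free_basis ac S B)"
  unfolding free_submodule_def free_basis_def submodule_on_def by blast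

lemma free_basis_linear_eq:
  assumes "free_basis ac S B" "linear_on ac S ac' f" "linear_on ac S ac' g"
    and eq: "\<And>b. b \<in> B \<Longrightarrow> f b = g b" and "u \<in> S"
  shows "f u = g u"
proof -
  have sub: "submodule_on ac S" and BS: "B \<subseteq> S" using assms(1) unfolding free_basis_def by auto
  obtain c :: "_ \<Rightarrow>\<^sub>0 _" where c: "Poly_Mapping.keys c \<subseteq> B"
    "u = (\<Sum>b\<in>Poly_Mapping.keys c. ac (Poly_Mapping.lookup c b) b)"
    using assms(1,5) unfolding free_basis_def by blast
  have mem: "ac (Poly_Mapping.lookup c b) b \<in> S" "b \<in> S" "b \<in> B" if "b \<in> Poly_Mapping.keys c" for b
    using submodule_onD(3)[OF sub] that c(1) BS by blast+
  have "f u = (\<Sum>b\<in>Poly_Mapping.keys c. f (ac (Poly_Mapping.lookup c b) b))"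
    unfolding c(2) by (rule linear_on_sum[OF assms(2) sub]) (rule mem)
  also have "\<dots> = (\<Sum>b\<in>Poly_Mapping.keys c. g (ac (Poly_Mapping.lookup c b) b))"
    using mem by (intro sum.cong refl) (simp add: linear_on_act[OF assms(2)] linear_on_act[OF assms(3)] eq)
  also have "\<dots> = g u"
    unfolding c(2) by (rule linear_on_sum[OF assms(3) sub, symmetric]) (rule mem)
  finally show ?thesis .
qed

text \<open>Coefficient vectors are unique, so the vector of a sum or a multiple is the sum or the
  multiple of the vectors. Reading the same coefficients against \<open>h\<close> is therefore
  linear.\<close>

lemma free_basis_extend:
  fixes ac :: "'a::ring_1 \<Rightarrow> 'p::ab_group_add \<Rightarrow> 'p" and ac' :: "'a \<Rightarrow> 'q::ab_group_add \<Rightarrow> 'q"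
  assumes free: "free_basis ac S B" and mod: "left_module ac" and mod': "left_module ac'"
    and sub: "submodule_on ac' T" and h: "h ` B \<subseteq> T"
  obtains f where "linear_on ac S ac' f" "f ` S \<subseteq> T" "\<And>b. b \<in> B \<Longrightarrow> f b = h b"
proof -
  define comb :: "('p \<Rightarrow>\<^sub>0 'a) \<Rightarrow> 'p" where
    "comb c = (\<Sum>b\<in>Poly_Mapping.keys c. ac (Poly_Mapping.lookup c b) b)" for c
  from free have B: "B \<subseteq> S" and subS: "submodule_on ac S"
    and rep: "\<And>u. u \<in> S \<Longrightarrow> \<exists>!c. Poly_Mapping.keys c \<subseteq> B \<and> u = comb c"
    unfolding free_basis_def comb_def by auto
  interpret M: left_module ac by fact
  interpret M': left_module ac' by fact
  define co where "co u = (THE c. Poly_Mapping.keys c \<subseteq> B \<and> u = comb c)" for u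
  have co: "Poly_Mapping.keys (co u) \<subseteq> B" "u = comb (co u)" if "u \<in> S" for u
    using theI'[OF rep[OF that]] unfolding co_def by auto
  have co_eq: "co u = c" if "u \<in> S" "Poly_Mapping.keys c \<subseteq> B" "u = comb c" for u c
    using rep[OF that(1)] co[OF that(1)] that by blast
  \<comment> \<open>Cancellation can make the keys of \<open>c + d\<close> smaller than the union of
    the keys, so all sums are compared over a common finite superset.\<close>
  have comb_super: "comb c = (\<Sum>b\<in>D. ac (Poly_Mapping.lookup c b) b)"
    if "Poly_Mapping.keys c \<subseteq> D" "finite D" for c D
    using that unfolding comb_def by (intro sum.mono_neutral_left) (auto simp: in_keys_iff left_module_zero[OF mod])
  define ext :: "('p \<Rightarrow>\<^sub>0 'a) \<Rightarrow> 'q" where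
    "ext c = (\<Sum>b\<in>Poly_Mapping.keys c. ac' (Poly_Mapping.lookup c b) (h b))" for c
  have ext_super: "ext c = (\<Sum>b\<in>D. ac' (Poly_Mapping.lookup c b) (h b))"
    if "Poly_Mapping.keys c \<subseteq> D" "finite D" for c D
    using that unfolding ext_def by (intro sum.mono_neutral_left) (auto simp: in_keys_iff left_module_zero[OF mod'])
  have add: "comb (c + d) = comb c + comb d" "ext (c + d) = ext c + ext d" for c d
  proof -
    let ?D = "Poly_Mapping.keys c \<union> Poly_Mapping.keys d"
    note k = Poly_Mapping.keys_add[of c d]
    have "comb (c + d) = (\<Sum>b\<in>?D. ac (Poly_Mapping.lookup c b) b + ac (Poly_Mapping.lookup d b) b)"
      by (simp add: comb_super[OF k] lookup_add M.act_add_left)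
    thus "comb (c + d) = comb c + comb d"
      using comb_super[of c ?D] comb_super[of d ?D] by (simp add: sum.distrib)
    have "ext (c + d) = (\<Sum>b\<in>?D. ac' (Poly_Mapping.lookup c b) (h b) + ac' (Poly_Mapping.lookup d b) (h b))"
      by (simp add: ext_super[OF k] lookup_add M'.act_add_left)
    thus "ext (c + d) = ext c + ext d"
      using ext_super[of c ?D] ext_super[of d ?D] by (simp add: sum.distrib)
  qed
  have k: "Poly_Mapping.keys (Poly_Mapping.map ((*) a) c) \<subseteq> Poly_Mapping.keys c" for a and c :: "'p \<Rightarrow>\<^sub>0 'a"
    by (auto simp: in_keys_iff Poly_Mapping.map.rep_eq when_def split: if_splits)
  have l: "Poly_Mapping.lookup (Poly_Mapping.map ((*) a) c) b = a * Poly_Mapping.lookup c b" for a b and c :: "'p \<Rightarrow>\<^sub>0 'a"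
    by (simp add: Poly_Mapping.map.rep_eq when_def)
  have scale: "comb (Poly_Mapping.map ((*) a) c) = ac a (comb c)"
      "ext (Poly_Mapping.map ((*) a) c) = ac' a (ext c)" for a c
    using comb_super[OF k] ext_super[OF k]
    by (simp_all add: comb_def[of c] ext_def[of c] l left_module_sum[OF mod] left_module_sum[OF mod']
        M.act_assoc M'.act_assoc)
  have co_add: "co (u + v) = co u + co v" if "u \<in> S" "v \<in> S" for u v
    using Poly_Mapping.keys_add[of "co u" "co v"] co[OF that(1)] co[OF that(2)]
    by (intro co_eq submodule_onD(2)[OF subS] that) (auto simp: add)
  have co_ac: "co (ac a u) = Poly_Mapping.map ((*) a) (co u)" if "u \<in> S" for a u
    using k[of a "co u"] co[OF that]
    by (intro co_eq submodule_onD(3)[OF subS] that) (auto simp: scale)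
  have f_in: "ext (co u) \<in> T" if "u \<in> S" for u
    unfolding ext_def using co(1)[OF that] h
    by (intro submodule_on_sum[OF sub] submodule_onD(3)[OF sub]) auto
  have f_b: "ext (co b) = h b" if "b \<in> B" for b
  proof -
    have "co b = Poly_Mapping.single b 1"
      using that B by (intro co_eq) (auto simp: comb_def M.act_one)
    thus ?thesis by (simp add: ext_def M'.act_one)
  qed
  have "linear_on ac S ac' (\<lambda>u. ext (co u))"
    unfolding linear_on_def by (simp add: co_add co_ac add scale)
  with f_in f_b show ?thesis by (intro that[of "\<lambda>u. ext (co u)"]) auto
qed

text \<open>Free modules are projective: preimages are chosen on a basis only, and agreement on the
  basis spreads to all of \<open>S\<close>. The chain maps and homotopies below are all built from
  this.\<close>

lemma free_submodule_lift:
  fixes ac :: "'a::ring_1 \<Rightarrow> 'p::ab_group_add \<Rightarrow> 'p" and ac' :: "'a \<Rightarrow> 'q::ab_group_add \<Rightarrow> 'q"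
    and ac'' :: "'a \<Rightarrow> 'r::ab_group_add \<Rightarrow> 'r"
  assumes free: "free_submodule ac S" and mod: "left_module ac" and mod': "left_module ac'"
    and sub: "submodule_on ac' T"
    and g: "linear_on ac' T ac'' g" and f: "linear_on ac S ac'' f" and im: "f ` S \<subseteq> g ` T"
  shows "\<exists>F. linear_on ac S ac' F \<and> F ` S \<subseteq> T \<and> (\<forall>u\<in>S. g (F u) = f u)"
proof -
  obtain B where B: "free_basis ac S B" using free free_submodule_iff by blast
  hence BS: "B \<subseteq> S" unfolding free_basis_def by auto
  define h where "h b = (SOME t. t \<in> T \<and> g t = f b)" for b
  have h: "h b \<in> T \<and> g (h b) = f b" if "b \<in> B" for b
  proof -
    have "f b \<in> g ` T" using im BS that by blast
    hence "\<exists>t. t \<in> T \<and> g t = f b" by auto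
    thus ?thesis unfolding h_def by (rule someI_ex)
  qed
  obtain F where F: "linear_on ac S ac' F" "F ` S \<subseteq> T" "\<And>b. b \<in> B \<Longrightarrow> F b = h b"
    using free_basis_extend[OF B mod mod' sub, of h] h by blast
  show ?thesis
  proof (intro exI conjI ballI)
    show "linear_on ac S ac' F" "F ` S \<subseteq> T" by fact+
    show "g (F u) = f u" if "u \<in> S" for u
      by (rule free_basis_linear_eq[OF B linear_on_compose[OF F(1) g F(2)] f _ that]) (simp add: F(3) h)
  qed
qed

subsection \<open>Comparison of resolutions\<close>

locale augmented =
  fixes \<epsilon> :: "'a::ring_1 \<Rightarrow> 'k::field"
  assumes aug_add: "\<epsilon> (a + b) = \<epsilon> a + \<epsilon> b"
    and aug_mult: "\<epsilon> (a * b) = \<epsilon> a * \<epsilon> b"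
    and aug_one: "\<epsilon> 1 = 1"
begin

lemma trivial_module: "left_module (trivial_act \<epsilon>)"
  by standard (simp_all add: trivial_act_def aug_add aug_mult aug_one algebra_simps)

lemma aug_zero: "\<epsilon> 0 = 0"
  using aug_add[of 0 0] by (metis add_cancel_left_left)

lemma aug_sum: "\<epsilon> (sum f A) = (\<Sum>i\<in>A. \<epsilon> (f i))"
  by (induction A rule: infinite_finite_induct) (simp_all add: aug_zero aug_add)

end

locale aug_resolution = augmented \<epsilon> for \<epsilon> :: "'a::ring_1 \<Rightarrow> 'k::field" +
  fixes Q :: "('a, 'k, 'p::ab_group_add) resolution"
  assumes res: "free_resolution \<epsilon> Q"
begin

lemma res_module: "left_module (act Q)"
  and res_free: "free_submodule (act Q) (obj Q i)"
  and bd_linear: "linear_on (act Q) (obj Q (Suc i)) (act Q) (bd Q i)"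
  and aug_linear: "linear_on (act Q) (obj Q 0) (trivial_act \<epsilon>) (aug Q)"
  and aug_surj: "aug Q ` obj Q 0 = UNIV"
  and exact_0: "bd Q 0 ` obj Q (Suc 0) = {u \<in> obj Q 0. aug Q u = 0}"
  and exact_Suc: "bd Q (Suc i) ` obj Q (Suc (Suc i)) = {u \<in> obj Q (Suc i). bd Q i u = 0}"
  using res unfolding free_resolution_def by auto

lemma res_sub: "submodule_on (act Q) (obj Q i)"
  by (rule free_submodule_submodule_on[OF res_free])

lemma bd_in: "u \<in> obj Q (Suc i) \<Longrightarrow> bd Q i u \<in> obj Q i"
  using exact_0 exact_Suc[of "i - 1"] by (cases i) auto

lemma bd_image: "bd Q i ` obj Q (Suc i) \<subseteq> obj Q i"
  using bd_in by blast

lemma bd_bd: "u \<in> obj Q (Suc (Suc i)) \<Longrightarrow> bd Q i (bd Q (Suc i) u) = 0"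
  using exact_Suc[of i] by blast

lemma aug_bd: "u \<in> obj Q (Suc 0) \<Longrightarrow> aug Q (bd Q 0 u) = 0"
  using exact_0 by blast

end

text \<open>For \<open>P = Q\<close> this is \<open>chain_lift\<close>; for \<open>j = 0\<close> and
  \<open>f = aug P\<close> it is a comparison map of resolutions. One notion serves the Yoneda
  product and the change of resolution.\<close>

definition lift_between ::
  "('a::ring_1, 'k::field, 'p::ab_group_add) resolution \<Rightarrow> ('a, 'k, 'q::ab_group_add) resolution \<Rightarrow>
   nat \<Rightarrow> ('p \<Rightarrow> 'k) \<Rightarrow> (nat \<Rightarrow> 'p \<Rightarrow> 'q) \<Rightarrow> bool" where
  "lift_between P Q j f F \<longleftrightarrow>
     (\<forall>i. linear_on (act P) (obj P (j + i)) (act Q) (F i) \<and> F i ` obj P (j + i) \<subseteq> obj Q i) \<and>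
     (\<forall>u\<in>obj P j. aug Q (F 0 u) = f u) \<and>
     (\<forall>i. \<forall>u\<in>obj P (Suc (j + i)). F i (bd P (j + i) u) = bd Q i (F (Suc i) u))"

lemma chain_lift_eq: "chain_lift Q = lift_between Q Q"
  unfolding chain_lift_def[abs_def] lift_between_def[abs_def] by simp

lemma lift_betweenD:
  assumes "lift_between P Q j f F"
  shows "linear_on (act P) (obj P (j + i)) (act Q) (F i)"
    "u \<in> obj P (j + i) \<Longrightarrow> F i u \<in> obj Q i"
    "u \<in> obj P j \<Longrightarrow> aug Q (F 0 u) = f u"
    "u \<in> obj P (Suc (j + i)) \<Longrightarrow> F i (bd P (j + i) u) = bd Q i (F (Suc i) u)"
  using assms unfolding lift_between_def by auto

locale resolution_pair = P: aug_resolution \<epsilon> P + Q: aug_resolution \<epsilon> Q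
  for \<epsilon> :: "'a::ring_1 \<Rightarrow> 'k::field"
    and P :: "('a, 'k, 'p::ab_group_add) resolution"
    and Q :: "('a, 'k, 'q::ab_group_add) resolution"
begin

text \<open>Each map lifts the previous one composed with the boundary, which works because the
  source is projective and the target exact; dependent choice collects the stages.\<close>

lemma lift_exists:
  assumes f: "linear_on (act P) (obj P j) (trivial_act \<epsilon>) f"
    and f0: "\<And>u. u \<in> obj P (Suc j) \<Longrightarrow> f (bd P j u) = 0"
  obtains F where "lift_between P Q j f F"
proof -
  \<comment> \<open>The clause on \<open>bd P\<close> is the invariant: the composite with the
    boundary of \<open>P\<close> already falls into the image of the boundary of \<open>Q\<close>,
    so the next stage can be lifted. For \<open>i = 0\<close> it comes from the vanishing of
    \<open>f\<close> on boundaries.\<close>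
  define A where "A i F \<longleftrightarrow> linear_on (act P) (obj P (j + i)) (act Q) F \<and> F ` obj P (j + i) \<subseteq> obj Q i \<and>
    (\<forall>u\<in>obj P (Suc (j + i)). F (bd P (j + i) u) \<in> bd Q i ` obj Q (Suc i)) \<and>
    (i = 0 \<longrightarrow> (\<forall>u\<in>obj P j. aug Q (F u) = f u))" for i F
  define R where "R i F F' \<longleftrightarrow> (\<forall>u\<in>obj P (Suc (j + i)). F (bd P (j + i) u) = bd Q i (F' u))" for i F F'
  have "\<exists>F. \<forall>i. A i (F i) \<and> R i (F i) (F (Suc i))"
  proof (rule dependent_nat_choice)
    obtain F where F: "linear_on (act P) (obj P j) (act Q) F" "F ` obj P j \<subseteq> obj Q 0"
      "\<forall>u\<in>obj P j. aug Q (F u) = f u"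
      using free_submodule_lift[OF P.res_free[of j] P.res_module Q.res_module Q.res_sub Q.aug_linear f]
      unfolding Q.aug_surj by blast
    have "F (bd P j u) \<in> bd Q 0 ` obj Q (Suc 0)" if "u \<in> obj P (Suc j)" for u
      using F(2,3) P.bd_in[OF that] f0[OF that] unfolding Q.exact_0 by auto
    with F show "\<exists>F. A 0 F" unfolding A_def by (intro exI[of _ F]) auto
  next
    fix F i assume A: "A i F"
    have lin: "linear_on (act P) (obj P (j + Suc i)) (act Q) (\<lambda>u. F (bd P (j + i) u))"
      using linear_on_compose[OF P.bd_linear _ P.bd_image, of "j + i" "act Q" F] A
      unfolding A_def add_Suc_right by blast
    have im: "(\<lambda>u. F (bd P (j + i) u)) ` obj P (j + Suc i) \<subseteq> bd Q i ` obj Q (Suc i)"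
      using A unfolding A_def by auto
    obtain F' where F': "linear_on (act P) (obj P (j + Suc i)) (act Q) F'" "F' ` obj P (j + Suc i) \<subseteq> obj Q (Suc i)"
      "\<forall>u\<in>obj P (j + Suc i). bd Q i (F' u) = F (bd P (j + i) u)"
      using free_submodule_lift[OF P.res_free P.res_module Q.res_module Q.res_sub Q.bd_linear lin im] by blast
    have "F 0 = 0"
      using A linear_on_zero[of "act P" "obj P (j + i)" "act Q" F] P.res_sub unfolding A_def by blast
    have "F' (bd P (j + Suc i) u) \<in> bd Q (Suc i) ` obj Q (Suc (Suc i))" if "u \<in> obj P (Suc (j + Suc i))" for u
    proof -
      have "bd P (j + Suc i) u \<in> obj P (j + Suc i)" using P.bd_in that by blast
      moreover have "bd P (j + i) (bd P (j + Suc i) u) = 0"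
        using P.bd_bd[of u "j + i"] that by simp
      ultimately show ?thesis
        unfolding Q.exact_Suc using F'(2) bspec[OF F'(3), of "bd P (j + Suc i) u"] \<open>F 0 = 0\<close> by auto
    qed
    hence "A (Suc i) F'" using F'(1,2) unfolding A_def by blast
    moreover have "R i F F'" using F'(3) unfolding R_def by simp
    ultimately show "\<exists>F'. A (Suc i) F' \<and> R i F F'" by blast
  qed
  then obtain F where F: "\<And>i. A i (F i)" "\<And>i. R i (F i) (F (Suc i))" by blast
  have "lift_between P Q j f F"
    unfolding lift_between_def
  proof (intro conjI allI ballI)
    fix i
    show "linear_on (act P) (obj P (j + i)) (act Q) (F i)" "F i ` obj P (j + i) \<subseteq> obj Q i"
      using F(1)[of i] unfolding A_def by blast+
    show "F i (bd P (j + i) u) = bd Q i (F (Suc i) u)" if "u \<in> obj P (Suc (j + i))" for u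
      using F(2)[of i] that unfolding R_def by blast
  next
    show "aug Q (F 0 u) = f u" if "u \<in> obj P j" for u
      using F(1)[of 0] that unfolding A_def by blast
  qed
  thus ?thesis by (rule that)
qed

text \<open>The defect \<open>D (Suc i) u - s i (bd P (j + i) u)\<close> is a cycle of
  \<open>Q\<close>, hence a boundary by exactness; projectivity turns the pointwise preimages into
  the linear map \<open>s (Suc i)\<close>.\<close>

lemma null_homotopy:
  assumes D: "lift_between P Q j (\<lambda>u. 0) D"
  obtains s where "\<And>i. linear_on (act P) (obj P (j + i)) (act Q) (s i)"
    "\<And>i u. u \<in> obj P (j + i) \<Longrightarrow> s i u \<in> obj Q (Suc i)"
    "\<And>u. u \<in> obj P j \<Longrightarrow> D 0 u = bd Q 0 (s 0 u)"
    "\<And>i u. u \<in> obj P (Suc (j + i)) \<Longrightarrow> D (Suc i) u = bd Q (Suc i) (s (Suc i) u) + s i (bd P (j + i) u)"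
proof -
  note D = lift_betweenD[OF D]
  \<comment> \<open>On boundaries of \<open>P\<close> the second term of the homotopy equation drops
    out. The clause on \<open>bd P\<close> records what remains, and it makes the next defect a
    cycle.\<close>
  define A where "A i s \<longleftrightarrow> linear_on (act P) (obj P (j + i)) (act Q) s \<and> s ` obj P (j + i) \<subseteq> obj Q (Suc i) \<and>
    (\<forall>u\<in>obj P (Suc (j + i)). bd Q i (s (bd P (j + i) u)) = D i (bd P (j + i) u)) \<and>
    (i = 0 \<longrightarrow> (\<forall>u\<in>obj P j. bd Q 0 (s u) = D 0 u))" for i s
  define R where "R i s s' \<longleftrightarrow> (\<forall>u\<in>obj P (Suc (j + i)).
    bd Q (Suc i) (s' u) = D (Suc i) u - s (bd P (j + i) u))" for i s s'
  have "\<exists>s. \<forall>i. A i (s i) \<and> R i (s i) (s (Suc i))"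
  proof (rule dependent_nat_choice)
    have lin: "linear_on (act P) (obj P j) (act Q) (D 0)" using D(1)[of 0] by simp
    have im0: "D 0 ` obj P j \<subseteq> bd Q 0 ` obj Q (Suc 0)"
      using D(2)[of _ 0] D(3) by (auto simp: Q.exact_0)
    obtain s where s: "linear_on (act P) (obj P j) (act Q) s" "s ` obj P j \<subseteq> obj Q (Suc 0)"
      "\<forall>u\<in>obj P j. bd Q 0 (s u) = D 0 u"
      using free_submodule_lift[OF P.res_free P.res_module Q.res_module Q.res_sub Q.bd_linear lin im0] by blast
    then show "\<exists>s. A 0 s" unfolding A_def using P.bd_in by (intro exI[of _ s]) auto
  next
    fix s i assume A: "A i s"
    have s_in: "s (bd P (j + i) u) \<in> obj Q (Suc i)" if "u \<in> obj P (Suc (j + i))" for u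
      using A P.bd_in[OF that] unfolding A_def by auto
    have D_in: "D (Suc i) u \<in> obj Q (Suc i)" if "u \<in> obj P (Suc (j + i))" for u
      using D(2)[of u "Suc i"] that by simp
    have lin: "linear_on (act P) (obj P (j + Suc i)) (act Q) (\<lambda>u. D (Suc i) u - s (bd P (j + i) u))"
      using linear_on_compose[OF P.bd_linear _ P.bd_image, of "j + i" "act Q" s] A
        linear_on_minus[OF D(1)[of "Suc i"] _ Q.res_module]
      unfolding A_def add_Suc_right by blast
    have im: "(\<lambda>u. D (Suc i) u - s (bd P (j + i) u)) ` obj P (j + Suc i) \<subseteq> bd Q (Suc i) ` obj Q (Suc (Suc i))"
    proof (safe, unfold Q.exact_Suc, safe)
      fix u assume "u \<in> obj P (j + Suc i)"
      hence u: "u \<in> obj P (Suc (j + i))" by simp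
      show "D (Suc i) u - s (bd P (j + i) u) \<in> obj Q (Suc i)"
        by (rule submodule_on_diff[OF Q.res_module Q.res_sub D_in[OF u] s_in[OF u]])
      have "bd Q i (D (Suc i) u - s (bd P (j + i) u)) = bd Q i (D (Suc i) u) - bd Q i (s (bd P (j + i) u))"
        by (rule linear_on_diff[OF Q.bd_linear Q.res_module Q.res_sub D_in[OF u] s_in[OF u]])
      also have "\<dots> = 0"
        using A D(4)[OF u] u unfolding A_def by simp
      finally show "bd Q i (D (Suc i) u - s (bd P (j + i) u)) = 0" .
    qed
    obtain s' where s': "linear_on (act P) (obj P (j + Suc i)) (act Q) s'" "s' ` obj P (j + Suc i) \<subseteq> obj Q (Suc (Suc i))"
      "\<forall>u\<in>obj P (j + Suc i). bd Q (Suc i) (s' u) = D (Suc i) u - s (bd P (j + i) u)"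
      using free_submodule_lift[OF P.res_free P.res_module Q.res_module Q.res_sub Q.bd_linear lin im] by blast
    have "s 0 = 0"
      using A linear_on_zero[of "act P" "obj P (j + i)" "act Q" s] P.res_sub unfolding A_def by blast
    hence "bd Q (Suc i) (s' (bd P (j + Suc i) u)) = D (Suc i) (bd P (j + Suc i) u)"
      if "u \<in> obj P (Suc (j + Suc i))" for u
      using that bspec[OF s'(3), of "bd P (j + Suc i) u"] P.bd_in[of u "j + Suc i"] P.bd_bd[of u "j + i"] by simp
    hence "A (Suc i) s'" using s'(1,2) unfolding A_def by simp
    moreover have "R i s s'" using s'(3) unfolding R_def by simp
    ultimately show "\<exists>s'. A (Suc i) s' \<and> R i s s'" by blast
  qed
  then obtain s where s: "\<And>i. A i (s i)" "\<And>i. R i (s i) (s (Suc i))" by blast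
  show ?thesis
  proof (rule that[of s])
    show "linear_on (act P) (obj P (j + i)) (act Q) (s i)" for i using s(1)[of i] unfolding A_def by auto
    show "s i u \<in> obj Q (Suc i)" if "u \<in> obj P (j + i)" for i u using s(1)[of i] that unfolding A_def by auto
    show "D 0 u = bd Q 0 (s 0 u)" if "u \<in> obj P j" for u using s(1)[of 0] that unfolding A_def by auto
    show "D (Suc i) u = bd Q (Suc i) (s (Suc i) u) + s i (bd P (j + i) u)" if "u \<in> obj P (Suc (j + i))" for i u
      using s(2)[of i] that unfolding R_def by simp
  qed
qed

lemma lift_between_minus:
  assumes "lift_between P Q j f F" "lift_between P Q j g G"
  shows "lift_between P Q j (\<lambda>u. f u - g u) (\<lambda>i u. F i u - G i u)"
  unfolding lift_between_def
proof (intro conjI allI ballI)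
  note F = lift_betweenD[OF assms(1)] and G = lift_betweenD[OF assms(2)]
  show "linear_on (act P) (obj P (j + i)) (act Q) (\<lambda>u. F i u - G i u)" for i
    by (intro linear_on_minus F G Q.res_module)
  show "(\<lambda>u. F i u - G i u) ` obj P (j + i) \<subseteq> obj Q i" for i
    using F(2) G(2) by (auto intro!: submodule_on_diff[OF Q.res_module Q.res_sub])
  show "aug Q (F 0 u - G 0 u) = f u - g u" if "u \<in> obj P j" for u
    using F(2)[of u 0] G(2)[of u 0] that
    by (simp add: linear_on_diff[OF Q.aug_linear Q.res_module Q.res_sub] F(3) G(3))
  show "F i (bd P (j + i) u) - G i (bd P (j + i) u) = bd Q i (F (Suc i) u - G (Suc i) u)"
    if "u \<in> obj P (Suc (j + i))" for i u
    using F(2)[of u "Suc i"] G(2)[of u "Suc i"] that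
    by (simp add: linear_on_diff[OF Q.bd_linear Q.res_module Q.res_sub] F(4) G(4))
qed

lemma lift_between_plus:
  assumes "lift_between P Q j f F" "lift_between P Q j g G"
  shows "lift_between P Q j (\<lambda>u. f u + g u) (\<lambda>i u. F i u + G i u)"
  unfolding lift_between_def
proof (intro conjI allI ballI)
  note F = lift_betweenD[OF assms(1)] and G = lift_betweenD[OF assms(2)]
  show "linear_on (act P) (obj P (j + i)) (act Q) (\<lambda>u. F i u + G i u)" for i
    by (intro linear_on_plus F G Q.res_module)
  show "(\<lambda>u. F i u + G i u) ` obj P (j + i) \<subseteq> obj Q i" for i
    using F(2) G(2) by (auto intro!: submodule_onD(2)[OF Q.res_sub])
  show "aug Q (F 0 u + G 0 u) = f u + g u" if "u \<in> obj P j" for u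
    using F(2)[of u 0] G(2)[of u 0] that
    by (simp add: linear_on_add[OF Q.aug_linear] F(3) G(3))
  show "F i (bd P (j + i) u) + G i (bd P (j + i) u) = bd Q i (F (Suc i) u + G (Suc i) u)"
    if "u \<in> obj P (Suc (j + i))" for i u
    using F(2)[of u "Suc i"] G(2)[of u "Suc i"] that
    by (simp add: linear_on_add[OF Q.bd_linear] F(4) G(4))
qed

end

subsection \<open>Dimensions of isomorphic vector spaces\<close>

lemma (in linear_map) iso_dim:
  assumes fd: "V.fin_dim" and surj: "T ` carrier V = carrier W"
    and ker: "\<And>v. \<lbrakk>v \<in> carrier V; T v = \<zero>\<^bsub>W\<^esub>\<rbrakk> \<Longrightarrow> v = \<zero>\<^bsub>V\<^esub>"
  shows "W.fin_dim" "W.dim = V.dim"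
proof -
  show "W.fin_dim" by (rule rank_nullity_main(2)[OF fd surj])
  have im: "imT = carrier W" using surj by (simp add: im_def)
  have k: "kerT = {\<zero>\<^bsub>V\<^esub>}"
    using ker by (auto simp: ker_def)
  interpret Z: vectorspace K "V.vs kerT"
    by (rule V.subspace_is_vs[OF kerT_is_subspace])
  have "Z.span {} = carrier (V.vs kerT)"
    using Z.span_is_subset2[of "{}"] Z.span_is_submodule[of "{}"] unfolding submodule_def by (auto simp: k)
  hence "Z.dim \<le> 0"
    unfolding Z.dim_def by (intro Least_le exI[of _ "{}"]) auto
  hence "Z.dim = 0" by simp
  moreover have "W.vs imT = W" by (simp add: im)
  ultimately show "W.dim = V.dim"
    using rank_nullity_main(1)[OF fd] by simp
qed

lemma linear_mapI:
  assumes "vectorspace K V" "vectorspace K W" "T \<in> carrier V \<rightarrow> carrier W"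
    "\<And>u v. \<lbrakk>u \<in> carrier V; v \<in> carrier V\<rbrakk> \<Longrightarrow> T (u \<oplus>\<^bsub>V\<^esub> v) = T u \<oplus>\<^bsub>W\<^esub> T v"
    "\<And>c v. \<lbrakk>c \<in> carrier K; v \<in> carrier V\<rbrakk> \<Longrightarrow> T (c \<odot>\<^bsub>V\<^esub> v) = c \<odot>\<^bsub>W\<^esub> T v"
  shows "linear_map K V W T"
  using assms unfolding linear_map_def mod_hom_def mod_hom_axioms_def LinearCombinations.module_hom_def vectorspace_def by auto

text \<open>No finiteness is assumed, because the graded pieces compared in
  \<open>hilbert_series_unique\<close> are arbitrary. The finite case is rank and nullity.\<close>

lemma dim_eq_of_iso:
  assumes V: "vectorspace K V" and W: "vectorspace K W" and bij: "bij_betw T (carrier V) (carrier W)"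
    and add: "\<And>u v. \<lbrakk>u \<in> carrier V; v \<in> carrier V\<rbrakk> \<Longrightarrow> T (u \<oplus>\<^bsub>V\<^esub> v) = T u \<oplus>\<^bsub>W\<^esub> T v"
    and smult: "\<And>c v. \<lbrakk>c \<in> carrier K; v \<in> carrier V\<rbrakk> \<Longrightarrow> T (c \<odot>\<^bsub>V\<^esub> v) = c \<odot>\<^bsub>W\<^esub> T v"
  shows "vectorspace.dim K V = vectorspace.dim K W"
proof -
  define S where "S = inv_into (carrier V) T"
  have TS: "T (S w) = w" "S w \<in> carrier V" if "w \<in> carrier W" for w
    using that bij unfolding S_def bij_betw_def by (auto intro: f_inv_into_f inv_into_into)
  have ST: "S (T v) = v" "T v \<in> carrier W" if "v \<in> carrier V" for v
    using that bij unfolding S_def bij_betw_def by auto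
  interpret V: vectorspace K V by fact
  interpret W: vectorspace K W by fact
  interpret T: linear_map K V W T
    using ST by (intro linear_mapI V W add smult) auto
  have Sadd: "S (u \<oplus>\<^bsub>W\<^esub> v) = S u \<oplus>\<^bsub>V\<^esub> S v" if "u \<in> carrier W" "v \<in> carrier W" for u v
    using add[OF TS(2)[OF that(1)] TS(2)[OF that(2)]] ST(1)[of "S u \<oplus>\<^bsub>V\<^esub> S v"] that TS by simp
  have Ssm: "S (c \<odot>\<^bsub>W\<^esub> v) = c \<odot>\<^bsub>V\<^esub> S v" if "c \<in> carrier K" "v \<in> carrier W" for c v
    using smult[OF that(1) TS(2)[OF that(2)]] ST(1)[of "c \<odot>\<^bsub>V\<^esub> S v"] that TS by simp
  interpret S: linear_map K W V S
    using TS by (intro linear_mapI V W Sadd Ssm) auto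
  have "T v = \<zero>\<^bsub>W\<^esub> \<Longrightarrow> v = \<zero>\<^bsub>V\<^esub>" if "v \<in> carrier V" for v
    using ST(1)[OF that] S.f0_is_0 by simp
  hence 1: "V.fin_dim \<Longrightarrow> W.dim = V.dim"
    using T.iso_dim(2) bij unfolding bij_betw_def by blast
  have 2: "W.fin_dim \<Longrightarrow> V.fin_dim"
    using S.rank_nullity_main(2) TS ST by force
  show ?thesis
  proof (cases "V.fin_dim \<or> W.fin_dim")
    \<comment> \<open>Without finite generating sets, both dimensions are the least number
      satisfying a predicate that never holds, hence the same unspecified number.\<close>
    case False
    hence "(\<exists>A. finite A \<and> card A = n \<and> A \<subseteq> carrier V \<and> V.gen_set A) =
      (\<exists>A. finite A \<and> card A = n \<and> A \<subseteq> carrier W \<and> W.gen_set A)" for n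
      unfolding V.fin_dim_def W.fin_dim_def by blast
    thus ?thesis unfolding V.dim_def W.dim_def by presburger
  qed (use 1 2 in auto)
qed

subsection \<open>Cochains and Ext\<close>

context aug_resolution
begin

abbreviation "cochain i \<equiv> carrier (cochains \<epsilon> Q i)"
abbreviation "cocycle i \<equiv> cocycles \<epsilon> Q i"
abbreviation "cob i \<equiv> coboundaries \<epsilon> Q i"
abbreviation "cls i z \<equiv> coboundaries \<epsilon> Q i +>\<^bsub>cochains \<epsilon> Q i\<^esub> z"

lemma cochain_iff:
  "f \<in> cochain i \<longleftrightarrow> linear_on (act Q) (obj Q i) (trivial_act \<epsilon>) f \<and> (\<forall>u. u \<notin> obj Q i \<longrightarrow> f u = 0)"
  by (simp add: cochains_def)

lemma cochain_zero: "0 \<in> cochain i"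
  unfolding cochain_iff by (simp add: linear_on_def trivial_act_def)

lemma cochain_plus: "f \<in> cochain i \<Longrightarrow> g \<in> cochain i \<Longrightarrow> f + g \<in> cochain i"
  using linear_on_plus[OF _ _ trivial_module] unfolding cochain_iff plus_fun_def by fastforce

lemma cochain_scale: "f \<in> cochain i \<Longrightarrow> (\<lambda>u. c * f u) \<in> cochain i"
  unfolding cochain_iff linear_on_def trivial_act_def by (simp add: algebra_simps)

lemma cochain_extend_zero:
  "linear_on (act Q) (obj Q i) (trivial_act \<epsilon>) f \<Longrightarrow> extend_zero (obj Q i) f \<in> cochain i"
  using linear_on_cong[OF _ res_sub, of i "trivial_act \<epsilon>" f "extend_zero (obj Q i) f"]
  unfolding cochain_iff by (simp add: extend_zero_def)

lemma cocycle_iff: "f \<in> cocycle i \<longleftrightarrow> f \<in> cochain i \<and> (\<forall>u\<in>obj Q (Suc i). f (bd Q i u) = 0)"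
  by (simp add: cocycles_def)

lemma cocycle_plus: "f \<in> cocycle i \<Longrightarrow> g \<in> cocycle i \<Longrightarrow> f + g \<in> cocycle i"
  unfolding cocycle_iff using cochain_plus by simp

lemma cocycle_scale: "f \<in> cocycle i \<Longrightarrow> (\<lambda>u. c * f u) \<in> cocycle i"
  unfolding cocycle_iff using cochain_scale by simp

lemma cocycle_zero: "0 \<in> cocycle i"
  unfolding cocycle_iff using cochain_zero by simp

lemma cob_Suc_iff:
  "f \<in> cob (Suc i) \<longleftrightarrow> (\<exists>g\<in>cochain i. f = (\<lambda>u. if u \<in> obj Q (Suc i) then g (bd Q i u) else 0))"
  by (simp add: extend_zero_def image_iff comp_def)

lemma cob_cocycle: "f \<in> cob i \<Longrightarrow> f \<in> cocycle i"
proof (cases i)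
  case 0
  thus "f \<in> cob i \<Longrightarrow> f \<in> cocycle i" using cocycle_zero by (simp add: zero_fun_def)
next
  case (Suc j)
  assume f: "f \<in> cob i"
  then obtain g where g: "g \<in> cochain j" "f = extend_zero (obj Q (Suc j)) (\<lambda>u. g (bd Q j u))"
    unfolding Suc cob_Suc_iff by (auto simp: extend_zero_def)
  have lin: "linear_on (act Q) (obj Q (Suc j)) (trivial_act \<epsilon>) (\<lambda>u. g (bd Q j u))"
    using linear_on_compose[OF bd_linear _ bd_image] g(1) unfolding cochain_iff by blast
  have g0: "g 0 = 0"
    using linear_on_zero[OF _ res_sub] g(1) unfolding cochain_iff by blast
  show "f \<in> cocycle i"
    unfolding cocycle_iff Suc g(2) using cochain_extend_zero[OF lin] bd_bd g0 by (simp add: extend_zero_def)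
qed

lemma cob_zero: "0 \<in> cob i"
proof (cases i)
  case (Suc j)
  show ?thesis unfolding Suc cob_Suc_iff using cochain_zero by (intro bexI[of _ 0]) auto
qed (simp add: zero_fun_def)

lemma cob_plus: "f \<in> cob i \<Longrightarrow> g \<in> cob i \<Longrightarrow> f + g \<in> cob i"
proof (cases i)
  case (Suc j)
  assume "f \<in> cob i" "g \<in> cob i"
  then obtain h k where "h \<in> cochain j" "k \<in> cochain j"
    "f = (\<lambda>u. if u \<in> obj Q i then h (bd Q j u) else 0)"
    "g = (\<lambda>u. if u \<in> obj Q i then k (bd Q j u) else 0)"
    unfolding Suc cob_Suc_iff by blast
  thus "f + g \<in> cob i" unfolding Suc cob_Suc_iff
    by (intro bexI[of _ "h + k"] cochain_plus) auto
qed (simp add: zero_fun_def plus_fun_def)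

lemma cob_scale: "f \<in> cob i \<Longrightarrow> (\<lambda>u. c * f u) \<in> cob i"
proof (cases i)
  case (Suc j)
  assume "f \<in> cob i"
  then obtain h where "h \<in> cochain j"
    "f = (\<lambda>u. if u \<in> obj Q i then h (bd Q j u) else 0)"
    unfolding Suc cob_Suc_iff by blast
  thus "(\<lambda>u. c * f u) \<in> cob i" unfolding Suc cob_Suc_iff
    by (intro bexI[of _ "\<lambda>u. c * h u"] cochain_scale) auto
qed simp

lemma cob_uminus: "f \<in> cob i \<Longrightarrow> - f \<in> cob i"
  using cob_scale[of f i "- 1"] by (simp add: fun_Compl_def)

lemma cob_minus: "f \<in> cob i \<Longrightarrow> g \<in> cob i \<Longrightarrow> f - g \<in> cob i"
  using cob_plus[of f i "- g"] cob_uminus[of g i] by simp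

lemma cocycle_minus: "f \<in> cocycle i \<Longrightarrow> g \<in> cocycle i \<Longrightarrow> f - g \<in> cocycle i"
  using cocycle_plus[of f i "\<lambda>u. - 1 * g u"] cocycle_scale[of g i "- 1"]
  by (simp add: plus_fun_def fun_diff_def)

section \<open>Ext as the vector space of cocycles modulo coboundaries\<close>

lemma cls_eq: "cls i z = {b + z | b. b \<in> cob i}"
  by (auto simp: a_r_coset_def' cochains_def plus_fun_def)

lemma mem_cls: "z' \<in> cls i z \<longleftrightarrow> z' - z \<in> cob i"
proof
  show "z' \<in> cls i z \<Longrightarrow> z' - z \<in> cob i" unfolding cls_eq by auto
  show "z' - z \<in> cob i \<Longrightarrow> z' \<in> cls i z" unfolding cls_eq by (intro CollectI exI[of _ "z' - z"]) simp
qed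

lemma cls_eq_iff: "cls i z = cls i z' \<longleftrightarrow> z - z' \<in> cob i"
proof
  assume "cls i z = cls i z'"
  moreover have "z \<in> cls i z" using cob_zero by (simp add: mem_cls)
  ultimately show "z - z' \<in> cob i" using mem_cls by blast
next
  assume *: "z - z' \<in> cob i"
  have "x - z \<in> cob i \<longleftrightarrow> x - z' \<in> cob i" for x
    using cob_plus[OF _ *, of "x - z"] cob_minus[OF _ *, of "x - z'"] by (auto simp: algebra_simps)
  thus "cls i z = cls i z'" by (intro Set.set_eqI) (simp add: mem_cls)
qed

lemma cls_eqI: "z - z' \<in> cob i \<Longrightarrow> cls i z = cls i z'"
  by (simp add: cls_eq_iff)

lemma cls_cob: "z \<in> cob i \<Longrightarrow> cls i z = cob i"
  using cls_eq_iff[of i z 0] by (simp add: cls_eq)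

lemma carrier_Ext: "carrier (Ext \<epsilon> Q i) = cls i ` cocycle i"
  by (auto simp: Ext_def quotient_space_def A_RCOSETS_def' a_r_coset_def' cochains_def)

lemma zero_Ext: "\<zero>\<^bsub>Ext \<epsilon> Q i\<^esub> = cls i 0"
  using cls_cob[OF cob_zero] by (simp add: Ext_def quotient_space_def)

lemma add_Ext: "cls i z \<oplus>\<^bsub>Ext \<epsilon> Q i\<^esub> cls i z' = cls i (z + z')"
proof -
  have "cls i z \<oplus>\<^bsub>Ext \<epsilon> Q i\<^esub> cls i z' = {x + y | x y. x \<in> cls i z \<and> y \<in> cls i z'}"
    by (auto simp: Ext_def quotient_space_def set_add_def' cochains_def plus_fun_def)
  also have "\<dots> = cls i (z + z')"
  proof (rule Set.set_eqI, rule iffI)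
    fix w assume "w \<in> {x + y | x y. x \<in> cls i z \<and> y \<in> cls i z'}"
    then obtain x y where w: "w = x + y" "x - z \<in> cob i" "y - z' \<in> cob i" by (auto simp: mem_cls)
    have e: "w - (z + z') = (x - z) + (y - z')" by (simp add: w algebra_simps)
    show "w \<in> cls i (z + z')" unfolding mem_cls e by (rule cob_plus[OF w(2,3)])
  next
    fix w assume "w \<in> cls i (z + z')"
    hence "w - z' - z \<in> cob i" by (simp add: mem_cls algebra_simps)
    thus "w \<in> {x + y | x y. x \<in> cls i z \<and> y \<in> cls i z'}"
      using cob_zero by (intro CollectI exI[of _ "w - z'"] exI[of _ z']) (simp add: mem_cls)
  qed
  finally show ?thesis .
qed

text \<open>In \<open>quotient_space\<close> a multiple of a coset is a union over all its
  representatives. Coboundaries are closed under scaling, so every representative contributes the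
  same coset, and \<open>z\<close> itself is one of them.\<close>

lemma smult_Ext: "c \<odot>\<^bsub>Ext \<epsilon> Q i\<^esub> cls i z = cls i (\<lambda>u. c * z u)"
proof -
  have "c \<odot>\<^bsub>Ext \<epsilon> Q i\<^esub> cls i z = (\<Union>x\<in>cls i z. cls i (\<lambda>u. c * x u))"
    by (auto simp: Ext_def quotient_space_def a_r_coset_def' cochains_def)
  also have "\<dots> = (\<Union>x\<in>cls i z. cls i (\<lambda>u. c * z u))"
  proof (intro SUP_cong refl cls_eqI)
    fix x assume "x \<in> cls i z"
    hence "(\<lambda>u. c * (x - z) u) \<in> cob i" unfolding mem_cls by (rule cob_scale)
    thus "(\<lambda>u. c * x u) - (\<lambda>u. c * z u) \<in> cob i"
      by (simp add: fun_diff_def algebra_simps)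
  qed
  also have "\<dots> = cls i (\<lambda>u. c * z u)" using cob_zero mem_cls[of z i z] by auto
  finally show ?thesis .
qed

lemma Ext_vectorspace: "vectorspace class_ring (Ext \<epsilon> Q i)"
proof -
  have e: "(\<lambda>u. a * b * f u) = (\<lambda>u. a * (b * f u))"
    "(\<lambda>u. (a + b) * f u) = (\<lambda>u. a * f u) + (\<lambda>u. b * f u)"
    "(\<lambda>u. a * (f u + g u)) = (\<lambda>u. a * f u) + (\<lambda>u. a * g u)" for a b :: 'k and f g :: "'p \<Rightarrow> 'k"
    by (auto simp: algebra_simps)
  have neg: "\<exists>w\<in>carrier (Ext \<epsilon> Q i). v \<oplus>\<^bsub>Ext \<epsilon> Q i\<^esub> w = \<zero>\<^bsub>Ext \<epsilon> Q i\<^esub>"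
    if "v \<in> carrier (Ext \<epsilon> Q i)" for v
  proof -
    obtain z where z: "z \<in> cocycle i" "v = cls i z" using \<open>v \<in> _\<close> unfolding carrier_Ext by blast
    have "0 - z \<in> cocycle i" by (rule cocycle_minus[OF cocycle_zero z(1)])
    thus ?thesis
      unfolding carrier_Ext z(2) zero_Ext
      by (intro bexI[of _ "cls i (0 - z)"]) (auto simp: add_Ext)
  qed
  have class_cring: "cring (class_ring :: 'k ring)" ..
  \<comment> \<open>Quantifiers over cosets become quantifiers over cocycles, so that each axiom
    reduces to a pointwise identity of functions.\<close>
  have all: "(\<forall>v\<in>carrier (Ext \<epsilon> Q i). R v) \<longleftrightarrow> (\<forall>z\<in>cocycle i. R (cls i z))" for R
    unfolding carrier_Ext by blast
  have mem: "z \<in> cocycle i \<Longrightarrow> cls i z \<in> carrier (Ext \<epsilon> Q i)" for z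
    unfolding carrier_Ext by blast
  have "Module.module class_ring (Ext \<epsilon> Q i)"
  proof (rule module_criteria)
    let ?E = "Ext \<epsilon> Q i" and ?K = "class_ring :: 'k ring"
    show "\<forall>v\<in>carrier ?E. \<exists>w\<in>carrier ?E. v \<oplus>\<^bsub>?E\<^esub> w = \<zero>\<^bsub>?E\<^esub>" using neg by blast
    show "\<zero>\<^bsub>?E\<^esub> \<in> carrier ?E" unfolding zero_Ext by (rule mem[OF cocycle_zero])
    have "\<forall>v\<in>carrier ?E. \<forall>w\<in>carrier ?E. v \<oplus>\<^bsub>?E\<^esub> w \<in> carrier ?E \<and> v \<oplus>\<^bsub>?E\<^esub> w = w \<oplus>\<^bsub>?E\<^esub> v"
      unfolding all add_Ext by (auto intro: mem cocycle_plus simp: add.commute)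
    thus "\<forall>v w. v \<in> carrier ?E \<and> w \<in> carrier ?E \<longrightarrow> v \<oplus>\<^bsub>?E\<^esub> w \<in> carrier ?E"
      "\<forall>v w. v \<in> carrier ?E \<and> w \<in> carrier ?E \<longrightarrow> v \<oplus>\<^bsub>?E\<^esub> w = w \<oplus>\<^bsub>?E\<^esub> v" by blast+
    have "\<forall>c. \<forall>v\<in>carrier ?E. c \<odot>\<^bsub>?E\<^esub> v \<in> carrier ?E"
      unfolding all smult_Ext by (auto intro: mem cocycle_scale)
    thus "\<forall>c v. c \<in> carrier ?K \<and> v \<in> carrier ?E \<longrightarrow> c \<odot>\<^bsub>?E\<^esub> v \<in> carrier ?E" by blast
    have "\<forall>v\<in>carrier ?E. \<forall>w\<in>carrier ?E. \<forall>x\<in>carrier ?E. v \<oplus>\<^bsub>?E\<^esub> w \<oplus>\<^bsub>?E\<^esub> x = v \<oplus>\<^bsub>?E\<^esub> (w \<oplus>\<^bsub>?E\<^esub> x)"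
      unfolding all add_Ext by (simp add: add.assoc)
    thus "\<forall>v w x. v \<in> carrier ?E \<and> w \<in> carrier ?E \<and> x \<in> carrier ?E \<longrightarrow>
        v \<oplus>\<^bsub>?E\<^esub> w \<oplus>\<^bsub>?E\<^esub> x = v \<oplus>\<^bsub>?E\<^esub> (w \<oplus>\<^bsub>?E\<^esub> x)" by blast
    show "\<forall>v\<in>carrier ?E. v \<oplus>\<^bsub>?E\<^esub> \<zero>\<^bsub>?E\<^esub> = v" unfolding all zero_Ext add_Ext by simp
    have "\<forall>a b. \<forall>v\<in>carrier ?E. a \<otimes>\<^bsub>?K\<^esub> b \<odot>\<^bsub>?E\<^esub> v = a \<odot>\<^bsub>?E\<^esub> (b \<odot>\<^bsub>?E\<^esub> v) \<and>
        (a \<oplus>\<^bsub>?K\<^esub> b) \<odot>\<^bsub>?E\<^esub> v = a \<odot>\<^bsub>?E\<^esub> v \<oplus>\<^bsub>?E\<^esub> b \<odot>\<^bsub>?E\<^esub> v"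
      unfolding all smult_Ext add_Ext class_ring_simps e(1,2) by simp
    thus "\<forall>a b v. a \<in> carrier ?K \<and> b \<in> carrier ?K \<and> v \<in> carrier ?E \<longrightarrow>
          a \<otimes>\<^bsub>?K\<^esub> b \<odot>\<^bsub>?E\<^esub> v = a \<odot>\<^bsub>?E\<^esub> (b \<odot>\<^bsub>?E\<^esub> v)"
      "\<forall>a b v. a \<in> carrier ?K \<and> b \<in> carrier ?K \<and> v \<in> carrier ?E \<longrightarrow>
          (a \<oplus>\<^bsub>?K\<^esub> b) \<odot>\<^bsub>?E\<^esub> v = a \<odot>\<^bsub>?E\<^esub> v \<oplus>\<^bsub>?E\<^esub> b \<odot>\<^bsub>?E\<^esub> v" by blast+
    show "\<forall>v\<in>carrier ?E. \<one>\<^bsub>?K\<^esub> \<odot>\<^bsub>?E\<^esub> v = v" unfolding all smult_Ext class_ring_simps by simp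
    have "\<forall>a. \<forall>v\<in>carrier ?E. \<forall>w\<in>carrier ?E. a \<odot>\<^bsub>?E\<^esub> (v \<oplus>\<^bsub>?E\<^esub> w) = a \<odot>\<^bsub>?E\<^esub> v \<oplus>\<^bsub>?E\<^esub> a \<odot>\<^bsub>?E\<^esub> w"
      unfolding all smult_Ext add_Ext plus_fun_apply e(3) by simp
    thus "\<forall>a v w. a \<in> carrier ?K \<and> v \<in> carrier ?E \<and> w \<in> carrier ?E \<longrightarrow>
        a \<odot>\<^bsub>?E\<^esub> (v \<oplus>\<^bsub>?E\<^esub> w) = a \<odot>\<^bsub>?E\<^esub> v \<oplus>\<^bsub>?E\<^esub> a \<odot>\<^bsub>?E\<^esub> w" by blast
  qed (rule class_cring)
  thus ?thesis unfolding vectorspace_def using class_field by auto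
qed

text \<open>\<open>T\<close> gives coordinates on the cocycles whose kernel is the space of coboundaries.\<close>

lemma Ext_dim:
  assumes add: "\<And>z z' k. \<lbrakk>z \<in> cocycle i; z' \<in> cocycle i; k < r\<rbrakk> \<Longrightarrow> T (z + z') k = T z k + T z' k"
    and scale: "\<And>c z k. \<lbrakk>z \<in> cocycle i; k < r\<rbrakk> \<Longrightarrow> T (\<lambda>u. c * z u) k = c * T z k"
    and ker: "\<And>z. \<lbrakk>z \<in> cocycle i; \<And>k. k < r \<Longrightarrow> T z k = 0\<rbrakk> \<Longrightarrow> z \<in> cob i"
    and cob: "\<And>z k. \<lbrakk>z \<in> cob i; k < r\<rbrakk> \<Longrightarrow> T z k = 0"
    and surj: "\<And>c :: nat \<Rightarrow> 'k. \<exists>z\<in>cocycle i. \<forall>k<r. T z k = c k"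
  shows "vectorspace.fin_dim class_ring (Ext \<epsilon> Q i)" "vectorspace.dim class_ring (Ext \<epsilon> Q i) = r"
proof -
  interpret E: vectorspace class_ring "Ext \<epsilon> Q i" by (rule Ext_vectorspace)
  interpret K: vec_space "TYPE('k)" r .
  obtain s where s: "\<And>c. s c \<in> cocycle i" "\<And>c k. k < r \<Longrightarrow> T (s c) k = c k"
    using surj by metis
  \<comment> \<open>The map runs from tuples to Ext, through a chosen cocycle with the given
    coordinates; in the other direction \<open>T\<close> would first have to be shown well defined
    on cosets.\<close>
  define S where "S v = cls i (s (\<lambda>k. if k < r then v $ k else 0))" for v
  have diff: "T (z - z') k = T z k - T z' k" if "z \<in> cocycle i" "z' \<in> cocycle i" "k < r" for z z' k
    using add[OF cocycle_minus[OF that(1,2)] that(2,3)] by simp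
  have cls_s: "cls i z = cls i (s c)" if "z \<in> cocycle i" "\<And>k. k < r \<Longrightarrow> T z k = c k" for z c
    using s that by (intro cls_eqI ker cocycle_minus) (auto simp: diff)
  interpret S: linear_map class_ring "module_vec TYPE('k) r" "Ext \<epsilon> Q i" S
  proof (rule linear_mapI)
    show "vectorspace class_ring (module_vec TYPE('k) r)" "vectorspace class_ring (Ext \<epsilon> Q i)" 
      by unfold_locales
    show "S \<in> carrier (module_vec TYPE('k) r) \<rightarrow> carrier (Ext \<epsilon> Q i)"
      using s unfolding S_def carrier_Ext by auto
    show "S (u \<oplus>\<^bsub>module_vec TYPE('k) r\<^esub> v) = S u \<oplus>\<^bsub>Ext \<epsilon> Q i\<^esub> S v"
      if "u \<in> carrier (module_vec TYPE('k) r)" "v \<in> carrier (module_vec TYPE('k) r)" for u v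
      unfolding S_def add_Ext using s that
      by (intro cls_s[symmetric] cocycle_plus) (auto simp: add module_vec_simps)
    show "S (c \<odot>\<^bsub>module_vec TYPE('k) r\<^esub> v) = c \<odot>\<^bsub>Ext \<epsilon> Q i\<^esub> S v"
      if "v \<in> carrier (module_vec TYPE('k) r)" for c v
      unfolding S_def smult_Ext using s that
      by (intro cls_s[symmetric] cocycle_scale) (auto simp: scale module_vec_simps)
  qed
  have surj': "S ` carrier (module_vec TYPE('k) r) = carrier (Ext \<epsilon> Q i)"
  proof
    show "carrier (Ext \<epsilon> Q i) \<subseteq> S ` carrier (module_vec TYPE('k) r)"
    proof
      fix e assume "e \<in> carrier (Ext \<epsilon> Q i)"
      then obtain z where z: "z \<in> cocycle i" "e = cls i z" unfolding carrier_Ext by blast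
      hence "e = S (vec r (T z))" unfolding S_def by (auto intro!: cls_s)
      thus "e \<in> S ` carrier (module_vec TYPE('k) r)" by (auto simp: module_vec_simps)
    qed
  qed auto
  have inj: "v = \<zero>\<^bsub>module_vec TYPE('k) r\<^esub>"
    if "v \<in> carrier (module_vec TYPE('k) r)" "S v = \<zero>\<^bsub>Ext \<epsilon> Q i\<^esub>" for v
  proof -
    have "s (\<lambda>k. if k < r then v $ k else 0) \<in> cob i"
      using that(2) unfolding S_def zero_Ext cls_eq_iff by simp
    hence "v $ k = 0" if "k < r" for k using cob[OF _ that] s(2)[OF that] that by force
    thus ?thesis using that(1) by (auto simp: module_vec_simps intro!: eq_vecI)
  qed
  from S.iso_dim[OF K.fin_dim surj' inj] show "E.fin_dim" "E.dim = r" by (auto simp: K.dim_is_n)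
qed

end

lemma lift_between_compose:
  assumes "lift_between P Q 0 (aug P) F" "lift_between Q P 0 (aug Q) G"
  shows "lift_between Q Q 0 (aug Q) (\<lambda>i u. F i (G i u))"
proof -
  note F = lift_betweenD[OF assms(1), simplified] and G = lift_betweenD[OF assms(2), simplified]
  have im: "G i ` obj Q i \<subseteq> obj P i" for i using G(2) by blast
  show ?thesis
    unfolding lift_between_def
    using linear_on_compose[OF G(1) F(1) im] F(2-4) G(2-4) by auto
qed

lemma (in aug_resolution) lift_between_id: "lift_between Q Q 0 (aug Q) (\<lambda>i u. u)"
  unfolding lift_between_def by (simp add: linear_on_def)

subsection \<open>Ext from a minimal resolution\<close>

context resolution_pair
begin

text \<open>Minimality makes every coboundary of \<open>P\<close> zero, so a cochain of
  \<open>P\<close> is already its own class and its values at the \<open>e k\<close> are free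
  coordinates. The comparison maps \<open>F\<close> and \<open>G\<close> carry this over to
  \<open>Q\<close>: the homotopy \<open>s\<close> shows that a cocycle of \<open>Q\<close> that
  vanishes after \<open>F\<close> is a coboundary, and \<open>t\<close> shows that pulling a cochain
  of \<open>P\<close> back along \<open>G\<close> and then along \<open>F\<close> returns it. The
  third conclusion is the form in which vanishing of Ext enters the comparison of gradings.\<close>

lemma Ext_dim_minimal:
  assumes minimal: "\<And>i f u. \<lbrakk>f \<in> P.cochain i; u \<in> obj P (Suc i)\<rbrakk> \<Longrightarrow> f (bd P i u) = 0"
    and e: "\<And>k. k < r \<Longrightarrow> e k \<in> obj P i"
    and uniq: "\<And>f. \<lbrakk>f \<in> P.cochain i; \<And>k. k < r \<Longrightarrow> f (e k) = 0\<rbrakk> \<Longrightarrow> f = 0"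
    and ex: "\<And>c :: nat \<Rightarrow> 'k. \<exists>f\<in>P.cochain i. \<forall>k<r. f (e k) = c k"
  shows "vectorspace.fin_dim class_ring (Ext \<epsilon> Q i)" "vectorspace.dim class_ring (Ext \<epsilon> Q i) = r"
    "r = 0 \<Longrightarrow> Q.cocycle i \<subseteq> Q.cob i"
proof -
  interpret QP: resolution_pair \<epsilon> Q P by unfold_locales
  interpret QQ: resolution_pair \<epsilon> Q Q by unfold_locales
  interpret PP: resolution_pair \<epsilon> P P by unfold_locales
  obtain F where Fl: "lift_between P Q 0 (aug P) F"
    using lift_exists[OF P.aug_linear P.aug_bd] by blast
  obtain G where Gl: "lift_between Q P 0 (aug Q) G"
    using QP.lift_exists[OF Q.aug_linear Q.aug_bd] by blast
  note F = lift_betweenD[OF Fl, simplified] and G = lift_betweenD[OF Gl, simplified]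
  have "lift_between Q Q 0 (\<lambda>u. 0) (\<lambda>i u. F i (G i u) - u)"
    using QQ.lift_between_minus[OF lift_between_compose[OF Fl Gl] Q.lift_between_id] by simp
  then obtain s where s: "\<And>i. linear_on (act Q) (obj Q i) (act Q) (s i)"
    "\<And>i u. u \<in> obj Q i \<Longrightarrow> s i u \<in> obj Q (Suc i)"
    "\<And>u. u \<in> obj Q 0 \<Longrightarrow> F 0 (G 0 u) - u = bd Q 0 (s 0 u)"
    "\<And>i u. u \<in> obj Q (Suc i) \<Longrightarrow> F (Suc i) (G (Suc i) u) - u = bd Q (Suc i) (s (Suc i) u) + s i (bd Q i u)"
    by (rule QQ.null_homotopy) (rule that, simp_all only: add_0)
  have "lift_between P P 0 (\<lambda>u. 0) (\<lambda>i u. G i (F i u) - u)"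
    using PP.lift_between_minus[OF lift_between_compose[OF Gl Fl] P.lift_between_id] by simp
  then obtain t where t: "\<And>i. linear_on (act P) (obj P i) (act P) (t i)"
    "\<And>i u. u \<in> obj P i \<Longrightarrow> t i u \<in> obj P (Suc i)"
    "\<And>u. u \<in> obj P 0 \<Longrightarrow> G 0 (F 0 u) - u = bd P 0 (t 0 u)"
    "\<And>i u. u \<in> obj P (Suc i) \<Longrightarrow> G (Suc i) (F (Suc i) u) - u = bd P (Suc i) (t (Suc i) u) + t i (bd P i u)"
    by (rule PP.null_homotopy) (rule that, simp_all only: add_0)
  have pull: "extend_zero (obj P j) (\<lambda>u. f (g u)) \<in> P.cochain j"
    if "f \<in> Q.cochain l" "linear_on (act P) (obj P j) (act Q) g" "\<And>u. u \<in> obj P j \<Longrightarrow> g u \<in> obj Q l" for f g j l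
  proof (rule P.cochain_extend_zero)
    show "linear_on (act P) (obj P j) (trivial_act \<epsilon>) (\<lambda>u. f (g u))"
      by (rule linear_on_compose[OF that(2), where T="obj Q l"]) (use that in \<open>auto simp: Q.cochain_iff\<close>)
  qed
  have pullQ: "extend_zero (obj Q j) (\<lambda>u. f (g u)) \<in> Q.cochain j"
    if "f \<in> P.cochain l" "linear_on (act Q) (obj Q j) (act P) g" "\<And>u. u \<in> obj Q j \<Longrightarrow> g u \<in> obj P l" for f g j l
  proof (rule Q.cochain_extend_zero)
    show "linear_on (act Q) (obj Q j) (trivial_act \<epsilon>) (\<lambda>u. f (g u))"
      by (rule linear_on_compose[OF that(2), where T="obj P l"]) (use that in \<open>auto simp: P.cochain_iff\<close>)
  qed
  have pullQQ: "extend_zero (obj Q j) (\<lambda>u. f (g u)) \<in> Q.cochain j"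
    if "f \<in> Q.cochain l" "linear_on (act Q) (obj Q j) (act Q) g" "\<And>u. u \<in> obj Q j \<Longrightarrow> g u \<in> obj Q l" for f g j l
  proof (rule Q.cochain_extend_zero)
    show "linear_on (act Q) (obj Q j) (trivial_act \<epsilon>) (\<lambda>u. f (g u))"
      by (rule linear_on_compose[OF that(2), where T="obj Q l"]) (use that in \<open>auto simp: Q.cochain_iff\<close>)
  qed
  have pullPP: "extend_zero (obj P j) (\<lambda>u. f (g u)) \<in> P.cochain j"
    if "f \<in> P.cochain l" "linear_on (act P) (obj P j) (act P) g" "\<And>u. u \<in> obj P j \<Longrightarrow> g u \<in> obj P l" for f g j l
  proof (rule P.cochain_extend_zero)
    show "linear_on (act P) (obj P j) (trivial_act \<epsilon>) (\<lambda>u. f (g u))"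
      by (rule linear_on_compose[OF that(2), where T="obj P l"]) (use that in \<open>auto simp: P.cochain_iff\<close>)
  qed
  have addQ: "z (x + y) = z x + z y" if "z \<in> Q.cochain j" "x \<in> obj Q j" "y \<in> obj Q j" for z x y j
    using that linear_on_add[of "act Q" "obj Q j"] unfolding Q.cochain_iff by blast
  have addP: "z (x + y) = z x + z y" if "z \<in> P.cochain j" "x \<in> obj P j" "y \<in> obj P j" for z x y j
    using that linear_on_add[of "act P" "obj P j"] unfolding P.cochain_iff by blast
  have diffQ: "z (x - y) = z x - z y" if "z \<in> Q.cochain j" "x \<in> obj Q j" "y \<in> obj Q j" for z x y j
    using that linear_on_diff[OF _ Q.res_module Q.res_sub] unfolding Q.cochain_iff by blast
  have diffP: "z (x - y) = z x - z y" if "z \<in> P.cochain j" "x \<in> obj P j" "y \<in> obj P j" for z x y j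
    using that linear_on_diff[OF _ P.res_module P.res_sub] unfolding P.cochain_iff by blast
  \<comment> \<open>Pulling a cocycle back along \<open>F\<close> and evaluating at the basis
    vectors of \<open>P\<close> gives the coordinates of its class.\<close>
  define T where "T z k = z (F i (e k))" for z :: "'q \<Rightarrow> 'k" and k :: nat
  have ker: "z \<in> Q.cob i" if z: "z \<in> Q.cocycle i" and z0: "\<And>k. k < r \<Longrightarrow> T z k = 0" for z
  proof -
    have zc: "z \<in> Q.cochain i" using z by (simp add: Q.cocycle_iff)
    have zF0: "extend_zero (obj P i) (\<lambda>u. z (F i u)) = 0"
      using uniq[OF pull[OF zc F(1) F(2)]] z0 e by (simp add: T_def extend_zero_def)
    hence zF: "z (F i u) = 0" if "u \<in> obj P i" for u
    proof -
      have "extend_zero (obj P i) (\<lambda>u. z (F i u)) u = 0" unfolding zF0 by simp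
      thus ?thesis using that by (simp add: extend_zero_def)
    qed
    show ?thesis
    proof (cases i)
      case 0
      have "z u = 0" if u: "u \<in> obj Q 0" for u
      proof -
        have GF: "F 0 (G 0 u) \<in> obj Q 0" "G 0 u \<in> obj P 0" using F(2) G(2) u by auto
        have "z (F 0 (G 0 u)) - z u = z (bd Q 0 (s 0 u))"
          using diffQ[OF zc[unfolded 0] GF(1) u] s(3)[OF u] by simp
        also have "\<dots> = 0" using z s(2)[OF u] 0 unfolding Q.cocycle_iff by blast
        finally show ?thesis using zF GF(2) 0 by simp
      qed
      moreover have "z u = 0" if "u \<notin> obj Q 0" for u using zc that 0 unfolding Q.cochain_iff by blast
      ultimately have "z = (\<lambda>u. 0)" by blast
      thus ?thesis using 0 by simp
    next
      case (Suc j)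
      \<comment> \<open>As \<open>z\<close> vanishes after \<open>F\<close> and on boundaries, the
        homotopy equation leaves \<open>z u = - z (s j (bd Q j u))\<close>: \<open>z\<close> is the
        coboundary of \<open>- h\<close>.\<close>
      define h where "h = extend_zero (obj Q j) (\<lambda>u. z (s j u))"
      have hc: "h \<in> Q.cochain j"
        unfolding h_def by (rule pullQQ[OF zc[unfolded Suc] s(1) s(2)])
      have "z u = - 1 * h (bd Q j u)" if u: "u \<in> obj Q (Suc j)" for u
      proof -
        have GF: "F (Suc j) (G (Suc j) u) \<in> obj Q (Suc j)" "G (Suc j) u \<in> obj P (Suc j)" using F(2) G(2) u by auto
        have in1: "bd Q (Suc j) (s (Suc j) u) \<in> obj Q (Suc j)" by (rule Q.bd_in[OF s(2)[OF u]])
        have in2: "s j (bd Q j u) \<in> obj Q (Suc j)" by (rule s(2)[OF Q.bd_in[OF u]])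
        have "z (F (Suc j) (G (Suc j) u)) - z u = z (bd Q (Suc j) (s (Suc j) u)) + z (s j (bd Q j u))"
          using diffQ[OF zc[unfolded Suc] GF(1) u] s(4)[OF u] addQ[OF zc[unfolded Suc] in1 in2] by simp
        also have "z (bd Q (Suc j) (s (Suc j) u)) = 0"
          using z s(2)[OF u] Suc unfolding Q.cocycle_iff by blast
        finally show ?thesis using zF GF(2) Q.bd_in[OF u] Suc by (simp add: h_def extend_zero_def eq_neg_iff_add_eq_0 neg_eq_iff_add_eq_0 add.commute)
      qed
      moreover have "z u = 0" if "u \<notin> obj Q (Suc j)" for u using zc that Suc unfolding Q.cochain_iff by blast
      ultimately have "z = (\<lambda>u. if u \<in> obj Q (Suc j) then (\<lambda>v. - 1 * h v) (bd Q j u) else 0)" by auto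
      thus ?thesis unfolding Suc Q.cob_Suc_iff by (intro bexI[OF _ Q.cochain_scale[OF hc]]) auto
    qed
  qed
  have cob: "T z k = 0" if z: "z \<in> Q.cob i" and k: "k < r" for z k
  proof (cases i)
    case 0
    thus ?thesis using z by (simp add: T_def)
  next
    case (Suc j)
    obtain g where g: "g \<in> Q.cochain j" "z = (\<lambda>u. if u \<in> obj Q (Suc j) then g (bd Q j u) else 0)"
      using z unfolding Suc Q.cob_Suc_iff by blast
    have ek: "e k \<in> obj P (Suc j)" using e[OF k] Suc by simp
    have "T z k = g (F j (bd P j (e k)))"
      using F(2)[OF ek] F(4)[OF ek] by (simp add: T_def g(2) Suc)
    also have "\<dots> = 0"
      using minimal[OF pull[OF g(1) F(1) F(2)] ek] P.bd_in[OF ek] by (simp add: extend_zero_def)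
    finally show ?thesis .
  qed
  have surj: "\<exists>z\<in>Q.cocycle i. \<forall>k<r. T z k = c k" for c
  proof -
    obtain f where f: "f \<in> P.cochain i" "\<And>k. k < r \<Longrightarrow> f (e k) = c k" using ex by blast
    define z where "z = extend_zero (obj Q i) (\<lambda>u. f (G i u))"
    have "z (bd Q i u) = 0" if u: "u \<in> obj Q (Suc i)" for u
      using minimal[OF f(1) G(2)[OF u]] G(4)[OF u] Q.bd_in[OF u] by (simp add: z_def extend_zero_def)
    hence zc: "z \<in> Q.cocycle i"
      unfolding Q.cocycle_iff z_def using pullQ[OF f(1) G(1) G(2)] by simp
    \<comment> \<open>Minimality kills both homotopy terms, each being a cochain of \<open>P\<close>
      evaluated at a boundary.\<close>
    have fGF: "f (G i (F i u)) = f u" if u: "u \<in> obj P i" for u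
    proof (cases i)
      case 0
      have GF: "G 0 (F 0 u) \<in> obj P 0" "u \<in> obj P 0" using F(2) G(2) u 0 by auto
      have "f (G 0 (F 0 u)) - f u = f (bd P 0 (t 0 u))"
        using diffP[OF f(1)[unfolded 0] GF] t(3)[OF GF(2)] by simp
      also have "\<dots> = 0" using minimal[OF f(1)[unfolded 0] t(2)[OF GF(2)]] .
      finally show ?thesis using 0 by simp
    next
      case (Suc j)
      have GF: "G (Suc j) (F (Suc j) u) \<in> obj P (Suc j)" "u \<in> obj P (Suc j)" using F(2) G(2) u Suc by auto
      have in1: "bd P (Suc j) (t (Suc j) u) \<in> obj P (Suc j)" by (rule P.bd_in[OF t(2)[OF GF(2)]])
      have in2: "t j (bd P j u) \<in> obj P (Suc j)" by (rule t(2)[OF P.bd_in[OF GF(2)]])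
      have "f (G (Suc j) (F (Suc j) u)) - f u = f (bd P (Suc j) (t (Suc j) u)) + f (t j (bd P j u))"
        using diffP[OF f(1)[unfolded Suc] GF] t(4)[OF GF(2)] addP[OF f(1)[unfolded Suc] in1 in2] by simp
      also have "f (bd P (Suc j) (t (Suc j) u)) = 0" using minimal[OF f(1)[unfolded Suc] t(2)[OF GF(2)]] .
      also have "f (t j (bd P j u)) = 0"
        using minimal[OF pullPP[OF f(1)[unfolded Suc] t(1) t(2)] GF(2)] P.bd_in[OF GF(2)] by (simp add: extend_zero_def)
      finally show ?thesis using Suc by simp
    qed
    have "T z k = c k" if "k < r" for k
      using F(2)[OF e[OF that]] fGF[OF e[OF that]] f(2)[OF that] by (simp add: T_def z_def extend_zero_def)
    thus ?thesis using zc by blast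
  qed
  show "vectorspace.fin_dim class_ring (Ext \<epsilon> Q i)" "vectorspace.dim class_ring (Ext \<epsilon> Q i) = r"
    using Q.Ext_dim[of i r T, OF _ _ ker cob surj] by (simp_all add: T_def)
  show "r = 0 \<Longrightarrow> Q.cocycle i \<subseteq> Q.cob i" using ker by blast
qed

end

subsection \<open>The Yoneda product\<close>

context aug_resolution
begin

lemma chain_lift_exists:
  assumes "f \<in> cocycle j"
  obtains F where "chain_lift Q j f F"
proof -
  interpret QQ: resolution_pair \<epsilon> Q Q by unfold_locales
  show ?thesis
    using QQ.lift_exists[of j f] assms that unfolding chain_lift_eq cocycle_iff cochain_iff by blast
qed

lemma pull_cochain:
  assumes "f \<in> cochain l" "linear_on (act Q) (obj Q j) (act Q) g" "\<And>u. u \<in> obj Q j \<Longrightarrow> g u \<in> obj Q l"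
  shows "extend_zero (obj Q j) (\<lambda>u. f (g u)) \<in> cochain j"
proof (rule cochain_extend_zero)
  show "linear_on (act Q) (obj Q j) (trivial_act \<epsilon>) (\<lambda>u. f (g u))"
    by (rule linear_on_compose[OF assms(2), where T="obj Q l"]) (use assms in \<open>auto simp: cochain_iff\<close>)
qed

lemma cochain_add: "z \<in> cochain j \<Longrightarrow> x \<in> obj Q j \<Longrightarrow> y \<in> obj Q j \<Longrightarrow> z (x + y) = z x + z y"
  using linear_on_add[of "act Q" "obj Q j"] unfolding cochain_iff by blast

lemma cochain_diff: "z \<in> cochain j \<Longrightarrow> x \<in> obj Q j \<Longrightarrow> y \<in> obj Q j \<Longrightarrow> z (x - y) = z x - z y"
  using linear_on_diff[OF _ res_module res_sub] unfolding cochain_iff by blast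

lemma product_cocycle:
  assumes "g \<in> cocycle i" "lift_between Q Q j f F"
  shows "extend_zero (obj Q (j + i)) (\<lambda>u. g (F i u)) \<in> cocycle (j + i)"
proof -
  note F = lift_betweenD[OF assms(2)]
  have "g (F i (bd Q (j + i) u)) = 0" if u: "u \<in> obj Q (Suc (j + i))" for u
    using F(4)[OF u] F(2)[of u "Suc i"] u assms(1) unfolding cocycle_iff by simp
  moreover have "g \<in> cochain i" using assms(1) unfolding cocycle_iff by blast
  ultimately show ?thesis
    unfolding cocycle_iff using pull_cochain[OF _ F(1,2)] bd_in by (simp add: extend_zero_def)
qed

text \<open>If \<open>g\<close> is \<open>h\<close> after the boundary, the chain map property moves
  the boundary past \<open>F\<close>, and the product becomes the coboundary of \<open>h\<close>
  composed with the preceding map of the lift.\<close>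

lemma product_cob_left:
  assumes "g \<in> cob i" "lift_between Q Q j f F"
  shows "extend_zero (obj Q (j + i)) (\<lambda>u. g (F i u)) \<in> cob (j + i)"
proof (cases i)
  case 0
  have "extend_zero (obj Q (j + i)) (\<lambda>u. g (F i u)) = 0"
    using assms(1) 0 by (auto simp: extend_zero_def)
  thus ?thesis using cob_zero by metis
next
  case (Suc l)
  note F = lift_betweenD[OF assms(2)]
  obtain h where h: "h \<in> cochain l" "g = (\<lambda>u. if u \<in> obj Q (Suc l) then h (bd Q l u) else 0)"
    using assms(1) unfolding Suc cob_Suc_iff by blast
  have "extend_zero (obj Q (j + i)) (\<lambda>u. g (F i u)) =
      (\<lambda>u. if u \<in> obj Q (Suc (j + l)) then extend_zero (obj Q (j + l)) (\<lambda>u. h (F l u)) (bd Q (j + l) u) else 0)"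
    using F(2)[of _ "Suc l"] F(4)[of _ l] bd_in by (auto simp: extend_zero_def h(2) Suc fun_eq_iff)
  thus ?thesis
    using pull_cochain[OF h(1) F(1,2)] unfolding Suc add_Suc_right cob_Suc_iff by blast
qed

text \<open>If \<open>f\<close> is \<open>c\<close> after the boundary, a map \<open>C\<close>
  lifting \<open>c\<close> through the augmentation gives, after the boundary, a lift of
  \<open>f\<close> concentrated in position 0. Its difference from \<open>D\<close> lifts the zero
  map and is null homotopic, and the cocycle \<open>g\<close> kills the boundary term of the
  homotopy, so a coboundary remains.\<close>

lemma product_cob_right:
  assumes g: "g \<in> cocycle i" and f: "f \<in> cob j" and D: "lift_between Q Q j f D"
  shows "extend_zero (obj Q (j + i)) (\<lambda>u. g (D i u)) \<in> cob (j + i)"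
proof -
  interpret QQ: resolution_pair \<epsilon> Q Q by unfold_locales
  have gc: "g \<in> cochain i" and gb: "\<And>u. u \<in> obj Q (Suc i) \<Longrightarrow> g (bd Q i u) = 0"
    using g unfolding cocycle_iff by auto
  have gadd: "\<And>x y. x \<in> obj Q i \<Longrightarrow> y \<in> obj Q i \<Longrightarrow> g (x + y) = g x + g y"
    by (rule cochain_add[OF gc])
  note D' = lift_betweenD[OF D]
  \<comment> \<open>The correction \<open>C\<close> changes only position 0 of the lift. The cochain
    \<open>k\<close> tests that composing with \<open>C\<close> yields a coboundary.\<close>
  have "\<exists>C. lift_between Q Q j (\<lambda>u. 0) (\<lambda>i u. D i u - (if i = 0 then C u else 0)) \<and>
    extend_zero (obj Q j) (\<lambda>u. k (C u)) \<in> cob j \<and> (\<forall>u\<in>obj Q j. C u \<in> obj Q 0)" if k: "k \<in> cochain 0" for k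
  proof (cases j)
    case 0
    have "\<And>u. f u = 0" using f 0 by simp
    hence "lift_between Q Q j (\<lambda>u. 0) (\<lambda>i u. D i u - (if i = 0 then 0 else 0))"
      using D unfolding lift_between_def by simp
    moreover have "extend_zero (obj Q j) (\<lambda>u. k 0) = 0"
      using cochain_diff[OF k, of 0 0] submodule_onD(1)[OF res_sub] by (auto simp: extend_zero_def)
    ultimately show ?thesis
      using submodule_onD(1)[OF res_sub] cob_zero[of j] by (intro exI[of _ "\<lambda>u. 0"]) simp
  next
    case (Suc l)
    obtain c where c: "c \<in> cochain l" "f = (\<lambda>u. if u \<in> obj Q j then c (bd Q l u) else 0)"
      using f unfolding Suc cob_Suc_iff by blast
    have "linear_on (act Q) (obj Q l) (trivial_act \<epsilon>) c" using c(1) unfolding cochain_iff by blast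
    moreover have "c ` obj Q l \<subseteq> aug Q ` obj Q 0" using aug_surj by blast
    ultimately obtain C where C: "linear_on (act Q) (obj Q l) (act Q) C" "C ` obj Q l \<subseteq> obj Q 0"
      "\<forall>u\<in>obj Q l. aug Q (C u) = c u"
      using free_submodule_lift[OF res_free res_module res_module res_sub aug_linear] by meson
    let ?C = "\<lambda>u. C (bd Q l u)"
    have Cin: "?C u \<in> obj Q 0" if "u \<in> obj Q j" for u using C(2) bd_in that Suc by blast
    have Clin: "linear_on (act Q) (obj Q j) (act Q) ?C"
      unfolding Suc by (rule linear_on_compose[OF bd_linear C(1) bd_image])
    have C0: "C 0 = 0" by (rule linear_on_zero[OF C(1) res_sub])
    have Cbd: "?C (bd Q j u) = 0" if "u \<in> obj Q (Suc j)" for u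
      using bd_bd[of u l] that Suc C0 by simp
    have "lift_between Q Q j (\<lambda>u. 0) (\<lambda>i u. D i u - (if i = 0 then ?C u else 0))"
      unfolding lift_between_def
    proof (intro conjI allI ballI)
      fix i
      show "linear_on (act Q) (obj Q (j + i)) (act Q) (\<lambda>u. D i u - (if i = 0 then ?C u else 0))"
        using D'(1)[of i] linear_on_minus[OF D'(1)[of 0] _ res_module, of ?C] Clin by (cases i) auto
      show "(\<lambda>u. D i u - (if i = 0 then ?C u else 0)) ` obj Q (j + i) \<subseteq> obj Q i"
        using D'(2) Cin submodule_on_diff[OF res_module res_sub] by (cases i) auto
      show "D i (bd Q (j + i) u) - (if i = 0 then ?C (bd Q (j + i) u) else 0) =
          bd Q i (D (Suc i) u - (if Suc i = 0 then ?C u else 0))" if "u \<in> obj Q (Suc (j + i))" for u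
        using D'(4)[OF that] Cbd that by (cases i) auto
    next
      fix u assume u: "u \<in> obj Q j"
      have "aug Q (D 0 u - ?C u) = aug Q (D 0 u) - aug Q (?C u)"
        using linear_on_diff[OF aug_linear res_module res_sub] D'(2)[of u 0] Cin u by simp
      also have "\<dots> = 0"
        using D'(3)[OF u] C(3) bd_in u Suc c(2) by simp
      finally show "aug Q (D 0 u - (if 0 = (0::nat) then ?C u else 0)) = 0" by simp
    qed
    moreover have "extend_zero (obj Q j) (\<lambda>u. k (?C u)) \<in> cob j"
    proof -
      have "extend_zero (obj Q j) (\<lambda>u. k (?C u)) =
         (\<lambda>u. if u \<in> obj Q (Suc l) then extend_zero (obj Q l) (\<lambda>u. k (C u)) (bd Q l u) else 0)"
        using bd_in by (auto simp: extend_zero_def Suc)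
      moreover have "extend_zero (obj Q l) (\<lambda>u. k (C u)) \<in> cochain l"
        using C(2) by (intro pull_cochain[OF k C(1)]) auto
      ultimately show ?thesis unfolding Suc cob_Suc_iff by blast
    qed
    ultimately show ?thesis using Cin by (intro exI[of _ ?C]) blast
  qed
  note ex = this
  \<comment> \<open>Only for \<open>i = 0\<close> does \<open>g\<close> meet the correction;
    otherwise the zero cochain is a placeholder of the right degree.\<close>
  define k where "k = (if i = 0 then g else 0)"
  have "k \<in> cochain 0" using gc cochain_zero[of 0] by (cases "i = 0") (auto simp: k_def)
  from ex[OF this] obtain C where C: "lift_between Q Q j (\<lambda>u. 0) (\<lambda>i u. D i u - (if i = 0 then C u else 0))"
    "extend_zero (obj Q j) (\<lambda>u. k (C u)) \<in> cob j" "\<forall>u\<in>obj Q j. C u \<in> obj Q 0" by blast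
  obtain s where s: "\<And>i. linear_on (act Q) (obj Q (j + i)) (act Q) (s i)"
    "\<And>i u. u \<in> obj Q (j + i) \<Longrightarrow> s i u \<in> obj Q (Suc i)"
    "\<And>u. u \<in> obj Q j \<Longrightarrow> D 0 u - C u = bd Q 0 (s 0 u)"
    "\<And>i u. u \<in> obj Q (Suc (j + i)) \<Longrightarrow> D (Suc i) u = bd Q (Suc i) (s (Suc i) u) + s i (bd Q (j + i) u)"
    by (rule QQ.null_homotopy[OF C(1)]) (rule that, simp_all)
  show ?thesis
  proof (cases i)
    case 0
    have "g (D 0 u) = g (C u)" if u: "u \<in> obj Q j" for u
      using gb[of "s 0 u"] s(2)[of u 0] s(3)[OF u] cochain_diff[OF gc, of "D 0 u" "C u"] D'(2)[of u 0] C(3) u 0 by simp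
    hence "extend_zero (obj Q (j + i)) (\<lambda>u. g (D i u)) = extend_zero (obj Q j) (\<lambda>u. g (C u))"
      using 0 by (auto simp: extend_zero_def)
    thus ?thesis using C(2) 0 by (simp add: k_def)
  next
    case (Suc l)
    have "g (D (Suc l) u) = g (s l (bd Q (j + l) u))" if u: "u \<in> obj Q (Suc (j + l))" for u
    proof -
      have in1: "bd Q (Suc l) (s (Suc l) u) \<in> obj Q i" "s (Suc l) u \<in> obj Q (Suc i)"
        using bd_in s(2)[of u "Suc l"] u Suc by auto
      have in2: "s l (bd Q (j + l) u) \<in> obj Q i" using s(2)[OF bd_in[OF u]] Suc by simp
      show ?thesis using s(4)[OF u] gadd[OF in1(1) in2] gb[OF in1(2)] Suc by simp
    qed
    hence "extend_zero (obj Q (j + i)) (\<lambda>u. g (D i u)) =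
      (\<lambda>u. if u \<in> obj Q (Suc (j + l)) then extend_zero (obj Q (j + l)) (\<lambda>u. g (s l u)) (bd Q (j + l) u) else 0)"
      using bd_in by (auto simp: extend_zero_def Suc fun_eq_iff)
    moreover have "extend_zero (obj Q (j + l)) (\<lambda>u. g (s l u)) \<in> cochain (j + l)"
      using s(1,2) by (intro pull_cochain[OF gc]) (auto simp: Suc)
    ultimately show ?thesis unfolding Suc add_Suc_right cob_Suc_iff by blast
  qed
qed

text \<open>Independence of the choices comes from writing the difference of two products as
  \<open>g' - g\<close> composed with \<open>F'\<close> plus \<open>g\<close> composed with
  \<open>F' - F\<close>, where \<open>F' - F\<close> lifts \<open>f' - f\<close>. Both summands are
  coboundaries, so the union in the definition is over a single coset.\<close>

lemma yoneda_product_cls: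
  assumes g: "g \<in> cocycle i" and f: "f \<in> cocycle j" and F: "lift_between Q Q j f F"
  shows "yoneda_product \<epsilon> Q i j (cls i g) (cls j f) = cls (i + j) (extend_zero (obj Q (i + j)) (\<lambda>u. g (F i u)))"
proof -
  interpret QQ: resolution_pair \<epsilon> Q Q by unfold_locales
  have "cls (i + j) (extend_zero (obj Q (i + j)) (g' \<circ> F' i)) = cls (i + j) (extend_zero (obj Q (i + j)) (\<lambda>u. g (F i u)))"
    if "g' \<in> cls i g" "f' \<in> cls j f" "chain_lift Q j f' F'" for g' f' F'
  proof (rule cls_eqI)
    have F': "lift_between Q Q j f' F'" using that(3) unfolding chain_lift_eq .
    have gg: "g' - g \<in> cob i" "f' - f \<in> cob j" using that mem_cls by blast+
    have g': "g' \<in> cochain i" "g \<in> cochain i"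
      using cocycle_plus[OF cob_cocycle[OF gg(1)] g] g unfolding cocycle_iff by auto
    have D: "lift_between Q Q j (f' - f) (\<lambda>i u. F' i u - F i u)"
      using QQ.lift_between_minus[OF F' F] by (simp add: fun_diff_def)
    have "extend_zero (obj Q (j + i)) (\<lambda>u. (g' - g) (F' i u)) + extend_zero (obj Q (j + i)) (\<lambda>u. g (F' i u - F i u)) \<in> cob (j + i)"
      by (intro cob_plus product_cob_left[OF gg(1) F'] product_cob_right[OF g gg(2) D])
    moreover have "extend_zero (obj Q (j + i)) (\<lambda>u. (g' - g) (F' i u)) + extend_zero (obj Q (j + i)) (\<lambda>u. g (F' i u - F i u)) =
      extend_zero (obj Q (i + j)) (g' \<circ> F' i) - extend_zero (obj Q (i + j)) (\<lambda>u. g (F i u))"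
      using lift_betweenD(2)[OF F] lift_betweenD(2)[OF F']
      by (auto simp: extend_zero_def fun_eq_iff add.commute[of i j] cochain_diff[OF g'(2)])
    ultimately show "extend_zero (obj Q (i + j)) (g' \<circ> F' i) - extend_zero (obj Q (i + j)) (\<lambda>u. g (F i u)) \<in> cob (i + j)"
      by (simp add: add.commute)
  qed
  note eq = this
  let ?c = "cls (i + j) (extend_zero (obj Q (i + j)) (\<lambda>u. g (F i u)))"
  let ?S = "{cls (i + j) (extend_zero (obj Q (i + j)) (g' \<circ> F' i)) | g' f' F'.
      g' \<in> cls i g \<and> f' \<in> cls j f \<and> chain_lift Q j f' F'}"
  have "?S = {?c}"
  proof (rule subset_antisym; rule subsetI)
    fix X assume "X \<in> ?S"
    then obtain g' f' F' where "X = cls (i + j) (extend_zero (obj Q (i + j)) (g' \<circ> F' i))"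
      "g' \<in> cls i g" "f' \<in> cls j f" "chain_lift Q j f' F'" by (elim CollectE exE conjE)
    thus "X \<in> {?c}" using eq[of g' f' F'] by simp
  next
    fix X assume "X \<in> {?c}"
    moreover have "g \<in> cls i g" "f \<in> cls j f" using cob_zero by (simp_all add: mem_cls)
    ultimately show "X \<in> ?S"
      using F unfolding chain_lift_eq by (intro CollectI exI[of _ g] exI[of _ f] exI[of _ F]) (simp add: comp_def)
  qed
  thus ?thesis unfolding yoneda_product_def by simp
qed

abbreviation "yp i j \<equiv> yoneda_product \<epsilon> Q i j"

lemma yoneda_closed:
  assumes "X \<in> carrier (Ext \<epsilon> Q i)" "Y \<in> carrier (Ext \<epsilon> Q j)"
  shows "yp i j X Y \<in> carrier (Ext \<epsilon> Q (i + j))"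
proof -
  obtain g f where *: "g \<in> cocycle i" "X = cls i g" "f \<in> cocycle j" "Y = cls j f"
    using assms unfolding carrier_Ext by blast
  obtain F where F: "lift_between Q Q j f F" using chain_lift_exists[OF *(3)] unfolding chain_lift_eq .
  show ?thesis
    unfolding *(2,4) yoneda_product_cls[OF *(1,3) F] carrier_Ext
    using product_cocycle[OF *(1) F] by (simp add: add.commute)
qed

lemma yoneda_add_left:
  assumes "X \<in> carrier (Ext \<epsilon> Q i)" "X' \<in> carrier (Ext \<epsilon> Q i)" "Y \<in> carrier (Ext \<epsilon> Q j)"
  shows "yp i j (X \<oplus>\<^bsub>Ext \<epsilon> Q i\<^esub> X') Y = yp i j X Y \<oplus>\<^bsub>Ext \<epsilon> Q (i + j)\<^esub> yp i j X' Y"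
proof -
  obtain g g' f where *: "g \<in> cocycle i" "X = cls i g" "g' \<in> cocycle i" "X' = cls i g'" "f \<in> cocycle j" "Y = cls j f"
    using assms unfolding carrier_Ext by blast
  obtain F where F: "lift_between Q Q j f F" using chain_lift_exists[OF *(5)] unfolding chain_lift_eq .
  show ?thesis
    unfolding *(2,4,6) add_Ext yoneda_product_cls[OF cocycle_plus[OF *(1,3)] *(5) F]
      yoneda_product_cls[OF *(1,5) F] yoneda_product_cls[OF *(3,5) F]
    by (rule arg_cong[where f="cls (i + j)"]) (auto simp: extend_zero_def)
qed

lemma yoneda_smult_left:
  assumes "X \<in> carrier (Ext \<epsilon> Q i)" "Y \<in> carrier (Ext \<epsilon> Q j)"
  shows "yp i j (c \<odot>\<^bsub>Ext \<epsilon> Q i\<^esub> X) Y = c \<odot>\<^bsub>Ext \<epsilon> Q (i + j)\<^esub> yp i j X Y"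
proof -
  obtain g f where *: "g \<in> cocycle i" "X = cls i g" "f \<in> cocycle j" "Y = cls j f"
    using assms unfolding carrier_Ext by blast
  obtain F where F: "lift_between Q Q j f F" using chain_lift_exists[OF *(3)] unfolding chain_lift_eq .
  show ?thesis
    unfolding *(2,4) smult_Ext yoneda_product_cls[OF cocycle_scale[OF *(1)] *(3) F]
      yoneda_product_cls[OF *(1,3) F]
    by (rule arg_cong[where f="cls (i + j)"]) (auto simp: extend_zero_def)
qed

lemma yoneda_add_right:
  assumes "X \<in> carrier (Ext \<epsilon> Q i)" "Y \<in> carrier (Ext \<epsilon> Q j)" "Y' \<in> carrier (Ext \<epsilon> Q j)"
  shows "yp i j X (Y \<oplus>\<^bsub>Ext \<epsilon> Q j\<^esub> Y') = yp i j X Y \<oplus>\<^bsub>Ext \<epsilon> Q (i + j)\<^esub> yp i j X Y'"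
proof -
  interpret QQ: resolution_pair \<epsilon> Q Q by unfold_locales
  obtain g f f' where *: "g \<in> cocycle i" "X = cls i g" "f \<in> cocycle j" "Y = cls j f" "f' \<in> cocycle j" "Y' = cls j f'"
    using assms unfolding carrier_Ext by blast
  obtain F where F: "lift_between Q Q j f F" using chain_lift_exists[OF *(3)] unfolding chain_lift_eq .
  obtain F' where F': "lift_between Q Q j f' F'" using chain_lift_exists[OF *(5)] unfolding chain_lift_eq .
  have FF: "lift_between Q Q j (f + f') (\<lambda>i u. F i u + F' i u)"
    using QQ.lift_between_plus[OF F F'] by (simp add: plus_fun_def)
  have "g \<in> cochain i" using *(1) by (simp add: cocycle_iff)
  thus ?thesis
    unfolding *(2,4,6) add_Ext yoneda_product_cls[OF *(1) cocycle_plus[OF *(3,5)] FF]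
      yoneda_product_cls[OF *(1,3) F] yoneda_product_cls[OF *(1,5) F']
    using lift_betweenD(2)[OF F] lift_betweenD(2)[OF F']
    by (intro arg_cong[where f="cls (i + j)"])
      (auto simp: extend_zero_def fun_eq_iff add.commute[of i j] cochain_add)
qed

lemma aug_cocycle: "extend_zero (obj Q 0) (aug Q) \<in> cocycle 0"
  unfolding cocycle_iff using cochain_extend_zero[OF aug_linear] aug_bd bd_in by (simp add: extend_zero_def)

lemma yoneda_one_left:
  assumes "Y \<in> carrier (Ext \<epsilon> Q j)"
  shows "yp 0 j (cls 0 (extend_zero (obj Q 0) (aug Q))) Y = Y"
proof -
  obtain f where *: "f \<in> cocycle j" "Y = cls j f"
    using assms unfolding carrier_Ext by blast
  obtain F where F: "lift_between Q Q j f F" using chain_lift_exists[OF *(1)] unfolding chain_lift_eq .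
  have "extend_zero (obj Q (0 + j)) (\<lambda>u. extend_zero (obj Q 0) (aug Q) (F 0 u)) = f"
    using lift_betweenD(2)[OF F, of _ 0] lift_betweenD(3)[OF F] *(1)
    unfolding cocycle_iff cochain_iff by (auto simp: extend_zero_def fun_eq_iff)
  thus ?thesis unfolding *(2) yoneda_product_cls[OF aug_cocycle *(1) F] by simp
qed

lemma yoneda_one_right:
  assumes "X \<in> carrier (Ext \<epsilon> Q i)"
  shows "yp i 0 X (cls 0 (extend_zero (obj Q 0) (aug Q))) = X"
proof -
  obtain g where *: "g \<in> cocycle i" "X = cls i g"
    using assms unfolding carrier_Ext by blast
  \<comment> \<open>The identity chain map lifts the augmentation, so multiplying by the unit on the
    right leaves the cocycle as it is.\<close>
  have F: "lift_between Q Q 0 (extend_zero (obj Q 0) (aug Q)) (\<lambda>i u. u)"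
    using lift_between_id unfolding lift_between_def by (simp add: extend_zero_def)
  have "extend_zero (obj Q (i + 0)) (\<lambda>u. g u) = g"
    using *(1) unfolding cocycle_iff cochain_iff by (auto simp: extend_zero_def)
  thus ?thesis unfolding *(2) yoneda_product_cls[OF *(1) aug_cocycle F] by simp
qed

end

locale central_resolution = aug_resolution \<epsilon> Q
  for \<epsilon> :: "'a::ring_1 \<Rightarrow> 'k::field" and Q :: "('a, 'k, 'p::ab_group_add) resolution" +
  fixes \<iota> :: "'k \<Rightarrow> 'a"
  assumes aug_\<iota>: "\<epsilon> (\<iota> c) = c" and central: "\<iota> c * a = a * \<iota> c"
begin

text \<open>Acting by \<open>\<iota> c\<close> is linear over \<open>A\<close> because
  \<open>\<iota> c\<close> is central, and after the augmentation it becomes multiplication by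
  \<open>c\<close>. Bilinearity in the second argument of the Yoneda product rests on this.\<close>

lemma lift_between_scale:
  assumes F: "lift_between Q Q j f F"
  shows "lift_between Q Q j (\<lambda>u. c * f u) (\<lambda>i u. act Q (\<iota> c) (F i u))"
proof -
  interpret M: left_module "act Q" by (rule res_module)
  note F = lift_betweenD[OF F]
  have comm: "act Q (\<iota> c) (act Q a u) = act Q a (act Q (\<iota> c) u)" for a u
    by (simp add: M.act_assoc[symmetric] central)
  show ?thesis
    unfolding lift_between_def
  proof (intro conjI allI ballI)
    fix i
    show "linear_on (act Q) (obj Q (j + i)) (act Q) (\<lambda>u. act Q (\<iota> c) (F i u))"
      using F(1)[of i] unfolding linear_on_def by (simp add: M.act_add_right comm)
    show "(\<lambda>u. act Q (\<iota> c) (F i u)) ` obj Q (j + i) \<subseteq> obj Q i"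
      using F(2) submodule_onD(3)[OF res_sub] by blast
    show "act Q (\<iota> c) (F i (bd Q (j + i) u)) = bd Q i (act Q (\<iota> c) (F (Suc i) u))" if "u \<in> obj Q (Suc (j + i))" for u
      using F(4)[OF that] F(2)[of u "Suc i"] linear_on_act[OF bd_linear] that by simp
  next
    show "aug Q (act Q (\<iota> c) (F 0 u)) = c * f u" if "u \<in> obj Q j" for u
      using F(3)[OF that] F(2)[of u 0] linear_on_act[OF aug_linear] that by (simp add: trivial_act_def aug_\<iota>)
  qed
qed

lemma yoneda_smult_right:
  assumes "X \<in> carrier (Ext \<epsilon> Q i)" "Y \<in> carrier (Ext \<epsilon> Q j)"
  shows "yp i j X (c \<odot>\<^bsub>Ext \<epsilon> Q j\<^esub> Y) = c \<odot>\<^bsub>Ext \<epsilon> Q (i + j)\<^esub> yp i j X Y"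
proof -
  obtain g f where *: "g \<in> cocycle i" "X = cls i g" "f \<in> cocycle j" "Y = cls j f"
    using assms unfolding carrier_Ext by blast
  obtain F where F: "lift_between Q Q j f F" using chain_lift_exists[OF *(3)] unfolding chain_lift_eq .
  have glin: "linear_on (act Q) (obj Q i) (trivial_act \<epsilon>) g"
    using *(1) unfolding cocycle_iff cochain_iff by blast
  have "g (act Q (\<iota> c) (F i u)) = c * g (F i u)" if "u \<in> obj Q (j + i)" for u
    using linear_on_act[OF glin lift_betweenD(2)[OF F that]] by (simp add: trivial_act_def aug_\<iota>)
  thus ?thesis
    unfolding *(2,4) smult_Ext yoneda_product_cls[OF *(1) cocycle_scale[OF *(3)] lift_between_scale[OF F]]
      yoneda_product_cls[OF *(1,3) F]
    by (intro arg_cong[where f="cls (i + j)"]) (auto simp: extend_zero_def add.commute[of i j])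
qed

text \<open>A cocycle of degree 0 vanishes on the kernel of \<open>P\<^sub>0 \<rightarrow> K\<close>.\<close>

lemma Ext_0:
  assumes "X \<in> carrier (Ext \<epsilon> Q 0)"
  obtains c where "X = c \<odot>\<^bsub>Ext \<epsilon> Q 0\<^esub> cls 0 (extend_zero (obj Q 0) (aug Q))"
proof -
  obtain f where *: "f \<in> cocycle 0" "X = cls 0 f"
    using assms unfolding carrier_Ext by blast
  have fc: "f \<in> cochain 0" using *(1) by (simp add: cocycle_iff)
  have "1 \<in> aug Q ` obj Q 0" unfolding aug_surj by simp
  then obtain p where p: "p \<in> obj Q 0" "aug Q p = 1" by auto
  show ?thesis
  proof (rule that[of "f p"])
    have "f u = f p * aug Q u" if u: "u \<in> obj Q 0" for u
    proof -
      \<comment> \<open>\<open>q\<close> is the multiple of \<open>p\<close> with the same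
        augmentation as \<open>u\<close>; the difference \<open>u - q\<close> is therefore a
        boundary and is killed by \<open>f\<close>.\<close>
      define q where "q = act Q (\<iota> (aug Q u)) p"
      have q: "q \<in> obj Q 0" "aug Q q = aug Q u"
        unfolding q_def using submodule_onD(3)[OF res_sub p(1)] linear_on_act[OF aug_linear p(1)] p(2)
        by (simp_all add: trivial_act_def aug_\<iota>)
      have flin: "linear_on (act Q) (obj Q 0) (trivial_act \<epsilon>) f" using fc unfolding cochain_iff by blast
      have fq: "f q = f p * aug Q u"
        unfolding q_def linear_on_act[OF flin p(1)] by (simp add: trivial_act_def aug_\<iota>)
      have "u - q \<in> bd Q 0 ` obj Q (Suc 0)"
        unfolding exact_0 using submodule_on_diff(1)[OF res_module res_sub u q(1)]
          linear_on_diff[OF aug_linear res_module res_sub u q(1)] q(2) by simp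
      hence "f (u - q) = 0" using *(1) unfolding cocycle_iff by auto
      thus ?thesis using cochain_diff[OF fc u q(1)] fq by simp
    qed
    hence "f = (\<lambda>u. f p * extend_zero (obj Q 0) (aug Q) u)"
      using fc unfolding cochain_iff by (auto simp: extend_zero_def)
    thus "X = f p \<odot>\<^bsub>Ext \<epsilon> Q 0\<^esub> cls 0 (extend_zero (obj Q 0) (aug Q))"
      unfolding *(2) smult_Ext by simp
  qed
qed

end

subsection \<open>Gradings of an algebra generated in degree one\<close>

locale bilinear_algebra =
  fixes E :: "('k::field, 'e) module" (structure)
  assumes vs: "vectorspace class_ring E"
    and mult_closed: "\<lbrakk>a \<in> carrier E; b \<in> carrier E\<rbrakk> \<Longrightarrow> a \<otimes> b \<in> carrier E"
    and distrib_right: "\<lbrakk>a \<in> carrier E; b \<in> carrier E; d \<in> carrier E\<rbrakk> \<Longrightarrow> (a \<oplus> b) \<otimes> d = a \<otimes> d \<oplus> b \<otimes> d"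
    and distrib_left: "\<lbrakk>a \<in> carrier E; b \<in> carrier E; d \<in> carrier E\<rbrakk> \<Longrightarrow> a \<otimes> (b \<oplus> d) = a \<otimes> b \<oplus> a \<otimes> d"
    and smult_left: "\<lbrakk>a \<in> carrier E; b \<in> carrier E\<rbrakk> \<Longrightarrow> (c \<odot> a) \<otimes> b = c \<odot> (a \<otimes> b)"
    and smult_right: "\<lbrakk>a \<in> carrier E; b \<in> carrier E\<rbrakk> \<Longrightarrow> a \<otimes> (c \<odot> b) = c \<odot> (a \<otimes> b)"
    and one_in: "\<one> \<in> carrier E"
    and one_left: "a \<in> carrier E \<Longrightarrow> \<one> \<otimes> a = a"
    and one_right: "a \<in> carrier E \<Longrightarrow> a \<otimes> \<one> = a"
begin

sublocale V: vectorspace class_ring E by (rule vs)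

lemma smult_in: "a \<in> carrier E \<Longrightarrow> c \<odot> a \<in> carrier E"
  using V.smult_closed by (simp add: class_ring_simps)

lemma mult_zero_left: "a \<in> carrier E \<Longrightarrow> \<zero> \<otimes> a = \<zero>"
  using distrib_right[of \<zero> \<zero> a] mult_closed[of \<zero> a] V.zero_closed by auto

lemma mult_zero_right: "a \<in> carrier E \<Longrightarrow> a \<otimes> \<zero> = \<zero>"
  using distrib_left[of a \<zero> \<zero>] mult_closed[of a \<zero>] V.zero_closed by auto

lemma uminus_eq_smult: "a \<in> carrier E \<Longrightarrow> \<ominus> a = (- 1) \<odot> a"
  using V.smult_minus_1 by (simp add: class_ring_simps)

text \<open>
  The powers of a subspace \<open>m\<close>; products are bracketed arbitrarily, so that associativity of the
  multiplication plays no role.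
\<close>

inductive power_filtration :: "'e set \<Rightarrow> nat \<Rightarrow> 'e \<Rightarrow> bool" for m :: "'e set" where
  base: "\<lbrakk>a \<in> m; k \<le> 1\<rbrakk> \<Longrightarrow> power_filtration m k a"
| mult: "\<lbrakk>power_filtration m i a; power_filtration m j b; k \<le> i + j\<rbrakk> \<Longrightarrow> power_filtration m k (a \<otimes> b)"
| zero: "power_filtration m k \<zero>"
| add: "\<lbrakk>power_filtration m k a; power_filtration m k b\<rbrakk> \<Longrightarrow> power_filtration m k (a \<oplus> b)"
| smult: "power_filtration m k a \<Longrightarrow> power_filtration m k (c \<odot> a)"

end

section \<open>Components of a connected graded algebra and the filtration by degree\<close>

locale graded_algebra = bilinear_algebra E for E :: "('k::field, 'e) module" (structure) +
  fixes H :: "nat \<Rightarrow> 'e set"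
  assumes graded: "connected_graded E H"
begin

lemma H_subspace: "VectorSpace.subspace class_ring (H i) E"
  and H_mult: "\<lbrakk>a \<in> H i; b \<in> H j\<rbrakk> \<Longrightarrow> a \<otimes> b \<in> H (i + j)"
  and H_0: "H 0 = range (\<lambda>c. c \<odot> \<one>)"
  using graded unfolding connected_graded_def by blast+

lemma H_in: "a \<in> H i \<Longrightarrow> a \<in> carrier E"
  and H_zero: "\<zero> \<in> H i"
  and H_add: "\<lbrakk>a \<in> H i; b \<in> H i\<rbrakk> \<Longrightarrow> a \<oplus> b \<in> H i"
  and H_smult: "a \<in> H i \<Longrightarrow> c \<odot> a \<in> H i"
  using H_subspace[of i] unfolding VectorSpace.subspace_def submodule_def by (auto simp: class_ring_simps)

definition component :: "'e \<Rightarrow> nat \<Rightarrow> 'e" where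
  "component e = (THE h. (\<forall>i. h i \<in> H i) \<and> finite {i. h i \<noteq> \<zero>} \<and> e = (\<Oplus>i\<in>{i. h i \<noteq> \<zero>}. h i))"

lemma component_ex1: "e \<in> carrier E \<Longrightarrow>
    \<exists>!h. (\<forall>i. h i \<in> H i) \<and> finite {i. h i \<noteq> \<zero>} \<and> e = (\<Oplus>i\<in>{i. h i \<noteq> \<zero>}. h i)"
  using graded unfolding connected_graded_def by blast

lemma component:
  assumes "e \<in> carrier E"
  shows "component e i \<in> H i" "finite {i. component e i \<noteq> \<zero>}"
    "e = (\<Oplus>i\<in>{i. component e i \<noteq> \<zero>}. component e i)"
  using theI'[OF component_ex1[OF assms]] unfolding component_def[symmetric] by blast+

lemma finsum_support:
  assumes "finite A" "{i. h i \<noteq> \<zero>} \<subseteq> A" "\<And>i. h i \<in> carrier E"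
  shows "(\<Oplus>i\<in>{i. h i \<noteq> \<zero>}. h i) = (\<Oplus>i\<in>A. h i)"
  using assms by (intro V.add.finprod_mono_neutral_cong_left) auto

lemma component_eq:
  assumes "finite A" "\<And>i. h i \<in> H i" "\<And>i. i \<notin> A \<Longrightarrow> h i = \<zero>"
  shows "component (\<Oplus>i\<in>A. h i) = h"
proof -
  have sub: "{i. h i \<noteq> \<zero>} \<subseteq> A" using assms(3) by blast
  have e: "(\<Oplus>i\<in>A. h i) = (\<Oplus>i\<in>{i. h i \<noteq> \<zero>}. h i)"
    by (rule finsum_support[OF assms(1) sub H_in[OF assms(2)], symmetric])
  have "(\<Oplus>i\<in>A. h i) \<in> carrier E" using H_in[OF assms(2)] by (intro V.finsum_closed) auto
  from the1_equality[OF component_ex1[OF this], of h] show ?thesis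
    unfolding component_def using assms(2) finite_subset[OF sub assms(1)] e by auto
qed

lemma component_add:
  assumes "a \<in> carrier E" "b \<in> carrier E"
  shows "component (a \<oplus> b) i = component a i \<oplus> component b i"
proof -
  let ?A = "{i. component a i \<noteq> \<zero>} \<union> {i. component b i \<noteq> \<zero>}"
  have fin: "finite ?A" using component(2) assms by simp
  note in_carrier = H_in[OF component(1)[OF assms(1)]] H_in[OF component(1)[OF assms(2)]]
  have "a = (\<Oplus>i\<in>?A. component a i)" "b = (\<Oplus>i\<in>?A. component b i)"
    using component(3)[OF assms(1)] component(3)[OF assms(2)]
      finsum_support[OF fin, of "component a"] finsum_support[OF fin, of "component b"] in_carrier by auto
  hence "a \<oplus> b = (\<Oplus>i\<in>?A. component a i \<oplus> component b i)"
    using in_carrier V.finsum_addf[of "component a" ?A "component b"] by auto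
  thus ?thesis
    using component_eq[OF fin, of "\<lambda>i. component a i \<oplus> component b i"] component(1) assms H_add by force
qed

lemma component_smult:
  assumes "a \<in> carrier E"
  shows "component (c \<odot> a) i = c \<odot> component a i"
proof -
  let ?A = "{i. component a i \<noteq> \<zero>}"
  note in_carrier = H_in[OF component(1)[OF assms(1)]]
  have "c \<odot> a = (\<Oplus>i\<in>?A. c \<odot> component a i)"
    by (subst component(3)[OF assms], rule V.finsum_smult)
      (use in_carrier component(2)[OF assms] in \<open>auto simp: class_ring_simps\<close>)
  moreover have "c \<odot> \<zero> = \<zero>" by (rule V.smult_r_null) (simp add: class_ring_simps)
  ultimately show ?thesis
    using component_eq[OF component(2)[OF assms], of "\<lambda>i. c \<odot> component a i"] component(1)[OF assms] H_smult
    by auto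
qed

lemma component_homogeneous: "a \<in> H j \<Longrightarrow> component a = (\<lambda>i. if i = j then a else \<zero>)"
  using component_eq[of "{j}" "\<lambda>i. if i = j then a else \<zero>"] H_in H_zero by auto

lemma component_zero: "component \<zero> i = \<zero>"
  using component_homogeneous[OF H_zero[of i]] by simp

text \<open>The sum of the pieces of degree at least \<open>k\<close>. Unlike the pieces, this
  filtration can be shown to be the same for two gradings.\<close>

definition H_ge :: "nat \<Rightarrow> 'e set" where
  "H_ge k = {e \<in> carrier E. \<forall>i<k. component e i = \<zero>}"

lemma H_ge_add: "\<lbrakk>a \<in> H_ge k; b \<in> H_ge k\<rbrakk> \<Longrightarrow> a \<oplus> b \<in> H_ge k"
  unfolding H_ge_def using component_add by auto

lemma H_ge_zero: "\<zero> \<in> H_ge k"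
  unfolding H_ge_def using component_zero by auto

lemma H_ge_smult: "a \<in> H_ge k \<Longrightarrow> c \<odot> a \<in> H_ge k"
  unfolding H_ge_def using component_smult smult_in V.smult_r_null by (auto simp: class_ring_simps)

lemma H_ge_minus: "\<lbrakk>a \<in> H_ge k; b \<in> H_ge k\<rbrakk> \<Longrightarrow> a \<ominus> b \<in> H_ge k"
  unfolding a_minus_def using uminus_eq_smult[of b] H_ge_add H_ge_smult unfolding H_ge_def by auto

lemma H_ge_anti: "j \<le> k \<Longrightarrow> H_ge k \<subseteq> H_ge j"
  unfolding H_ge_def by auto

lemma H_in_H_ge: "a \<in> H i \<Longrightarrow> k \<le> i \<Longrightarrow> a \<in> H_ge k"
  unfolding H_ge_def using component_homogeneous H_in by auto

lemma H_Int_H_ge: "a \<in> H i \<Longrightarrow> a \<in> H_ge k \<Longrightarrow> i < k \<Longrightarrow> a = \<zero>"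
  unfolding H_ge_def using component_homogeneous by auto

lemma H_ge_Suc:
  assumes "e \<in> H_ge k"
  shows "e \<ominus> component e k \<in> H_ge (Suc k)"
proof -
  have e: "e \<in> carrier E" "component e k \<in> H k" using assms component(1) unfolding H_ge_def by auto
  have "component (e \<ominus> component e k) i = \<zero>" if "i < Suc k" for i
  proof -
    have c: "component e i \<in> carrier E" using H_in component(1)[OF e(1)] by blast
    have "component (e \<ominus> component e k) i = component e i \<oplus> (- 1) \<odot> component (component e k) i"
      unfolding a_minus_def using uminus_eq_smult e H_in smult_in component_add component_smult by simp
    also have "\<dots> = \<zero>"
    proof (cases "i = k")
      case True
      thus ?thesis using component_homogeneous[OF e(2)] uminus_eq_smult[OF c] c V.r_neg[OF c] by simp
    next
      case False
      hence "component e i = \<zero>" using assms that unfolding H_ge_def by auto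
      moreover have "(- 1) \<odot> \<zero> = \<zero>" by (rule V.smult_r_null) (simp add: class_ring_simps)
      ultimately show ?thesis using component_homogeneous[OF e(2)] False by simp
    qed
    finally show ?thesis .
  qed
  thus ?thesis unfolding H_ge_def using e H_in by auto
qed

text \<open>Homogeneous components are added one at a time; bilinear statements about
  \<open>H_ge\<close> thereby reduce to homogeneous factors.\<close>

lemma H_ge_induct:
  assumes e: "e \<in> H_ge k" and zero: "P \<zero>"
    and step: "\<And>i a s. \<lbrakk>k \<le> i; a \<in> H i; s \<in> carrier E; P s\<rbrakk> \<Longrightarrow> P (a \<oplus> s)"
  shows "P e"
proof -
  have ec: "e \<in> carrier E" using e unfolding H_ge_def by auto
  note in_carrier = H_in[OF component(1)[OF ec]]
  have "P (\<Oplus>i\<in>A. component e i) \<and> (\<Oplus>i\<in>A. component e i) \<in> carrier E" if "finite A" "A \<subseteq> {k..}" for A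
    using that
  proof (induction A)
    case (insert x A)
    thus ?case using step[of x "component e x"] component(1)[OF ec] in_carrier by (auto simp: V.finsum_insert)
  qed (use zero in auto)
  moreover have "{i. component e i \<noteq> \<zero>} \<subseteq> {k..}"
    using e unfolding H_ge_def by (auto simp: not_less[symmetric])
  ultimately show ?thesis using component(2,3)[OF ec] by metis
qed

lemma H_ge_mult:
  assumes "a \<in> H_ge i" "b \<in> H_ge j"
  shows "a \<otimes> b \<in> H_ge (i + j)"
proof (rule H_ge_induct[OF assms(1)])
  have b: "b \<in> carrier E" using assms(2) unfolding H_ge_def by auto
  show "\<zero> \<otimes> b \<in> H_ge (i + j)" using mult_zero_left[OF b] H_ge_zero by simp
  fix i' x s assume x: "i \<le> i'" "x \<in> H i'" and s: "s \<in> carrier E" "s \<otimes> b \<in> H_ge (i + j)"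
  have "x \<otimes> b \<in> H_ge (i + j)"
  proof (rule H_ge_induct[OF assms(2)])
    show "x \<otimes> \<zero> \<in> H_ge (i + j)" using mult_zero_right[OF H_in[OF x(2)]] H_ge_zero by simp
    fix j' y t assume y: "j \<le> j'" "y \<in> H j'" "t \<in> carrier E" "x \<otimes> t \<in> H_ge (i + j)"
    have "x \<otimes> y \<in> H_ge (i + j)" using H_in_H_ge[OF H_mult[OF x(2) y(2)]] x y by simp
    thus "x \<otimes> (y \<oplus> t) \<in> H_ge (i + j)"
      using distrib_left[OF H_in[OF x(2)] H_in[OF y(2)] y(3)] H_ge_add y by simp
  qed
  thus "(x \<oplus> s) \<otimes> b \<in> H_ge (i + j)"
    using distrib_right[OF H_in[OF x(2)] s(1) b] H_ge_add s by simp
qed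

lemma power_filtration_subset: "power_filtration (H_ge 1) k a \<Longrightarrow> a \<in> H_ge k \<and> a \<in> H_ge 1"
proof (induction rule: power_filtration.induct)
  case (mult i a j b k)
  have "a \<otimes> b \<in> H_ge (i + j)" "a \<otimes> b \<in> H_ge (1 + 1)" using mult.IH H_ge_mult by blast+
  thus ?case using H_ge_anti[OF mult.hyps(3)] H_ge_anti[of 1 "1 + 1"] by auto
next
  case (base a k)
  thus ?case using H_ge_anti[of k 1] by auto
qed (simp_all add: H_ge_zero H_ge_add H_ge_smult)

text \<open>If degree 1 generates, an element of degree \<open>i\<close> is a combination of
  \<open>i\<close>-fold products of elements of positive degree. So \<open>H_ge 1\<close> alone
  determines the whole filtration.\<close>

lemma H_ge_eq_power_filtration:
  assumes gen: "fin_gen_degree_one E H" and k: "1 \<le> k"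
  shows "H_ge k = {a. power_filtration (H_ge 1) k a}"
proof
  show "{a. power_filtration (H_ge 1) k a} \<subseteq> H_ge k" using power_filtration_subset by blast
  let ?W = "power_filtration (H_ge 1)"
  \<comment> \<open>\<open>S\<close> contains the scalars and degree 1 and is closed under the ring
    operations, hence is everything. Degree 0 is exempt from the condition because scalars are not
    products of positive elements.\<close>
  define S where "S = {e \<in> carrier E. \<forall>i\<ge>1. ?W i (component e i)}"
  have S_add: "a \<oplus> b \<in> S" if "a \<in> S" "b \<in> S" for a b
    using that component_add power_filtration.add unfolding S_def by auto
  have S_smult: "c \<odot> a \<in> S" if "a \<in> S" for a c
    using that component_smult smult_in power_filtration.smult unfolding S_def by auto
  have S_zero: "\<zero> \<in> S"
    unfolding S_def using component_zero power_filtration.zero by auto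
  have S_homogeneous: "a \<in> S" if "a \<in> H i" "i = 0 \<or> ?W i (a)" for a i
    using that component_homogeneous[OF that(1)] H_in power_filtration.zero unfolding S_def by auto
  have S_mult: "a \<otimes> b \<in> S" if "a \<in> S" "b \<in> S" for a b
  proof -
    have c: "a \<in> carrier E" "b \<in> carrier E" using that unfolding S_def by auto
    have hom: "x \<otimes> y \<in> S" if "x \<in> H i" "i = 0 \<or> ?W i (x)" "y \<in> H j" "j = 0 \<or> ?W j (y)" for x y i j
    proof (cases "i = 0 \<or> j = 0")
      case True
      note hyp = that
      have "y \<in> S" "x \<in> S" using S_homogeneous that by blast+
      show ?thesis
      proof (cases "i = 0")
        case True
        then obtain c where "x = c \<odot> \<one>" using hyp(1) H_0 by blast
        thus ?thesis using \<open>y \<in> S\<close> S_smult smult_left one_in one_left H_in[OF hyp(3)] by simp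
      next
        case False
        then obtain c where "y = c \<odot> \<one>" using hyp(3) \<open>i = 0 \<or> j = 0\<close> H_0 by blast
        thus ?thesis using \<open>x \<in> S\<close> S_smult smult_right one_in one_right H_in[OF hyp(1)] by simp
      qed
    next
      case False
      thus ?thesis
        using S_homogeneous[OF H_mult[OF that(1,3)]] power_filtration.mult[of "H_ge 1" i x j y "i + j"] that by simp
    qed
    have cb: "component b j \<in> H j \<and> (j = 0 \<or> ?W j (component b j))"
      and ca: "component a j \<in> H j \<and> (j = 0 \<or> ?W j (component a j))" for j
      using component(1)[OF c(1)] component(1)[OF c(2)] that unfolding S_def by (auto simp: Suc_le_eq)
    have left: "x \<otimes> b \<in> S" if x: "x \<in> H i" "i = 0 \<or> ?W i (x)" for x i
    proof -
      have "x \<otimes> (\<Oplus>j\<in>A. component b j) \<in> S \<and> (\<Oplus>j\<in>A. component b j) \<in> carrier E" if "finite A" for A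
        using that
      proof (induction A)
        case empty
        thus ?case using mult_zero_right[OF H_in[OF x(1)]] S_zero by simp
      next
        case (insert j A)
        have "component b i \<in> carrier E" for i using cb H_in by blast
        thus ?case using insert S_add hom[OF x cb[THEN conjunct1] cb[THEN conjunct2]]
          by (auto simp: V.finsum_insert distrib_left[OF H_in[OF x(1)]])
      qed
      thus ?thesis using component(2,3)[OF c(2)] by metis
    qed
    have "(\<Oplus>j\<in>A. component a j) \<otimes> b \<in> S \<and> (\<Oplus>j\<in>A. component a j) \<in> carrier E" if "finite A" for A
      using that
    proof (induction A)
      case empty
      thus ?case using mult_zero_left[OF c(2)] S_zero by simp
    next
      case (insert j A)
      have "component a i \<in> carrier E" for i using ca H_in by blast
      thus ?case using insert S_add left[OF ca[THEN conjunct1] ca[THEN conjunct2]]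
        by (auto simp: V.finsum_insert distrib_right[OF _ _ c(2)])
    qed
    thus ?thesis using component(2,3)[OF c(1)] by metis
  qed
  obtain X where X: "X \<subseteq> H 1" "generate_ring E (range (\<lambda>c. c \<odot> \<one>) \<union> X) = carrier E"
    using gen unfolding fin_gen_degree_one_def by auto
  have "a \<in> S" if "a \<in> generate_ring E (range (\<lambda>c. c \<odot> \<one>) \<union> X)" for a
    using that
  proof induction
    case one
    have "\<one> \<in> H 0" unfolding H_0 using one_in V.smult_one by (auto simp: class_ring_simps intro!: image_eqI[of _ _ 1])
    thus ?case using S_homogeneous by blast
  next
    case (incl h)
    thus ?case
    proof
      assume "h \<in> X"
      hence h: "h \<in> H 1" using X by auto
      thus ?thesis using S_homogeneous[OF h] power_filtration.base[of h "H_ge 1" 1] H_in_H_ge[OF h] by simp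
    qed (use S_homogeneous H_0 in blast)
  next
    case (a_inv h)
    thus ?case using S_smult[of h "- 1"] uminus_eq_smult[of h] unfolding S_def by auto
  qed (use S_add S_mult in blast)+
  hence all: "carrier E \<subseteq> S" using X by blast
  show "H_ge k \<subseteq> {a. power_filtration (H_ge 1) k a}"
  proof
    fix e assume "e \<in> H_ge k"
    hence "?W k e"
    proof (rule H_ge_induct)
      show "?W k (\<zero>)" by (rule power_filtration.zero)
      fix i a s assume *: "k \<le> i" "a \<in> H i" "s \<in> carrier E" "?W k (s)"
      have "?W i (component a i)" using all H_in[OF *(2)] k * unfolding S_def by fastforce
      hence "?W i (a)" using component_homogeneous[OF *(2)] by simp
      \<comment> \<open>The exponent can be lowered: the inequalities in the rules of
        \<open>power_filtration\<close> are there for this.\<close>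
      hence "?W k a" using \<open>k \<le> i\<close>
      proof (induction arbitrary: k rule: power_filtration.induct)
        case (mult i a j b k')
        show ?case by (rule power_filtration.mult[OF mult.hyps(1,2)]) (use mult in simp)
      qed (auto intro: power_filtration.intros)
      thus "?W k (a \<oplus> s)" using * power_filtration.add by blast
    qed
    thus "e \<in> {a. power_filtration (H_ge 1) k a}" by simp
  qed
qed

text \<open>
  An element of a nilpotent ideal lies in \<open>H_ge 1\<close>: otherwise its powers would have nonzero
  components in \<open>H 0\<close>.
\<close>

lemma H_ge_1_eq:
  assumes one_ne: "\<one> \<noteq> \<zero>"
    and F: "F 0 = carrier E" "F N = {\<zero>}"
    and F_mult: "\<And>k a b. \<lbrakk>a \<in> F 1; b \<in> F k\<rbrakk> \<Longrightarrow> a \<otimes> b \<in> F (Suc k)"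
    and F_1: "F 1 \<subseteq> carrier E"
    and decomp: "\<And>e. e \<in> carrier E \<Longrightarrow> \<exists>c. \<exists>f\<in>F 1. e = c \<odot> \<one> \<oplus> f"
  shows "H_ge 1 = F 1"
proof -
  have oneH: "c \<odot> \<one> \<in> H 0" for c unfolding H_0 by auto
  have smult_one_zero: "c = 0" if "c \<odot> \<one> = \<zero>" for c
  proof (rule ccontr)
    assume "c \<noteq> 0"
    have "\<one> = (inverse c * c) \<odot> \<one>" using \<open>c \<noteq> 0\<close> V.smult_one[OF one_in] by (simp add: class_ring_simps)
    also have "\<dots> = inverse c \<odot> (c \<odot> \<one>)"
      using V.smult_assoc1[of "inverse c" c \<one>] one_in by (simp add: class_ring_simps)
    also have "\<dots> = \<zero>" unfolding that by (rule V.smult_r_null) (simp add: class_ring_simps)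
    finally show False using one_ne by simp
  qed
  have sub: "f \<in> H_ge 1" if f: "f \<in> F 1" for f
  proof -
    have fc: "f \<in> carrier E" using f F_1 by blast
    obtain c where c: "component f 0 = c \<odot> \<one>" using component(1)[OF fc, of 0] H_0 by auto
    define h where "h = f \<ominus> component f 0"
    have h: "h \<in> H_ge 1" using H_ge_Suc[of f 0] fc unfolding h_def H_ge_def by simp
    have hc: "h \<in> carrier E" using h unfolding H_ge_def by simp
    have one_c: "c \<odot> \<one> \<in> carrier E" for c by (rule smult_in[OF one_in])
    have fh: "f = c \<odot> \<one> \<oplus> h"
      unfolding h_def c a_minus_def using fc one_c by (simp add: V.add.m_lcomm V.r_neg)
    \<comment> \<open>Powers of \<open>f\<close> bracketed to the right: \<open>w k\<close> lies in
      \<open>F k\<close> while its part of degree 0 is \<open>c ^ k\<close> times the unit. At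
      \<open>k = N\<close> this forces \<open>c ^ N = 0\<close>.\<close>
    define w where "w k = ((\<lambda>v. f \<otimes> v) ^^ k) \<one>" for k
    have w: "w k \<in> F k \<and> (\<exists>v\<in>H_ge 1. w k = (c ^ k) \<odot> \<one> \<oplus> v)" for k
    proof (induction k)
      case 0
      have "\<one> = 1 \<odot> \<one> \<oplus> \<zero>" using one_in V.smult_one by (simp add: class_ring_simps)
      hence "\<exists>v\<in>H_ge 1. w 0 = (c ^ 0) \<odot> \<one> \<oplus> v" using H_ge_zero[of 1] by (intro bexI[of _ \<zero>]) (simp_all add: w_def)
      thus ?case using F one_in by (simp add: w_def)
    next
      case (Suc k)
      then obtain v where v: "v \<in> H_ge 1" "w k = (c ^ k) \<odot> \<one> \<oplus> v" by blast
      have vc: "v \<in> carrier E" and wc: "w k \<in> carrier E" using v one_c unfolding H_ge_def by auto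
      have "w (Suc k) = f \<otimes> w k" by (simp add: w_def)
      also have "\<dots> = (c \<odot> \<one>) \<otimes> w k \<oplus> h \<otimes> w k"
        using distrib_right[OF one_c hc wc] fh by simp
      also have "(c \<odot> \<one>) \<otimes> w k = c \<odot> w k" using smult_left one_left one_in wc by simp
      also have "\<dots> = (c ^ Suc k) \<odot> \<one> \<oplus> c \<odot> v"
        using V.smult_r_distr[of c "(c ^ k) \<odot> \<one>" v] V.smult_assoc1[of c "c ^ k" \<one>] one_c one_in vc v(2)
        by (simp add: class_ring_simps)
      finally have "w (Suc k) = (c ^ Suc k) \<odot> \<one> \<oplus> (c \<odot> v \<oplus> h \<otimes> w k)"
        using one_c vc wc hc smult_in mult_closed by (simp add: V.a_assoc)
      moreover have "w k \<in> H_ge 0" using wc unfolding H_ge_def by simp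
      hence "h \<otimes> w k \<in> H_ge 1" using H_ge_mult[OF h, of "w k" 0] by simp
      hence "c \<odot> v \<oplus> h \<otimes> w k \<in> H_ge 1" using v H_ge_smult H_ge_add by blast
      moreover have "w (Suc k) \<in> F (Suc k)" using F_mult[OF f] Suc by (simp add: w_def)
      ultimately show ?case by blast
    qed
    obtain v where v: "v \<in> H_ge 1" "\<zero> = (c ^ N) \<odot> \<one> \<oplus> v" using w[of N] F(2) by auto
    have vc: "v \<in> carrier E" using v unfolding H_ge_def by auto
    have "component \<zero> 0 = component ((c ^ N) \<odot> \<one>) 0 \<oplus> component v 0"
      unfolding v(2) by (rule component_add[OF one_c vc])
    moreover have "component v 0 = \<zero>" using v(1) unfolding H_ge_def by simp
    ultimately have "(c ^ N) \<odot> \<one> = \<zero>"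
      using component_zero[of 0] fun_cong[OF component_homogeneous[OF oneH[of "c ^ N"]], of 0] one_c by simp
    hence "c = 0" using smult_one_zero by fastforce
    moreover have "0 \<odot> \<one> = \<zero>" using V.smult_l_null[OF one_in] by (simp add: class_ring_simps)
    ultimately show ?thesis using fh h hc by simp
  qed
  \<comment> \<open>Here \<open>e = c \<odot> \<one> \<oplus> f\<close> with \<open>f\<close> in
    \<open>H_ge 1\<close> by the inclusion just shown; comparing parts of degree 0 removes the
    scalar.\<close>
  moreover have "e \<in> F 1" if e: "e \<in> H_ge 1" for e
  proof -
    obtain c f where *: "f \<in> F 1" "e = c \<odot> \<one> \<oplus> f" using decomp e unfolding H_ge_def by blast
    have fH: "f \<in> H_ge 1" by (rule sub[OF *(1)])
    have cr: "f \<in> carrier E" "c \<odot> \<one> \<in> carrier E" using F_1 * smult_in one_in by auto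
    have "component e 0 = c \<odot> \<one> \<oplus> component f 0"
      unfolding *(2) component_add[OF cr(2,1)] using component_homogeneous[OF oneH] by simp
    hence "c \<odot> \<one> = \<zero>" using e fH cr unfolding H_ge_def by auto
    thus ?thesis using * cr by simp
  qed
  ultimately show ?thesis by blast
qed

end

text \<open>The piece of degree \<open>k\<close> is a complement of \<open>H_ge (Suc k)\<close> in
  \<open>H_ge k\<close>, and the two gradings share this filtration. Two complements of the same
  subspace are isomorphic, although the pieces themselves may differ.\<close>

lemma hilbert_series_unique:
  assumes "graded_algebra E H" "graded_algebra E H'" "fin_gen_degree_one E H" "fin_gen_degree_one E H'"
    and eq1: "graded_algebra.H_ge E H 1 = graded_algebra.H_ge E H' 1"
  shows "hilbert_series E H = hilbert_series E H'"
proof -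
  interpret A: graded_algebra E H by fact
  interpret B: graded_algebra E H' by fact
  have eq: "A.H_ge k = B.H_ge k" for k
  proof (cases "1 \<le> k")
    case True
    have "A.H_ge k = {a. A.power_filtration (A.H_ge 1) k a}"
      by (rule A.H_ge_eq_power_filtration[OF assms(3) True])
    also have "\<dots> = {a. A.power_filtration (B.H_ge 1) k a}" by (simp only: eq1)
    also have "\<dots> = B.H_ge k"
      by (rule B.H_ge_eq_power_filtration[OF assms(4) True, symmetric])
    finally show ?thesis .
  next
    case False
    thus ?thesis unfolding A.H_ge_def B.H_ge_def by simp
  qed
  have "vectorspace.dim class_ring (E\<lparr>carrier := H k\<rparr>) = vectorspace.dim class_ring (E\<lparr>carrier := H' k\<rparr>)" for k
  proof -
    have vs1: "vectorspace class_ring (E\<lparr>carrier := H k\<rparr>)" by (rule A.V.subspace_is_vs[OF A.H_subspace])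
    have vs2: "vectorspace class_ring (E\<lparr>carrier := H' k\<rparr>)" by (rule A.V.subspace_is_vs[OF B.H_subspace])
    have mem: "a \<in> H k \<Longrightarrow> a \<in> B.H_ge k" "b \<in> H' k \<Longrightarrow> b \<in> A.H_ge k" for a b
      using A.H_in_H_ge B.H_in_H_ge eq by auto
    have diff: "a \<ominus>\<^bsub>E\<^esub> B.component a k \<in> A.H_ge (Suc k)" if "a \<in> H k" for a
      using B.H_ge_Suc[OF mem(1)[OF that]] eq by simp
    have zero_of: "a = b" if "a \<ominus>\<^bsub>E\<^esub> b = \<zero>\<^bsub>E\<^esub>" "a \<in> carrier E" "b \<in> carrier E" for a b
    proof -
      have "a = (a \<ominus>\<^bsub>E\<^esub> b) \<oplus>\<^bsub>E\<^esub> b" using that(2,3) by (simp add: a_minus_def A.V.a_assoc A.V.l_neg)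
      thus ?thesis using that by simp
    qed
    \<comment> \<open>The isomorphism takes the component for the second grading. It changes an
      element only modulo \<open>H_ge (Suc k)\<close>, which gives injectivity, and the component
      for the first grading supplies preimages.\<close>
    have bij: "bij_betw (\<lambda>a. B.component a k) (H k) (H' k)"
      unfolding bij_betw_def
    proof
      show "inj_on (\<lambda>a. B.component a k) (H k)"
      proof (rule inj_onI)
        fix a b assume ab: "a \<in> H k" "b \<in> H k" "B.component a k = B.component b k"
        have c: "a \<in> carrier E" "b \<in> carrier E" "B.component a k \<in> carrier E"
          using A.H_in ab B.H_in[OF B.component(1)] by auto
        have "(a \<ominus>\<^bsub>E\<^esub> B.component a k) \<ominus>\<^bsub>E\<^esub> (b \<ominus>\<^bsub>E\<^esub> B.component b k) \<in> A.H_ge (Suc k)"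
          by (intro A.H_ge_minus diff ab)
        moreover have "(a \<ominus>\<^bsub>E\<^esub> B.component a k) \<ominus>\<^bsub>E\<^esub> (b \<ominus>\<^bsub>E\<^esub> B.component b k) = a \<ominus>\<^bsub>E\<^esub> b"
          unfolding ab(3)[symmetric] a_minus_def using c
          by (simp add: A.V.minus_add A.V.a_ac A.V.r_neg A.V.r_neg1 A.V.r_neg2)
        moreover have "a \<ominus>\<^bsub>E\<^esub> b \<in> H k"
          unfolding a_minus_def using A.uminus_eq_smult[OF c(2)] A.H_add A.H_smult ab by simp
        ultimately have "a \<ominus>\<^bsub>E\<^esub> b = \<zero>\<^bsub>E\<^esub>" using A.H_Int_H_ge by (metis lessI)
        thus "a = b" using zero_of c by blast
      qed
      show "(\<lambda>a. B.component a k) ` H k = H' k"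
      proof (rule subset_antisym)
        show "(\<lambda>a. B.component a k) ` H k \<subseteq> H' k" using B.component(1) A.H_in by blast
        show "H' k \<subseteq> (\<lambda>a. B.component a k) ` H k"
        proof
          fix b assume b: "b \<in> H' k"
          let ?a = "A.component b k"
          have c: "b \<in> carrier E" "?a \<in> H k" "?a \<in> carrier E"
            using B.H_in[OF b] A.component(1) A.H_in by auto
          have d: "b \<ominus>\<^bsub>E\<^esub> ?a \<in> B.H_ge (Suc k)" using A.H_ge_Suc[OF mem(2)[OF b]] eq by simp
          have "b = (b \<ominus>\<^bsub>E\<^esub> ?a) \<oplus>\<^bsub>E\<^esub> ?a" using c by (simp add: a_minus_def A.V.a_assoc A.V.l_neg)
          hence "B.component b k = B.component (b \<ominus>\<^bsub>E\<^esub> ?a) k \<oplus>\<^bsub>E\<^esub> B.component ?a k"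
            using B.component_add c A.V.minus_closed by metis
          hence "B.component ?a k = b"
            using d B.component_homogeneous[OF b] B.H_in[OF B.component(1)[OF c(3)]] unfolding B.H_ge_def by simp
          thus "b \<in> (\<lambda>a. B.component a k) ` H k" using c(2) by force
        qed
      qed
    qed
    show ?thesis
      using dim_eq_of_iso[OF vs1 vs2, of "\<lambda>a. B.component a k"] bij B.component_add B.component_smult A.H_in
      by simp
  qed
  thus ?thesis unfolding hilbert_series_def by simp
qed

subsection \<open>The Yoneda algebra\<close>

context central_resolution
begin

abbreviation "YA \<equiv> yoneda_algebra \<epsilon> Q"

lemma Ext_abelian: "abelian_group (Ext \<epsilon> Q i)"
  using Ext_vectorspace[of i] unfolding vectorspace_def Module.module_def by blast

lemma Ext_zero_in: "\<zero>\<^bsub>Ext \<epsilon> Q i\<^esub> \<in> carrier (Ext \<epsilon> Q i)"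
  using abelian_monoid.zero_closed[OF abelian_group.axioms(1)[OF Ext_abelian]] .

lemma Ext_add_zero:
  assumes "X \<in> carrier (Ext \<epsilon> Q i)"
  shows "X \<oplus>\<^bsub>Ext \<epsilon> Q i\<^esub> \<zero>\<^bsub>Ext \<epsilon> Q i\<^esub> = X" "\<zero>\<^bsub>Ext \<epsilon> Q i\<^esub> \<oplus>\<^bsub>Ext \<epsilon> Q i\<^esub> X = X"
proof -
  interpret abelian_group "Ext \<epsilon> Q i" by (rule Ext_abelian)
  show "X \<oplus>\<^bsub>Ext \<epsilon> Q i\<^esub> \<zero>\<^bsub>Ext \<epsilon> Q i\<^esub> = X" "\<zero>\<^bsub>Ext \<epsilon> Q i\<^esub> \<oplus>\<^bsub>Ext \<epsilon> Q i\<^esub> X = X"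
    using assms by simp_all
qed

lemma Ext_smult_zero: "c \<odot>\<^bsub>Ext \<epsilon> Q i\<^esub> \<zero>\<^bsub>Ext \<epsilon> Q i\<^esub> = \<zero>\<^bsub>Ext \<epsilon> Q i\<^esub>"
  by (simp add: zero_Ext smult_Ext zero_fun_def)

lemma Ext_zero_smult: "X \<in> carrier (Ext \<epsilon> Q i) \<Longrightarrow> 0 \<odot>\<^bsub>Ext \<epsilon> Q i\<^esub> X = \<zero>\<^bsub>Ext \<epsilon> Q i\<^esub>"
  by (auto simp: carrier_Ext zero_Ext smult_Ext zero_fun_def)

lemma Ext_smult_in: "X \<in> carrier (Ext \<epsilon> Q i) \<Longrightarrow> c \<odot>\<^bsub>Ext \<epsilon> Q i\<^esub> X \<in> carrier (Ext \<epsilon> Q i)"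
  by (auto simp: carrier_Ext smult_Ext intro!: imageI cocycle_scale)

lemma yoneda_zero_left: "Y \<in> carrier (Ext \<epsilon> Q j) \<Longrightarrow> yp i j \<zero>\<^bsub>Ext \<epsilon> Q i\<^esub> Y = \<zero>\<^bsub>Ext \<epsilon> Q (i + j)\<^esub>"
  using yoneda_smult_left[OF Ext_zero_in, of Y j i 0] Ext_zero_smult[OF yoneda_closed[OF Ext_zero_in, of Y j i]]
  unfolding Ext_smult_zero by simp

lemma yoneda_zero_right: "X \<in> carrier (Ext \<epsilon> Q i) \<Longrightarrow> yp i j X \<zero>\<^bsub>Ext \<epsilon> Q j\<^esub> = \<zero>\<^bsub>Ext \<epsilon> Q (i + j)\<^esub>"
  using yoneda_smult_right[OF _ Ext_zero_in, of X i j 0] Ext_zero_smult[OF yoneda_closed[OF _ Ext_zero_in, of X i j]]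
  unfolding Ext_smult_zero by simp

lemma carrier_YA: "e \<in> carrier YA \<longleftrightarrow>
    (\<forall>i. e i \<in> carrier (Ext \<epsilon> Q i)) \<and> finite {i. e i \<noteq> \<zero>\<^bsub>Ext \<epsilon> Q i\<^esub>}"
  by (simp add: yoneda_algebra_def)

lemma YA_simps:
  "\<zero>\<^bsub>YA\<^esub> i = \<zero>\<^bsub>Ext \<epsilon> Q i\<^esub>"
  "\<one>\<^bsub>YA\<^esub> i = (if i = 0 then cls 0 (extend_zero (obj Q 0) (aug Q)) else \<zero>\<^bsub>Ext \<epsilon> Q i\<^esub>)"
  "(e \<oplus>\<^bsub>YA\<^esub> e') i = e i \<oplus>\<^bsub>Ext \<epsilon> Q i\<^esub> e' i"
  "(c \<odot>\<^bsub>YA\<^esub> e) i = c \<odot>\<^bsub>Ext \<epsilon> Q i\<^esub> e i"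
  "(e \<otimes>\<^bsub>YA\<^esub> e') k = (\<Oplus>\<^bsub>Ext \<epsilon> Q k\<^esub>i\<in>{..k}. yp i (k - i) (e i) (e' (k - i)))"
  by (simp_all add: yoneda_algebra_def)

lemma YA_in: "e \<in> carrier YA \<Longrightarrow> e i \<in> carrier (Ext \<epsilon> Q i)"
  by (simp add: carrier_YA)

lemma yp_in:
  assumes "e \<in> carrier YA" "e' \<in> carrier YA" "i \<le> k"
  shows "yp i (k - i) (e i) (e' (k - i)) \<in> carrier (Ext \<epsilon> Q k)"
  using yoneda_closed[OF YA_in[OF assms(1), of i] YA_in[OF assms(2), of "k - i"]] assms(3) by simp

lemma YA_mult_zero:
  assumes "\<And>i. i \<le> k \<Longrightarrow> yp i (k - i) (e i) (e' (k - i)) = \<zero>\<^bsub>Ext \<epsilon> Q k\<^esub>"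
  shows "(e \<otimes>\<^bsub>YA\<^esub> e') k = \<zero>\<^bsub>Ext \<epsilon> Q k\<^esub>"
proof -
  interpret abelian_group "Ext \<epsilon> Q k" by (rule Ext_abelian)
  have "(\<Oplus>\<^bsub>Ext \<epsilon> Q k\<^esub>i\<in>{..k}. yp i (k - i) (e i) (e' (k - i))) = (\<Oplus>\<^bsub>Ext \<epsilon> Q k\<^esub>i\<in>{..k}. \<zero>\<^bsub>Ext \<epsilon> Q k\<^esub>)"
    using assms by (intro finsum_cong') auto
  thus ?thesis by (simp add: YA_simps)
qed

lemma YA_term_zero:
  assumes "e \<in> carrier YA" "e' \<in> carrier YA" "i \<le> k" "e i = \<zero>\<^bsub>Ext \<epsilon> Q i\<^esub> \<or> e' (k - i) = \<zero>\<^bsub>Ext \<epsilon> Q (k - i)\<^esub>"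
  shows "yp i (k - i) (e i) (e' (k - i)) = \<zero>\<^bsub>Ext \<epsilon> Q k\<^esub>"
  using assms(3,4) yoneda_zero_left[OF YA_in[OF assms(2)], of i "k - i"]
    yoneda_zero_right[OF YA_in[OF assms(1)], of i "k - i"] by auto

lemma YA_mult_closed:
  assumes e: "e \<in> carrier YA" "e' \<in> carrier YA"
  shows "e \<otimes>\<^bsub>YA\<^esub> e' \<in> carrier YA"
  unfolding carrier_YA
proof
  have "(e \<otimes>\<^bsub>YA\<^esub> e') k \<in> carrier (Ext \<epsilon> Q k)" for k
  proof -
    interpret abelian_group "Ext \<epsilon> Q k" by (rule Ext_abelian)
    show ?thesis unfolding YA_simps using yp_in[OF e] by (intro finsum_closed) auto
  qed
  thus "\<forall>k. (e \<otimes>\<^bsub>YA\<^esub> e') k \<in> carrier (Ext \<epsilon> Q k)" by blast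
  obtain m m' where m: "\<And>i. e i \<noteq> \<zero>\<^bsub>Ext \<epsilon> Q i\<^esub> \<Longrightarrow> i \<le> m" "\<And>i. e' i \<noteq> \<zero>\<^bsub>Ext \<epsilon> Q i\<^esub> \<Longrightarrow> i \<le> m'"
    using e unfolding carrier_YA finite_nat_set_iff_bounded_le by blast
  have "(e \<otimes>\<^bsub>YA\<^esub> e') k = \<zero>\<^bsub>Ext \<epsilon> Q k\<^esub>" if "k > m + m'" for k
  proof (intro YA_mult_zero YA_term_zero e)
    fix i assume "i \<le> k"
    hence "i > m \<or> k - i > m'" using that by linarith
    thus "e i = \<zero>\<^bsub>Ext \<epsilon> Q i\<^esub> \<or> e' (k - i) = \<zero>\<^bsub>Ext \<epsilon> Q (k - i)\<^esub>" using m by (meson not_le)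
  qed
  thus "finite {k. (e \<otimes>\<^bsub>YA\<^esub> e') k \<noteq> \<zero>\<^bsub>Ext \<epsilon> Q k\<^esub>}"
    unfolding finite_nat_set_iff_bounded_le by (metis (mono_tags, lifting) mem_Collect_eq not_le)
qed

lemma YA_one_in: "\<one>\<^bsub>YA\<^esub> \<in> carrier YA"
  unfolding carrier_YA
proof
  show "\<forall>i. \<one>\<^bsub>YA\<^esub> i \<in> carrier (Ext \<epsilon> Q i)"
    using aug_cocycle Ext_zero_in by (auto simp: YA_simps carrier_Ext)
  have "{i. \<one>\<^bsub>YA\<^esub> i \<noteq> \<zero>\<^bsub>Ext \<epsilon> Q i\<^esub>} \<subseteq> {0}" by (auto simp: YA_simps)
  thus "finite {i. \<one>\<^bsub>YA\<^esub> i \<noteq> \<zero>\<^bsub>Ext \<epsilon> Q i\<^esub>}" by (rule finite_subset) simp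
qed

lemma YA_bilinear:
  assumes "vectorspace class_ring YA"
  shows "bilinear_algebra YA"
proof (rule bilinear_algebra.intro)
  show "vectorspace class_ring YA" by fact
  show "\<one>\<^bsub>YA\<^esub> \<in> carrier YA" by (rule YA_one_in)
next
  fix a b d assume a: "a \<in> carrier YA" and b: "b \<in> carrier YA"
  show "a \<otimes>\<^bsub>YA\<^esub> b \<in> carrier YA" by (rule YA_mult_closed[OF a b])
  show "(c \<odot>\<^bsub>YA\<^esub> a) \<otimes>\<^bsub>YA\<^esub> b = c \<odot>\<^bsub>YA\<^esub> (a \<otimes>\<^bsub>YA\<^esub> b)" 
    "a \<otimes>\<^bsub>YA\<^esub> (c \<odot>\<^bsub>YA\<^esub> b) = c \<odot>\<^bsub>YA\<^esub> (a \<otimes>\<^bsub>YA\<^esub> b)" for c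
  proof -
    have *: "(\<Oplus>\<^bsub>Ext \<epsilon> Q k\<^esub>i\<in>{..k}. c \<odot>\<^bsub>Ext \<epsilon> Q k\<^esub> yp i (k - i) (a i) (b (k - i))) = (c \<odot>\<^bsub>YA\<^esub> (a \<otimes>\<^bsub>YA\<^esub> b)) k" for k
    proof -
      interpret vectorspace class_ring "Ext \<epsilon> Q k" by (rule Ext_vectorspace)
      show ?thesis unfolding YA_simps
        using yp_in[OF a b] by (intro finsum_smult[symmetric]) (auto simp: class_ring_simps)
    qed
    have 1: "yp i (k - i) (c \<odot>\<^bsub>Ext \<epsilon> Q i\<^esub> a i) (b (k - i)) = c \<odot>\<^bsub>Ext \<epsilon> Q k\<^esub> yp i (k - i) (a i) (b (k - i))"
      "yp i (k - i) (a i) (c \<odot>\<^bsub>Ext \<epsilon> Q (k - i)\<^esub> b (k - i)) = c \<odot>\<^bsub>Ext \<epsilon> Q k\<^esub> yp i (k - i) (a i) (b (k - i))"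
      if "i \<le> k" for i k
      using yoneda_smult_left[OF YA_in[OF a] YA_in[OF b], of i "k - i" c]
        yoneda_smult_right[OF YA_in[OF a] YA_in[OF b], of i "k - i" c] that by simp_all
    show "(c \<odot>\<^bsub>YA\<^esub> a) \<otimes>\<^bsub>YA\<^esub> b = c \<odot>\<^bsub>YA\<^esub> (a \<otimes>\<^bsub>YA\<^esub> b)" 
    proof
      fix k
      interpret abelian_group "Ext \<epsilon> Q k" by (rule Ext_abelian)
      show "((c \<odot>\<^bsub>YA\<^esub> a) \<otimes>\<^bsub>YA\<^esub> b) k = (c \<odot>\<^bsub>YA\<^esub> (a \<otimes>\<^bsub>YA\<^esub> b)) k"
        unfolding *[symmetric] unfolding YA_simps
        using 1 yp_in[OF a b] Ext_smult_in by (intro finsum_cong') auto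
    qed
    show "a \<otimes>\<^bsub>YA\<^esub> (c \<odot>\<^bsub>YA\<^esub> b) = c \<odot>\<^bsub>YA\<^esub> (a \<otimes>\<^bsub>YA\<^esub> b)" 
    proof
      fix k
      interpret abelian_group "Ext \<epsilon> Q k" by (rule Ext_abelian)
      show "(a \<otimes>\<^bsub>YA\<^esub> (c \<odot>\<^bsub>YA\<^esub> b)) k = (c \<odot>\<^bsub>YA\<^esub> (a \<otimes>\<^bsub>YA\<^esub> b)) k"
        unfolding *[symmetric] unfolding YA_simps
        using 1 yp_in[OF a b] Ext_smult_in by (intro finsum_cong') auto
    qed
  qed
  {
    assume d: "d \<in> carrier YA"
    show "(a \<oplus>\<^bsub>YA\<^esub> b) \<otimes>\<^bsub>YA\<^esub> d = a \<otimes>\<^bsub>YA\<^esub> d \<oplus>\<^bsub>YA\<^esub> b \<otimes>\<^bsub>YA\<^esub> d"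
    proof
      fix k
      interpret abelian_group "Ext \<epsilon> Q k" by (rule Ext_abelian)
      have 1: "yp i (k - i) (a i \<oplus>\<^bsub>Ext \<epsilon> Q i\<^esub> b i) (d (k - i)) =
          yp i (k - i) (a i) (d (k - i)) \<oplus>\<^bsub>Ext \<epsilon> Q k\<^esub> yp i (k - i) (b i) (d (k - i))" if "i \<le> k" for i
        using yoneda_add_left[OF YA_in[OF a] YA_in[OF b] YA_in[OF d], of i "k - i"] that by simp
      have "((a \<oplus>\<^bsub>YA\<^esub> b) \<otimes>\<^bsub>YA\<^esub> d) k = (\<Oplus>\<^bsub>Ext \<epsilon> Q k\<^esub>i\<in>{..k}.
          yp i (k - i) (a i) (d (k - i)) \<oplus>\<^bsub>Ext \<epsilon> Q k\<^esub> yp i (k - i) (b i) (d (k - i)))"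
        unfolding YA_simps using 1 yp_in[OF a d] yp_in[OF b d] by (intro finsum_cong') auto
      also have "\<dots> = (a \<otimes>\<^bsub>YA\<^esub> d \<oplus>\<^bsub>YA\<^esub> b \<otimes>\<^bsub>YA\<^esub> d) k"
        unfolding YA_simps using yp_in[OF a d] yp_in[OF b d] by (intro finsum_addf) auto
      finally show "((a \<oplus>\<^bsub>YA\<^esub> b) \<otimes>\<^bsub>YA\<^esub> d) k = (a \<otimes>\<^bsub>YA\<^esub> d \<oplus>\<^bsub>YA\<^esub> b \<otimes>\<^bsub>YA\<^esub> d) k" .
    qed
    show "a \<otimes>\<^bsub>YA\<^esub> (b \<oplus>\<^bsub>YA\<^esub> d) = a \<otimes>\<^bsub>YA\<^esub> b \<oplus>\<^bsub>YA\<^esub> a \<otimes>\<^bsub>YA\<^esub> d"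
    proof
      fix k
      interpret abelian_group "Ext \<epsilon> Q k" by (rule Ext_abelian)
      have 1: "yp i (k - i) (a i) (b (k - i) \<oplus>\<^bsub>Ext \<epsilon> Q (k - i)\<^esub> d (k - i)) =
          yp i (k - i) (a i) (b (k - i)) \<oplus>\<^bsub>Ext \<epsilon> Q k\<^esub> yp i (k - i) (a i) (d (k - i))" if "i \<le> k" for i
        using yoneda_add_right[OF YA_in[OF a] YA_in[OF b] YA_in[OF d], of i "k - i"] that by simp
      have "(a \<otimes>\<^bsub>YA\<^esub> (b \<oplus>\<^bsub>YA\<^esub> d)) k = (\<Oplus>\<^bsub>Ext \<epsilon> Q k\<^esub>i\<in>{..k}.
          yp i (k - i) (a i) (b (k - i)) \<oplus>\<^bsub>Ext \<epsilon> Q k\<^esub> yp i (k - i) (a i) (d (k - i)))"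
        unfolding YA_simps using 1 yp_in[OF a d] yp_in[OF a b] by (intro finsum_cong') auto
      also have "\<dots> = (a \<otimes>\<^bsub>YA\<^esub> b \<oplus>\<^bsub>YA\<^esub> a \<otimes>\<^bsub>YA\<^esub> d) k"
        unfolding YA_simps using yp_in[OF a d] yp_in[OF a b] by (intro finsum_addf) auto
      finally show "(a \<otimes>\<^bsub>YA\<^esub> (b \<oplus>\<^bsub>YA\<^esub> d)) k = (a \<otimes>\<^bsub>YA\<^esub> b \<oplus>\<^bsub>YA\<^esub> a \<otimes>\<^bsub>YA\<^esub> d) k" .
    qed
  }
next
  fix a assume a: "a \<in> carrier YA"
  show "\<one>\<^bsub>YA\<^esub> \<otimes>\<^bsub>YA\<^esub> a = a"
  proof
    fix k
    interpret abelian_group "Ext \<epsilon> Q k" by (rule Ext_abelian)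
    have "yp i (k - i) (\<one>\<^bsub>YA\<^esub> i) (a (k - i)) = (if 0 = i then a k else \<zero>\<^bsub>Ext \<epsilon> Q k\<^esub>)" if "i \<le> k" for i
      using yoneda_one_left[OF YA_in[OF a], of k] yoneda_zero_left[OF YA_in[OF a], of i "k - i"] that
      by (auto simp: YA_simps)
    hence "(\<one>\<^bsub>YA\<^esub> \<otimes>\<^bsub>YA\<^esub> a) k = (\<Oplus>\<^bsub>Ext \<epsilon> Q k\<^esub>i\<in>{..k}. if 0 = i then a k else \<zero>\<^bsub>Ext \<epsilon> Q k\<^esub>)"
      unfolding YA_simps(5) using YA_in[OF a] by (intro finsum_cong') auto
    also have "\<dots> = a k" using YA_in[OF a] by (intro add.finprod_singleton) auto
    finally show "(\<one>\<^bsub>YA\<^esub> \<otimes>\<^bsub>YA\<^esub> a) k = a k" .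
  qed
  show "a \<otimes>\<^bsub>YA\<^esub> \<one>\<^bsub>YA\<^esub> = a"
  proof
    fix k
    interpret abelian_group "Ext \<epsilon> Q k" by (rule Ext_abelian)
    have "yp i (k - i) (a i) (\<one>\<^bsub>YA\<^esub> (k - i)) = (if k = i then a k else \<zero>\<^bsub>Ext \<epsilon> Q k\<^esub>)" if "i \<le> k" for i
      using yoneda_one_right[OF YA_in[OF a], of k] yoneda_zero_right[OF YA_in[OF a], of i "k - i"] that
      by (auto simp: YA_simps)
    hence "(a \<otimes>\<^bsub>YA\<^esub> \<one>\<^bsub>YA\<^esub>) k = (\<Oplus>\<^bsub>Ext \<epsilon> Q k\<^esub>i\<in>{..k}. if k = i then a k else \<zero>\<^bsub>Ext \<epsilon> Q k\<^esub>)"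
      unfolding YA_simps(5) using YA_in[OF a] by (intro finsum_cong') auto
    also have "\<dots> = a k" using YA_in[OF a] by (intro add.finprod_singleton) auto
    finally show "(a \<otimes>\<^bsub>YA\<^esub> \<one>\<^bsub>YA\<^esub>) k = a k" .
  qed
qed

text \<open>Vanishing of Ext from \<open>N\<close> on makes the ideal of positive Ext degree
  nilpotent, and \<open>H_ge_1_eq\<close> then identifies it with the positive part of any connected
  grading, whether or not that grading is by Ext degree.\<close>

theorem yoneda_hilbert_series_unique:
  assumes vanish: "\<And>i. N \<le> i \<Longrightarrow> cocycle i \<subseteq> cob i"
    and H: "connected_graded YA H" "fin_gen_degree_one YA H"
    and H': "connected_graded YA H'" "fin_gen_degree_one YA H'"
  shows "hilbert_series YA H = hilbert_series YA H'"
proof -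
  \<comment> \<open>Being a subspace includes that the ambient structure is a vector space.\<close>
  have vs: "vectorspace class_ring YA"
    using H(1) unfolding connected_graded_def VectorSpace.subspace_def by blast
  have gr: "graded_algebra YA H" "graded_algebra YA H'"
    using YA_bilinear[OF vs] H(1) H'(1) unfolding graded_algebra_def graded_algebra_axioms_def by auto
  \<comment> \<open>The filtration by Ext degree; \<open>F N\<close> is zero by the vanishing
    hypothesis.\<close>
  define F where "F k = {e \<in> carrier YA. \<forall>i<k. e i = \<zero>\<^bsub>Ext \<epsilon> Q i\<^esub>}" for k :: nat
  have F_mult: "a \<otimes>\<^bsub>YA\<^esub> b \<in> F (Suc k)" if "a \<in> F 1" "b \<in> F k" for a b k
  proof -
    have ab: "a \<in> carrier YA" "b \<in> carrier YA" using that by (auto simp: F_def)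
    have "(a \<otimes>\<^bsub>YA\<^esub> b) i = \<zero>\<^bsub>Ext \<epsilon> Q i\<^esub>" if "i < Suc k" for i
    proof (intro YA_mult_zero YA_term_zero ab)
      fix l assume l: "l \<le> i"
      show "a l = \<zero>\<^bsub>Ext \<epsilon> Q l\<^esub> \<or> b (i - l) = \<zero>\<^bsub>Ext \<epsilon> Q (i - l)\<^esub>"
        using \<open>i < Suc k\<close> l \<open>a \<in> F 1\<close> \<open>b \<in> F k\<close> by (cases "l = 0") (simp_all add: F_def)
    qed
    thus ?thesis using YA_mult_closed[OF ab] by (simp add: F_def)
  qed
  have zero_in: "\<zero>\<^bsub>YA\<^esub> \<in> carrier YA" using Ext_zero_in by (simp add: carrier_YA YA_simps)
  have F_N: "F N = {\<zero>\<^bsub>YA\<^esub>}"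
  proof (rule subset_antisym)
    show "F N \<subseteq> {\<zero>\<^bsub>YA\<^esub>}"
    proof
      fix e assume e: "e \<in> F N"
      have "e i = \<zero>\<^bsub>Ext \<epsilon> Q i\<^esub>" for i
      proof (cases "i < N")
        case False
        obtain z where z: "z \<in> cocycle i" "e i = cls i z"
          using e YA_in[of e i] unfolding F_def carrier_Ext by blast
        hence "z \<in> cob i" using vanish[of i] False by auto
        thus ?thesis unfolding z(2) zero_Ext by (simp add: cls_eq_iff)
      qed (use e F_def in auto)
      hence "e = \<zero>\<^bsub>YA\<^esub>" by (auto simp: YA_simps)
      thus "e \<in> {\<zero>\<^bsub>YA\<^esub>}" by simp
    qed
    show "{\<zero>\<^bsub>YA\<^esub>} \<subseteq> F N" using zero_in by (simp add: F_def YA_simps)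
  qed
  have one_ne: "\<one>\<^bsub>YA\<^esub> \<noteq> \<zero>\<^bsub>YA\<^esub>"
  proof
    assume "\<one>\<^bsub>YA\<^esub> = \<zero>\<^bsub>YA\<^esub>"
    hence "\<one>\<^bsub>YA\<^esub> 0 = \<zero>\<^bsub>YA\<^esub> 0" by simp
    hence "cls 0 (extend_zero (obj Q 0) (aug Q)) = cls 0 0"
      by (simp only: YA_simps zero_Ext if_True refl)
    hence z: "extend_zero (obj Q 0) (aug Q) = (\<lambda>u. 0)"
      unfolding cls_eq_iff by simp
    have "1 \<in> aug Q ` obj Q 0" unfolding aug_surj by simp
    then obtain p where "p \<in> obj Q 0" "aug Q p = 1" by auto
    thus False using fun_cong[OF z, of p] by (simp add: extend_zero_def)
  qed
  have decomp: "\<exists>c. \<exists>f\<in>F 1. e = c \<odot>\<^bsub>YA\<^esub> \<one>\<^bsub>YA\<^esub> \<oplus>\<^bsub>YA\<^esub> f" if e: "e \<in> carrier YA" for e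
  proof -
    obtain c where c: "e 0 = c \<odot>\<^bsub>Ext \<epsilon> Q 0\<^esub> cls 0 (extend_zero (obj Q 0) (aug Q))"
      using Ext_0[OF YA_in[OF e]] by blast
    define f where "f i = (if i = 0 then \<zero>\<^bsub>Ext \<epsilon> Q i\<^esub> else e i)" for i
    have "{i. f i \<noteq> \<zero>\<^bsub>Ext \<epsilon> Q i\<^esub>} \<subseteq> {i. e i \<noteq> \<zero>\<^bsub>Ext \<epsilon> Q i\<^esub>}" by (auto simp: f_def)
    moreover have "finite {i. e i \<noteq> \<zero>\<^bsub>Ext \<epsilon> Q i\<^esub>}" using e unfolding carrier_YA by blast
    ultimately have "finite {i. f i \<noteq> \<zero>\<^bsub>Ext \<epsilon> Q i\<^esub>}" by (rule finite_subset)
    moreover have "f i \<in> carrier (Ext \<epsilon> Q i)" for i using YA_in[OF e] Ext_zero_in by (simp add: f_def)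
    ultimately have "f \<in> F 1" unfolding F_def carrier_YA by (simp add: f_def)
    moreover have "e = c \<odot>\<^bsub>YA\<^esub> \<one>\<^bsub>YA\<^esub> \<oplus>\<^bsub>YA\<^esub> f"
    proof
      fix i
      show "e i = (c \<odot>\<^bsub>YA\<^esub> \<one>\<^bsub>YA\<^esub> \<oplus>\<^bsub>YA\<^esub> f) i"
        using c Ext_add_zero[OF YA_in[OF e, of i]] by (auto simp: YA_simps f_def Ext_smult_zero)
    qed
    ultimately show ?thesis by blast
  qed
  have eq: "graded_algebra.H_ge YA H'' 1 = F 1" if g: "graded_algebra YA H''" for H''
    by (rule graded_algebra.H_ge_1_eq[OF g one_ne _ F_N F_mult _ decomp]) (auto simp: F_def)
  show ?thesis
    by (rule hilbert_series_unique[OF gr H(2) H'(2)]) (simp only: eq[OF gr(1)] eq[OF gr(2)])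
qed

end

subsection \<open>Words and slices in the free algebra\<close>

abbreviation len :: "'x free_monoid \<Rightarrow> nat" where "len w \<equiv> length (letters w)"

lemma len_plus [simp]: "len (u + v) = len u + len v"
  and len_zero [simp]: "len 0 = 0"
  and letters_plus [simp]: "letters (u + v) = letters u @ letters v"
  and letters_zero [simp]: "letters 0 = []"
  by (simp_all add: plus_free_monoid_def zero_free_monoid_def)

lemma letters_inject [simp]: "letters u = letters v \<longleftrightarrow> u = v"
  by (metis free_monoid.expand)

lemma len_eq_0 [simp]: "letters w = [] \<longleftrightarrow> w = 0"
  using letters_inject[of w 0] by simp

lemma word_plus_eq_left: "len u = len u' \<Longrightarrow> u + w = u' + w' \<longleftrightarrow> u = u' \<and> w = w'"
  by (auto simp: plus_free_monoid_def)

lemma word_plus_eq_right: "len w = len w' \<Longrightarrow> u + w = u' + w' \<longleftrightarrow> u = u' \<and> w = w'"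
  by (auto simp: plus_free_monoid_def)

lemma word_split:
  assumes "i \<le> len w"
  shows "\<exists>u v. w = u + v \<and> len u = i \<and> len v = len w - i"
proof (intro exI conjI)
  show "w = Word (take i (letters w)) + Word (drop i (letters w))"
    by (simp add: plus_free_monoid_def)
qed (use assms in auto)

abbreviation look :: "('w \<Rightarrow>\<^sub>0 'k::zero) \<Rightarrow> 'w \<Rightarrow> 'k" where "look \<equiv> Poly_Mapping.lookup"

definition mono :: "nat free_monoid \<Rightarrow> 'k::field free_algebra" where
  "mono w = Poly_Mapping.single w 1"

text \<open>The left cofactor of the word \<open>u\<close>: the terms beginning with
  \<open>u\<close>, with \<open>u\<close> removed. Slices stand in for tensor decompositions of the
  free algebra, and membership in products of subspaces is tested on them.\<close>

definition lslice :: "nat free_monoid \<Rightarrow> 'k::field free_algebra \<Rightarrow> 'k free_algebra" where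
  "lslice u p = Poly_Mapping.map_key (\<lambda>w. u + w) p"

definition rslice :: "nat free_monoid \<Rightarrow> 'k::field free_algebra \<Rightarrow> 'k free_algebra" where
  "rslice v p = Poly_Mapping.map_key (\<lambda>w. w + v) p"

definition part :: "nat \<Rightarrow> 'k::field free_algebra \<Rightarrow> 'k free_algebra" where
  "part N p = Poly_Mapping.mapp (\<lambda>w c. if len w = N then c else 0) p"

lemma look_lslice [simp]: "look (lslice u p) w = look p (u + w)"
  unfolding lslice_def by (subst Poly_Mapping.map_key.rep_eq) (auto simp: inj_on_def word_plus_eq_left)

lemma look_rslice [simp]: "look (rslice v p) w = look p (w + v)"
  unfolding rslice_def by (subst Poly_Mapping.map_key.rep_eq) (auto simp: inj_on_def word_plus_eq_right)

lemma look_part [simp]: "look (part N p) w = (if len w = N then look p w else 0)"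
  unfolding part_def by (auto simp: lookup_mapp in_keys_iff when_def)

lemma slice_linear [simp]:
  "lslice u (p + q) = lslice u p + lslice u q" "rslice u (p + q) = rslice u p + rslice u q"
  "part N (p + q) = part N p + part N q"
  "lslice u 0 = 0" "rslice u 0 = 0" "part N 0 = 0"
  by (rule poly_mapping_eqI, simp add: lookup_add)+

lemma slice_sum:
  "lslice u (sum f A) = (\<Sum>i\<in>A. lslice u (f i))" "rslice u (sum f A) = (\<Sum>i\<in>A. rslice u (f i))"
  "part N (sum f A) = (\<Sum>i\<in>A. part N (f i))"
  by (rule poly_mapping_eqI, simp add: lookup_sum)+

lemma lslice_plus: "lslice (u + v) p = lslice v (lslice u p)"
  and rslice_plus: "rslice (u + v) p = rslice u (rslice v p)"
  and slice_commute: "lslice u (rslice v p) = rslice v (lslice u p)"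
  and slice_zero: "lslice 0 p = p" "rslice 0 p = p"
  by (rule poly_mapping_eqI, simp add: add.assoc)+

lemma poly_mapping_sum_single:
  fixes p :: "'w \<Rightarrow>\<^sub>0 'k::comm_monoid_add"
  shows "p = (\<Sum>w\<in>Poly_Mapping.keys p. Poly_Mapping.single w (look p w))"
proof (rule poly_mapping_eqI)
  fix k
  have "(\<Sum>w\<in>Poly_Mapping.keys p. look (Poly_Mapping.single w (look p w)) k) =
      (\<Sum>w\<in>Poly_Mapping.keys p. if w = k then look p k else 0)"
    by (rule sum.cong) (auto simp: lookup_single when_def)
  also have "\<dots> = look p k" by (simp add: in_keys_iff)
  finally show "look p k = look (\<Sum>w\<in>Poly_Mapping.keys p. Poly_Mapping.single w (look p w)) k"
    by (simp add: lookup_sum)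
qed

lemma poly_mapping_single_induct:
  fixes p :: "'w \<Rightarrow>\<^sub>0 'k::comm_monoid_add"
  assumes "P 0" "\<And>p q. P p \<Longrightarrow> P q \<Longrightarrow> P (p + q)" "\<And>w. w \<in> Poly_Mapping.keys p \<Longrightarrow> P (Poly_Mapping.single w (look p w))"
  shows "P p"
proof -
  have "P (\<Sum>w\<in>A. Poly_Mapping.single w (look p w))" if "finite A" "A \<subseteq> Poly_Mapping.keys p" for A
    using that by (induction A) (auto intro: assms)
  thus ?thesis using poly_mapping_sum_single[of p] by (metis finite_keys order_refl)
qed

lemma free_scalar_commute: "free_scalar c * p = p * free_scalar c"
proof (induction p rule: poly_mapping_single_induct)
  case (3 w)
  thus ?case by (simp add: free_scalar_def mult_single mult.commute)
qed (simp_all add: algebra_simps)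

lemma look_scalar [simp]: "look (free_scalar c * p) w = c * look p w" "look (p * free_scalar c) w = c * look p w"
  unfolding free_scalar_commute[of c p, symmetric] unfolding free_scalar_def
  by (simp_all add: mult_map_scale_conv_mult[symmetric] Poly_Mapping.map.rep_eq when_def)

lemma free_scalar_simps [simp]: "free_scalar 1 = 1" "free_scalar 0 = 0"
  "free_scalar (a + b) = free_scalar a + free_scalar b" "free_scalar (a * b) = free_scalar a * free_scalar b"
  by (simp_all add: free_scalar_def single_add mult_single)

lemma slice_scalar [simp]: "lslice u (free_scalar c * p) = free_scalar c * lslice u p"
  "rslice u (free_scalar c * p) = free_scalar c * rslice u p"
  "part N (free_scalar c * p) = free_scalar c * part N p"
  by (rule poly_mapping_eqI, simp)+

lemma mono_plus: "mono (u + v) = mono u * mono v"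
  by (simp add: mono_def mult_single)

text \<open>As all words of \<open>b\<close> are at least as long as \<open>v\<close>, the suffix is
  cut from \<open>b\<close> alone and never reaches into \<open>p\<close>.\<close>

lemma rslice_mult:
  fixes p b :: "'k::field free_algebra"
  assumes "\<And>w. w \<in> Poly_Mapping.keys b \<Longrightarrow> len v \<le> len w"
  shows "rslice v (p * b) = p * rslice v b"
proof -
  have 1: "rslice v (Poly_Mapping.single u x * Poly_Mapping.single w y) = Poly_Mapping.single u x * rslice v (Poly_Mapping.single w y)"
    if w: "w \<in> Poly_Mapping.keys b" for u w and x y :: 'k
  proof -
    obtain w1 w2 where w12: "w = w1 + w2" "len w2 = len v"
      using word_split[of "len w - len v" w] assms[OF w] by (metis diff_diff_cancel diff_le_self)
    have "rslice v (Poly_Mapping.single (a + w2) z) = (if w2 = v then Poly_Mapping.single a z else 0)" for a and z :: 'k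
      using word_plus_eq_right[OF w12(2)]
      by (intro poly_mapping_eqI) (auto simp: lookup_single when_def)
    from this[of "u + w1"] this[of w1] show ?thesis by (simp add: mult_single w12(1) add.assoc)
  qed
  have 2: "rslice v (Poly_Mapping.single u x * b) = Poly_Mapping.single u x * rslice v b" for u and x :: 'k
    by (subst (1 2) poly_mapping_sum_single[of b]) (simp add: sum_distrib_left slice_sum 1)
  show ?thesis
    by (subst (1 2) poly_mapping_sum_single[of p]) (simp add: sum_distrib_right slice_sum 2)
qed

lemma lslice_mult:
  fixes p b :: "'k::field free_algebra"
  assumes "\<And>w. w \<in> Poly_Mapping.keys b \<Longrightarrow> len v \<le> len w"
  shows "lslice v (b * p) = lslice v b * p"
proof -
  have 1: "lslice v (Poly_Mapping.single w y * Poly_Mapping.single u x) = lslice v (Poly_Mapping.single w y) * Poly_Mapping.single u x"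
    if w: "w \<in> Poly_Mapping.keys b" for u w and x y :: 'k
  proof -
    obtain w1 w2 where w12: "w = w1 + w2" "len w1 = len v"
      using word_split[OF assms[OF w]] by metis
    have "lslice v (Poly_Mapping.single (w1 + a) z) = (if w1 = v then Poly_Mapping.single a z else 0)" for a and z :: 'k
      using word_plus_eq_left[OF w12(2)]
      by (intro poly_mapping_eqI) (auto simp: lookup_single when_def)
    from this[of "w2 + u"] this[of w2] show ?thesis by (simp add: mult_single w12(1) add.assoc)
  qed
  have 2: "lslice v (b * Poly_Mapping.single u x) = lslice v b * Poly_Mapping.single u x" for u and x :: 'k
    by (subst (1 2) poly_mapping_sum_single[of b]) (simp add: sum_distrib_right slice_sum 1)
  show ?thesis
    by (subst (1 2) poly_mapping_sum_single[of p]) (simp add: sum_distrib_left slice_sum 2)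
qed

lemma rslice_homogeneous:
  assumes "\<And>w. w \<in> Poly_Mapping.keys b \<Longrightarrow> len w = len v"
  shows "rslice v b = free_scalar (look b v)"
proof (rule poly_mapping_eqI)
  fix w
  have "look b (w + v) = 0" if "w \<noteq> 0"
    using assms[of "w + v"] that by (auto simp: in_keys_iff)
  thus "look (rslice v b) w = look (free_scalar (look b v)) w"
    by (auto simp: free_scalar_def lookup_single when_def)
qed

lemma rslice_mono: "len v = len w \<Longrightarrow> rslice v (mono w) = (if v = w then 1 else 0)"
  and lslice_mono: "len v = len w \<Longrightarrow> lslice v (mono w) = (if v = w then 1 else 0)"
  using word_plus_eq_right[of w w 0] word_plus_eq_left[of w w 0]
  by (auto intro!: poly_mapping_eqI simp: mono_def lookup_single lookup_one when_def word_plus_eq_right[of v w] word_plus_eq_left[of v w])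

section \<open>Words of a given length and expansion along prefixes and suffixes\<close>

definition words :: "nat \<Rightarrow> nat \<Rightarrow> nat free_monoid set" where
  "words m i = {w. len w = i \<and> set (letters w) \<subseteq> {..<m}}"

lemma finite_words: "finite (words m i)"
proof -
  have "words m i \<subseteq> Word ` {xs. set xs \<subseteq> {..<m} \<and> length xs = i}"
  proof
    fix w assume "w \<in> words m i"
    thus "w \<in> Word ` {xs. set xs \<subseteq> {..<m} \<and> length xs = i}"
      by (intro image_eqI[of _ _ "letters w"]) (auto simp: words_def)
  qed
  thus ?thesis by (rule finite_subset) (simp add: finite_lists_length_eq)
qed

lemma words_len: "w \<in> words m i \<Longrightarrow> len w = i"
  by (simp add: words_def)

lemma free_alg_iff: "p \<in> free_alg m \<longleftrightarrow> (\<forall>w. look p w \<noteq> 0 \<longrightarrow> set (letters w) \<subseteq> {..<m})"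
  by (auto simp: free_alg_def in_keys_iff)

lemma free_alg_zero: "0 \<in> free_alg m"
  and free_alg_one: "1 \<in> free_alg m"
  and free_alg_scalar: "free_scalar c \<in> free_alg m"
  and free_alg_mono: "w \<in> words m i \<Longrightarrow> mono w \<in> free_alg m"
  by (auto simp: free_alg_iff free_scalar_def lookup_single lookup_one mono_def words_def when_def split: if_splits)

lemma free_alg_add: "p \<in> free_alg m \<Longrightarrow> q \<in> free_alg m \<Longrightarrow> p + q \<in> free_alg m"
  and free_alg_diff: "p \<in> free_alg m \<Longrightarrow> q \<in> free_alg m \<Longrightarrow> p - q \<in> free_alg m"
proof -
  have "look p w \<noteq> 0 \<or> look q w \<noteq> 0" if "look (p + q) w \<noteq> 0 \<or> look (p - q) w \<noteq> 0" for w
    using that by (auto simp: lookup_add lookup_minus)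
  thus "p \<in> free_alg m \<Longrightarrow> q \<in> free_alg m \<Longrightarrow> p + q \<in> free_alg m"
    "p \<in> free_alg m \<Longrightarrow> q \<in> free_alg m \<Longrightarrow> p - q \<in> free_alg m"
    unfolding free_alg_iff by blast+
qed

lemma free_alg_sum: "(\<And>i. i \<in> A \<Longrightarrow> f i \<in> free_alg m) \<Longrightarrow> sum f A \<in> free_alg m"
  by (induction A rule: infinite_finite_induct) (auto intro: free_alg_zero free_alg_add)

lemma free_alg_mult: "p \<in> free_alg m \<Longrightarrow> q \<in> free_alg m \<Longrightarrow> p * q \<in> free_alg m"
proof -
  assume p: "p \<in> free_alg m" and q: "q \<in> free_alg m"
  have "set (letters w) \<subseteq> {..<m}" if w: "w \<in> Poly_Mapping.keys (p * q)" for w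
  proof -
    obtain a b where "w = a + b" "a \<in> Poly_Mapping.keys p" "b \<in> Poly_Mapping.keys q"
      using Poly_Mapping.keys_mult[of p q] w by blast
    thus ?thesis using p q unfolding free_alg_def by auto
  qed
  thus "p * q \<in> free_alg m" unfolding free_alg_def by blast
qed

lemma free_alg_slice:
  assumes "p \<in> free_alg m"
  shows "lslice u p \<in> free_alg m" "rslice u p \<in> free_alg m" "part N p \<in> free_alg m"
proof -
  note w = assms[unfolded free_alg_iff, rule_format]
  have "set (letters w) \<subseteq> {..<m}" if "look p (u + w) \<noteq> 0 \<or> look p (w + u) \<noteq> 0" for w
    using that w[of "u + w"] w[of "w + u"] by auto
  thus "lslice u p \<in> free_alg m" "rslice u p \<in> free_alg m"
    unfolding free_alg_iff look_lslice look_rslice by blast+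
  show "part N p \<in> free_alg m" unfolding free_alg_iff look_part using w by metis
qed

lemma slice_outside:
  assumes "p \<in> free_alg m" "\<not> set (letters u) \<subseteq> {..<m}"
  shows "lslice u p = 0" "rslice u p = 0"
proof -
  have "look p (u + w) = 0" "look p (w + u) = 0" for w
    using assms(1)[unfolded free_alg_iff, rule_format, of "u + w"]
      assms(1)[unfolded free_alg_iff, rule_format, of "w + u"] assms(2) by auto
  thus "lslice u p = 0" "rslice u p = 0" by (auto intro!: poly_mapping_eqI)
qed

text \<open>A word of length at least \<open>i\<close> has exactly one suffix of length
  \<open>i\<close>, so the suffixes sort the terms of \<open>p\<close> without overlap.\<close>

lemma sum_rslice:
  assumes "p \<in> free_alg m" "\<And>w. w \<in> Poly_Mapping.keys p \<Longrightarrow> i \<le> len w"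
  shows "p = (\<Sum>v\<in>words m i. rslice v p * mono v)"
proof (rule poly_mapping_eqI)
  fix w
  show "look p w = look (\<Sum>v\<in>words m i. rslice v p * mono v) w"
  proof (cases "i \<le> len w")
    case True
    then obtain a b where ab: "w = a + b" "len b = i"
      using word_split[of "len w - i" w] by (metis diff_diff_cancel diff_le_self)
    have "rslice b (\<Sum>v\<in>words m i. rslice v p * mono v) = (\<Sum>v\<in>words m i. if v = b then rslice b p else 0)"
      unfolding slice_sum using ab(2)
      by (intro sum.cong refl) (subst rslice_mult, auto simp: mono_def rslice_mono[unfolded mono_def] words_len split: if_splits)
    also have "\<dots> = rslice b p"
      using slice_outside[OF assms(1), of b] ab(2) by (simp add: finite_words) (auto simp: words_def)
    finally show ?thesis using look_rslice[of b p a] look_rslice[of b "\<Sum>v\<in>words m i. rslice v p * mono v" a] ab by simp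
  next
    case False
    have "look (rslice v p * mono v) w = 0" if "v \<in> words m i" for v
    proof (rule ccontr)
      assume "look (rslice v p * mono v) w \<noteq> 0"
      then obtain a b where "w = a + b" "b \<in> Poly_Mapping.keys (mono v :: 'a free_algebra)"
        using Poly_Mapping.keys_mult[of "rslice v p" "mono v"] by (auto simp: in_keys_iff)
      thus False using False that by (auto simp: mono_def words_len)
    qed
    moreover have "look p w = 0" using assms(2) False by (auto simp: in_keys_iff)
    ultimately show ?thesis by (simp add: lookup_sum)
  qed
qed

lemma sum_lslice:
  assumes "p \<in> free_alg m" "\<And>w. w \<in> Poly_Mapping.keys p \<Longrightarrow> i \<le> len w"
  shows "p = (\<Sum>v\<in>words m i. mono v * lslice v p)"
proof (rule poly_mapping_eqI)
  fix w
  show "look p w = look (\<Sum>v\<in>words m i. mono v * lslice v p) w"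
  proof (cases "i \<le> len w")
    case True
    then obtain b a where ab: "w = b + a" "len b = i"
      using word_split by metis
    have "lslice b (\<Sum>v\<in>words m i. mono v * lslice v p) = (\<Sum>v\<in>words m i. if v = b then lslice b p else 0)"
      unfolding slice_sum using ab(2)
      by (intro sum.cong refl) (subst lslice_mult, auto simp: mono_def lslice_mono[unfolded mono_def] words_len split: if_splits)
    also have "\<dots> = lslice b p"
      using slice_outside[OF assms(1), of b] ab(2) by (simp add: finite_words) (auto simp: words_def)
    finally show ?thesis using look_lslice[of b p a] look_lslice[of b "\<Sum>v\<in>words m i. mono v * lslice v p" a] ab by simp
  next
    case False
    have "look (mono v * lslice v p) w = 0" if "v \<in> words m i" for v
    proof (rule ccontr)
      assume "look (mono v * lslice v p) w \<noteq> 0"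
      then obtain b a where "w = b + a" "b \<in> Poly_Mapping.keys (mono v :: 'a free_algebra)"
        using Poly_Mapping.keys_mult[of "mono v" "lslice v p"] by (auto simp: in_keys_iff)
      thus False using False that by (auto simp: mono_def words_len)
    qed
    moreover have "look p w = 0" using assms(2) False by (auto simp: in_keys_iff)
    ultimately show ?thesis by (simp add: lookup_sum)
  qed
qed

subsection \<open>The lattice of a quadratic ideal\<close>

lemma subspace_prod_mult: "u \<in> U \<Longrightarrow> v \<in> V \<Longrightarrow> u * v \<in> subspace_prod U V"
  unfolding subspace_prod_def
  by (rule CollectI, rule exI[of _ 1], rule exI[of _ "\<lambda>_. u"], rule exI[of _ "\<lambda>_. v"]) simp

lemma subspace_prod_zero: "0 \<in> subspace_prod U V"
  unfolding subspace_prod_def by (rule CollectI, rule exI[of _ 0]) simp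

lemma subspace_prod_add:
  assumes "p \<in> subspace_prod U V" "q \<in> subspace_prod U V"
  shows "p + q \<in> subspace_prod U V"
proof -
  obtain N u v where p: "p = (\<Sum>k<(N::nat). u k * v k)" "\<forall>k<N. u k \<in> U" "\<forall>k<N. v k \<in> V"
    using assms(1) unfolding subspace_prod_def by blast
  obtain M u' v' where q: "q = (\<Sum>k<(M::nat). u' k * v' k)" "\<forall>k<M. u' k \<in> U" "\<forall>k<M. v' k \<in> V"
    using assms(2) unfolding subspace_prod_def by blast
  define a where "a k = (if k < N then u k else u' (k - N))" for k
  define b where "b k = (if k < N then v k else v' (k - N))" for k
  have "(\<Sum>k<N+M. a k * b k) = (\<Sum>k<N. a k * b k) + (\<Sum>k<M. a (N + k) * b (N + k))"
    by (induction M) (simp_all add: add.assoc)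
  also have "\<dots> = p + q" by (simp add: p q a_def b_def)
  finally show ?thesis
    unfolding subspace_prod_def
    by (intro CollectI exI[of _ "N + M"] exI[of _ a] exI[of _ b]) (auto simp: a_def b_def p q)
qed

lemma subspace_prod_sum: "(\<And>i. i \<in> A \<Longrightarrow> f i \<in> subspace_prod U V) \<Longrightarrow> sum f A \<in> subspace_prod U V"
  by (induction A rule: infinite_finite_induct) (auto intro: subspace_prod_zero subspace_prod_add)

lemma subspace_prod_subset:
  assumes "0 \<in> T" "\<And>p q. p \<in> T \<Longrightarrow> q \<in> T \<Longrightarrow> p + q \<in> T" "\<And>u v. u \<in> U \<Longrightarrow> v \<in> V \<Longrightarrow> u * v \<in> T"
  shows "subspace_prod U V \<subseteq> T"
proof
  fix p assume "p \<in> subspace_prod U V"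
  then obtain N u v where p: "p = (\<Sum>k<(N::nat). u k * v k)" "\<forall>k<N. u k \<in> U" "\<forall>k<N. v k \<in> V"
    unfolding subspace_prod_def by blast
  have "(\<Sum>k<n. u k * v k) \<in> T" if "n \<le> N" for n
    using that by (induction n) (use p assms in auto)
  thus "p \<in> T" using p(1) by blast
qed

section \<open>Powers of the augmentation ideal of the free algebra and homogeneous elements\<close>

definition free_ge :: "nat \<Rightarrow> nat \<Rightarrow> 'k::field free_algebra set" where
  "free_ge m s = {p \<in> free_alg m. \<forall>w. look p w \<noteq> 0 \<longrightarrow> s \<le> len w}"

lemma free_ge_keys: "p \<in> free_ge m s \<Longrightarrow> w \<in> Poly_Mapping.keys p \<Longrightarrow> s \<le> len w"
  by (auto simp: free_ge_def in_keys_iff)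

lemma free_ge_alg: "p \<in> free_ge m s \<Longrightarrow> p \<in> free_alg m"
  by (simp add: free_ge_def)

lemma free_ge_zero: "0 \<in> free_ge m s"
  by (simp add: free_ge_def free_alg_zero)

lemma free_ge_0: "free_ge m 0 = free_alg m"
  by (simp add: free_ge_def)

lemma free_ge_add: "p \<in> free_ge m s \<Longrightarrow> q \<in> free_ge m s \<Longrightarrow> p + q \<in> free_ge m s"
  by (auto simp: free_ge_def lookup_add intro: free_alg_add) (metis add_0)

lemma free_ge_mult:
  assumes "p \<in> free_ge m s" "q \<in> free_ge m t"
  shows "p * q \<in> free_ge m (s + t)"
proof -
  have "s + t \<le> len w" if "look (p * q) w \<noteq> 0" for w
  proof -
    obtain a b where ab: "w = a + b" "a \<in> Poly_Mapping.keys p" "b \<in> Poly_Mapping.keys q"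
      using Poly_Mapping.keys_mult[of p q] \<open>look (p * q) w \<noteq> 0\<close> unfolding in_keys_iff[symmetric] by blast
    thus ?thesis using free_ge_keys[OF assms(1)] free_ge_keys[OF assms(2)] by (simp add: add_mono)
  qed
  thus ?thesis using assms free_alg_mult unfolding free_ge_def by blast
qed

lemma free_ge_anti: "s \<le> t \<Longrightarrow> free_ge m t \<subseteq> free_ge m s"
  by (auto simp: free_ge_def)

lemma free_ge_mono: "w \<in> words m i \<Longrightarrow> mono w \<in> free_ge m i"
  using free_alg_mono[of w m i] by (auto simp: free_ge_def mono_def lookup_single words_len when_def split: if_splits)

lemma free_ge_rslice: "p \<in> free_ge m (s + len v) \<Longrightarrow> rslice v p \<in> free_ge m s"
  using free_alg_slice by (fastforce simp: free_ge_def)+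

lemma free_positive_eq: "free_positive m = free_ge m 1"
  by (auto simp: free_positive_def free_ge_def in_keys_iff)

text \<open>Splitting off the last letter of every word factors an element of
  \<open>free_ge m (Suc s)\<close>. The powers in the lattice generators thereby become plain length
  conditions.\<close>

lemma subspace_power_positive: "subspace_power m (free_positive m) s = free_ge m s"
proof (induction s)
  case 0
  show ?case by (simp add: free_ge_0)
next
  case (Suc s)
  have "subspace_prod (free_ge m s) (free_ge m 1) = free_ge m (Suc s)"
  proof (rule subset_antisym)
    show "subspace_prod (free_ge m s) (free_ge m 1) \<subseteq> free_ge m (Suc s)"
      using free_ge_mult[of _ m s _ 1] by (intro subspace_prod_subset free_ge_zero free_ge_add) auto
    show "free_ge m (Suc s) \<subseteq> subspace_prod (free_ge m s) (free_ge m 1)"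
    proof
      fix p assume p: "p \<in> free_ge m (Suc s)"
      have "p = (\<Sum>v\<in>words m 1. rslice v p * mono v)"
        using free_ge_keys[OF p] by (intro sum_rslice free_ge_alg[OF p]) fastforce
      also have "\<dots> \<in> subspace_prod (free_ge m s) (free_ge m 1)"
        using p by (intro subspace_prod_sum subspace_prod_mult free_ge_rslice free_ge_mono) (simp_all add: words_len)
      finally show "p \<in> subspace_prod (free_ge m s) (free_ge m 1)" .
    qed
  qed
  thus ?case using Suc by (simp add: free_positive_eq)
qed

lemma free_homogeneous_iff: "p \<in> free_homogeneous m N \<longleftrightarrow> p \<in> free_alg m \<and> (\<forall>w. look p w \<noteq> 0 \<longrightarrow> len w = N)"
  by (auto simp: free_homogeneous_def in_keys_iff)

lemma part_homogeneous: "p \<in> free_homogeneous m N \<Longrightarrow> part M p = (if M = N then p else 0)"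
  by (auto simp: free_homogeneous_iff intro!: poly_mapping_eqI)

lemma part_in_homogeneous: "p \<in> free_alg m \<Longrightarrow> part N p \<in> free_homogeneous m N"
  using free_alg_slice(3) by (auto simp: free_homogeneous_iff split: if_splits)

lemma homogeneous_free_ge: "p \<in> free_homogeneous m N \<Longrightarrow> p \<in> free_ge m N"
  by (auto simp: free_homogeneous_iff free_ge_def)

lemma free_homogeneous_alg: "p \<in> free_homogeneous m N \<Longrightarrow> p \<in> free_alg m"
  by (simp add: free_homogeneous_iff)

lemma free_homogeneous_lslice: "p \<in> free_homogeneous m (len u + N) \<Longrightarrow> lslice u p \<in> free_homogeneous m N"
  and free_homogeneous_rslice: "p \<in> free_homogeneous m (N + len u) \<Longrightarrow> rslice u p \<in> free_homogeneous m N"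
  using free_alg_slice by (fastforce simp: free_homogeneous_iff)+

lemma free_homogeneous_mult:
  assumes "p \<in> free_homogeneous m s" "q \<in> free_homogeneous m t"
  shows "p * q \<in> free_homogeneous m (s + t)"
proof -
  have "len w = s + t" if "look (p * q) w \<noteq> 0" for w
  proof -
    obtain a b where ab: "w = a + b" "a \<in> Poly_Mapping.keys p" "b \<in> Poly_Mapping.keys q"
      using Poly_Mapping.keys_mult[of p q] \<open>look (p * q) w \<noteq> 0\<close> unfolding in_keys_iff[symmetric] by blast
    thus ?thesis using assms by (simp add: free_homogeneous_iff in_keys_iff)
  qed
  thus ?thesis using assms free_alg_mult unfolding free_homogeneous_iff by blast
qed

lemma free_homogeneous_add: "p \<in> free_homogeneous m s \<Longrightarrow> q \<in> free_homogeneous m s \<Longrightarrow> p + q \<in> free_homogeneous m s"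
proof -
  assume p: "p \<in> free_homogeneous m s" "q \<in> free_homogeneous m s"
  have "look p w \<noteq> 0 \<or> look q w \<noteq> 0" if "look (p + q) w \<noteq> 0" for w
    using that by (auto simp: lookup_add)
  thus "p + q \<in> free_homogeneous m s"
    using p free_alg_add[of p m q] unfolding free_homogeneous_iff by blast
qed

lemma free_homogeneous_zero: "0 \<in> free_homogeneous m s"
  by (auto simp: free_homogeneous_iff free_alg_zero)

lemma free_homogeneous_scalar: "p \<in> free_homogeneous m s \<Longrightarrow> free_scalar c * p \<in> free_homogeneous m s"
  using free_alg_mult[OF free_alg_scalar, of p m c] by (simp add: free_homogeneous_iff)

lemma part_lslice: "lslice u (part N p) = (if len u \<le> N then part (N - len u) (lslice u p) else 0)"
  and part_rslice: "rslice u (part N p) = (if len u \<le> N then part (N - len u) (rslice u p) else 0)"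
  by (auto intro!: poly_mapping_eqI)

section \<open>Lattice elements attached to a homogeneous quadratic ideal\<close>

locale koszul_ideal =
  fixes m :: nat and I :: "'k::field free_algebra set"
  assumes ideal: "free_ideal m I"
    and part_ideal: "p \<in> I \<Longrightarrow> part N p \<in> I"
    and quadratic: "quadratic_ideal m I"
    and distributive: "distributive_lattice (koszul_lattice m I)"
begin

lemma ideal_alg: "p \<in> I \<Longrightarrow> p \<in> free_alg m"
  and ideal_zero: "0 \<in> I"
  and ideal_add: "p \<in> I \<Longrightarrow> q \<in> I \<Longrightarrow> p + q \<in> I"
  and ideal_left: "f \<in> free_alg m \<Longrightarrow> p \<in> I \<Longrightarrow> f * p \<in> I"
  and ideal_right: "f \<in> free_alg m \<Longrightarrow> p \<in> I \<Longrightarrow> p * f \<in> I"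
  using ideal unfolding free_ideal_def by blast+

lemma ideal_sum: "(\<And>i. i \<in> A \<Longrightarrow> f i \<in> I) \<Longrightarrow> sum f A \<in> I"
  by (induction A rule: infinite_finite_induct) (auto intro: ideal_zero ideal_add)

lemma ideal_power_1: "subspace_power m I 1 = I"
proof -
  have "subspace_prod (free_alg m) I = I"
  proof (rule subset_antisym)
    show "subspace_prod (free_alg m) I \<subseteq> I"
      by (intro subspace_prod_subset ideal_zero ideal_add ideal_left)
    show "I \<subseteq> subspace_prod (free_alg m) I"
      using subspace_prod_mult[OF free_alg_one] by fastforce
  qed
  thus ?thesis by simp
qed

text \<open>By \<open>D_eq\<close> this is the lattice generator with exponents \<open>s\<close>, 1
  and \<open>h\<close>. Described by slices, membership is a condition on every prefix of length
  \<open>s\<close> and suffix of length \<open>h\<close>, which makes intersections easy to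
  handle.\<close>

definition D :: "nat \<Rightarrow> nat \<Rightarrow> 'k free_algebra set" where
  "D s h = {p \<in> free_ge m (s + h). \<forall>u v. len u = s \<longrightarrow> len v = h \<longrightarrow> lslice u (rslice v p) \<in> I}"

lemma D_zero: "0 \<in> D s h"
  by (auto simp: D_def free_ge_zero ideal_zero)

lemma D_add: "p \<in> D s h \<Longrightarrow> q \<in> D s h \<Longrightarrow> p + q \<in> D s h"
  by (auto simp: D_def intro: free_ge_add ideal_add)

lemma D_sum: "(\<And>i. i \<in> A \<Longrightarrow> f i \<in> D s h) \<Longrightarrow> sum f A \<in> D s h"
  by (induction A rule: infinite_finite_induct) (auto intro: D_zero D_add)

lemma D_alg: "p \<in> D s h \<Longrightarrow> p \<in> free_alg m"
  by (auto simp: D_def free_ge_def)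

lemma D_part: "p \<in> D s h \<Longrightarrow> part N p \<in> D s h"
proof -
  assume p: "p \<in> D s h"
  have "part N p \<in> free_ge m (s + h)" using p free_alg_slice(3) by (auto simp: D_def free_ge_def split: if_splits)
  moreover have "lslice u (rslice v (part N p)) \<in> I" if "len u = s" "len v = h" for u v
    using p that part_ideal ideal_zero by (auto simp: D_def part_lslice part_rslice)
  ultimately show ?thesis by (auto simp: D_def)
qed

lemma D_mult_mono:
  assumes "p \<in> D s h" "w \<in> words m t"
  shows "p * mono w \<in> D s (h + t)"
proof -
  have "p * mono w \<in> free_ge m (s + (h + t))"
    using free_ge_mult[of p m "s + h" "mono w" t] assms free_ge_mono by (auto simp: D_def add.assoc)
  moreover have "lslice u (rslice v (p * mono w)) \<in> I" if uv: "len u = s" "len v = h + t" for u v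
  proof -
    obtain v1 v2 where v: "v = v1 + v2" "len v1 = h" "len v2 = t"
      using word_split[of h v] uv(2) by auto
    have "rslice v2 (p * mono w) = p * rslice v2 (mono w)"
      by (rule rslice_mult) (simp add: mono_def v(3) words_len[OF assms(2)])
    also have "\<dots> = (if v2 = w then p else 0)"
      using v(3) words_len[OF assms(2)] by (simp add: rslice_mono)
    finally have "rslice v (p * mono w) = rslice v1 (if v2 = w then p else 0)"
      unfolding v(1) rslice_plus by simp
    thus ?thesis using assms(1) uv(1) v(2) ideal_zero unfolding D_def by (cases "v2 = w") simp_all
  qed
  ultimately show ?thesis by (auto simp: D_def)
qed

lemma D_eq: "subspace_prod (subspace_prod (free_ge m s) I) (free_ge m h) = D s h"
proof (rule subset_antisym)
  have 1: "subspace_prod (free_ge m s) I \<subseteq> D s 0"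
  proof (intro subspace_prod_subset D_zero D_add)
    fix a i :: "'k free_algebra" assume a: "a \<in> free_ge m s" and i: "i \<in> I"
    have "a * i \<in> free_ge m (s + 0)"
      using free_ge_mult[OF a, of i 0] ideal_alg[OF i] by (simp add: free_ge_0)
    moreover have "lslice u (a * i) \<in> I" if "len u = s" for u
    proof -
      have "lslice u (a * i) = lslice u a * i"
        by (rule lslice_mult) (drule free_ge_keys[OF a], simp add: that)
      thus ?thesis using ideal_left[OF free_alg_slice(1)[OF free_ge_alg[OF a]] i] by simp
    qed
    ultimately show "a * i \<in> D s 0" by (auto simp: D_def slice_zero)
  qed
  show "subspace_prod (subspace_prod (free_ge m s) I) (free_ge m h) \<subseteq> D s h"
  proof (intro subspace_prod_subset D_zero D_add)
    fix x b :: "'k free_algebra" assume "x \<in> subspace_prod (free_ge m s) I" and b: "b \<in> free_ge m h"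
    hence x: "x \<in> D s 0" using 1 by blast
    have xg: "x \<in> free_ge m s" using x by (simp add: D_def)
    have "lslice u (rslice v (x * b)) \<in> I" if uv: "len u = s" "len v = h" for u v
    proof -
      have "rslice v (x * b) = x * rslice v b"
        by (rule rslice_mult) (drule free_ge_keys[OF b], simp add: uv)
      moreover have "lslice u (x * rslice v b) = lslice u x * rslice v b"
        by (rule lslice_mult) (drule free_ge_keys[OF xg], simp add: uv)
      ultimately have "lslice u (rslice v (x * b)) = lslice u x * rslice v b" by simp
      moreover have "lslice u x \<in> I" using x uv by (auto simp: D_def slice_zero)
      ultimately show ?thesis using free_alg_slice(2)[OF free_ge_alg[OF b]] ideal_right by simp
    qed
    thus "x * b \<in> D s h" using free_ge_mult[OF xg b] by (auto simp: D_def)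
  qed
  show "D s h \<subseteq> subspace_prod (subspace_prod (free_ge m s) I) (free_ge m h)"
  proof
    fix p assume p: "p \<in> D s h"
    have pg: "p \<in> free_ge m (s + h)" using p by (simp add: D_def)
    have r: "rslice v p \<in> subspace_prod (free_ge m s) I" if v: "v \<in> words m h" for v
    proof -
      have q: "rslice v p \<in> free_ge m s" using free_ge_rslice[of p m s v] pg words_len[OF v] by simp
      have "rslice v p = (\<Sum>u\<in>words m s. mono u * lslice u (rslice v p))"
        by (rule sum_lslice[OF free_ge_alg[OF q] free_ge_keys[OF q]])
      also have "\<dots> \<in> subspace_prod (free_ge m s) I"
      proof (rule subspace_prod_sum, rule subspace_prod_mult)
        fix u assume u: "u \<in> words m s"
        show "mono u \<in> free_ge m s" by (rule free_ge_mono[OF u])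
        show "lslice u (rslice v p) \<in> I" using p words_len[OF u] words_len[OF v] unfolding D_def by blast
      qed
      finally show ?thesis .
    qed
    have "p = (\<Sum>v\<in>words m h. rslice v p * mono v)"
      by (rule sum_rslice[OF free_ge_alg[OF pg]]) (drule free_ge_keys[OF pg], simp)
    also have "\<dots> \<in> subspace_prod (subspace_prod (free_ge m s) I) (free_ge m h)"
      by (intro subspace_prod_sum subspace_prod_mult free_ge_mono r)
    finally show "p \<in> subspace_prod (subspace_prod (free_ge m s) I) (free_ge m h)" .
  qed
qed

lemma D_lattice: "D s h \<in> koszul_lattice m I"
  using koszul_lattice.generator[of m s I 1 h]
  unfolding subspace_power_positive ideal_power_1 D_eq .

text \<open>It is the generator with all exponents 0, and serves as the empty intersection in
  \<open>J_lattice\<close>.\<close>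

lemma free_alg_lattice: "free_alg m \<in> koszul_lattice m I"
proof -
  have "subspace_prod (free_alg m) (free_alg m) = (free_alg m :: 'k free_algebra set)"
  proof (rule subset_antisym)
    show "subspace_prod (free_alg m) (free_alg m) \<subseteq> (free_alg m :: 'k free_algebra set)"
      by (intro subspace_prod_subset free_alg_zero free_alg_add free_alg_mult)
    show "(free_alg m :: 'k free_algebra set) \<subseteq> subspace_prod (free_alg m) (free_alg m)"
      using subspace_prod_mult[OF free_alg_one] by fastforce
  qed
  thus ?thesis using koszul_lattice.generator[of m 0 I 0 0] by simp
qed

text \<open>In degree \<open>N\<close> the condition \<open>D s (N - 2 - s)\<close> places a
  relation at the letters \<open>s\<close> and \<open>s + 1\<close>. So \<open>J N i\<close> demands
  relations at all positions inside the last \<open>i\<close> letters; its part of degree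
  \<open>N\<close> is \<open>V^(N-i) W_i\<close> for the Koszul space \<open>W_i\<close>. For
  \<open>i \<le> 1\<close> there is no room for a relation.\<close>

definition J :: "nat \<Rightarrow> nat \<Rightarrow> 'k free_algebra set" where
  "J N i = {p \<in> free_alg m. \<forall>s. N - i \<le> s \<longrightarrow> s + 2 \<le> N \<longrightarrow> p \<in> D s (N - 2 - s)}"

lemma J_lattice: "J N i \<in> koszul_lattice m I"
proof -
  have *: "{p \<in> free_alg m. \<forall>s\<in>A. p \<in> D s (N - 2 - s)} \<in> koszul_lattice m I" if "finite A" for A
    using that
  proof (induction A)
    case (insert x A)
    have "{p \<in> free_alg m. \<forall>s\<in>insert x A. p \<in> D s (N - 2 - s)} =
        {p \<in> free_alg m. \<forall>s\<in>A. p \<in> D s (N - 2 - s)} \<inter> D x (N - 2 - x)" by auto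
    thus ?case using koszul_lattice.inter[OF insert.IH D_lattice] by simp
  qed (use free_alg_lattice in auto)
  have J: "J N i = {p \<in> free_alg m. \<forall>s\<in>{s. N - i \<le> s \<and> s + 2 \<le> N}. p \<in> D s (N - 2 - s)}"
    by (auto simp: J_def)
  have "finite {s. N - i \<le> s \<and> s + 2 \<le> N}" by (rule finite_subset[of _ "{..N}"]) auto
  thus ?thesis unfolding J by (rule *)
qed

lemma J_part: "p \<in> J N i \<Longrightarrow> part M p \<in> J N i"
  using free_alg_slice(3) D_part by (auto simp: J_def)

definition L :: "'k free_algebra set" where
  "L = {p \<in> free_ge m 2. \<forall>u. part 2 (lslice u p) \<in> I}"

lemma L_add: "p \<in> L \<Longrightarrow> q \<in> L \<Longrightarrow> p + q \<in> L"
  by (auto simp: L_def intro: free_ge_add ideal_add)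

lemma L_zero: "0 \<in> L"
  by (auto simp: L_def free_ge_zero ideal_zero)

lemma L_sum: "(\<And>i. i \<in> A \<Longrightarrow> f i \<in> L) \<Longrightarrow> sum f A \<in> L"
  by (induction A rule: infinite_finite_induct) (auto intro: L_zero L_add)

lemma mono_L:
  assumes w: "w \<in> words m i" and r: "r \<in> I" "r \<in> free_homogeneous m 2"
  shows "mono w * r \<in> L"
proof -
  have hom: "mono w * r \<in> free_homogeneous m (i + 2)"
    using free_alg_mono[OF w] words_len[OF w] r
    by (intro free_homogeneous_mult) (auto simp: free_homogeneous_iff mono_def lookup_single when_def split: if_splits)
  have "part 2 (lslice u (mono w * r)) \<in> I" for u
  proof (cases "len u = i")
    case True
    have "lslice u (mono w * r) = lslice u (mono w) * r"
      by (rule lslice_mult) (simp add: mono_def True words_len[OF w])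
    also have "\<dots> = (if u = w then r else 0)"
      using True words_len[OF w] by (simp add: lslice_mono)
    finally show ?thesis using r part_ideal ideal_zero by auto
  next
    case False
    have "part 2 (lslice u (mono w * r)) = 0"
    proof (rule poly_mapping_eqI)
      fix x
      have "look (mono w * r) (u + x) = 0" if "len x = 2"
        using hom False that by (auto simp: free_homogeneous_iff)
      thus "look (part 2 (lslice u (mono w * r))) x = look 0 x" by simp
    qed
    thus ?thesis using ideal_zero by simp
  qed
  moreover have "mono w * r \<in> free_ge m 2"
    using homogeneous_free_ge[OF hom] free_ge_anti[of 2 "i + 2"] by auto
  ultimately show ?thesis by (auto simp: L_def)
qed

lemma mono_exists: "set (letters w) \<subseteq> {..<m} \<Longrightarrow> w \<in> words m (len w)"
  by (simp add: words_def)

text \<open>Each word of \<open>q\<close> splits into a prefix and its last two letters; collecting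
  the terms with a given prefix \<open>u\<close> leaves the quadratic part of
  \<open>lslice u q\<close>.\<close>

lemma L_expand:
  assumes "q \<in> L" and M: "\<And>w. look q w \<noteq> 0 \<Longrightarrow> len w \<le> M"
  shows "q = (\<Sum>u\<in>(\<Union>i\<in>{..M}. words m i). mono u * part 2 (lslice u q))"
proof (rule poly_mapping_eqI)
  fix w
  let ?A = "\<Union>i\<in>{..M}. words m i"
  have fin: "finite ?A" using finite_words by auto
  have key: "look (mono u * part 2 (lslice u q)) w = (if len w = len u + 2 \<and> (\<exists>x. w = u + x) then look q w else 0)" for u
  proof (cases "len w = len u + 2")
    case True
    then obtain a b where ab: "w = a + b" "len a = len u" "len b = 2" using word_split[of "len u" w] by auto
    have "lslice a (mono u * part 2 (lslice u q)) = lslice a (mono u) * part 2 (lslice u q)"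
      by (rule lslice_mult) (simp add: mono_def ab)
    also have "\<dots> = (if a = u then part 2 (lslice u q) else 0)"
      using ab(2) by (simp add: lslice_mono)
    finally have "look (mono u * part 2 (lslice u q)) w = (if a = u then look q w else 0)"
      using look_lslice[of a "mono u * part 2 (lslice u q)" b] ab by auto
    moreover have "(\<exists>x. w = u + x) \<longleftrightarrow> a = u" using ab(1) word_plus_eq_left[OF ab(2)] by auto
    ultimately show ?thesis using True by simp
  next
    case False
    have "look (mono u * part 2 (lslice u q)) w = 0"
    proof (rule ccontr)
      assume "look (mono u * part 2 (lslice u q)) w \<noteq> 0"
      then obtain b a where "w = b + a" "b \<in> Poly_Mapping.keys (mono u :: 'k free_algebra)"
        "a \<in> Poly_Mapping.keys (part 2 (lslice u q))"
        using Poly_Mapping.keys_mult[of "mono u" "part 2 (lslice u q)"] unfolding in_keys_iff[symmetric] by blast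
      thus False using False by (auto simp: mono_def in_keys_iff split: if_splits)
    qed
    thus ?thesis using False by simp
  qed
  show "look q w = look (\<Sum>u\<in>?A. mono u * part 2 (lslice u q)) w"
  proof (cases "look q w = 0")
    case True
    thus ?thesis by (simp add: lookup_sum key)
  next
    case False
    have "2 \<le> len w" using assms(1) False unfolding L_def free_ge_def by blast
    then obtain a b where ab: "w = a + b" "len a = len w - 2" "len b = 2"
      using word_split[of "len w - 2" w] by auto
    have "set (letters w) \<subseteq> {..<m}" using assms(1) False unfolding L_def free_ge_def free_alg_iff by blast
    hence "a \<in> words m (len a)" using ab(1) by (auto simp: words_def)
    moreover have "len a \<le> M" using M[OF False] ab(2) by simp
    ultimately have a: "a \<in> ?A" by blast
    have iff: "(len w = len u + 2 \<and> (\<exists>x. w = u + x)) \<longleftrightarrow> u = a" for u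
    proof
      assume *: "len w = len u + 2 \<and> (\<exists>x. w = u + x)"
      then obtain x where x: "w = u + x" by blast
      have "len u = len a" using * ab(2) by simp
      from word_plus_eq_left[OF this, of x b] show "u = a" using x ab(1) by simp
    next
      assume "u = a"
      thus "len w = len u + 2 \<and> (\<exists>x. w = u + x)"
        using ab(1,2) \<open>2 \<le> len w\<close> by (intro conjI exI[of _ b]) auto
    qed
    have "look (\<Sum>u\<in>?A. mono u * part 2 (lslice u q)) w = (\<Sum>u\<in>?A. if u = a then look q w else 0)"
      unfolding lookup_sum key iff ..
    also have "\<dots> = look q w" using sum.delta[OF fin, of a "\<lambda>_. look q w"] a by simp
    finally show ?thesis by simp
  qed
qed

lemma L_left:
  assumes "f \<in> free_alg m" "q \<in> L"
  shows "f * q \<in> L"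
proof -
  define M where "M = Max (len ` Poly_Mapping.keys q)"
  have M: "len w \<le> M" if "look q w \<noteq> 0" for w
    unfolding M_def using that by (intro Max_ge) (auto simp: in_keys_iff)
  have r: "part 2 (lslice u q) \<in> I" "part 2 (lslice u q) \<in> free_homogeneous m 2" for u
  proof -
    have "q \<in> free_alg m" using assms(2) by (simp add: L_def free_ge_def)
    from free_alg_slice(1)[OF this] show "part 2 (lslice u q) \<in> free_homogeneous m 2"
      by (rule part_in_homogeneous)
    show "part 2 (lslice u q) \<in> I" using assms(2) by (simp add: L_def)
  qed
  have 1: "Poly_Mapping.single w c * (mono u * part 2 (lslice u q)) \<in> L"
    if "set (letters w) \<subseteq> {..<m}" "u \<in> words m i" for w c u i
  proof -
    have "Poly_Mapping.single w c * mono u = mono (w + u) * free_scalar c"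
      by (simp add: mono_def free_scalar_def mult_single)
    hence "Poly_Mapping.single w c * (mono u * part 2 (lslice u q)) = mono (w + u) * (free_scalar c * part 2 (lslice u q))"
      by (simp add: mult.assoc[symmetric])
    moreover have "w + u \<in> words m (len w + i)" using that by (auto simp: words_def)
    moreover have "free_scalar c * part 2 (lslice u q) \<in> free_homogeneous m 2"
      by (rule free_homogeneous_scalar[OF r(2)])
    ultimately show ?thesis
      using mono_L[of "w + u" "len w + i" "free_scalar c * part 2 (lslice u q)"] ideal_left[OF free_alg_scalar r(1)] by simp
  qed
  have "Poly_Mapping.single w c * q \<in> L" if "set (letters w) \<subseteq> {..<m}" for w c
  proof -
    let ?A = "\<Union>i\<in>{..M}. words m i"
    have "Poly_Mapping.single w c * q = (\<Sum>u\<in>?A. Poly_Mapping.single w c * (mono u * part 2 (lslice u q)))"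
      using arg_cong[OF L_expand[OF assms(2) M], of "\<lambda>z. Poly_Mapping.single w c * z"]
      unfolding sum_distrib_left .
    also have "\<dots> \<in> L"
    proof (rule L_sum)
      fix u assume "u \<in> ?A"
      then obtain i where "u \<in> words m i" by blast
      thus "Poly_Mapping.single w c * (mono u * part 2 (lslice u q)) \<in> L" by (rule 1[OF \<open>set (letters w) \<subseteq> {..<m}\<close>])
    qed
    finally show ?thesis .
  qed
  hence "(\<Sum>w\<in>Poly_Mapping.keys f. Poly_Mapping.single w (look f w) * q) \<in> L"
    using assms(1) by (intro L_sum) (auto simp: free_alg_def)
  moreover have "f * q = (\<Sum>w\<in>Poly_Mapping.keys f. Poly_Mapping.single w (look f w) * q)"
    using arg_cong[OF poly_mapping_sum_single[of f], of "\<lambda>z. z * q"] unfolding sum_distrib_right .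
  ultimately show ?thesis by simp
qed

lemma D_subset: "D 0 1 \<subseteq> I" "L \<subseteq> I"
proof -
  show "D 0 1 \<subseteq> I"
  proof
    fix p assume p: "p \<in> D 0 1"
    have "p = (\<Sum>v\<in>words m 1. rslice v p * mono v)"
      using p by (intro sum_rslice) (auto simp: D_def free_ge_def in_keys_iff)
    also have "\<dots> \<in> I"
      using p free_alg_mono by (intro ideal_sum ideal_right) (auto simp: D_def slice_zero words_len)
    finally show "p \<in> I" .
  qed
  show "L \<subseteq> I"
  proof
    fix q assume q: "q \<in> L"
    define M where "M = Max (len ` Poly_Mapping.keys q)"
    have M: "len w \<le> M" if "look q w \<noteq> 0" for w
      unfolding M_def using that by (intro Max_ge) (auto simp: in_keys_iff)
    have "(\<Sum>u\<in>(\<Union>i\<in>{..M}. words m i). mono u * part 2 (lslice u q)) \<in> I"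
      using q free_alg_mono by (intro ideal_sum ideal_left) (auto simp: L_def)
    thus "q \<in> I" using L_expand[OF q M] by simp
  qed
qed

text \<open>\<open>D 0 1\<close> is \<open>I F_+\<close> and \<open>L\<close> is \<open>F R\<close>, where \<open>R\<close> is the space of relations.\<close>

lemma ideal_decompose: "p \<in> I \<Longrightarrow> \<exists>p1\<in>D 0 1. \<exists>p2\<in>L. p = p1 + p2"
proof -
  obtain S where S: "S \<subseteq> free_homogeneous m 2" "I = free_ideal m hull S"
    using quadratic unfolding quadratic_ideal_def by blast
  have SI: "S \<subseteq> I" unfolding S(2) by (rule hull_subset)
  \<comment> \<open>\<open>Z\<close> turns out to be a two-sided ideal containing the quadratic
    generators, so it contains \<open>I\<close>.\<close>
  define Z where "Z = {p1 + p2 | p1 p2. p1 \<in> D 0 1 \<and> p2 \<in> L}"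
  have Z: "Z \<subseteq> I" using D_subset ideal_add unfolding Z_def by blast
  have ZI: "p1 + p2 \<in> Z" if "p1 \<in> D 0 1" "p2 \<in> L" for p1 p2 using that unfolding Z_def by blast
  have Z_add: "p + q \<in> Z" if "p \<in> Z" "q \<in> Z" for p q
  proof -
    obtain p1 p2 q1 q2 where *: "p = p1 + p2" "q = q1 + q2" "p1 \<in> D 0 1" "q1 \<in> D 0 1" "p2 \<in> L" "q2 \<in> L"
      using \<open>p \<in> Z\<close> \<open>q \<in> Z\<close> unfolding Z_def by blast
    have "p + q = (p1 + q1) + (p2 + q2)" by (simp add: *(1,2) algebra_simps)
    thus ?thesis using ZI D_add L_add * by metis
  qed
  have D_left: "f * p \<in> D 0 1" if "f \<in> free_alg m" "p \<in> D 0 1" for f p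
  proof -
    have pg: "p \<in> free_ge m 1" using that by (simp add: D_def)
    have "rslice v (f * p) \<in> I" if v: "len v = 1" for v
      using rslice_mult[of p v f] free_ge_keys[OF pg] v \<open>p \<in> D 0 1\<close> \<open>f \<in> free_alg m\<close> ideal_left
      by (auto simp: D_def slice_zero)
    moreover have "f * p \<in> free_ge m 1" using free_ge_mult[of f m 0 p 1] pg that by (simp add: free_ge_0)
    ultimately show ?thesis by (auto simp: D_def slice_zero)
  qed
  have Z_left: "f * p \<in> Z" if "f \<in> free_alg m" "p \<in> Z" for f p
    using that D_left[OF that(1)] L_left[OF that(1)] unfolding Z_def by (fastforce simp: distrib_left)
  \<comment> \<open>The constant term of \<open>f\<close> only scales \<open>p\<close>; the rest has
    positive length and moves \<open>p\<close>, an element of \<open>I\<close>, into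
    \<open>D 0 1\<close>.\<close>
  have Z_right: "p * f \<in> Z" if f: "f \<in> free_alg m" and p: "p \<in> Z" for f p
  proof -
    have "part 0 f = free_scalar (look f 0)"
      by (intro poly_mapping_eqI) (auto simp: free_scalar_def lookup_single when_def)
    hence "p * f = free_scalar (look f 0) * p + p * (f - part 0 f)"
      by (simp add: free_scalar_commute algebra_simps)
    moreover have "free_scalar (look f 0) * p \<in> Z" by (rule Z_left[OF free_alg_scalar p])
    moreover have "p * (f - part 0 f) \<in> D 0 1"
    proof -
      have pI: "p \<in> I" using p Z by blast
      have f': "f - part 0 f \<in> free_ge m 1"
        using f free_alg_slice(3)[OF f] free_alg_diff
        by (auto simp: free_ge_def lookup_minus Suc_le_eq split: if_splits)
      have "rslice v (p * (f - part 0 f)) \<in> I" if v: "len v = 1" for v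
        using rslice_mult[of "f - part 0 f" v p] free_ge_keys[OF f'] v
          ideal_right[OF free_alg_slice(2)[OF free_ge_alg[OF f']] pI] by simp
      moreover have "p * (f - part 0 f) \<in> free_ge m 1"
        using free_ge_mult[of p m 0 _ 1] f' ideal_alg[OF pI] by (simp add: free_ge_0)
      ultimately show ?thesis by (auto simp: D_def slice_zero)
    qed
    ultimately show ?thesis using Z_add ZI[OF _ L_zero] by simp
  qed
  have "free_ideal m Z"
    unfolding free_ideal_def using Z ideal_alg Z_add Z_left Z_right ZI[OF D_zero L_zero] by auto
  moreover have "S \<subseteq> Z"
  proof
    fix r assume r: "r \<in> S"
    have "mono 0 * r \<in> L" using r S(1) SI by (intro mono_L[of 0 0]) (auto simp: words_def)
    thus "r \<in> Z" using ZI[OF D_zero] by (fastforce simp: mono_def)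
  qed
  ultimately have "I \<subseteq> Z" unfolding S(2) by (intro hull_minimal)
  thus "p \<in> I \<Longrightarrow> \<exists>p1\<in>D 0 1. \<exists>p2\<in>L. p = p1 + p2" unfolding Z_def by blast
qed

lemma ideal_free_ge: "I \<subseteq> free_ge m 2"
proof -
  obtain S where S: "S \<subseteq> free_homogeneous m 2" "I = free_ideal m hull S"
    using quadratic unfolding quadratic_ideal_def by blast
  have "free_ideal m (free_ge m 2 :: 'k free_algebra set)"
    unfolding free_ideal_def
    using free_ge_mult[of _ m 0 _ 2, unfolded free_ge_0 add_0] free_ge_mult[of _ m 2 _ 0, unfolded free_ge_0 add_0_right]
    by (auto intro: free_ge_zero free_ge_alg free_ge_add)
  moreover have "S \<subseteq> free_ge m 2" using S(1) homogeneous_free_ge by blast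
  ultimately show ?thesis unfolding S(2) by (intro hull_minimal)
qed

text \<open>\<open>ideal_decompose\<close> is applied to each right slice by a word of length
  \<open>h\<close> and cut to degree \<open>N - h\<close>. There an element of \<open>L\<close> has
  its relation in the last two letters, that is, at position \<open>N - 2 - h\<close> of the whole
  word.\<close>

lemma D_decompose:
  assumes w: "w \<in> free_homogeneous m N" "w \<in> D 0 h" and N: "h + 2 \<le> N"
  shows "\<exists>p1\<in>D 0 (Suc h). \<exists>p2\<in>D (N - 2 - h) h. w = p1 + p2"
proof -
  have "\<exists>p1\<in>D 0 1. \<exists>p2\<in>D (N - 2 - h) 0. rslice v w = p1 + p2" if v: "v \<in> words m h" for v
  proof -
    have hom: "rslice v w \<in> free_homogeneous m (N - h)"
      using free_homogeneous_rslice[of w m "N - h" v] w(1) words_len[OF v] N by simp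
    have "rslice v w \<in> I" using w(2) words_len[OF v] by (auto simp: D_def slice_zero)
    then obtain p1 p2 where p: "p1 \<in> D 0 1" "p2 \<in> L" "rslice v w = p1 + p2"
      using ideal_decompose by blast
    have "rslice v w = part (N - h) p1 + part (N - h) p2"
      using part_homogeneous[OF hom, of "N - h"] p(3) by simp
    moreover have "part (N - h) p1 \<in> D 0 1" by (rule D_part[OF p(1)])
    moreover have "part (N - h) p2 \<in> D (N - 2 - h) 0"
    proof -
      have le: "N - 2 - h \<le> N - h" by arith
      have pa: "p2 \<in> free_alg m" using p(2) by (auto simp: L_def free_ge_def)
      have "part (N - h) p2 \<in> free_ge m (N - 2 - h)"
        using homogeneous_free_ge[OF part_in_homogeneous[OF pa]] free_ge_anti[OF le] by blast
      moreover have "lslice u (part (N - h) p2) \<in> I" if "len u = N - 2 - h" for u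
      proof -
        have "lslice u (part (N - h) p2) = part 2 (lslice u p2)"
          using that N le by (simp add: part_lslice)
        thus ?thesis using p(2) by (auto simp: L_def)
      qed
      ultimately show ?thesis by (auto simp: D_def slice_zero)
    qed
    ultimately show ?thesis by blast
  qed
  then obtain a b where ab: "\<And>v. v \<in> words m h \<Longrightarrow> a v \<in> D 0 1 \<and> b v \<in> D (N - 2 - h) 0 \<and> rslice v w = a v + b v"
    by metis
  have "w = (\<Sum>v\<in>words m h. rslice v w * mono v)"
    using w N by (intro sum_rslice) (auto simp: free_homogeneous_iff in_keys_iff)
  also have "\<dots> = (\<Sum>v\<in>words m h. a v * mono v) + (\<Sum>v\<in>words m h. b v * mono v)"
    unfolding sum.distrib[symmetric] using ab by (intro sum.cong refl) (simp add: distrib_right)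
  finally have "w = (\<Sum>v\<in>words m h. a v * mono v) + (\<Sum>v\<in>words m h. b v * mono v)" .
  moreover have "(\<Sum>v\<in>words m h. a v * mono v) \<in> D 0 (Suc h)"
    using ab D_mult_mono[of _ 0 1 _ h] by (intro D_sum) auto
  moreover have "(\<Sum>v\<in>words m h. b v * mono v) \<in> D (N - 2 - h) h"
    using ab D_mult_mono[of _ "N - 2 - h" 0 _ h] by (intro D_sum) auto
  ultimately show ?thesis by blast
qed

text \<open>This is the only use of distributivity.\<close>

lemma J_exact:
  assumes w: "w \<in> free_homogeneous m N" "w \<in> J N (Suc i)" "w \<in> D 0 i" and N: "Suc i < N"
  shows "\<exists>w1 w2. w1 \<in> free_homogeneous m N \<and> w2 \<in> free_homogeneous m N \<and> w = w1 + w2 \<and>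
    w1 \<in> J N (Suc i) \<and> w1 \<in> D 0 (Suc i) \<and> w2 \<in> J N (Suc (Suc i))"
proof -
  have "w \<in> D 0 (Suc i) + D (N - 2 - i) i"
    using D_decompose[OF w(1,3)] N set_plus_intro by force
  hence "w \<in> J N (Suc i) \<inter> (D 0 (Suc i) + D (N - 2 - i) i)" using w by blast
  also have "\<dots> = (J N (Suc i) \<inter> D 0 (Suc i)) + (J N (Suc i) \<inter> D (N - 2 - i) i)"
    by (rule distributive[unfolded distributive_lattice_def, rule_format, OF J_lattice D_lattice D_lattice])
  finally have "w \<in> (J N (Suc i) \<inter> D 0 (Suc i)) + (J N (Suc i) \<inter> D (N - 2 - i) i)" .
  then obtain w1 w2 where "w = w1 + w2" "w1 \<in> J N (Suc i) \<inter> D 0 (Suc i)" "w2 \<in> J N (Suc i) \<inter> D (N - 2 - i) i"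
    by (rule set_plus_elim)
  hence *: "w = w1 + w2" "w1 \<in> J N (Suc i)" "w1 \<in> D 0 (Suc i)" "w2 \<in> J N (Suc i)" "w2 \<in> D (N - 2 - i) i"
    by auto
  \<comment> \<open>Of the positions demanded by \<open>J N (Suc (Suc i))\<close> only
    \<open>s = N - 2 - i\<close> is new, and that one is supplied by the membership of
    \<open>w2\<close> in \<open>D (N - 2 - i) i\<close>.\<close>
  have "part N w2 \<in> J N (Suc (Suc i))"
    unfolding J_def
  proof (intro CollectI conjI allI impI)
    show "part N w2 \<in> free_alg m" using *(5) D_alg free_alg_slice(3) by blast
    fix s assume s: "N - Suc (Suc i) \<le> s" "s + 2 \<le> N"
    show "part N w2 \<in> D s (N - 2 - s)"
    proof (cases "s = N - 2 - i")
      case True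
      hence "N - 2 - s = i" using N by simp
      thus ?thesis using D_part[OF *(5)] True by simp
    next
      case False
      hence "N - Suc i \<le> s" using s N by simp
      thus ?thesis using D_part *(4) s by (auto simp: J_def)
    qed
  qed
  moreover have "w = part N w1 + part N w2" using part_homogeneous[OF w(1), of N] *(1) by simp
  moreover have "part N w1 \<in> free_homogeneous m N" "part N w2 \<in> free_homogeneous m N"
    using D_alg[OF *(3)] D_alg[OF *(5)] by (auto intro: part_in_homogeneous)
  moreover have "part N w1 \<in> J N (Suc i)" "part N w1 \<in> D 0 (Suc i)"
    using J_part[OF *(2)] D_part[OF *(3)] by auto
  ultimately show ?thesis by blast
qed

end

subsection \<open>Free modules of functions with finite support set\<close>

definition fun_act :: "'a::ring_1 \<Rightarrow> ('x \<Rightarrow> 'a) \<Rightarrow> 'x \<Rightarrow> 'a" where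
  "fun_act a u = (\<lambda>k. a * u k)"

lemma left_module_fun_act: "left_module fun_act"
  by standard (auto simp: fun_act_def algebra_simps)

definition unit_fun :: "'x \<Rightarrow> 'x \<Rightarrow> 'a::ring_1" where
  "unit_fun k = (\<lambda>l. if l = k then 1 else 0)"

lemma unit_fun_inj: "unit_fun k = (unit_fun l :: 'x \<Rightarrow> 'a::ring_1) \<longleftrightarrow> k = l"
proof
  assume "unit_fun k = (unit_fun l :: 'x \<Rightarrow> 'a)"
  hence "unit_fun k k = (unit_fun l k :: 'a)" by simp
  thus "k = l" by (simp add: unit_fun_def split: if_splits)
qed simp

lemma sum_fun_apply: "sum f A x = (\<Sum>i\<in>A. f i x)"
  by (induction A rule: infinite_finite_induct) simp_all

lemma sum_unit_fun:
  assumes "finite K" "\<And>k. k \<notin> K \<Longrightarrow> u k = 0"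
  shows "(\<Sum>k\<in>K. fun_act (u k) (unit_fun k)) = (u :: 'x \<Rightarrow> 'a::ring_1)"
proof
  fix l
  have "(\<Sum>k\<in>K. fun_act (u k) (unit_fun k)) l = (\<Sum>k\<in>K. if k = l then u l else 0)"
    by (subst sum_fun_apply) (auto simp: fun_act_def unit_fun_def intro!: sum.cong)
  also have "\<dots> = u l" using assms by (simp add: sum.delta)
  finally show "(\<Sum>k\<in>K. fun_act (u k) (unit_fun k)) l = u l" .
qed

lemma free_submodule_fun:
  fixes K :: "'x set"
  assumes K: "finite K"
  shows "free_submodule (fun_act :: 'a::ring_1 \<Rightarrow> _) {u. \<forall>k. k \<notin> K \<longrightarrow> u k = 0}"
  unfolding free_submodule_def
proof (intro conjI ballI allI)
  let ?S = "{u :: 'x \<Rightarrow> 'a. \<forall>k. k \<notin> K \<longrightarrow> u k = 0}"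
  show "(0 :: 'x \<Rightarrow> 'a) \<in> ?S" by simp
  show "u + v \<in> ?S" if "u \<in> ?S" "v \<in> ?S" for u v using that by simp
  show "fun_act a u \<in> ?S" if "u \<in> ?S" for a u using that by (simp add: fun_act_def)
  let ?B = "unit_fun ` K :: ('x \<Rightarrow> 'a) set"
  have BS: "?B \<subseteq> ?S" by (auto simp: unit_fun_def)
  have finB: "finite ?B" using K by simp
  have comb: "(\<Sum>b\<in>Poly_Mapping.keys c. fun_act (Poly_Mapping.lookup c b) b) =
      (\<Sum>k\<in>K. fun_act (Poly_Mapping.lookup c (unit_fun k)) (unit_fun k))"
    if "Poly_Mapping.keys c \<subseteq> ?B" for c :: "('x \<Rightarrow> 'a) \<Rightarrow>\<^sub>0 'a"
  proof -
    have "(\<Sum>b\<in>Poly_Mapping.keys c. fun_act (Poly_Mapping.lookup c b) b) =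
        (\<Sum>b\<in>?B. fun_act (Poly_Mapping.lookup c b) b)"
      using that finB by (intro sum.mono_neutral_left) (auto simp: in_keys_iff fun_act_def fun_eq_iff)
    also have "\<dots> = (\<Sum>k\<in>K. fun_act (Poly_Mapping.lookup c (unit_fun k)) (unit_fun k))"
      by (subst sum.reindex) (auto simp: inj_on_def unit_fun_inj)
    finally show ?thesis .
  qed
  have coeff: "(\<Sum>k\<in>K. fun_act (f k) (unit_fun k :: 'x \<Rightarrow> 'a)) l = (if l \<in> K then f l else 0)" for f :: "'x \<Rightarrow> 'a" and l
  proof -
    have "(\<Sum>k\<in>K. fun_act (f k) (unit_fun k :: 'x \<Rightarrow> 'a)) l = (\<Sum>k\<in>K. if k = l then f l else 0)"
      by (subst sum_fun_apply) (auto simp: fun_act_def unit_fun_def intro!: sum.cong)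
    thus ?thesis using K by (simp add: sum.delta)
  qed
  show "\<exists>B\<subseteq>?S. \<forall>u\<in>?S. \<exists>!c :: ('x \<Rightarrow> 'a) \<Rightarrow>\<^sub>0 'a. Poly_Mapping.keys c \<subseteq> B \<and>
      u = (\<Sum>b\<in>Poly_Mapping.keys c. fun_act (Poly_Mapping.lookup c b) b)"
  proof (intro exI[of _ ?B] conjI BS ballI)
    fix u assume u: "u \<in> ?S"
    define c where "c = (\<Sum>k\<in>K. Poly_Mapping.single (unit_fun k :: 'x \<Rightarrow> 'a) (u k))"
    have lc: "Poly_Mapping.lookup c (unit_fun l) = (if l \<in> K then u l else 0)" for l
    proof -
      have "Poly_Mapping.lookup c (unit_fun l) = (\<Sum>k\<in>K. if k = l then u l else 0)"
        unfolding c_def lookup_sum by (intro sum.cong refl) (auto simp: lookup_single when_def unit_fun_inj)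
      thus ?thesis using K by (simp add: sum.delta)
    qed
    have kc: "Poly_Mapping.keys c \<subseteq> ?B"
    proof
      fix b assume "b \<in> Poly_Mapping.keys c"
      hence "(\<Sum>k\<in>K. Poly_Mapping.lookup (Poly_Mapping.single (unit_fun k :: 'x \<Rightarrow> 'a) (u k)) b) \<noteq> 0"
        unfolding c_def in_keys_iff lookup_sum .
      then obtain k where "k \<in> K" "Poly_Mapping.lookup (Poly_Mapping.single (unit_fun k :: 'x \<Rightarrow> 'a) (u k)) b \<noteq> 0"
        by (rule sum.not_neutral_contains_not_neutral)
      thus "b \<in> ?B" by (auto simp: lookup_single when_def split: if_splits)
    qed
    show "\<exists>!c :: ('x \<Rightarrow> 'a) \<Rightarrow>\<^sub>0 'a. Poly_Mapping.keys c \<subseteq> ?B \<and>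
      u = (\<Sum>b\<in>Poly_Mapping.keys c. fun_act (Poly_Mapping.lookup c b) b)"
    proof (rule ex1I[of _ c], intro conjI kc)
      show "u = (\<Sum>b\<in>Poly_Mapping.keys c. fun_act (Poly_Mapping.lookup c b) b)"
        unfolding comb[OF kc] using u by (auto simp: coeff lc)
      fix d :: "('x \<Rightarrow> 'a) \<Rightarrow>\<^sub>0 'a"
      assume d: "Poly_Mapping.keys d \<subseteq> ?B \<and> u = (\<Sum>b\<in>Poly_Mapping.keys d. fun_act (Poly_Mapping.lookup d b) b)"
      hence "u = (\<Sum>k\<in>K. fun_act (Poly_Mapping.lookup d (unit_fun k)) (unit_fun k))" using comb[of d] by (elim conjE) (rule trans)
      hence du: "Poly_Mapping.lookup d (unit_fun l) = u l" if "l \<in> K" for l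
        using coeff[of "\<lambda>k. Poly_Mapping.lookup d (unit_fun k)" l] that by simp
      show "d = c"
      proof (rule poly_mapping_eqI)
        fix b
        show "Poly_Mapping.lookup d b = Poly_Mapping.lookup c b"
        proof (cases "b \<in> ?B")
          case True
          thus ?thesis using du lc by auto
        next
          case False
          hence "b \<notin> Poly_Mapping.keys d" "b \<notin> Poly_Mapping.keys c" using d kc by blast+
          thus ?thesis by (simp add: in_keys_iff)
        qed
      qed
    qed
  qed
qed

subsection \<open>Coordinates on the Koszul spaces\<close>

lemma free_algebra_vector_space: "vector_space (\<lambda>c (p :: 'k::field free_algebra). free_scalar c * p)"
  by standard (auto simp: algebra_simps)

lemma homogeneous_expand:
  assumes "p \<in> free_homogeneous m i"
  shows "p = (\<Sum>v\<in>words m i. free_scalar (look p v) * mono v)"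
proof -
  have "p = (\<Sum>v\<in>words m i. rslice v p * mono v)"
    by (rule sum_rslice[OF free_homogeneous_alg[OF assms]])
      (use assms in \<open>simp add: free_homogeneous_iff in_keys_iff\<close>)
  also have "\<dots> = (\<Sum>v\<in>words m i. free_scalar (look p v) * mono v)"
  proof (intro sum.cong refl)
    fix v assume v: "v \<in> words m i"
    have "rslice v p = free_scalar (look p v)"
      by (rule rslice_homogeneous) (use assms words_len[OF v] in \<open>simp add: free_homogeneous_iff in_keys_iff\<close>)
    thus "rslice v p * mono v = free_scalar (look p v) * mono v" by simp
  qed
  finally show ?thesis .
qed

text \<open>The dual functionals are extended beyond \<open>W\<close>, so that on degree
  \<open>i\<close> they are combinations of word coefficients with weights \<open>lam l v\<close>.
  In this form they can also be applied to the last \<open>i\<close> letters of longer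
  words.\<close>

lemma subspace_dual_basis:
  fixes W :: "'k::field free_algebra set"
  assumes W: "W \<subseteq> free_homogeneous m i"
  obtains j :: nat and b lam where "\<And>k. k < j \<Longrightarrow> b k \<in> W"
    "\<And>p. p \<in> W \<Longrightarrow> p = (\<Sum>l<j. free_scalar (\<Sum>v\<in>words m i. lam l v * look p v) * b l)"
    "\<And>k l. k < j \<Longrightarrow> l < j \<Longrightarrow> (\<Sum>v\<in>words m i. lam l v * look (b k) v) = (if k = l then 1 else 0)"
proof -
  let ?s = "\<lambda>c (p :: 'k free_algebra). free_scalar c * p"
  interpret F: vector_space ?s by (rule free_algebra_vector_space)
  interpret K: vector_space "(*) :: 'k \<Rightarrow> 'k \<Rightarrow> 'k" by standard (auto simp: algebra_simps)
  interpret FK: vector_space_pair ?s "(*) :: 'k \<Rightarrow> 'k \<Rightarrow> 'k" ..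
  obtain B where B: "B \<subseteq> W" "F.independent B" "W \<subseteq> F.span B"
    using F.maximal_independent_subset[of W] by blast
  have "free_homogeneous m i \<subseteq> F.span (mono ` words m i)"
  proof
    fix p :: "'k free_algebra" assume p: "p \<in> free_homogeneous m i"
    have "(\<Sum>v\<in>words m i. ?s (look p v) (mono v)) \<in> F.span (mono ` words m i)"
      by (intro F.span_sum F.span_scale F.span_base imageI)
    thus "p \<in> F.span (mono ` words m i)" using homogeneous_expand[OF p] by simp
  qed
  hence "B \<subseteq> F.span (mono ` words m i)" using B(1) W by blast
  moreover have "finite (mono ` words m i :: 'k free_algebra set)" using finite_words by blast
  ultimately have finB: "finite B" using F.independent_span_bound B(2) by blast
  then obtain b where b: "bij_betw b {0..<card B} B" using ex_bij_betw_nat_finite by blast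
  define j where "j = card B"
  have bB: "b k \<in> B" if "k < j" for k using b that unfolding bij_betw_def j_def by auto
  have binj: "b k = b l \<longleftrightarrow> k = l" if "k < j" "l < j" for k l
    using b that unfolding bij_betw_def j_def inj_on_def by auto
  have "\<exists>g. Vector_Spaces.linear ?s (*) g \<and> (\<forall>x\<in>B. g x = (if x = b l then 1 else 0))" for l :: nat
    by (rule FK.linear_independent_extend[OF B(2)])
  then obtain g :: "nat \<Rightarrow> 'k free_algebra \<Rightarrow> 'k"
    where g: "\<And>l. Vector_Spaces.linear ?s (*) (g l)" "\<And>l x. x \<in> B \<Longrightarrow> g l x = (if x = b l then 1 else 0)"
    by metis
  define lam where "lam l v = g l (mono v)" for l v
  have gp: "g l p = (\<Sum>v\<in>words m i. lam l v * look p v)" if p: "p \<in> free_homogeneous m i" for l p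
  proof -
    have "g l p = g l (\<Sum>v\<in>words m i. ?s (look p v) (mono v))" using homogeneous_expand[OF p] by simp
    also have "\<dots> = (\<Sum>v\<in>words m i. look p v * g l (mono v))"
      unfolding FK.linear_sum[OF g(1)] FK.linear_scale[OF g(1)] ..
    finally show ?thesis by (simp add: lam_def mult.commute)
  qed
  show ?thesis
  proof
    show "b k \<in> W" if "k < j" for k using bB[OF that] B(1) by blast
    show "(\<Sum>v\<in>words m i. lam l v * look (b k) v) = (if k = l then 1 else 0)" if "k < j" "l < j" for k l
      using gp[of "b k" l] g(2)[OF bB[OF that(1)], of l] bB[OF that(1)] B(1) W binj[OF that] by auto
    fix p assume p: "p \<in> W"
    hence "p \<in> F.span B" using B(3) by blast
    then obtain u where u: "p = (\<Sum>x\<in>B. ?s (u x) x)" using F.span_finite[OF finB] by auto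
    have "g l p = (\<Sum>x\<in>B. u x * g l x)" for l
      by (subst u) (simp only: FK.linear_sum[OF g(1)] FK.linear_scale[OF g(1)])
    hence gl: "g l p = u (b l)" if "l < j" for l
      using g(2) finB bB[OF that] by (simp add: if_distrib[of "\<lambda>z. u _ * z"] cong: if_cong)
    have "p = (\<Sum>l\<in>{0..<card B}. ?s (u (b l)) (b l))"
      by (rule trans[OF u sum.reindex_bij_betw[OF b, of "\<lambda>x. ?s (u x) x", symmetric]])
    also have "\<dots> = (\<Sum>l<j. ?s (g l p) (b l))"
      using gl by (intro sum.cong) (auto simp: j_def)
    also have "\<dots> = (\<Sum>l<j. free_scalar (\<Sum>v\<in>words m i. lam l v * look p v) * b l)"
      unfolding gp[OF subsetD[OF W p]] ..
    finally show "p = (\<Sum>l<j. free_scalar (\<Sum>v\<in>words m i. lam l v * look p v) * b l)" .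
  qed
qed

context koszul_ideal
begin

text \<open>The space \<open>W_i\<close>: elements of degree \<open>i\<close> with a relation at
  every pair of adjacent letters.\<close>

definition koszul_space :: "nat \<Rightarrow> 'k free_algebra set" where
  "koszul_space i = J i i \<inter> free_homogeneous m i"

definition is_dual_basis :: "nat \<Rightarrow> nat \<times> (nat \<Rightarrow> 'k free_algebra) \<times> (nat \<Rightarrow> nat free_monoid \<Rightarrow> 'k) \<Rightarrow> bool" where
  "is_dual_basis i = (\<lambda>(j, b, lam). (\<forall>k<j. b k \<in> koszul_space i) \<and>
    (\<forall>p\<in>koszul_space i. p = (\<Sum>l<j. free_scalar (\<Sum>v\<in>words m i. lam l v * look p v) * b l)) \<and>
    (\<forall>k<j. \<forall>l<j. (\<Sum>v\<in>words m i. lam l v * look (b k) v) = (if k = l then 1 else 0)))"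

definition kdata :: "nat \<Rightarrow> nat \<times> (nat \<Rightarrow> 'k free_algebra) \<times> (nat \<Rightarrow> nat free_monoid \<Rightarrow> 'k)" where
  "kdata i = (SOME d. is_dual_basis i d)"

definition kdim :: "nat \<Rightarrow> nat" where "kdim i = fst (kdata i)"
definition kbasis :: "nat \<Rightarrow> nat \<Rightarrow> 'k free_algebra" where "kbasis i = fst (snd (kdata i))"
definition kdual :: "nat \<Rightarrow> nat \<Rightarrow> nat free_monoid \<Rightarrow> 'k" where "kdual i = snd (snd (kdata i))"

lemma kdata: "is_dual_basis i (kdim i, kbasis i, kdual i)"
proof -
  have sub: "koszul_space i \<subseteq> free_homogeneous m i" by (simp add: koszul_space_def)
  have "\<exists>d. is_dual_basis i d"
  proof (rule subspace_dual_basis[OF sub])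
    fix j :: nat and b lam
    assume "\<And>k. k < j \<Longrightarrow> b k \<in> koszul_space i"
      and "\<And>p. p \<in> koszul_space i \<Longrightarrow> p = (\<Sum>l<j. free_scalar (\<Sum>v\<in>words m i. lam l v * look p v) * b l)"
      and "\<And>k l. k < j \<Longrightarrow> l < j \<Longrightarrow> (\<Sum>v\<in>words m i. lam l v * look (b k) v) = (if k = l then 1 else 0)"
    hence "is_dual_basis i (j, b, lam)" unfolding is_dual_basis_def split_conv by blast
    thus "\<exists>d. is_dual_basis i d" by (rule exI)
  qed
  hence "is_dual_basis i (kdata i)" unfolding kdata_def by (rule someI_ex)
  thus ?thesis unfolding kdim_def kbasis_def kdual_def by simp
qed

lemma kbasis_in: "k < kdim i \<Longrightarrow> kbasis i k \<in> koszul_space i"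
  and kbasis_expand: "p \<in> koszul_space i \<Longrightarrow>
    p = (\<Sum>l<kdim i. free_scalar (\<Sum>v\<in>words m i. kdual i l v * look p v) * kbasis i l)"
  and kdual_kbasis: "\<lbrakk>k < kdim i; l < kdim i\<rbrakk> \<Longrightarrow>
    (\<Sum>v\<in>words m i. kdual i l v * look (kbasis i k) v) = (if k = l then 1 else 0)"
  using kdata[of i] unfolding is_dual_basis_def split_conv by blast+

lemma kbasis_homogeneous: "k < kdim i \<Longrightarrow> kbasis i k \<in> free_homogeneous m i"
  and kbasis_J: "k < kdim i \<Longrightarrow> kbasis i k \<in> J i i"
  using kbasis_in unfolding koszul_space_def by blast+

text \<open>The \<open>l\<close>-th dual functional applied to the last \<open>i\<close> letters,
  with the letters in front kept as a polynomial coefficient.\<close>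

definition coord :: "nat \<Rightarrow> nat \<Rightarrow> 'k free_algebra \<Rightarrow> 'k free_algebra" where
  "coord i l q = (\<Sum>v\<in>words m i. free_scalar (kdual i l v) * rslice v q)"

lemma coord_add: "coord i l (p + q) = coord i l p + coord i l q"
  by (simp add: coord_def distrib_left sum.distrib)

lemma coord_sum: "coord i l (sum f A) = (\<Sum>x\<in>A. coord i l (f x))"
  by (induction A rule: infinite_finite_induct) (simp_all add: coord_add, simp_all add: coord_def)

lemma coord_mult:
  assumes "b \<in> free_ge m i"
  shows "coord i l (p * b) = p * coord i l b"
proof -
  have "rslice v (p * b) = p * rslice v b" if v: "v \<in> words m i" for v
    by (rule rslice_mult) (drule free_ge_keys[OF assms], simp add: words_len[OF v])
  hence "coord i l (p * b) = (\<Sum>v\<in>words m i. free_scalar (kdual i l v) * (p * rslice v b))"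
    unfolding coord_def by simp
  also have "\<dots> = (\<Sum>v\<in>words m i. p * (free_scalar (kdual i l v) * rslice v b))"
  proof (intro sum.cong refl)
    fix v
    show "free_scalar (kdual i l v) * (p * rslice v b) = p * (free_scalar (kdual i l v) * rslice v b)"
      unfolding mult.assoc[symmetric] free_scalar_commute[of _ p] ..
  qed
  finally show ?thesis by (simp add: coord_def sum_distrib_left)
qed

lemma free_scalar_sum: "free_scalar (sum f A) = (\<Sum>x\<in>A. free_scalar (f x))"
  by (induction A rule: infinite_finite_induct) simp_all

lemma coord_kbasis:
  assumes "k < kdim i" "l < kdim i"
  shows "coord i l (kbasis i k) = (if k = l then 1 else 0)"
proof -
  have "rslice v (kbasis i k) = free_scalar (look (kbasis i k) v)" if v: "v \<in> words m i" for v
    by (rule rslice_homogeneous)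
      (use kbasis_homogeneous[OF assms(1)] words_len[OF v] in \<open>simp add: free_homogeneous_iff in_keys_iff\<close>)
  hence "coord i l (kbasis i k) = free_scalar (\<Sum>v\<in>words m i. kdual i l v * look (kbasis i k) v)"
    by (simp add: coord_def free_scalar_sum)
  thus ?thesis using kdual_kbasis[OF assms] by simp
qed

lemma kbasis_free_ge: "k < kdim i \<Longrightarrow> kbasis i k \<in> free_ge m i"
  by (rule homogeneous_free_ge[OF kbasis_homogeneous])

lemma coord_combination:
  assumes "l < kdim i"
  shows "coord i l (\<Sum>k<kdim i. p k * kbasis i k) = p l"
proof -
  have "coord i l (\<Sum>k<kdim i. p k * kbasis i k) = (\<Sum>k<kdim i. if k = l then p l else 0)"
    unfolding coord_sum by (intro sum.cong refl) (simp add: coord_mult kbasis_free_ge coord_kbasis assms)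
  thus ?thesis using assms by (simp add: sum.delta)
qed

lemma coord_alg: "q \<in> free_alg m \<Longrightarrow> coord i l q \<in> free_alg m"
  unfolding coord_def by (intro free_alg_sum free_alg_mult free_alg_scalar free_alg_slice)

lemma free_homogeneous_sum: "(\<And>x. x \<in> A \<Longrightarrow> f x \<in> free_homogeneous m N) \<Longrightarrow> sum f A \<in> free_homogeneous m N"
  by (induction A rule: infinite_finite_induct) (auto intro: free_homogeneous_zero free_homogeneous_add)

lemma coord_homogeneous: "q \<in> free_homogeneous m (N + i) \<Longrightarrow> coord i l q \<in> free_homogeneous m N"
  unfolding coord_def
  by (intro free_homogeneous_sum free_homogeneous_scalar free_homogeneous_rslice) (simp add: words_len)

lemma coord_ideal: "q \<in> D 0 i \<Longrightarrow> coord i l q \<in> I"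
  unfolding coord_def by (intro ideal_sum ideal_left free_alg_scalar) (simp add: D_def slice_zero words_len)

lemma lslice_mult_homogeneous:
  assumes "p \<in> free_homogeneous m (len u)"
  shows "lslice u (p * b) = free_scalar (look p u) * b"
proof -
  have "lslice u (p * b) = lslice u p * b"
    by (rule lslice_mult) (use assms in \<open>simp add: free_homogeneous_iff in_keys_iff\<close>)
  moreover have "lslice u p = free_scalar (look p u)"
  proof (rule poly_mapping_eqI)
    fix w
    have "look p (u + w) = 0" if "w \<noteq> 0"
      using assms that unfolding free_homogeneous_iff by fastforce
    thus "look (lslice u p) w = look (free_scalar (look p u)) w"
      by (auto simp: free_scalar_def lookup_single when_def)
  qed
  ultimately show ?thesis by simp
qed

lemma J_lslice:
  assumes q: "q \<in> free_homogeneous m N" "q \<in> J N i" "i \<le> N" and u: "len u = N - i"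
  shows "lslice u q \<in> koszul_space i"
proof -
  have hom: "lslice u q \<in> free_homogeneous m i"
    by (rule free_homogeneous_lslice) (use q u in simp)
  have "lslice u q \<in> D s (i - 2 - s)" if s: "s + 2 \<le> i" for s
  proof -
    have "q \<in> D (N - i + s) (N - 2 - (N - i + s))" using q s unfolding J_def by simp
    moreover have "N - 2 - (N - i + s) = i - 2 - s" using q(3) s by simp
    ultimately have qD: "q \<in> D (N - i + s) (i - 2 - s)" by simp
    have "lslice u' (rslice v (lslice u q)) \<in> I" if "len u' = s" "len v = i - 2 - s" for u' v
    proof -
      have "lslice u' (rslice v (lslice u q)) = lslice (u + u') (rslice v q)"
        unfolding lslice_plus slice_commute ..
      moreover have "len (u + u') = N - i + s" using u that by simp
      ultimately show ?thesis using qD that(2) unfolding D_def by auto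
    qed
    moreover have "lslice u q \<in> free_ge m (s + (i - 2 - s))"
      using homogeneous_free_ge[OF hom] free_ge_anti[of "s + (i - 2 - s)" i] s by auto
    ultimately show ?thesis unfolding D_def by blast
  qed
  thus ?thesis using hom free_homogeneous_alg[OF hom] unfolding koszul_space_def J_def by auto
qed

text \<open>An element of degree \<open>N\<close> is determined by its slices along prefixes of
  length \<open>N - i\<close>. For elements of \<open>J N i\<close> these slices lie in the Koszul
  space, where the dual basis reproduces them.\<close>

lemma coord_expand:
  assumes q: "q \<in> free_homogeneous m N" "q \<in> J N i" "i \<le> N"
  shows "q = (\<Sum>l<kdim i. coord i l q * kbasis i l)"
proof -
  have ch: "coord i l q \<in> free_homogeneous m (N - i)" for l
    by (rule coord_homogeneous) (use q in simp)
  let ?r = "\<Sum>l<kdim i. coord i l q * kbasis i l"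
  have rh: "?r \<in> free_homogeneous m N"
  proof (rule free_homogeneous_sum)
    fix l assume "l \<in> {..<kdim i}"
    hence "coord i l q * kbasis i l \<in> free_homogeneous m (N - i + i)"
      by (intro free_homogeneous_mult ch kbasis_homogeneous) simp
    thus "coord i l q * kbasis i l \<in> free_homogeneous m N" using q(3) by simp
  qed
  have eq: "lslice u q = lslice u ?r" if u: "u \<in> words m (N - i)" for u
  proof -
    note lu = words_len[OF u]
    have "look (coord i l q) u = (\<Sum>v\<in>words m i. kdual i l v * look (lslice u q) v)" for l
      unfolding coord_def lookup_sum by simp
    moreover have "lslice u ?r = (\<Sum>l<kdim i. free_scalar (look (coord i l q) u) * kbasis i l)"
      unfolding slice_sum using ch lu by (intro sum.cong refl lslice_mult_homogeneous) simp
    ultimately show ?thesis using kbasis_expand[OF J_lslice[OF q lu]] by simp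
  qed
  have "q = (\<Sum>u\<in>words m (N - i). mono u * lslice u q)"
    by (rule sum_lslice[OF free_homogeneous_alg[OF q(1)]])
      (use q(1) in \<open>simp add: free_homogeneous_iff in_keys_iff\<close>)
  also have "\<dots> = (\<Sum>u\<in>words m (N - i). mono u * lslice u ?r)"
    by (intro sum.cong refl) (simp add: eq)
  also have "\<dots> = ?r"
    by (rule sum_lslice[OF free_homogeneous_alg[OF rh], symmetric])
      (use rh in \<open>simp add: free_homogeneous_iff in_keys_iff\<close>)
  finally show ?thesis .
qed

text \<open>The converse of \<open>coord_expand\<close>: a relation inside a basis element of
  \<open>W_i\<close> is shifted by the \<open>N - i\<close> letters of the coefficient.\<close>

lemma combination_J:
  assumes p: "\<And>k. k < kdim i \<Longrightarrow> p k \<in> free_homogeneous m (N - i)" and N: "i \<le> N"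
  shows "(\<Sum>k<kdim i. p k * kbasis i k) \<in> J N i" "(\<Sum>k<kdim i. p k * kbasis i k) \<in> free_homogeneous m N"
proof -
  have hom: "p k * kbasis i k \<in> free_homogeneous m N" if "k < kdim i" for k
    using free_homogeneous_mult[OF p[OF that] kbasis_homogeneous[OF that]] N by simp
  show "(\<Sum>k<kdim i. p k * kbasis i k) \<in> free_homogeneous m N"
    by (intro free_homogeneous_sum hom) simp
  have "p k * kbasis i k \<in> D s (N - 2 - s)" if k: "k < kdim i" and s: "N - i \<le> s" "s + 2 \<le> N" for k s
  proof -
    define s' where "s' = s - (N - i)"
    have s': "s' + 2 \<le> i" "i - 2 - s' = N - 2 - s" "s = N - i + s'" using s N by (auto simp: s'_def)
    have bD: "kbasis i k \<in> D s' (N - 2 - s)" using kbasis_J[OF k] s' unfolding J_def by auto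
    have "lslice u (rslice v (p k * kbasis i k)) \<in> I" if uv: "len u = s" "len v = N - 2 - s" for u v
    proof -
      have "N - i \<le> len u" using uv(1) s(1) by simp
      then obtain u1 u2 where u: "u = u1 + u2" "len u1 = N - i" "len u2 = len u - (N - i)"
        using word_split by blast
      have "lslice u1 (p k * kbasis i k) = free_scalar (look (p k) u1) * kbasis i k"
        by (rule lslice_mult_homogeneous) (use p[OF k] u(2) in simp)
      hence "lslice u (rslice v (p k * kbasis i k)) = free_scalar (look (p k) u1) * lslice u2 (rslice v (kbasis i k))"
        unfolding u(1) lslice_plus slice_commute[of u1] by simp
      moreover have "len u2 = s'" using u(3) uv(1) s'(3) by simp
      hence "lslice u2 (rslice v (kbasis i k)) \<in> I" using bD uv(2) unfolding D_def by blast
      ultimately show ?thesis using ideal_left[OF free_alg_scalar] by simp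
    qed
    moreover have "p k * kbasis i k \<in> free_ge m (s + (N - 2 - s))"
      using homogeneous_free_ge[OF hom[OF k]] free_ge_anti[of "s + (N - 2 - s)" N] s by auto
    ultimately show ?thesis unfolding D_def by blast
  qed
  hence "p k * kbasis i k \<in> J N i" if "k < kdim i" for k
    using that free_homogeneous_alg[OF hom[OF that]] unfolding J_def by blast
  thus "(\<Sum>k<kdim i. p k * kbasis i k) \<in> J N i"
    unfolding J_def by (auto intro!: free_alg_sum D_sum)
qed

lemma J_anti: "J N (Suc i) \<subseteq> J N i"
  unfolding J_def by auto

lemma J_small: "i \<le> 1 \<Longrightarrow> J N i = free_alg m"
  unfolding J_def by auto

text \<open>Since \<open>W_(i+1)\<close> lies in \<open>V W_i\<close>, its basis elements have
  linear forms as coordinates over the basis of \<open>W_i\<close>. These forms are the matrix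
  entries of the Koszul differential.\<close>

definition link :: "nat \<Rightarrow> nat \<Rightarrow> nat \<Rightarrow> 'k free_algebra" where
  "link i k l = coord i l (kbasis (Suc i) k)"

lemma link_homogeneous: "k < kdim (Suc i) \<Longrightarrow> link i k l \<in> free_homogeneous m 1"
  unfolding link_def by (rule coord_homogeneous) (simp add: kbasis_homogeneous)

lemma link_expand:
  assumes "k < kdim (Suc i)"
  shows "kbasis (Suc i) k = (\<Sum>l<kdim i. link i k l * kbasis i l)"
  unfolding link_def using kbasis_J[OF assms] J_anti
  by (intro coord_expand[of _ "Suc i"] kbasis_homogeneous assms) auto

text \<open>Multiplying the two matrices computes the coordinates of a basis element of
  \<open>W_(i+2)\<close> over its last \<open>i\<close> letters. The two letters in front form a
  relation, because that element lies in \<open>D 0 i\<close>.\<close>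

lemma link_link:
  assumes "r < kdim (Suc (Suc i))"
  shows "(\<Sum>k<kdim (Suc i). link (Suc i) r k * link i k l) \<in> I"
proof -
  have "(\<Sum>k<kdim (Suc i). link (Suc i) r k * link i k l) = coord i l (kbasis (Suc (Suc i)) r)"
    unfolding link_expand[OF assms] coord_sum
  proof (intro sum.cong refl)
    fix k assume k: "k \<in> {..<kdim (Suc i)}"
    have "kbasis (Suc i) k \<in> free_ge m i"
      using kbasis_free_ge[of k "Suc i"] free_ge_anti[of i "Suc i"] k by auto
    thus "link (Suc i) r k * link i k l = coord i l (link (Suc i) r k * kbasis (Suc i) k)"
      by (simp add: coord_mult link_def[of i])
  qed
  moreover have "kbasis (Suc (Suc i)) r \<in> D 0 i"
    using kbasis_J[OF assms] unfolding J_def by auto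
  ultimately show ?thesis using coord_ideal by simp
qed

lemma kdim_0: "kdim 0 = 1"
proof -
  have w0: "words m 0 = {0}" by (auto simp: words_def)
  have one: "(1 :: 'k free_algebra) \<in> koszul_space 0"
    unfolding koszul_space_def J_small[of 0, simplified]
    by (auto simp: free_alg_one free_homogeneous_iff lookup_one when_def)
  have "kdim 0 \<noteq> 0"
  proof
    assume "kdim 0 = 0"
    hence "(1 :: 'k free_algebra) = 0" using kbasis_expand[OF one] by simp
    thus False by simp
  qed
  \<comment> \<open>The empty word is the only word of length 0, so two functionals cannot separate
    two basis vectors.\<close>
  moreover have False if "1 < kdim 0"
  proof -
    have "kdual 0 0 0 * look (kbasis 0 0) 0 = 1" "kdual 0 1 0 * look (kbasis 0 0) 0 = 0"
      "kdual 0 1 0 * look (kbasis 0 1) 0 = 1"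
      using kdual_kbasis[of 0 0 0] kdual_kbasis[of 0 0 1] kdual_kbasis[of 1 0 1] that by (simp_all add: w0)
    thus False by auto
  qed
  ultimately show ?thesis by (cases "kdim 0") auto
qed

end

subsection \<open>The Koszul resolution\<close>

lemma sum_part:
  obtains M where "p = (\<Sum>d<M. part d p)"
proof (rule that[of "Suc (Max (len ` Poly_Mapping.keys p))"], rule poly_mapping_eqI)
  fix w
  let ?M = "Suc (Max (len ` Poly_Mapping.keys p))"
  have "look (\<Sum>d<?M. part d p) w = (\<Sum>d<?M. if d = len w then look p w else 0)"
    unfolding lookup_sum by (intro sum.cong refl) simp
  also have "\<dots> = look p w"
  proof (cases "look p w = 0")
    case False
    hence "len w \<le> Max (len ` Poly_Mapping.keys p)" by (intro Max_ge) (auto simp: in_keys_iff)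
    thus ?thesis by (simp add: sum.delta)
  qed simp
  finally show "look p w = look (\<Sum>d<?M. part d p) w" by simp
qed

locale koszul_presentation = koszul_ideal m I + augmented \<epsilon>
  for m :: nat and I :: "'k::field free_algebra set" and \<epsilon> :: "'a::ring_1 \<Rightarrow> 'k" +
  fixes \<phi> :: "'k free_algebra \<Rightarrow> 'a" and \<iota> :: "'k \<Rightarrow> 'a"
  assumes phi_add: "\<lbrakk>p \<in> free_alg m; q \<in> free_alg m\<rbrakk> \<Longrightarrow> \<phi> (p + q) = \<phi> p + \<phi> q"
    and phi_mult: "\<lbrakk>p \<in> free_alg m; q \<in> free_alg m\<rbrakk> \<Longrightarrow> \<phi> (p * q) = \<phi> p * \<phi> q"
    and phi_scalar: "\<phi> (free_scalar c) = \<iota> c"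
    and phi_surj: "\<exists>p\<in>free_alg m. \<phi> p = a"
    and I_eq: "I = {p \<in> free_alg m. \<phi> p = 0}"
    and aug_iota: "\<epsilon> (\<iota> c) = c"
    and aug_1: "p \<in> free_homogeneous m 1 \<Longrightarrow> \<epsilon> (\<phi> p) = 0"
begin

lemma phi_zero: "\<phi> 0 = 0"
  using phi_add[OF free_alg_zero free_alg_zero] by simp

lemma phi_sum: "(\<And>x. x \<in> A \<Longrightarrow> f x \<in> free_alg m) \<Longrightarrow> \<phi> (sum f A) = (\<Sum>x\<in>A. \<phi> (f x))"
  by (induction A rule: infinite_finite_induct) (auto simp: phi_zero phi_add free_alg_sum)

lemma phi_one: "\<phi> 1 = 1"
proof -
  obtain p where p: "p \<in> free_alg m" "\<phi> p = 1" using phi_surj by blast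
  have "\<phi> 1 = \<phi> p * \<phi> 1" using p by simp
  also have "\<dots> = \<phi> (p * 1)" by (rule phi_mult[OF p(1) free_alg_one, symmetric])
  finally show ?thesis using p by simp
qed

lemma iota_add: "\<iota> (a + b) = \<iota> a + \<iota> b"
  and iota_mult: "\<iota> (a * b) = \<iota> a * \<iota> b"
  and iota_one: "\<iota> 1 = 1"
  and iota_zero: "\<iota> 0 = 0"
  unfolding phi_scalar[symmetric]
  by (simp_all add: phi_add phi_mult free_alg_scalar phi_one phi_zero)

lemma iota_central: "\<iota> c * a = a * \<iota> c"
proof -
  obtain p where p: "p \<in> free_alg m" "\<phi> p = a" using phi_surj by blast
  have "\<phi> (free_scalar c * p) = \<phi> (p * free_scalar c)" by (simp only: free_scalar_commute)
  thus ?thesis using p by (simp add: phi_mult free_alg_scalar phi_scalar)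
qed

text \<open>The grading by word length, carried to \<open>A\<close> along
  \<open>\<phi>\<close>.\<close>

definition G :: "nat \<Rightarrow> 'a set" where "G d = \<phi> ` free_homogeneous m d"

lemma G_zero: "0 \<in> G d"
  unfolding G_def using free_homogeneous_zero phi_zero by (metis imageI)

lemma G_add: "a \<in> G d \<Longrightarrow> b \<in> G d \<Longrightarrow> a + b \<in> G d"
proof -
  assume "a \<in> G d" "b \<in> G d"
  then obtain p q where p: "p \<in> free_homogeneous m d" "a = \<phi> p" "q \<in> free_homogeneous m d" "b = \<phi> q"
    unfolding G_def by blast
  have "a + b = \<phi> (p + q)"
    using phi_add[OF free_homogeneous_alg[OF p(1)] free_homogeneous_alg[OF p(3)]] p by simp
  thus "a + b \<in> G d" unfolding G_def using free_homogeneous_add[OF p(1,3)] by blast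
qed

lemma G_sum: "(\<And>x. x \<in> A \<Longrightarrow> f x \<in> G d) \<Longrightarrow> sum f A \<in> G d"
  by (induction A rule: infinite_finite_induct) (auto intro: G_zero G_add)

lemma G_scale: "a \<in> G d \<Longrightarrow> \<iota> c * a \<in> G d"
proof -
  assume "a \<in> G d"
  then obtain p where p: "p \<in> free_homogeneous m d" "a = \<phi> p" unfolding G_def by blast
  have "\<iota> c * a = \<phi> (free_scalar c * p)"
    using phi_mult[OF free_alg_scalar free_homogeneous_alg[OF p(1)]] p(2) by (simp add: phi_scalar)
  thus ?thesis unfolding G_def using free_homogeneous_scalar[OF p(1)] by blast
qed

lemma G_mult: "a \<in> G d \<Longrightarrow> b \<in> G e \<Longrightarrow> a * b \<in> G (d + e)"
proof -
  assume "a \<in> G d" "b \<in> G e"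
  then obtain p q where p: "p \<in> free_homogeneous m d" "a = \<phi> p" "q \<in> free_homogeneous m e" "b = \<phi> q"
    unfolding G_def by blast
  have "a * b = \<phi> (p * q)"
    using phi_mult[OF free_homogeneous_alg[OF p(1)] free_homogeneous_alg[OF p(3)]] p by simp
  thus ?thesis unfolding G_def using free_homogeneous_mult[OF p(1,3)] by blast
qed

lemma aug_positive: "a \<in> G (Suc d) \<Longrightarrow> \<epsilon> a = 0"
proof -
  assume "a \<in> G (Suc d)"
  then obtain p where p: "p \<in> free_homogeneous m (Suc d)" "a = \<phi> p" unfolding G_def by blast
  have pe: "p = (\<Sum>v\<in>words m 1. rslice v p * mono v)"
    by (rule sum_rslice[OF free_homogeneous_alg[OF p(1)]])
      (use p(1) in \<open>simp add: free_homogeneous_iff in_keys_iff\<close>)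
  have m1: "(mono v :: 'k free_algebra) \<in> free_homogeneous m 1" if "v \<in> words m 1" for v
    using that free_alg_mono[OF that] by (auto simp: free_homogeneous_iff mono_def lookup_single words_len when_def split: if_splits)
  have ra: "rslice v p \<in> free_alg m" for v by (rule free_alg_slice(2)[OF free_homogeneous_alg[OF p(1)]])
  have "\<phi> p = (\<Sum>v\<in>words m 1. \<phi> (rslice v p) * \<phi> (mono v))"
    by (subst pe, subst phi_sum) (auto intro!: free_alg_mult ra free_homogeneous_alg[OF m1] sum.cong phi_mult)
  thus ?thesis using aug_1[OF m1] by (simp add: p(2) aug_sum aug_mult)
qed

lemma phi_part_zero: "p \<in> free_alg m \<Longrightarrow> \<phi> p = 0 \<Longrightarrow> \<phi> (part d p) = 0"
  using part_ideal[of p d] unfolding I_eq by simp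

text \<open>The kernel of \<open>\<phi>\<close> is homogeneous: a relation between images of
  homogeneous elements lifts to an element of \<open>I\<close>, and each of its parts lies in
  \<open>I\<close> again.\<close>

lemma G_direct:
  assumes "\<And>d. d < M \<Longrightarrow> a d \<in> G d" "(\<Sum>d<M. a d) = 0" "d < M"
  shows "a d = 0"
proof -
  have "\<forall>d. \<exists>p. d < M \<longrightarrow> p \<in> free_homogeneous m d \<and> a d = \<phi> p" using assms(1) unfolding G_def by blast
  then obtain p where p: "\<And>d. d < M \<Longrightarrow> p d \<in> free_homogeneous m d" "\<And>d. d < M \<Longrightarrow> a d = \<phi> (p d)" by metis
  have pa: "p e \<in> free_alg m" if "e < M" for e by (rule free_homogeneous_alg[OF p(1)[OF that]])
  have "\<phi> (\<Sum>d<M. p d) = (\<Sum>d<M. \<phi> (p d))" by (rule phi_sum) (simp add: pa)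
  also have "\<dots> = 0" using assms(2) p(2) by simp
  finally have "\<phi> (\<Sum>d<M. p d) = 0" .
  hence "\<phi> (part d (\<Sum>d<M. p d)) = 0" by (intro phi_part_zero free_alg_sum) (auto intro: pa)
  moreover have "part d (\<Sum>d<M. p d) = (\<Sum>e<M. if e = d then p d else 0)"
    unfolding slice_sum
  proof (intro sum.cong refl)
    fix e assume "e \<in> {..<M}"
    hence "p e \<in> free_homogeneous m e" using p(1) by simp
    thus "part d (p e) = (if e = d then p d else 0)" by (simp add: part_homogeneous)
  qed
  hence "part d (\<Sum>d<M. p d) = p d" using assms(3) by (simp add: sum.delta)
  ultimately show ?thesis using p(2)[OF assms(3)] by simp
qed

section \<open>The Koszul complex and its exactness\<close>

definition kobj :: "nat \<Rightarrow> (nat \<Rightarrow> 'a) set" where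
  "kobj i = {u. \<forall>k. k \<notin> {..<kdim i} \<longrightarrow> u k = 0}"

text \<open>A row vector times the matrix of linear forms; the matrix stands on the right, so the
  map is linear over the left action of \<open>A\<close>.\<close>

definition kbd :: "nat \<Rightarrow> (nat \<Rightarrow> 'a) \<Rightarrow> nat \<Rightarrow> 'a" where
  "kbd i u = (\<lambda>l. if l < kdim i then \<Sum>k<kdim (Suc i). u k * \<phi> (link i k l) else 0)"

definition koszul_resolution :: "('a, 'k, nat \<Rightarrow> 'a) resolution" where
  "koszul_resolution = \<lparr>act = fun_act, obj = kobj, bd = kbd, aug = (\<lambda>u. \<epsilon> (u 0))\<rparr>"

text \<open>The strand of total degree \<open>N\<close>: the generators in position \<open>i\<close>
  have degree \<open>i\<close>. Beyond position \<open>N\<close> the strand is set to zero, since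
  truncated subtraction would otherwise put scalars there.\<close>

definition kgraded :: "nat \<Rightarrow> nat \<Rightarrow> (nat \<Rightarrow> 'a) set" where
  "kgraded N i = {u \<in> kobj i. if i \<le> N then \<forall>k. u k \<in> G (N - i) else u = 0}"

lemma kobj_zero: "u \<in> kobj i \<Longrightarrow> \<not> k < kdim i \<Longrightarrow> u k = 0"
  by (simp add: kobj_def)

lemma kbd_in: "kbd i u \<in> kobj i"
  by (simp add: kbd_def kobj_def)

lemma kbd_add: "kbd i (u + v) = kbd i u + kbd i v"
  by (auto simp: kbd_def distrib_right sum.distrib)

lemma kbd_zero: "kbd i 0 = 0"
  by (auto simp: kbd_def)

lemma kbd_sum: "kbd i (sum f A) = (\<Sum>x\<in>A. kbd i (f x))"
  by (induction A rule: infinite_finite_induct)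
    (simp_all only: kbd_add kbd_zero sum.infinite sum.empty sum.insert not_False_eq_True)

lemma link_G: "k < kdim (Suc i) \<Longrightarrow> \<phi> (link i k l) \<in> G 1"
  unfolding G_def using link_homogeneous by blast

lemma link_alg: "k < kdim (Suc i) \<Longrightarrow> link i k l \<in> free_alg m"
  by (rule free_homogeneous_alg[OF link_homogeneous])

lemma kbd_graded:
  assumes "u \<in> kgraded N (Suc i)"
  shows "kbd i u \<in> kgraded N i"
proof (cases "Suc i \<le> N")
  case True
  have u: "u k \<in> G (N - Suc i)" for k using assms True by (simp add: kgraded_def)
  have "u k * \<phi> (link i k l) \<in> G (N - i)" if "k < kdim (Suc i)" for k l
    using G_mult[OF u link_G[OF that]] True by (simp add: Suc_diff_Suc)
  hence "kbd i u l \<in> G (N - i)" for l unfolding kbd_def by (auto intro!: G_sum G_zero)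
  thus ?thesis using kbd_in True by (simp add: kgraded_def)
next
  case False
  hence "u = 0" using assms by (simp add: kgraded_def)
  thus ?thesis using kbd_zero kbd_in[of i 0] G_zero by (simp add: kgraded_def)
qed

lemma kbd_kbd:
  assumes "w \<in> kobj (Suc (Suc i))"
  shows "kbd i (kbd (Suc i) w) = 0"
proof
  fix l
  have z: "(\<Sum>k<kdim (Suc i). \<phi> (link (Suc i) r k) * \<phi> (link i k l)) = 0" if r: "r < kdim (Suc (Suc i))" for r
  proof -
    have "(\<Sum>k<kdim (Suc i). link (Suc i) r k * link i k l) \<in> I" by (rule link_link[OF r])
    hence "\<phi> (\<Sum>k<kdim (Suc i). link (Suc i) r k * link i k l) = 0" unfolding I_eq by simp
    thus ?thesis
      by (subst (asm) phi_sum) (auto simp: phi_mult link_alg r intro!: free_alg_mult link_alg)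
  qed
  have "(\<Sum>k<kdim (Suc i). kbd (Suc i) w k * \<phi> (link i k l)) =
      (\<Sum>k<kdim (Suc i). \<Sum>r<kdim (Suc (Suc i)). w r * (\<phi> (link (Suc i) r k) * \<phi> (link i k l)))"
    by (intro sum.cong refl) (simp add: kbd_def sum_distrib_right mult.assoc)
  also have "\<dots> = (\<Sum>r<kdim (Suc (Suc i)). w r * (\<Sum>k<kdim (Suc i). \<phi> (link (Suc i) r k) * \<phi> (link i k l)))"
    by (subst sum.swap) (simp add: sum_distrib_left)
  also have "\<dots> = 0" using z by simp
  finally show "kbd i (kbd (Suc i) w) l = 0 l" by (simp add: kbd_def[of i])
qed

lemma graded_lift:
  assumes "\<And>k. u k \<in> G d"
  shows "\<exists>p. (\<forall>k. p k \<in> free_homogeneous m d) \<and> (\<forall>k. u k = \<phi> (p k))"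
proof -
  have "\<forall>k. \<exists>q. q \<in> free_homogeneous m d \<and> u k = \<phi> q" using assms unfolding G_def by blast
  thus ?thesis by metis
qed

text \<open>A tuple of coefficients is encoded as one element of the free algebra, a combination of
  the basis of \<open>W_(i+1)\<close>. The differential then amounts to reading the same element in
  coordinates over \<open>W_i\<close>.\<close>

lemma phi_combination:
  assumes "\<And>k. p k \<in> free_alg m" "l < kdim i"
  shows "\<phi> (coord i l (\<Sum>k<kdim (Suc i). p k * kbasis (Suc i) k)) = kbd i (\<lambda>k. \<phi> (p k)) l"
proof -
  have "coord i l (\<Sum>k<kdim (Suc i). p k * kbasis (Suc i) k) = (\<Sum>k<kdim (Suc i). p k * link i k l)"
    unfolding coord_sum
  proof (intro sum.cong refl)
    fix k assume k: "k \<in> {..<kdim (Suc i)}"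
    have "kbasis (Suc i) k \<in> free_ge m i"
      using kbasis_free_ge[of k "Suc i"] free_ge_anti[of i "Suc i"] k by auto
    thus "coord i l (p k * kbasis (Suc i) k) = p k * link i k l"
      by (simp add: coord_mult link_def[of i])
  qed
  moreover have "\<phi> (\<Sum>k<kdim (Suc i). p k * link i k l) = (\<Sum>k<kdim (Suc i). \<phi> (p k * link i k l))"
    by (rule phi_sum) (simp add: free_alg_mult assms link_alg)
  moreover have "\<dots> = (\<Sum>k<kdim (Suc i). \<phi> (p k) * \<phi> (link i k l))"
    by (intro sum.cong refl phi_mult) (simp_all add: assms link_alg)
  ultimately show ?thesis using assms(2) by (simp add: kbd_def)
qed

text \<open>The cycle \<open>u\<close> is encoded as an element \<open>q\<close> of
  \<open>J N (Suc i)\<close>. The vanishing of its boundary says that the coordinates of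
  \<open>q\<close> over \<open>W_i\<close> lie in \<open>I\<close>, that is, \<open>q\<close> lies
  in \<open>D 0 i\<close>. This is the hypothesis of \<open>J_exact\<close>, whose splitting yields
  the preimage.\<close>

lemma graded_exact:
  assumes u: "u \<in> kgraded N (Suc i)" and u0: "kbd i u = 0"
  shows "\<exists>w\<in>kgraded N (Suc (Suc i)). kbd (Suc i) w = u"
proof (cases "Suc i \<le> N")
  case False
  hence "u = 0" using u by (simp add: kgraded_def)
  moreover have "0 \<in> kgraded N (Suc (Suc i))" using False by (simp add: kgraded_def kobj_def)
  ultimately show ?thesis using kbd_zero by (intro bexI[of _ 0]) auto
next
  case True
  have uo: "u \<in> kobj (Suc i)" and uG: "\<And>k. u k \<in> G (N - Suc i)" using u True by (simp_all add: kgraded_def)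
  obtain p where p: "\<And>k. p k \<in> free_homogeneous m (N - Suc i)" "\<And>k. u k = \<phi> (p k)"
    using graded_lift[of u, OF uG] by blast
  note pa = free_homogeneous_alg[OF p(1)]
  define q where "q = (\<Sum>k<kdim (Suc i). p k * kbasis (Suc i) k)"
  have qJ: "q \<in> J N (Suc i)" and qh: "q \<in> free_homogeneous m N"
    using combination_J[of "Suc i" p N] p True by (simp_all add: q_def)
  have cI: "coord i l q \<in> I" if "l < kdim i" for l
  proof -
    have "u = (\<lambda>k. \<phi> (p k))" using p(2) by blast
    hence "\<phi> (coord i l q) = 0" using phi_combination[OF pa that] u0 by (simp add: q_def)
    thus ?thesis using coord_alg[OF free_homogeneous_alg[OF qh]] by (simp add: I_eq)
  qed
  have qe: "q = (\<Sum>l<kdim i. coord i l q * kbasis i l)"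
    using qJ J_anti True by (intro coord_expand[OF qh]) auto
  have "(\<Sum>l<kdim i. coord i l q * kbasis i l) \<in> D 0 i"
  proof (rule D_sum)
    fix l assume l: "l \<in> {..<kdim i}"
    have "rslice v (coord i l q * kbasis i l) \<in> I" if v: "len v = i" for v
    proof -
      have "rslice v (coord i l q * kbasis i l) = coord i l q * rslice v (kbasis i l)"
        using l by (intro rslice_mult) (auto simp: v dest: free_ge_keys[OF kbasis_free_ge])
      thus ?thesis using ideal_right[OF free_alg_slice(2)[OF free_ge_alg[OF kbasis_free_ge]] cI] l by simp
    qed
    moreover have "coord i l q * kbasis i l \<in> free_ge m (0 + i)"
      using l by (intro free_ge_mult kbasis_free_ge) (auto simp: free_ge_0 intro: coord_alg free_homogeneous_alg[OF qh])
    ultimately show "coord i l q * kbasis i l \<in> D 0 i" by (simp add: D_def slice_zero)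
  qed
  hence qD: "q \<in> D 0 i" using qe by simp
  have up: "u k = \<phi> (coord (Suc i) k q)" if "k < kdim (Suc i)" for k
    using coord_combination[OF that, of p] p(2) by (simp add: q_def)
  show ?thesis
  proof (cases "Suc i = N")
    \<comment> \<open>At the end of the strand the coordinates over \<open>W_i\<close> are linear
      forms, while \<open>I\<close> starts in degree 2; so they vanish.\<close>
    case eq: True
    have "coord i l q = 0" if "l < kdim i" for l
    proof -
      have "coord i l q \<in> free_homogeneous m 1" by (rule coord_homogeneous) (use qh eq in simp)
      moreover have "coord i l q \<in> free_ge m 2" using cI[OF that] ideal_free_ge by blast
      ultimately have "look (coord i l q) w = 0" for w
        unfolding free_homogeneous_iff free_ge_def by fastforce
      thus ?thesis by (intro poly_mapping_eqI) simp
    qed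
    hence "q = 0" using qe by simp
    hence "u k = 0" for k
      using up[of k] kobj_zero[OF uo, of k] by (cases "k < kdim (Suc i)") (simp_all add: coord_def phi_zero)
    hence "u = 0" by auto
    moreover have "0 \<in> kgraded N (Suc (Suc i))" using eq by (simp add: kgraded_def kobj_def)
    ultimately show ?thesis using kbd_zero by (intro bexI[of _ 0]) auto
  next
    case False
    hence N: "Suc i < N" using True by simp
    \<comment> \<open>The coordinates of \<open>w1\<close> over the basis of \<open>W_(i+1)\<close>
      lie in \<open>I\<close> and vanish in \<open>A\<close>, whereas \<open>w2\<close> is a
      combination of the basis of \<open>W_(i+2)\<close>, whose coefficients give the
      preimage.\<close>
    obtain w1 w2 where w: "w1 \<in> free_homogeneous m N" "w2 \<in> free_homogeneous m N" "q = w1 + w2"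
      "w1 \<in> D 0 (Suc i)" "w2 \<in> J N (Suc (Suc i))"
      using J_exact[OF qh qJ qD N] by blast
    define g where "g r = (if r < kdim (Suc (Suc i)) then coord (Suc (Suc i)) r w2 else 0)" for r
    have gh: "g r \<in> free_homogeneous m (N - Suc (Suc i))" for r
    proof -
      have eqN: "N - Suc (Suc i) + Suc (Suc i) = N" using N by simp
      have "w2 \<in> free_homogeneous m (N - Suc (Suc i) + Suc (Suc i))" unfolding eqN by (rule w(2))
      from coord_homogeneous[OF this] show ?thesis by (simp add: g_def free_homogeneous_zero)
    qed
    have w2e: "w2 = (\<Sum>r<kdim (Suc (Suc i)). g r * kbasis (Suc (Suc i)) r)"
      using coord_expand[OF w(2,5)] N by (simp add: g_def)
    have "u = kbd (Suc i) (\<lambda>r. \<phi> (g r))"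
    proof
      fix k
      show "u k = kbd (Suc i) (\<lambda>r. \<phi> (g r)) k"
      proof (cases "k < kdim (Suc i)")
        case k: True
        have "\<phi> (coord (Suc i) k q) = \<phi> (coord (Suc i) k w1) + \<phi> (coord (Suc i) k w2)"
          unfolding w(3) coord_add
          by (intro phi_add coord_alg free_homogeneous_alg[OF w(1)] free_homogeneous_alg[OF w(2)])
        also have "\<phi> (coord (Suc i) k w1) = 0" using coord_ideal[OF w(4)] unfolding I_eq by blast
        also have "\<phi> (coord (Suc i) k w2) = kbd (Suc i) (\<lambda>r. \<phi> (g r)) k"
          using phi_combination[OF free_homogeneous_alg[OF gh] k] w2e by simp
        finally show ?thesis using up[OF k] by simp
      qed (use kobj_zero[OF uo] in \<open>simp add: kbd_def\<close>)
    qed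
    moreover have "(\<lambda>r. \<phi> (g r)) \<in> kgraded N (Suc (Suc i))"
      using N gh by (auto simp: kgraded_def kobj_def G_def) (simp add: g_def phi_zero)
    ultimately show ?thesis by blast
  qed
qed

text \<open>As \<open>J (Suc d) 1\<close> imposes no relation, every polynomial of positive degree
  is a combination of the basis in position 1.\<close>

lemma graded_exact_0:
  assumes u: "u \<in> kgraded (Suc d) 0"
  shows "\<exists>w\<in>kgraded (Suc d) 1. kbd 0 w = u"
proof -
  have uo: "u \<in> kobj 0" and uG: "\<And>k. u k \<in> G (Suc d)" using u by (simp_all add: kgraded_def)
  obtain p where p: "\<And>k. p k \<in> free_homogeneous m (Suc d)" "\<And>k. u k = \<phi> (p k)"
    using graded_lift[of u, OF uG] by blast
  define q where "q = (\<Sum>k<kdim 0. p k * kbasis 0 k)"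
  have qh: "q \<in> free_homogeneous m (Suc d)"
    using combination_J[of 0 p "Suc d"] p by (simp add: q_def)
  have qJ: "q \<in> J (Suc d) 1" using free_homogeneous_alg[OF qh] J_small by simp
  define g where "g r = (if r < kdim 1 then coord 1 r q else 0)" for r
  have gh: "g r \<in> free_homogeneous m d" for r
    unfolding g_def using coord_homogeneous[of q d 1 r] qh by (simp add: free_homogeneous_zero)
  have qe: "q = (\<Sum>r<kdim (Suc 0). g r * kbasis (Suc 0) r)"
    using coord_expand[OF qh qJ] by (simp add: g_def)
  have "u = kbd 0 (\<lambda>r. \<phi> (g r))"
  proof
    fix k
    show "u k = kbd 0 (\<lambda>r. \<phi> (g r)) k"
    proof (cases "k < kdim 0")
      case True
      have "\<phi> (coord 0 k (\<Sum>r<kdim (Suc 0). g r * kbasis (Suc 0) r)) = kbd 0 (\<lambda>r. \<phi> (g r)) k"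
        by (rule phi_combination[OF free_homogeneous_alg[OF gh] True])
      hence "\<phi> (coord 0 k q) = kbd 0 (\<lambda>r. \<phi> (g r)) k" using qe by simp
      thus ?thesis using coord_combination[OF True, of p] p(2) by (simp add: q_def)
    qed (use kobj_zero[OF uo] in \<open>simp add: kbd_def\<close>)
  qed
  moreover have "(\<lambda>r. \<phi> (g r)) \<in> kgraded (Suc d) 1"
    using gh by (auto simp: kgraded_def kobj_def G_def) (simp add: g_def phi_zero)
  ultimately show ?thesis by blast
qed

lemma kobj_decompose:
  assumes u: "u \<in> kobj i"
  shows "\<exists>M f. (\<forall>d. f d \<in> kgraded (d + i) i) \<and> u = (\<Sum>d<(M::nat). f d)"
proof -
  have "\<forall>k. \<exists>p. p \<in> free_alg m \<and> \<phi> p = u k" using phi_surj by blast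
  then obtain p0 where p0: "\<And>k. p0 k \<in> free_alg m" "\<And>k. \<phi> (p0 k) = u k" by metis
  define p where "p k = (if k < kdim i then p0 k else 0)" for k
  have p: "p k \<in> free_alg m" "\<phi> (p k) = u k" for k
    using p0 kobj_zero[OF u] by (auto simp: p_def free_alg_zero phi_zero)
  have "\<exists>M. p k = (\<Sum>d<M. part d (p k))" for k using sum_part[of "p k"] by metis
  then obtain M0 where M0: "\<And>k. p k = (\<Sum>d<M0 k. part d (p k))" by metis
  \<comment> \<open>Inserting 0 keeps the maximum defined when position \<open>i\<close> has no
    generators.\<close>
  define M where "M = Max (insert 0 (M0 ` {..<kdim i}))"
  have pM: "p k = (\<Sum>d<M. part d (p k))" for k
  proof (cases "k < kdim i")
    case True
    have le: "M0 k \<le> M" unfolding M_def using True by (intro Max_ge) auto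
    have "part d (p k) = 0" if "M0 k \<le> d" for d
    proof -
      have "part d (p k) = part d (\<Sum>e<M0 k. part e (p k))" using M0[of k] by simp
      also have "\<dots> = (\<Sum>e<M0 k. 0)"
        unfolding slice_sum using that
        by (intro sum.cong refl) (simp add: part_homogeneous[OF part_in_homogeneous[OF p(1)]])
      finally show ?thesis by simp
    qed
    hence "(\<Sum>d<M0 k. part d (p k)) = (\<Sum>d<M. part d (p k))"
      using le by (intro sum.mono_neutral_left) auto
    thus ?thesis using M0[of k] by simp
  next
    case False
    thus ?thesis by (simp add: p_def)
  qed
  define f where "f d k = \<phi> (part d (p k))" for d k
  show ?thesis
  proof (intro exI conjI allI)
    show "f d \<in> kgraded (d + i) i" for d
      using part_in_homogeneous[OF p(1)] by (auto simp: kgraded_def kobj_def f_def G_def p_def phi_zero)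
    show "u = (\<Sum>d<M. f d)"
    proof
      fix k
      have "u k = \<phi> (\<Sum>d<M. part d (p k))" using p(2)[of k] pM[of k] by simp
      also have "\<dots> = (\<Sum>d<M. f d k)" unfolding f_def by (rule phi_sum) (rule free_alg_slice(3)[OF p(1)])
      finally show "u k = (\<Sum>d<M. f d) k" by (simp add: sum_fun_apply)
    qed
  qed
qed

text \<open>The differential preserves total degree and \<open>A\<close> is the direct sum of its
  pieces, so a cycle is a sum of homogeneous cycles, to which \<open>graded_exact\<close>
  applies.\<close>

lemma full_exact:
  assumes u: "u \<in> kobj (Suc i)" and u0: "kbd i u = 0"
  shows "\<exists>w\<in>kobj (Suc (Suc i)). kbd (Suc i) w = u"
proof -
  obtain M f where f: "\<And>d. f d \<in> kgraded (d + Suc i) (Suc i)" "u = (\<Sum>d<(M::nat). f d)"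
    using kobj_decompose[OF u] by blast 
  have fz: "kbd i (f d) = 0" if d: "d < M" for d
  proof
    fix l
    \<comment> \<open>The entries of the boundary of \<open>f d\<close> have degree
      \<open>d + 1\<close>; the shift puts them into the piece that \<open>G_direct\<close>
      expects.\<close>
    define a where "a e = (if e = 0 then 0 else kbd i (f (e - 1)) l)" for e
    have aG: "a e \<in> G e" for e
    proof (cases e)
      case (Suc e')
      thus ?thesis using kbd_graded[OF f(1)[of e']] by (simp add: a_def kgraded_def)
    qed (simp add: a_def G_zero)
    have "(\<Sum>e<Suc M. a e) = (\<Sum>d<M. kbd i (f d) l)"
      by (subst sum.lessThan_Suc_shift) (simp add: a_def)
    also have "\<dots> = kbd i u l" unfolding f(2) kbd_sum by (simp add: sum_fun_apply)
    also have "\<dots> = 0" by (simp add: u0)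
    finally have "a (Suc d) = 0" using d by (intro G_direct[of "Suc M" a]) (simp_all add: aG)
    thus "kbd i (f d) l = 0 l" by (simp add: a_def)
  qed
  have "\<forall>d. \<exists>w. d < M \<longrightarrow> w \<in> kgraded (d + Suc i) (Suc (Suc i)) \<and> kbd (Suc i) w = f d"
    using graded_exact[OF f(1) fz] by blast
  then obtain w where w: "\<And>d. d < M \<Longrightarrow> w d \<in> kgraded (d + Suc i) (Suc (Suc i))" "\<And>d. d < M \<Longrightarrow> kbd (Suc i) (w d) = f d"
    by metis
  have "kbd (Suc i) (\<Sum>d<M. w d) = u" unfolding kbd_sum f(2) using w(2) by simp
  moreover have "(\<Sum>d<M. w d) \<in> kobj (Suc (Suc i))"
    using w(1) by (auto simp: kobj_def kgraded_def sum_fun_apply)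
  ultimately show ?thesis by blast
qed

lemma full_exact_0:
  assumes u: "u \<in> kobj 0" and u0: "\<epsilon> (u 0) = 0"
  shows "\<exists>w\<in>kobj 1. kbd 0 w = u"
proof -
  obtain M f where f: "\<And>d. f d \<in> kgraded (d + 0) 0" "u = (\<Sum>d<(M::nat). f d)"
    using kobj_decompose[OF u] by blast
  have fG: "f d k \<in> G d" for d k using f(1)[of d] by (simp add: kgraded_def)
  \<comment> \<open>Positive degrees lie in the kernel of \<open>\<epsilon>\<close> anyway, so the
    hypothesis on \<open>u\<close> says that its part of degree 0, a scalar, is zero.\<close>
  have f0: "f 0 = 0" if "0 < M"
  proof -
    have "\<epsilon> (u 0) = (\<Sum>d<M. \<epsilon> (f d 0))" unfolding f(2) by (simp add: sum_fun_apply aug_sum)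
    also have "\<dots> = (\<Sum>d\<in>{0}. \<epsilon> (f d 0))"
    proof (rule sum.mono_neutral_right)
      show "\<forall>d\<in>{..<M} - {0}. \<epsilon> (f d 0) = 0"
      proof
        fix d assume "d \<in> {..<M} - {0}"
        then obtain e where "d = Suc e" by (cases d) auto
        thus "\<epsilon> (f d 0) = 0" using aug_positive fG[of d 0] by simp
      qed
    qed (use that in auto)
    finally have e: "\<epsilon> (f 0 0) = 0" using u0 by simp
    obtain p where p: "p \<in> free_homogeneous m 0" "f 0 0 = \<phi> p" using fG[of 0 0] unfolding G_def by blast
    have "p = free_scalar (look p 0)"
      using p(1) by (intro poly_mapping_eqI) (auto simp: free_homogeneous_iff free_scalar_def lookup_single when_def)
    hence "f 0 0 = \<iota> (look p 0)" using p(2) phi_scalar by metis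
    hence "f 0 0 = 0" using e aug_iota iota_zero by simp
    moreover have "f 0 k = 0" if "k \<noteq> 0" for k
      using f(1)[of 0] that by (simp add: kgraded_def kobj_def kdim_0)
    ultimately have "f 0 k = 0" for k by (cases "k = 0") simp_all
    thus ?thesis by auto
  qed
  have "\<exists>w. d < M \<longrightarrow> w \<in> kobj 1 \<and> kbd 0 w = f d" for d
  proof (cases d)
    case 0
    thus ?thesis using f0 kbd_zero by (intro exI[of _ 0]) (simp add: kobj_def)
  next
    case (Suc e)
    thus ?thesis using graded_exact_0[of "f d" e] f(1)[of d] by (auto simp: kgraded_def)
  qed
  then obtain w where w: "\<And>d. d < M \<Longrightarrow> w d \<in> kobj 1" "\<And>d. d < M \<Longrightarrow> kbd 0 (w d) = f d" by metis
  have "kbd 0 (\<Sum>d<M. w d) = u" unfolding kbd_sum f(2) using w(2) by simp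
  moreover have "(\<Sum>d<M. w d) \<in> kobj 1"
    using w(1) by (auto simp: kobj_def sum_fun_apply)
  ultimately show ?thesis by blast
qed

text \<open>This is minimality of the Koszul complex: the matrix entries are linear forms, which the
  augmentation kills.\<close>

lemma aug_kbd: "\<epsilon> (kbd i u l) = 0"
proof -
  have "\<epsilon> (\<phi> (link i k l)) = 0" if "k < kdim (Suc i)" for k by (rule aug_1[OF link_homogeneous[OF that]])
  thus ?thesis by (simp add: kbd_def aug_sum aug_mult aug_zero)
qed

lemma koszul_free_resolution: "free_resolution \<epsilon> koszul_resolution"
proof -
  have kfree: "free_submodule fun_act (kobj i)" for i
    unfolding kobj_def by (rule free_submodule_fun) simp
  have lin: "linear_on fun_act (kobj (Suc i)) fun_act (kbd i)" for i
    unfolding linear_on_def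
    by (auto simp: kbd_add) (auto simp: kbd_def fun_act_def sum_distrib_left mult.assoc)
  have laug: "linear_on fun_act (kobj 0) (trivial_act \<epsilon>) (\<lambda>u. \<epsilon> (u 0))"
    unfolding linear_on_def by (simp add: aug_add aug_mult fun_act_def trivial_act_def)
  have surj: "(\<lambda>u. \<epsilon> (u 0)) ` kobj 0 = UNIV"
  proof -
    have "c \<in> (\<lambda>u. \<epsilon> (u 0)) ` kobj 0" for c
      by (rule image_eqI[of _ _ "\<lambda>k. if k = 0 then \<iota> c else 0"]) (auto simp: aug_iota kobj_def kdim_0)
    thus ?thesis by blast
  qed
  have ex0: "kbd 0 ` kobj (Suc 0) = {u \<in> kobj 0. \<epsilon> (u 0) = 0}"
    using full_exact_0 kbd_in aug_kbd by fastforce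
  have ex: "kbd (Suc i) ` kobj (Suc (Suc i)) = {u \<in> kobj (Suc i). kbd i u = 0}" for i
  proof (rule subset_antisym)
    show "kbd (Suc i) ` kobj (Suc (Suc i)) \<subseteq> {u \<in> kobj (Suc i). kbd i u = 0}"
      using kbd_in kbd_kbd by blast
    show "{u \<in> kobj (Suc i). kbd i u = 0} \<subseteq> kbd (Suc i) ` kobj (Suc (Suc i))"
      using full_exact by blast
  qed
  show ?thesis
    unfolding free_resolution_def koszul_resolution_def
    using left_module_fun_act kfree lin laug surj ex0 ex by simp
qed

sublocale K: aug_resolution \<epsilon> koszul_resolution
  by unfold_locales (rule koszul_free_resolution)

lemma koszul_simps:
  "obj koszul_resolution = kobj" "bd koszul_resolution = kbd" "act koszul_resolution = fun_act"
  by (simp_all add: koszul_resolution_def)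

lemma unit_fun_kobj: "k < kdim i \<Longrightarrow> unit_fun k \<in> kobj i"
  by (auto simp: unit_fun_def kobj_def)

lemma koszul_cochain_eval:
  assumes f: "f \<in> K.cochain i" and u: "u \<in> kobj i"
  shows "f u = (\<Sum>k<kdim i. \<epsilon> (u k) * f (unit_fun k))"
proof -
  have lin: "linear_on fun_act (kobj i) (trivial_act \<epsilon>) f"
    using f unfolding K.cochain_iff koszul_simps by blast
  have sub: "submodule_on fun_act (kobj i)" using K.res_sub[of i] unfolding koszul_simps .
  have mem: "fun_act (u k) (unit_fun k) \<in> kobj i" if "k \<in> {..<kdim i}" for k
    using that by (intro submodule_onD(3)[OF sub] unit_fun_kobj) simp
  have ue: "(\<Sum>k<kdim i. fun_act (u k) (unit_fun k)) = u"
    by (rule sum_unit_fun) (use u in \<open>auto simp: kobj_def\<close>)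
  have "f u = f (\<Sum>k<kdim i. fun_act (u k) (unit_fun k))" by (simp only: ue)
  also have "\<dots> = (\<Sum>k<kdim i. f (fun_act (u k) (unit_fun k)))" by (rule linear_on_sum[OF lin sub mem])
  also have "\<dots> = (\<Sum>k<kdim i. \<epsilon> (u k) * f (unit_fun k))"
    using linear_on_act[OF lin unit_fun_kobj] by (intro sum.cong refl) (simp add: trivial_act_def)
  finally show ?thesis .
qed

text \<open>The Koszul complex is minimal with \<open>kdim i\<close> generators in position
  \<open>i\<close>, so \<open>Ext_dim_minimal\<close> applies to any resolution \<open>Q\<close>.
  The last conclusion transfers information backwards: a resolution that is zero in position
  \<open>i\<close> forces \<open>W_i\<close> to be zero.\<close>

theorem Ext_koszul:
  assumes Q: "aug_resolution \<epsilon> Q"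
  shows "vectorspace.fin_dim class_ring (Ext \<epsilon> Q i)" "vectorspace.dim class_ring (Ext \<epsilon> Q i) = kdim i"
    "kdim i = 0 \<Longrightarrow> cocycles \<epsilon> Q i \<subseteq> coboundaries \<epsilon> Q i"
    "obj Q i = {0} \<Longrightarrow> kdim i = 0"
proof -
  interpret Q: aug_resolution \<epsilon> Q by (rule Q)
  interpret KQ: resolution_pair \<epsilon> koszul_resolution Q ..
  have minimal: "f (bd koszul_resolution i u) = 0"
    if "f \<in> K.cochain i" "u \<in> obj koszul_resolution (Suc i)" for f i u
    unfolding koszul_simps koszul_cochain_eval[OF that(1) kbd_in] by (simp add: aug_kbd)
  have uniq: "f = 0" if f: "f \<in> K.cochain i" and 0: "\<And>k. k < kdim i \<Longrightarrow> f (unit_fun k) = 0" for f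
  proof
    fix u
    show "f u = 0 u"
    proof (cases "u \<in> kobj i")
      case True
      thus ?thesis unfolding koszul_cochain_eval[OF f True] using 0 by simp
    next
      case False
      thus ?thesis using f unfolding K.cochain_iff koszul_simps by simp
    qed
  qed
  have ex: "\<exists>f\<in>K.cochain i. \<forall>k<kdim i. f (unit_fun k) = c k" for c :: "nat \<Rightarrow> 'k"
  proof -
    define f where "f u = (\<Sum>k<kdim i. \<epsilon> (u k) * c k)" for u
    have "linear_on fun_act (kobj i) (trivial_act \<epsilon>) f"
      unfolding linear_on_def f_def
      by (simp add: aug_add aug_mult fun_act_def trivial_act_def distrib_right sum.distrib sum_distrib_left mult.assoc)
    hence fc: "extend_zero (kobj i) f \<in> K.cochain i"
      using K.cochain_extend_zero[of i f] unfolding koszul_simps by blast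
    have "f (unit_fun k) = c k" if "k < kdim i" for k
    proof -
      have "f (unit_fun k) = (\<Sum>l<kdim i. if l = k then c k else 0)"
        unfolding f_def by (intro sum.cong refl) (simp add: unit_fun_def aug_one aug_zero)
      thus ?thesis using that by (simp add: sum.delta)
    qed
    hence "\<forall>k<kdim i. extend_zero (kobj i) f (unit_fun k) = c k"
      using unit_fun_kobj by (simp add: extend_zero_def)
    thus ?thesis using fc by blast
  qed
  have e: "k < kdim i \<Longrightarrow> unit_fun k \<in> obj koszul_resolution i" for k
    unfolding koszul_simps by (rule unit_fun_kobj)
  show fd: "vectorspace.fin_dim class_ring (Ext \<epsilon> Q i)"
    by (rule KQ.Ext_dim_minimal(1)[where e=unit_fun and r="kdim i" and i=i])
      ((rule minimal, assumption, assumption) | (rule e, assumption) | rule ex | (rule uniq, assumption, simp))+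
  show dim: "vectorspace.dim class_ring (Ext \<epsilon> Q i) = kdim i"
    by (rule KQ.Ext_dim_minimal(2)[where e=unit_fun and r="kdim i" and i=i])
      ((rule minimal, assumption, assumption) | (rule e, assumption) | rule ex | (rule uniq, assumption, simp))+
  show "cocycles \<epsilon> Q i \<subseteq> coboundaries \<epsilon> Q i" if "kdim i = 0"
    by (rule KQ.Ext_dim_minimal(3)[where e=unit_fun and r="kdim i" and i=i])
      ((rule minimal, assumption, assumption) | (rule e, assumption) | rule ex | (rule uniq, assumption, simp) | rule that)+
  assume Q0: "obj Q i = {0}"
  have "z = 0" if "z \<in> Q.cochain i" for z
  proof
    fix u
    have "z 0 = 0" using that linear_on_zero[OF _ Q.res_sub] unfolding Q.cochain_iff by blast
    thus "z u = 0 u" using that Q0 unfolding Q.cochain_iff by (cases "u = 0") auto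
  qed
  note z0 = this
  have "Q.cocycle i \<subseteq> Q.cob i"
  proof
    fix z assume "z \<in> Q.cocycle i"
    hence "z = 0" using z0 unfolding Q.cocycle_iff by blast
    thus "z \<in> Q.cob i" using Q.cob_zero by simp
  qed
  hence "carrier (Ext \<epsilon> Q i) \<subseteq> {\<zero>\<^bsub>Ext \<epsilon> Q i\<^esub>}"
    unfolding Q.carrier_Ext Q.zero_Ext using Q.cls_cob Q.cob_zero by fastforce
  note sub0 = this
  interpret E: vectorspace class_ring "Ext \<epsilon> Q i" by (rule Q.Ext_vectorspace)
  have "E.span {} = carrier (Ext \<epsilon> Q i)"
    using sub0 E.span_is_subset2[of "{}"] E.span_is_submodule[of "{}"] unfolding submodule_def by auto
  hence "E.dim \<le> 0"
    unfolding E.dim_def by (intro Least_le exI[of _ "{}"]) auto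
  thus "kdim i = 0" using dim by simp
qed

end

subsection \<open>The Hilbert series of a Koszul algebra\<close>

text \<open>A basis of the kernel inside \<open>C\<close> is extended to a basis of
  \<open>C\<close>; \<open>f\<close> is injective on the span of the added vectors, so their images
  form a basis of the image.\<close>

lemma (in vector_space_pair) dim_image_kernel:
  assumes lin: "Vector_Spaces.linear s1 s2 f" and sub: "vs1.subspace C"
    and fin: "finite B0" "C \<subseteq> vs1.span B0"
  shows "vs1.dim C = vs2.dim (f ` C) + vs1.dim {x \<in> C. f x = 0}"
proof -
  define K where "K = {x \<in> C. f x = 0}"
  obtain B1 where B1: "B1 \<subseteq> K" "vs1.independent B1" "K \<subseteq> vs1.span B1"
    by (rule vs1.maximal_independent_subset)
  have "B1 \<subseteq> C" using B1(1) by (auto simp: K_def)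
  then obtain B where B: "B1 \<subseteq> B" "B \<subseteq> C" "vs1.independent B" "C \<subseteq> vs1.span B"
    by (rule vs1.maximal_independent_subset_extend[OF _ B1(2)])
  have finB: "finite B" using vs1.independent_span_bound[OF fin(1) B(3)] B(2) fin(2) by auto
  define B2 where "B2 = B - B1"
  have fin12: "finite B1" "finite B2" using finB B(1) finite_subset by (auto simp: B2_def)
  have B2i: "vs1.independent B2" by (rule vs1.independent_mono[OF B(3)]) (simp add: B2_def)
  have B2C: "vs1.span B2 \<subseteq> C" using B(2) sub by (intro vs1.span_minimal) (auto simp: B2_def)
  have zero: "z = 0" if z: "z \<in> vs1.span B1" "z \<in> vs1.span B2" for z
  proof -
    obtain u where u: "z = (\<Sum>v\<in>B1. s1 (u v) v)" using z(1) vs1.span_finite[OF fin12(1)] by auto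
    obtain v where v: "z = (\<Sum>x\<in>B2. s1 (v x) x)" using z(2) vs1.span_finite[OF fin12(2)] by auto
    define c where "c b = (if b \<in> B1 then u b else - v b)" for b
    have "(\<Sum>b\<in>B1 \<union> B2. s1 (c b) b) = (\<Sum>b\<in>B1. s1 (c b) b) + (\<Sum>b\<in>B2. s1 (c b) b)"
      by (rule sum.union_disjoint) (use fin12 in \<open>auto simp: B2_def\<close>)
    also have "(\<Sum>b\<in>B1. s1 (c b) b) = z" by (simp add: u c_def)
    also have "(\<Sum>b\<in>B2. s1 (c b) b) = - z"
      unfolding v sum_negf[symmetric] by (intro sum.cong refl) (auto simp: c_def B2_def)
    finally have s: "(\<Sum>b\<in>B1 \<union> B2. s1 (c b) b) = 0" by simp
    have "c b = 0" if "b \<in> B1 \<union> B2" for b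
      by (rule vs1.independentD[OF B(3) _ _ s that]) (use fin12 B(1) in \<open>auto simp: B2_def\<close>)
    hence "u b = 0" if "b \<in> B1" for b using that by (force simp: c_def)
    thus ?thesis by (simp add: u)
  qed
  have inj: "inj_on f (vs1.span B2)"
  proof (rule inj_onI)
    fix x y assume xy: "x \<in> vs1.span B2" "y \<in> vs1.span B2" "f x = f y"
    have d: "x - y \<in> vs1.span B2" by (rule vs1.span_diff[OF xy(1,2)])
    moreover have "f (x - y) = 0" using xy(3) by (simp add: linear_diff[OF lin])
    ultimately have "x - y \<in> vs1.span B1" using B1(3) B2C by (auto simp: K_def)
    thus "x = y" using zero[OF _ d] by simp
  qed
  have fi: "vs2.independent (f ` B2)"
    by (rule linear_independent_injective_image[OF lin B2i inj])
  have "f ` C \<subseteq> vs2.span (f ` B2)"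
  proof
    fix y assume "y \<in> f ` C"
    then obtain x where x: "x \<in> C" "y = f x" by auto
    then obtain u where u: "x = (\<Sum>b\<in>B. s1 (u b) b)" using B(4) vs1.span_finite[OF finB] by auto
    have "y = (\<Sum>b\<in>B. s2 (u b) (f b))"
      unfolding x(2) u by (simp only: linear_sum[OF lin] linear_scale[OF lin])
    also have "\<dots> = (\<Sum>b\<in>B2. s2 (u b) (f b))"
    proof (rule sum.mono_neutral_right[OF finB])
      show "\<forall>b\<in>B - B2. s2 (u b) (f b) = 0"
      proof
        fix b assume "b \<in> B - B2"
        hence "b \<in> K" using B1(1) by (auto simp: B2_def)
        thus "s2 (u b) (f b) = 0" by (simp add: K_def)
      qed
    qed (auto simp: B2_def)
    also have "\<dots> \<in> vs2.span (f ` B2)"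
      by (intro vs2.span_sum vs2.span_scale vs2.span_base imageI)
    finally show "y \<in> vs2.span (f ` B2)" .
  qed
  moreover have "f ` B2 \<subseteq> f ` C" using B(2) by (auto simp: B2_def)
  moreover have "card (f ` B2) = card B2"
    by (rule card_image) (rule inj_on_subset[OF inj vs1.span_superset])
  ultimately have "vs2.dim (f ` C) = card B2" using fi by (intro vs2.dim_unique[of "f ` B2"]) auto
  moreover have "vs1.dim K = card B1" using B1 by (intro vs1.dim_unique[of B1]) auto
  moreover have "vs1.dim C = card B" using B by (intro vs1.dim_unique[of B]) auto
  moreover have "card B = card B2 + card B1"
  proof -
    have "B = B2 \<union> B1" using B(1) by (auto simp: B2_def)
    hence "card B = card (B2 \<union> B1)" by simp
    also have "\<dots> = card B2 + card B1" by (rule card_Un_disjoint) (use fin12 in \<open>auto simp: B2_def\<close>)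
    finally show ?thesis .
  qed
  ultimately show ?thesis by (simp add: K_def)
qed

context koszul_presentation
begin

definition scale_alg :: "'k \<Rightarrow> 'a \<Rightarrow> 'a" where "scale_alg c a = \<iota> c * a"
definition scale_fun :: "'k \<Rightarrow> (nat \<Rightarrow> 'a) \<Rightarrow> nat \<Rightarrow> 'a" where "scale_fun c u = (\<lambda>k. \<iota> c * u k)"

sublocale VA: vector_space scale_alg
  by standard (simp_all add: scale_alg_def iota_add iota_mult iota_one algebra_simps)

sublocale VF: vector_space scale_fun
  by standard (auto simp: scale_fun_def iota_add iota_mult iota_one algebra_simps)

definition hdim :: "nat \<Rightarrow> nat" where "hdim d = VA.dim (G d)"

definition gspace :: "nat \<Rightarrow> nat \<Rightarrow> (nat \<Rightarrow> 'a) set" where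
  "gspace j d = {u. \<forall>k. if k < j then u k \<in> G d else u k = 0}"

lemma G_span: "G d \<subseteq> VA.span ((\<lambda>v. \<phi> (mono v)) ` words m d)"
proof
  fix a assume "a \<in> G d"
  then obtain p where p: "p \<in> free_homogeneous m d" "a = \<phi> p" unfolding G_def by blast
  have "a = \<phi> (\<Sum>v\<in>words m d. free_scalar (look p v) * mono v)"
    using homogeneous_expand[OF p(1)] p(2) by simp
  also have "\<dots> = (\<Sum>v\<in>words m d. \<phi> (free_scalar (look p v) * mono v))"
    by (rule phi_sum) (intro free_alg_mult free_alg_scalar free_alg_mono)
  also have "\<dots> = (\<Sum>v\<in>words m d. scale_alg (look p v) (\<phi> (mono v)))"
    by (intro sum.cong refl) (simp add: phi_mult free_alg_scalar free_alg_mono phi_scalar scale_alg_def)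
  also have "\<dots> \<in> VA.span ((\<lambda>v. \<phi> (mono v)) ` words m d)"
    by (intro VA.span_sum VA.span_scale VA.span_base imageI)
  finally show "a \<in> VA.span ((\<lambda>v. \<phi> (mono v)) ` words m d)" .
qed

lemma gspace_subspace: "VF.subspace (gspace j d)"
  unfolding VF.subspace_def gspace_def scale_fun_def using G_zero G_add G_scale by auto

lemma gspace_Suc_span:
  assumes "finite B" "gspace j d \<subseteq> VF.span B"
  shows "\<exists>B'. finite B' \<and> gspace (Suc j) d \<subseteq> VF.span B'"
proof -
  let ?e = "\<lambda>a k. if k = j then a else (0::'a)"
  let ?W = "(\<lambda>v. \<phi> (mono v)) ` words m d"
  let ?B = "B \<union> ?e ` ?W"
  interpret AF: vector_space_pair scale_alg scale_fun ..
  have lin: "Vector_Spaces.linear scale_alg scale_fun ?e"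
    using VA.vector_space_axioms VF.vector_space_axioms
    by (auto simp: Vector_Spaces.linear_iff scale_alg_def scale_fun_def)
  have e: "?e a \<in> VF.span ?B" if "a \<in> G d" for a
  proof -
    have "?e a \<in> ?e ` VA.span ?W" using that G_span by blast
    also have "\<dots> = VF.span (?e ` ?W)" by (rule AF.linear_span_image[OF lin, symmetric])
    also have "\<dots> \<subseteq> VF.span ?B" by (rule VF.span_mono) simp
    finally show ?thesis .
  qed
  have "gspace (Suc j) d \<subseteq> VF.span ?B"
  proof
    fix u assume u: "u \<in> gspace (Suc j) d"
    define v where "v k = (if k < j then u k else 0)" for k
    have "u l = (v + ?e (u j)) l" for l
      using u[unfolded gspace_def, THEN CollectD, THEN spec[of _ l]]
      by (cases "l < j"; cases "l = j") (simp_all add: v_def)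
    hence uv: "u = v + ?e (u j)" by (rule ext)
    have "v \<in> gspace j d"
      unfolding gspace_def
    proof (intro CollectI allI)
      fix k show "if k < j then v k \<in> G d else v k = 0"
        using u[unfolded gspace_def, THEN CollectD, THEN spec[of _ k]] by (auto simp: v_def split: if_splits)
    qed
    hence "v \<in> VF.span ?B" using assms(2) VF.span_mono[of B ?B] by blast
    moreover have "u j \<in> G d" using u[unfolded gspace_def, THEN CollectD, THEN spec[of _ j]] by simp
    ultimately have "v + ?e (u j) \<in> VF.span ?B" using e by (intro VF.span_add) auto
    thus "u \<in> VF.span ?B" using uv by simp
  qed
  moreover have "finite ?B" using assms(1) finite_words by blast
  ultimately show ?thesis by blast
qed

lemma gspace_span: "\<exists>B. finite B \<and> gspace j d \<subseteq> VF.span B"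
proof (induction j)
  case 0
  have "gspace 0 d \<subseteq> VF.span {}" by (auto simp: gspace_def fun_eq_iff)
  thus ?case by blast
next
  case (Suc j)
  thus ?case using gspace_Suc_span by blast
qed

lemma dim_zero_space: "VF.dim {0} = 0"
  by (rule VF.dim_unique[of "{}"]) (auto simp: VF.independent_empty)

lemma gspace_dim: "VF.dim (gspace j d) = j * hdim d"
proof (induction j)
  case 0
  have "gspace 0 d = {0}" by (auto simp: gspace_def fun_eq_iff)
  thus ?case using dim_zero_space by simp
next
  case (Suc j)
  interpret FA: vector_space_pair scale_fun scale_alg ..
  let ?f = "\<lambda>u :: nat \<Rightarrow> 'a. u j"
  have lin: "Vector_Spaces.linear scale_fun scale_alg ?f"
    using VA.vector_space_axioms VF.vector_space_axioms
    by (auto simp: Vector_Spaces.linear_iff scale_alg_def scale_fun_def)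
  obtain B where B: "finite B" "gspace (Suc j) d \<subseteq> VF.span B" using gspace_span by blast
  have "?f ` gspace (Suc j) d = G d"
  proof (rule subset_antisym)
    show "?f ` gspace (Suc j) d \<subseteq> G d"
    proof
      fix a assume "a \<in> ?f ` gspace (Suc j) d"
      then obtain u where u: "u \<in> gspace (Suc j) d" "a = u j" by blast
      thus "a \<in> G d" using u(1)[unfolded gspace_def, THEN CollectD, THEN spec[of _ j]] by simp
    qed
    show "G d \<subseteq> ?f ` gspace (Suc j) d"
    proof
      fix a assume "a \<in> G d"
      thus "a \<in> ?f ` gspace (Suc j) d"
        using G_zero by (intro image_eqI[of _ _ "\<lambda>k. if k = j then a else 0"]) (auto simp: gspace_def)
    qed
  qed
  moreover have "{u \<in> gspace (Suc j) d. ?f u = 0} = gspace j d"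
  proof (rule Set.set_eqI)
    fix u
    have "(\<forall>k. if k < Suc j then u k \<in> G d else u k = 0) \<and> u j = 0 \<longleftrightarrow> (\<forall>k. if k < j then u k \<in> G d else u k = 0)"
      (is "?l \<and> _ \<longleftrightarrow> ?r")
    proof
      assume l: "?l \<and> u j = 0"
      show ?r
      proof
        fix k show "if k < j then u k \<in> G d else u k = 0"
          using l[THEN conjunct1, THEN spec[of _ k]] l[THEN conjunct2] by (cases "k = j"; cases "k < j") simp_all
      qed
    next
      assume r: ?r
      hence j: "u j = 0" by (metis less_irrefl)
      have ?l
      proof
        fix k show "if k < Suc j then u k \<in> G d else u k = 0"
          using r[THEN spec[of _ k]] j G_zero[of d] by (cases "k = j"; cases "k < j") simp_all
      qed
      thus "?l \<and> u j = 0" using j by blast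
    qed
    thus "u \<in> {u \<in> gspace (Suc j) d. ?f u = 0} \<longleftrightarrow> u \<in> gspace j d" by (simp add: gspace_def)
  qed
  ultimately show ?case
    using FA.dim_image_kernel[OF lin gspace_subspace B] Suc by (simp add: hdim_def)
qed

lemma kgraded_gspace: "i \<le> N \<Longrightarrow> kgraded N i = gspace (kdim i) (N - i)"
proof (rule Set.set_eqI)
  fix u assume "i \<le> N"
  have "(\<forall>k. \<not> k < kdim i \<longrightarrow> u k = 0) \<and> (\<forall>k. u k \<in> G (N - i)) \<longleftrightarrow>
      (\<forall>k. if k < kdim i then u k \<in> G (N - i) else u k = 0)"
    (is "?l \<longleftrightarrow> ?r")
  proof
    assume r: ?r
    have "u k \<in> G (N - i)" for k using r G_zero[of "N - i"] by (cases "k < kdim i") simp_all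
    thus ?l using r by simp
  qed simp
  thus "u \<in> kgraded N i \<longleftrightarrow> u \<in> gspace (kdim i) (N - i)"
    using \<open>i \<le> N\<close> by (simp add: kgraded_def kobj_def gspace_def)
qed

lemma kgraded_zero: "N < i \<Longrightarrow> kgraded N i = {0}"
  by (auto simp: kgraded_def kobj_def)

lemma kgraded_finite: "VF.subspace (kgraded N i)" "\<exists>B. finite B \<and> kgraded N i \<subseteq> VF.span B"
proof -
  show "VF.subspace (kgraded N i)"
    by (cases "i \<le> N") (simp_all add: kgraded_gspace gspace_subspace kgraded_zero VF.subspace_single_0)
  show "\<exists>B. finite B \<and> kgraded N i \<subseteq> VF.span B"
  proof (cases "i \<le> N")
    case True
    thus ?thesis using gspace_span by (simp add: kgraded_gspace)
  next
    case False
    hence "kgraded N i \<subseteq> VF.span {}" by (simp add: kgraded_zero)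
    thus ?thesis by blast
  qed
qed

lemma kgraded_dim: "VF.dim (kgraded N i) = (if i \<le> N then kdim i * hdim (N - i) else 0)"
  by (simp add: kgraded_gspace gspace_dim kgraded_zero dim_zero_space)

text \<open>For positive total degree the strand is a finite exact sequence of finite-dimensional
  spaces, so the alternating sum of its dimensions vanishes.\<close>

theorem koszul_euler:
  assumes "0 < N"
  shows "(\<Sum>i\<le>N. (- 1) ^ i * int (kdim i * hdim (N - i))) = 0"
proof -
  interpret FF: vector_space_pair scale_fun scale_fun ..
  have lin: "Vector_Spaces.linear scale_fun scale_fun (kbd i)" for i
  proof -
    have "kbd i (scale_fun c u) = scale_fun c (kbd i u)" for c u
      by (auto simp: kbd_def scale_fun_def sum_distrib_left mult.assoc)
    thus ?thesis unfolding Vector_Spaces.linear_iff using VF.vector_space_axioms kbd_add by simp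
  qed
  \<comment> \<open>By exactness the dimension in position \<open>i + 1\<close> is
    \<open>im i + im (Suc i)\<close>: image plus kernel, the kernel being the next image.\<close>
  define im where "im i = VF.dim (kbd i ` kgraded N (Suc i))" for i
  have dS: "VF.dim (kgraded N (Suc i)) = im i + im (Suc i)" for i
  proof -
    obtain B where B: "finite B" "kgraded N (Suc i) \<subseteq> VF.span B" using kgraded_finite(2) by blast
    have "{u \<in> kgraded N (Suc i). kbd i u = 0} = kbd (Suc i) ` kgraded N (Suc (Suc i))"
    proof (rule subset_antisym)
      show "{u \<in> kgraded N (Suc i). kbd i u = 0} \<subseteq> kbd (Suc i) ` kgraded N (Suc (Suc i))"
        using graded_exact by blast
      show "kbd (Suc i) ` kgraded N (Suc (Suc i)) \<subseteq> {u \<in> kgraded N (Suc i). kbd i u = 0}"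
      proof
        fix u assume "u \<in> kbd (Suc i) ` kgraded N (Suc (Suc i))"
        then obtain w where w: "w \<in> kgraded N (Suc (Suc i))" "u = kbd (Suc i) w" by blast
        have "kbd i u = 0" unfolding w(2) by (rule kbd_kbd) (use w(1) in \<open>simp add: kgraded_def\<close>)
        thus "u \<in> {u \<in> kgraded N (Suc i). kbd i u = 0}" using kbd_graded[OF w(1)] w(2) by simp
      qed
    qed
    thus ?thesis using FF.dim_image_kernel[OF lin[of i] kgraded_finite(1) B] by (simp add: im_def)
  qed
  have d0: "VF.dim (kgraded N 0) = im 0"
  proof -
    obtain d where d: "N = Suc d" using assms by (cases N) auto
    have "kbd 0 ` kgraded N (Suc 0) = kgraded N 0"
    proof (rule subset_antisym)
      show "kbd 0 ` kgraded N (Suc 0) \<subseteq> kgraded N 0" using kbd_graded by blast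
      show "kgraded N 0 \<subseteq> kbd 0 ` kgraded N (Suc 0)"
      proof
        fix u assume "u \<in> kgraded N 0"
        then obtain w where "w \<in> kgraded N (Suc 0)" "kbd 0 w = u"
          using graded_exact_0[of u d] unfolding d One_nat_def by blast
        thus "u \<in> kbd 0 ` kgraded N (Suc 0)" by blast
      qed
    qed
    thus ?thesis by (simp add: im_def)
  qed
  \<comment> \<open>The sum telescopes to its last image, and the image arriving at position
    \<open>N\<close> is zero because position \<open>N + 1\<close> of the strand is.\<close>
  have "(\<Sum>i\<le>n. (- 1) ^ i * int (VF.dim (kgraded N i))) = (- 1) ^ n * int (im n)" for n
    by (induction n) (simp_all add: d0 dS algebra_simps)
  hence "(\<Sum>i\<le>N. (- 1) ^ i * int (VF.dim (kgraded N i))) = (- 1) ^ N * int (im N)" .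
  moreover have "im N = 0" using dim_zero_space by (simp add: im_def kgraded_zero kbd_zero)
  ultimately have "(\<Sum>i\<le>N. (- 1) ^ i * int (VF.dim (kgraded N i))) = 0" by simp
  moreover have "int (VF.dim (kgraded N i)) = int (kdim i * hdim (N - i))" if "i \<in> {..N}" for i
    using that by (simp add: kgraded_dim)
  ultimately show ?thesis by (metis (no_types, lifting) sum.cong)
qed

lemma hdim_0: "hdim 0 = 1"
proof -
  have w0: "words m 0 = {0}" by (auto simp: words_def)
  have "G 0 \<subseteq> VA.span {1}" using G_span[of 0] by (simp add: w0 mono_def phi_one)
  moreover have "1 \<in> G 0"
    unfolding G_def using phi_one by (intro image_eqI[of _ _ 1]) (auto simp: free_homogeneous_iff free_alg_one lookup_one when_def)
  moreover have "VA.independent {1}" by (simp add: VA.dependent_single)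
  ultimately show ?thesis unfolding hdim_def by (intro VA.dim_unique[of "{1}"]) auto
qed

end

subsection \<open>Coefficients with respect to the standard monomials\<close>

text \<open>
  The standard monomial with exponent \<open>\<alpha>\<close> is indexed by the multiset of its letters, so that
  multidegrees are added as multisets.
\<close>

locale skew_pbw_algebra = augmented \<epsilon> for \<epsilon> :: "'a::ring_1 \<Rightarrow> 'k::field" +
  fixes \<iota> :: "'k \<Rightarrow> 'a" and n :: nat and x :: "nat \<Rightarrow> 'a"
  assumes pbw: "skew_PBW \<iota> n x"
    and iota_central: "\<iota> c * a = a * \<iota> c"
    and aug_iota: "\<epsilon> (\<iota> c) = c"
begin

lemma iota_add: "\<iota> (a + b) = \<iota> a + \<iota> b"
  and iota_mult: "\<iota> (a * b) = \<iota> a * \<iota> b"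
  and iota_one: "\<iota> 1 = 1"
  using pbw unfolding skew_PBW_def ring_hom_1_def by blast+

lemma iota_zero: "\<iota> 0 = 0"
  using iota_add[of 0 0] by simp

definition wd :: "nat list \<Rightarrow> 'a" where "wd xs = prod_list (map x xs)"

definition std :: "nat multiset \<Rightarrow> 'a" where "std M = wd (sorted_list_of_multiset M)"

definition expo :: "nat multiset \<Rightarrow> nat list" where "expo M = map (count M) [0..<n]"

abbreviation "MS \<equiv> {M. set_mset M \<subseteq> {..<n}}"

lemma mult_iota: "z * (\<iota> c * w) = \<iota> c * (z * w)"
  by (metis mult.assoc iota_central)

lemma size_sorted: "length (sorted_list_of_multiset M) = size M"
  by (metis size_mset mset_sorted_list_of_multiset)

lemma wd_append: "wd (xs @ ys) = wd xs * wd ys"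
  and wd_Nil: "wd [] = 1"
  and wd_Cons: "wd (i # xs) = x i * wd xs"
  by (simp_all add: wd_def)

lemma sorted_list_eq:
  assumes "M \<in> MS"
  shows "sorted_list_of_multiset M = concat (map (\<lambda>i. replicate (count M i) i) [0..<n])"
proof -
  let ?l = "\<lambda>k. concat (map (\<lambda>i. replicate (count M i) i) [0..<k])"
  have c: "count (mset (?l k)) j = (if j < k then count M j else 0)" for k j
    by (induction k) (auto simp: less_Suc_eq)
  have "mset (?l n) = M"
  proof (rule multiset_eqI)
    fix j
    show "count (mset (?l n)) j = count M j"
      using assms c[of n j] by (auto simp: not_in_iff[symmetric] subset_iff)
  qed
  moreover have "sorted (?l k) \<and> set (?l k) \<subseteq> {..<k}" for k
    by (induction k) (auto simp: sorted_append less_Suc_eq)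
  ultimately show ?thesis
    by (metis sorted_list_of_multiset_mset sorted_sort_id)
qed

lemma prod_list_concat: "prod_list (map f (concat xss)) = prod_list (map (\<lambda>xs. prod_list (map f xs)) xss)"
  for f :: "'x \<Rightarrow> 'a"
  by (induction xss) simp_all

lemma std_monomial:
  assumes "M \<in> MS"
  shows "std M = monomial x (expo M)"
proof -
  have "std M = prod_list (map (\<lambda>i. x i ^ count M i) [0..<n])"
    unfolding std_def wd_def sorted_list_eq[OF assms] prod_list_concat map_map comp_def
    by (simp add: prod_list_replicate)
  moreover have "map (\<lambda>i. x i ^ (expo M ! i)) [0..<n] = map (\<lambda>i. x i ^ count M i) [0..<n]"
    by (rule map_cong) (auto simp: expo_def)
  moreover have "length (expo M) = n" by (simp add: expo_def)
  ultimately show ?thesis unfolding monomial_def by metis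
qed

definition unexpo :: "nat list \<Rightarrow> nat multiset" where
  "unexpo \<alpha> = mset (concat (map (\<lambda>i. replicate (\<alpha> ! i) i) [0..<n]))"

lemma count_unexpo: "count (unexpo \<alpha>) j = (if j < n then \<alpha> ! j else 0)"
proof -
  have "count (mset (concat (map (\<lambda>i. replicate (\<alpha> ! i) i) [0..<k]))) j = (if j < k then \<alpha> ! j else 0)" for k
    by (induction k) (auto simp: less_Suc_eq)
  thus ?thesis unfolding unexpo_def .
qed

lemma unexpo_MS: "unexpo \<alpha> \<in> MS"
proof -
  have "j < n" if "j \<in># unexpo \<alpha>" for j
    using that count_unexpo[of \<alpha> j] by (metis count_eq_zero_iff)
  thus ?thesis by auto
qed

lemma unexpo_expo: "M \<in> MS \<Longrightarrow> unexpo (expo M) = M"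
  by (rule multiset_eqI) (auto simp: count_unexpo expo_def not_in_iff[symmetric] subset_iff)

lemma expo_unexpo: "length \<alpha> = n \<Longrightarrow> expo (unexpo \<alpha>) = \<alpha>"
  by (rule nth_equalityI) (auto simp: expo_def count_unexpo)

lemma length_expo: "length (expo M) = n"
  by (simp add: expo_def)

definition comb :: "(nat list \<Rightarrow>\<^sub>0 'k) \<Rightarrow> 'a" where
  "comb c = (\<Sum>\<alpha>\<in>Poly_Mapping.keys c. \<iota> (Poly_Mapping.lookup c \<alpha>) * monomial x \<alpha>)"

lemma comb_ex1: "\<exists>!c. Poly_Mapping.keys c \<subseteq> {\<alpha>. length \<alpha> = n} \<and> a = comb c"
  using pbw unfolding skew_PBW_def comb_def by blast

definition co :: "'a \<Rightarrow> (nat list \<Rightarrow>\<^sub>0 'k)" where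
  "co a = (THE c. Poly_Mapping.keys c \<subseteq> {\<alpha>. length \<alpha> = n} \<and> a = comb c)"

lemma co: "Poly_Mapping.keys (co a) \<subseteq> {\<alpha>. length \<alpha> = n}" "comb (co a) = a"
  using theI'[OF comb_ex1[of a]] unfolding co_def by auto

lemma co_eq: "Poly_Mapping.keys c \<subseteq> {\<alpha>. length \<alpha> = n} \<Longrightarrow> co (comb c) = c"
  unfolding co_def by (rule the1_equality[OF comb_ex1]) auto

lemma comb_super:
  assumes "Poly_Mapping.keys c \<subseteq> A" "finite A"
  shows "comb c = (\<Sum>\<alpha>\<in>A. \<iota> (Poly_Mapping.lookup c \<alpha>) * monomial x \<alpha>)"
  unfolding comb_def using assms by (intro sum.mono_neutral_left) (auto simp: in_keys_iff iota_zero)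

lemma comb_add: "comb (c + d) = comb c + comb d"
proof -
  let ?A = "Poly_Mapping.keys c \<union> Poly_Mapping.keys d"
  have "comb (c + d) = (\<Sum>\<alpha>\<in>?A. \<iota> (Poly_Mapping.lookup c \<alpha>) * monomial x \<alpha> + \<iota> (Poly_Mapping.lookup d \<alpha>) * monomial x \<alpha>)"
    by (subst comb_super[of _ ?A]) (auto simp: Poly_Mapping.keys_add lookup_add iota_add distrib_right)
  thus ?thesis using comb_super[of c ?A] comb_super[of d ?A] by (simp add: sum.distrib)
qed

text \<open>With the value 0 outside \<open>MS\<close>, supports consist automatically of multisets
  of letters below \<open>n\<close>.\<close>

definition cf :: "'a \<Rightarrow> nat multiset \<Rightarrow> 'k" where
  "cf a M = (if M \<in> MS then Poly_Mapping.lookup (co a) (expo M) else 0)"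

lemma cf_add: "cf (a + b) M = cf a M + cf b M"
proof -
  have "co (a + b) = co a + co b"
    using co_eq[of "co a + co b"] co[of a] co[of b] Poly_Mapping.keys_add[of "co a" "co b"]
    by (simp add: comb_add subset_iff) blast
  thus ?thesis by (simp add: cf_def lookup_add)
qed

lemma cf_zero: "cf 0 M = 0"
  using cf_add[of 0 0 M] by (metis add_cancel_left_left)

lemma cf_sum: "cf (sum f A) M = (\<Sum>i\<in>A. cf (f i) M)"
  by (induction A rule: infinite_finite_induct) (simp_all add: cf_zero cf_add)

lemma cf_single:
  assumes "M \<in> MS"
  shows "cf (\<iota> c * std M) M' = (if M' = M then c else 0)"
proof -
  have "comb (Poly_Mapping.single (expo M) c) = \<iota> c * std M"
    using comb_super[of "Poly_Mapping.single (expo M) c" "{expo M}"] by (simp add: std_monomial[OF assms])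
  moreover have "Poly_Mapping.keys (Poly_Mapping.single (expo M) c) \<subseteq> {\<alpha>. length \<alpha> = n}"
    using length_expo by (auto split: if_splits)
  ultimately have co': "co (\<iota> c * std M) = Poly_Mapping.single (expo M) c" using co_eq by metis
  have "expo M' = expo M \<longleftrightarrow> M' = M" if "M' \<in> MS"
    using unexpo_expo[OF that] unexpo_expo[OF assms] by metis
  thus ?thesis using assms by (auto simp: cf_def co' lookup_single when_def)
qed

lemma cf_outside: "M \<notin> MS \<Longrightarrow> cf a M = 0"
  by (simp add: cf_def)

lemma cf_finite: "finite {M. cf a M \<noteq> 0}"
proof (rule finite_subset)
  show "{M. cf a M \<noteq> 0} \<subseteq> unexpo ` Poly_Mapping.keys (co a)"
  proof
    fix M assume "M \<in> {M. cf a M \<noteq> 0}"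
    hence "M \<in> MS" "expo M \<in> Poly_Mapping.keys (co a)" by (auto simp: cf_def in_keys_iff split: if_splits)
    thus "M \<in> unexpo ` Poly_Mapping.keys (co a)" using unexpo_expo[of M] by force
  qed
qed simp

lemma cf_expand:
  assumes "{M. cf a M \<noteq> 0} \<subseteq> A" "finite A" "A \<subseteq> MS"
  shows "a = (\<Sum>M\<in>A. \<iota> (cf a M) * std M)"
proof -
  have inj: "inj_on expo A" using unexpo_expo assms(3) by (metis inj_on_inverseI subsetD)
  have "Poly_Mapping.keys (co a) \<subseteq> expo ` A"
  proof
    fix \<alpha> assume a: "\<alpha> \<in> Poly_Mapping.keys (co a)"
    hence l: "length \<alpha> = n" using co(1) by blast
    have "cf a (unexpo \<alpha>) \<noteq> 0" using a unexpo_MS[of \<alpha>] by (simp add: cf_def expo_unexpo[OF l] in_keys_iff)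
    hence "unexpo \<alpha> \<in> A" using assms(1) by blast
    thus "\<alpha> \<in> expo ` A" using expo_unexpo[OF l] by force
  qed
  hence "a = (\<Sum>\<alpha>\<in>expo ` A. \<iota> (Poly_Mapping.lookup (co a) \<alpha>) * monomial x \<alpha>)"
    using comb_super[of "co a" "expo ` A"] co(2)[of a] assms(2) by simp
  also have "\<dots> = (\<Sum>M\<in>A. \<iota> (Poly_Mapping.lookup (co a) (expo M)) * monomial x (expo M))"
    by (subst sum.reindex[OF inj]) simp
  also have "\<dots> = (\<Sum>M\<in>A. \<iota> (cf a M) * std M)"
    using assms(3) by (intro sum.cong refl) (auto simp: cf_def std_monomial)
  finally show ?thesis .
qed

lemma cf_support_MS: "{M. cf a M \<noteq> 0} \<subseteq> MS"
  using cf_outside by blast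

lemma cf_expand': "a = (\<Sum>M | cf a M \<noteq> 0. \<iota> (cf a M) * std M)"
  by (rule cf_expand[OF order_refl cf_finite cf_support_MS])

lemma cf_scale: "cf (\<iota> c * a) M = c * cf a M"
proof -
  let ?A = "{M. cf a M \<noteq> 0}"
  have "\<iota> c * a = (\<Sum>M\<in>?A. \<iota> (c * cf a M) * std M)"
    using arg_cong[OF cf_expand'[of a], of "\<lambda>z. \<iota> c * z"]
    unfolding sum_distrib_left iota_mult mult.assoc .
  hence "cf (\<iota> c * a) M = (\<Sum>M'\<in>?A. cf (\<iota> (c * cf a M') * std M') M)"
    by (simp only: cf_sum)
  also have "\<dots> = (\<Sum>M'\<in>?A. if M = M' then c * cf a M else 0)"
  proof (intro sum.cong refl)
    fix M' assume "M' \<in> ?A"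
    hence "M' \<in> MS" using cf_support_MS by blast
    thus "cf (\<iota> (c * cf a M') * std M') M = (if M = M' then c * cf a M else 0)" by (simp add: cf_single)
  qed
  also have "\<dots> = c * cf a M"
    using cf_finite[of a] by (cases "cf a M = 0") (simp_all add: sum.delta')
  finally show ?thesis .
qed

lemma cf_diff: "cf (a - b) M = cf a M - cf b M"
  using cf_add[of "a - b" b M] by simp

lemma cf_ext: "(\<And>M. cf a M = cf b M) \<Longrightarrow> a = b"
  using cf_expand'[of a] cf_expand'[of b] by simp

subsection \<open>Multiplication of standard monomials\<close>

text \<open>The filtration by total degree in the variables, with a strict bound: errors of
  straightening a word of length \<open>N\<close> belong to \<open>low N\<close>, and degree at most
  \<open>N\<close> is \<open>low (Suc N)\<close>.\<close>

definition low :: "nat \<Rightarrow> 'a set" where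
  "low N = {a. \<forall>M. cf a M \<noteq> 0 \<longrightarrow> size M < N}"

lemma low_add: "a \<in> low N \<Longrightarrow> b \<in> low N \<Longrightarrow> a + b \<in> low N"
  unfolding low_def using cf_add by (auto) (metis add_0)

lemma low_zero: "0 \<in> low N"
  by (simp add: low_def cf_zero)

lemma low_scale: "a \<in> low N \<Longrightarrow> \<iota> c * a \<in> low N"
  by (simp add: low_def cf_scale)

lemma low_sum: "(\<And>i. i \<in> A \<Longrightarrow> f i \<in> low N) \<Longrightarrow> sum f A \<in> low N"
  by (induction A rule: infinite_finite_induct) (auto intro: low_zero low_add)

lemma low_mono: "N \<le> N' \<Longrightarrow> a \<in> low N \<Longrightarrow> a \<in> low N'"
  unfolding low_def by fastforce

lemma std_low: "M \<in> MS \<Longrightarrow> size M < N \<Longrightarrow> std M \<in> low N"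
  using cf_single[of M 1] by (auto simp: low_def iota_one split: if_splits)

text \<open>In the associated graded algebra such a word is a nonzero multiple of the standard
  monomial with the same letters. That the factor is nonzero is what keeps leading terms alive
  later.\<close>

definition straight :: "nat list \<Rightarrow> bool" where
  "straight xs \<longleftrightarrow> (\<exists>c. c \<noteq> 0 \<and> wd xs - \<iota> c * std (mset xs) \<in> low (length xs))"

lemma straight_low:
  assumes "straight xs" "set xs \<subseteq> {..<n}" "length xs < N"
  shows "wd xs \<in> low N"
proof -
  obtain c where c: "wd xs - \<iota> c * std (mset xs) \<in> low (length xs)" using assms(1) unfolding straight_def by blast
  have "wd xs - \<iota> c * std (mset xs) \<in> low N" by (rule low_mono[OF _ c]) (use assms(3) in simp)
  moreover have "\<iota> c * std (mset xs) \<in> low N"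
    by (intro low_scale std_low) (use assms in auto)
  ultimately have "(wd xs - \<iota> c * std (mset xs)) + \<iota> c * std (mset xs) \<in> low N" by (rule low_add)
  thus ?thesis by simp
qed

text \<open>Straightening is assumed only up to the length that occurs, so that the lemma can be
  used inside the induction proving \<open>all_straight\<close>.\<close>

lemma low_mult_var:
  assumes words: "\<And>ys. \<lbrakk>set ys \<subseteq> {..<n}; length ys \<le> N\<rbrakk> \<Longrightarrow> straight ys"
    and a: "a \<in> low N" and i: "i < n"
  shows "x i * a \<in> low (Suc N)"
proof -
  have "x i * a = (\<Sum>M | cf a M \<noteq> 0. \<iota> (cf a M) * (x i * std M))"
    using arg_cong[OF cf_expand'[of a], of "\<lambda>z. x i * z"]
    unfolding sum_distrib_left mult_iota .
  also have "\<dots> \<in> low (Suc N)"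
  proof (intro low_sum low_scale)
    fix M assume "M \<in> {M. cf a M \<noteq> 0}"
    hence nz: "cf a M \<noteq> 0" by simp
    have M: "set_mset M \<subseteq> {..<n}" using nz cf_support_MS[of a] by auto
    have sM: "size M < N" using a nz unfolding low_def by simp
    let ?ys = "i # sorted_list_of_multiset M"
    have l: "length ?ys = Suc (size M)" by (simp add: size_sorted)
    have ys: "set ?ys \<subseteq> {..<n}" using M i by simp
    have "wd ?ys \<in> low (Suc N)"
      by (rule straight_low[OF words[OF ys] ys]) (use sM l in linarith)+
    thus "x i * std M \<in> low (Suc N)" by (simp add: std_def wd_Cons)
  qed
  finally show ?thesis .
qed

lemma rel: "i < n \<Longrightarrow> j < n \<Longrightarrow>
    \<exists>c r s. c \<noteq> 0 \<and> x j * x i - \<iota> c * (x i * x j) = \<iota> r + (\<Sum>k<n. \<iota> (s k) * x k)"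
  using pbw unfolding skew_PBW_def by blast

text \<open>The letter \<open>j\<close> moves past one smaller letter at a time by the defining
  relation. The error terms are words of length at most that of the current list, covered by the
  hypothesis, hence of lower degree than the word being sorted.\<close>

lemma straight_insort:
  assumes words: "\<And>zs. \<lbrakk>set zs \<subseteq> {..<n}; length zs \<le> length ys\<rbrakk> \<Longrightarrow> straight zs"
    and "set ys \<subseteq> {..<n}" "j < n"
  shows "\<exists>c. c \<noteq> 0 \<and> wd (j # ys) - \<iota> c * wd (List.insort j ys) \<in> low (Suc (length ys))"
  using assms
proof (induction ys)
  case Nil
  show ?case by (intro exI[of _ 1]) (simp add: iota_one low_zero)
next
  case (Cons i ys)
  show ?case
  proof (cases "j \<le> i")
    case True
    thus ?thesis by (intro exI[of _ 1]) (simp add: iota_one low_zero)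
  next
    case False
    have i: "i < n" and ysn: "set ys \<subseteq> {..<n}" using Cons.prems by auto
    obtain c r s where c: "c \<noteq> 0" "x j * x i - \<iota> c * (x i * x j) = \<iota> r + (\<Sum>k<n. \<iota> (s k) * x k)"
      using rel[OF i Cons.prems(3)] by blast
    obtain c' where c': "c' \<noteq> 0" "wd (j # ys) - \<iota> c' * wd (List.insort j ys) \<in> low (Suc (length ys))"
      using Cons.IH[OF Cons.prems(1) ysn Cons.prems(3)] by fastforce
    have 1: "wd (j # i # ys) - \<iota> c * wd (i # j # ys) \<in> low (Suc (Suc (length ys)))"
    proof -
      have "wd (j # i # ys) - \<iota> c * wd (i # j # ys) = (x j * x i - \<iota> c * (x i * x j)) * wd ys"
        by (simp add: wd_Cons algebra_simps)
      also have "\<dots> = \<iota> r * wd ys + (\<Sum>k<n. \<iota> (s k) * wd (k # ys))"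
        unfolding c(2) by (simp add: distrib_right sum_distrib_right wd_Cons mult.assoc)
      also have "\<dots> \<in> low (Suc (Suc (length ys)))"
      proof (intro low_add low_scale low_sum)
        show "wd ys \<in> low (Suc (Suc (length ys)))"
          by (rule straight_low[OF Cons.prems(1)]) (use ysn in auto)
        show "wd (k # ys) \<in> low (Suc (Suc (length ys)))" if "k \<in> {..<n}" for k
          by (rule straight_low[OF Cons.prems(1)]) (use ysn that in auto)
      qed
      finally show ?thesis .
    qed
    have 2: "\<iota> c * (x i * (wd (j # ys) - \<iota> c' * wd (List.insort j ys))) \<in> low (Suc (Suc (length ys)))"
      by (intro low_scale low_mult_var[OF Cons.prems(1) c'(2) i]) auto
    have ins: "List.insort j (i # ys) = i # List.insort j ys" using False by simp
    have "(wd (j # i # ys) - \<iota> c * wd (i # j # ys)) + \<iota> c * (x i * (wd (j # ys) - \<iota> c' * wd (List.insort j ys))) =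
        wd (j # i # ys) - \<iota> (c * c') * wd (List.insort j (i # ys))"
      unfolding ins wd_Cons[of i] right_diff_distrib mult_iota[of "x i"] iota_mult mult.assoc by simp
    hence "wd (j # i # ys) - \<iota> (c * c') * wd (List.insort j (i # ys)) \<in> low (Suc (Suc (length ys)))"
      using low_add[OF 1 2] by (simp only:)
    thus ?thesis using c(1) c'(1) by (intro exI[of _ "c * c'"]) simp
  qed
qed

text \<open>Induction on the length: the tail is replaced by its standard monomial, and the first
  letter is then inserted into it. The nonzero factors multiply.\<close>

lemma all_straight: "set xs \<subseteq> {..<n} \<Longrightarrow> straight xs"
proof (induction "length xs" arbitrary: xs rule: less_induct)
  case less
  show ?case
  proof (cases xs)
    case Nil
    thus ?thesis unfolding straight_def by (intro exI[of _ 1]) (simp add: iota_one std_def wd_Nil low_zero)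
  next
    case (Cons j ys)
    have jn: "j < n" and ysn: "set ys \<subseteq> {..<n}" using less.prems Cons by auto
    have words: "straight zs" if "set zs \<subseteq> {..<n}" "length zs \<le> length ys" for zs
      using less.hyps[of zs] that Cons by simp
    obtain c where c: "c \<noteq> 0" "wd ys - \<iota> c * std (mset ys) \<in> low (length ys)"
      using words[OF ysn] unfolding straight_def by blast
    have 1: "x j * (wd ys - \<iota> c * std (mset ys)) \<in> low (Suc (length ys))"
      by (rule low_mult_var[OF words c(2) jn])
    let ?zs = "sorted_list_of_multiset (mset ys)"
    have l: "length ?zs = length ys" by simp
    obtain c' where c': "c' \<noteq> 0" "wd (j # ?zs) - \<iota> c' * wd (List.insort j ?zs) \<in> low (Suc (length ?zs))"
      using straight_insort[of ?zs j] words ysn jn by auto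
    have 2: "\<iota> c * (wd (j # ?zs) - \<iota> c' * wd (List.insort j ?zs)) \<in> low (Suc (length ys))"
      using low_scale[OF c'(2)] l by simp
    have m: "std (mset xs) = wd (List.insort j ?zs)"
      unfolding std_def Cons by simp
    have "x j * (wd ys - \<iota> c * std (mset ys)) + \<iota> c * (wd (j # ?zs) - \<iota> c' * wd (List.insort j ?zs)) =
        wd xs - \<iota> (c * c') * std (mset xs)"
      unfolding m unfolding Cons std_def wd_Cons right_diff_distrib mult_iota[of "x j"] iota_mult mult.assoc by simp
    hence "wd xs - \<iota> (c * c') * std (mset xs) \<in> low (length xs)"
      using low_add[OF 1 2] Cons by simp
    thus ?thesis unfolding straight_def using c(1) c'(1) by (intro exI[of _ "c * c'"]) simp
  qed
qed

lemma std_mult: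
  assumes "M \<in> MS" "M' \<in> MS"
  shows "\<exists>c. c \<noteq> 0 \<and> std M * std M' - \<iota> c * std (M + M') \<in> low (size M + size M')"
proof -
  let ?xs = "sorted_list_of_multiset M @ sorted_list_of_multiset M'"
  have "straight ?xs" by (rule all_straight) (use assms in auto)
  thus ?thesis unfolding straight_def by (simp add: wd_append std_def size_sorted)
qed

definition mc :: "nat multiset \<Rightarrow> nat multiset \<Rightarrow> 'k" where
  "mc M M' = (SOME c. c \<noteq> 0 \<and> std M * std M' - \<iota> c * std (M + M') \<in> low (size M + size M'))"

lemma mc:
  assumes "M \<in> MS" "M' \<in> MS"
  shows "mc M M' \<noteq> 0" "std M * std M' - \<iota> (mc M M') * std (M + M') \<in> low (size M + size M')"
  using someI_ex[OF std_mult[OF assms]] unfolding mc_def by auto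

lemma cf_std_mult:
  assumes "M \<in> MS" "M' \<in> MS" "size M + size M' \<le> size N"
  shows "cf (std M * std M') N = (if N = M + M' then mc M M' else 0)"
proof -
  have "cf (std M * std M' - \<iota> (mc M M') * std (M + M')) N = 0"
    using mc(2)[OF assms(1,2)] assms(3) unfolding low_def mem_Collect_eq by (meson not_le)
  moreover have "M + M' \<in> MS" using assms by auto
  ultimately show ?thesis by (simp add: cf_diff cf_single)
qed

lemma cf_mult_expand:
  assumes "M \<in> MS"
  shows "cf (std M * a) N = (\<Sum>M' | cf a M' \<noteq> 0. cf a M' * cf (std M * std M') N)"
proof -
  have "std M * a = (\<Sum>M' | cf a M' \<noteq> 0. \<iota> (cf a M') * (std M * std M'))"
    using arg_cong[OF cf_expand'[of a], of "\<lambda>z. std M * z"]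
    unfolding sum_distrib_left mult_iota .
  thus ?thesis by (simp only: cf_sum cf_scale)
qed

text \<open>In the top degree, multiplication by a standard monomial is a shift of multidegrees with
  nonzero factors, as in a polynomial ring up to scalars; all other contributions have smaller total
  degree.\<close>

lemma cf_top:
  assumes M: "M \<in> MS" and a: "\<And>M'. cf a M' \<noteq> 0 \<Longrightarrow> size M' \<le> t" and N: "size N = size M + t"
  shows "cf (std M * a) N = (if M \<subseteq># N then mc M (N - M) * cf a (N - M) else 0)"
proof -
  have "cf (std M * a) N = (\<Sum>M' | cf a M' \<noteq> 0. if M' = N - M \<and> M \<subseteq># N then mc M (N - M) * cf a (N - M) else 0)"
    unfolding cf_mult_expand[OF M, of a N]
  proof (intro sum.cong refl)
    fix M' assume M': "M' \<in> {M'. cf a M' \<noteq> 0}"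
    hence "M' \<in> MS" "size M' \<le> t" using a cf_support_MS by blast+
    hence "cf (std M * std M') N = (if N = M + M' then mc M M' else 0)"
      by (intro cf_std_mult M) (simp_all add: N)
    moreover have "N = M + M' \<longleftrightarrow> M' = N - M \<and> M \<subseteq># N" by (metis add_diff_cancel_left' mset_subset_eq_add_left subset_mset.add_diff_inverse)
    ultimately show "cf a M' * cf (std M * std M') N = (if M' = N - M \<and> M \<subseteq># N then mc M (N - M) * cf a (N - M) else 0)"
      by (cases "M' = N - M \<and> M \<subseteq># N") (auto simp: mult.commute)
  qed
  also have "\<dots> = (if M \<subseteq># N then mc M (N - M) * cf a (N - M) else 0)"
    using cf_finite[of a] by (cases "cf a (N - M) = 0"; cases "M \<subseteq># N") (simp_all add: sum.delta)
  finally show ?thesis .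
qed

lemma cf_mult_support:
  assumes M: "M \<in> MS" and N: "cf (std M * a) N \<noteq> 0"
  shows "\<exists>M'. cf a M' \<noteq> 0 \<and> (N = M + M' \<or> size N < size M + size M')"
proof -
  have "(\<Sum>M' | cf a M' \<noteq> 0. cf a M' * cf (std M * std M') N) \<noteq> 0"
    using N unfolding cf_mult_expand[OF M, of a N] .
  then obtain M' where M': "M' \<in> {M'. cf a M' \<noteq> 0}" "cf a M' * cf (std M * std M') N \<noteq> 0"
    by (rule sum.not_neutral_contains_not_neutral)
  have "M' \<in> MS" using M'(1) cf_support_MS by blast
  hence "N = M + M'" if "size M + size M' \<le> size N"
    using cf_std_mult[OF M _ that] M'(2) by (auto split: if_splits)
  thus ?thesis using M'(1) by (meson mem_Collect_eq not_le)
qed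

subsection \<open>A free resolution of length \<open>n\<close>\<close>

text \<open>The pair \<open>(M, S)\<close> stands for the standard monomial of \<open>M\<close>
  times the basis vector of \<open>S\<close>; its multidegree is
  \<open>M + mset_set S\<close>.\<close>

definition bas :: "nat multiset \<Rightarrow> nat set \<Rightarrow> nat set \<Rightarrow> 'a" where
  "bas M S = (\<lambda>T. if T = S then std M else 0)"

definition Sp :: "(nat multiset \<times> nat set) set \<Rightarrow> (nat set \<Rightarrow> 'a) set" where
  "Sp X = {u. \<forall>M S. cf (u S) M \<noteq> 0 \<longrightarrow> (M, S) \<in> X}"

definition Adm :: "nat \<Rightarrow> (nat multiset \<times> nat set) set" where
  "Adm q = {(M, S). M \<in> MS \<and> S \<subseteq> {..<n} \<and> card S = q}"

text \<open>Pairs of multidegree \<open>\<beta>\<close>, together with all pairs of strictly smaller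
  total degree, where the error terms of straightening end up. Boundary maps respect these sets by
  \<open>dd_image\<close>.\<close>

definition Xd :: "nat multiset \<Rightarrow> nat \<Rightarrow> (nat multiset \<times> nat set) set" where
  "Xd \<beta> q = {(M, S) \<in> Adm q. M + mset_set S = \<beta> \<or> size M + q < size \<beta>}"

text \<open>One side of a matching: if \<open>i\<close> is the largest letter of the multidegree,
  \<open>(M, insert i S)\<close> with \<open>i\<close> outside \<open>S\<close> is matched with
  \<open>(M + {#i#}, S)\<close>. Pairs in \<open>TD\<close> have the largest letter in the basis
  vector, and the leading terms of their boundaries lie on the other side.\<close>

definition TD :: "(nat multiset \<times> nat set) set" where
  "TD = {(M, S). M + mset_set S \<noteq> {#} \<and> Max (set_mset (M + mset_set S)) \<in> S}"

text \<open>The pair of the empty monomial and the empty set is unmatched; it survives as the copy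
  of \<open>K\<close> that is resolved.\<close>

definition TZ :: "(nat multiset \<times> nat set) set" where
  "TZ = TD \<union> {({#}, {})}"

definition dd :: "(nat set \<Rightarrow> nat set \<Rightarrow> 'a) \<Rightarrow> (nat set \<Rightarrow> 'a) \<Rightarrow> nat set \<Rightarrow> 'a" where
  "dd D u = (\<lambda>T. \<Sum>S\<in>Pow {..<n}. u S * D S T)"

abbreviation sc :: "'k \<Rightarrow> (nat set \<Rightarrow> 'a) \<Rightarrow> nat set \<Rightarrow> 'a" where
  "sc c u \<equiv> fun_act (\<iota> c) u"

lemma fun_act_zero: "fun_act a 0 = 0" and fun_act_apply: "fun_act a u k = a * u k"
  by (auto simp: fun_act_def)

lemma Sp_zero: "0 \<in> Sp X"
  by (simp add: Sp_def cf_zero)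

lemma Sp_add: "u \<in> Sp X \<Longrightarrow> v \<in> Sp X \<Longrightarrow> u + v \<in> Sp X"
  unfolding Sp_def by (simp add: cf_add) (metis add_0)

lemma Sp_scale: "u \<in> Sp X \<Longrightarrow> sc c u \<in> Sp X"
  by (simp add: Sp_def fun_act_def cf_scale)

lemma Sp_mono: "X \<subseteq> Y \<Longrightarrow> u \<in> Sp X \<Longrightarrow> u \<in> Sp Y"
  unfolding Sp_def by blast

lemma sc_minus: "u - v = u + sc (- 1) v"
proof -
  have "\<iota> (- 1) + \<iota> 1 = 0" by (simp only: iota_add[symmetric]) (simp add: iota_zero)
  hence "\<iota> (- 1) = - 1" by (simp add: iota_one eq_neg_iff_add_eq_0)
  thus ?thesis by (auto simp: fun_act_def)
qed

lemma Sp_diff: "u \<in> Sp X \<Longrightarrow> v \<in> Sp X \<Longrightarrow> u - v \<in> Sp X"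
  unfolding sc_minus by (intro Sp_add Sp_scale)

lemma bas_coeff: "M \<in> MS \<Longrightarrow> cf (bas M S T) N = (if (N, T) = (M, S) then 1 else 0)"
  using cf_single[of M 1 N] by (auto simp: bas_def iota_one cf_zero)

lemma bas_Sp: "M \<in> MS \<Longrightarrow> (M, S) \<in> X \<Longrightarrow> bas M S \<in> Sp X"
  unfolding Sp_def by (simp add: bas_coeff)

lemma Sp_expand:
  assumes u: "u \<in> Sp X" and X: "X \<subseteq> Adm q"
  defines "F \<equiv> {p. cf (u (snd p)) (fst p) \<noteq> 0}"
  shows "finite F" "F \<subseteq> X" "u = (\<Sum>p\<in>F. sc (cf (u (snd p)) (fst p)) (bas (fst p) (snd p)))"
proof -
  show FX: "F \<subseteq> X" using u by (auto simp: F_def Sp_def)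
  have "F \<subseteq> (\<Union>S\<in>Pow {..<n}. (\<lambda>M. (M, S)) ` {M. cf (u S) M \<noteq> 0})"
  proof
    fix p assume p: "p \<in> F"
    hence "snd p \<in> Pow {..<n}" using FX X by (cases p) (auto simp: Adm_def)
    moreover have "p \<in> (\<lambda>M. (M, snd p)) ` {M. cf (u (snd p)) M \<noteq> 0}"
      using p by (intro image_eqI[of _ _ "fst p"]) (auto simp: F_def)
    ultimately show "p \<in> (\<Union>S\<in>Pow {..<n}. (\<lambda>M. (M, S)) ` {M. cf (u S) M \<noteq> 0})" by blast
  qed
  thus fin: "finite F" by (rule finite_subset) (simp add: cf_finite)
  show "u = (\<Sum>p\<in>F. sc (cf (u (snd p)) (fst p)) (bas (fst p) (snd p)))"
  proof (rule ext, rule cf_ext)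
    fix T N
    have "cf ((\<Sum>p\<in>F. sc (cf (u (snd p)) (fst p)) (bas (fst p) (snd p))) T) N =
        (\<Sum>p\<in>F. cf (u (snd p)) (fst p) * cf (bas (fst p) (snd p) T) N)"
      by (simp only: sum_fun_apply fun_act_def cf_sum cf_scale)
    also have "\<dots> = (\<Sum>p\<in>F. if p = (N, T) then cf (u T) N else 0)"
    proof (intro sum.cong refl)
      fix p assume "p \<in> F"
      hence "fst p \<in> MS" using FX X by (cases p) (auto simp: Adm_def)
      thus "cf (u (snd p)) (fst p) * cf (bas (fst p) (snd p) T) N = (if p = (N, T) then cf (u T) N else 0)"
        by (simp add: bas_coeff prod_eq_iff)
    qed
    also have "\<dots> = cf (u T) N" using fin by (simp add: F_def)
    finally show "cf (u T) N = cf ((\<Sum>p\<in>F. sc (cf (u (snd p)) (fst p)) (bas (fst p) (snd p))) T) N" ..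
  qed
qed

lemma Sp_induct:
  assumes u: "u \<in> Sp X" and X: "X \<subseteq> Adm q"
    and "P 0" "\<And>u v. P u \<Longrightarrow> P v \<Longrightarrow> P (u + v)" "\<And>c u. P u \<Longrightarrow> P (sc c u)"
    and "\<And>M S. (M, S) \<in> X \<Longrightarrow> P (bas M S)"
  shows "P u"
proof -
  let ?F = "{p. cf (u (snd p)) (fst p) \<noteq> 0}"
  have s: "P (\<Sum>p\<in>E. sc (cf (u (snd p)) (fst p)) (bas (fst p) (snd p)))" if "E \<subseteq> X" for E
    using that
  proof (induction E rule: infinite_finite_induct)
    case (insert p E)
    have "P (sc (cf (u (snd p)) (fst p)) (bas (fst p) (snd p)))" using insert.prems by (intro assms(5,6)) auto
    moreover have "P (\<Sum>p\<in>E. sc (cf (u (snd p)) (fst p)) (bas (fst p) (snd p)))" using insert by blast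
    ultimately show ?case unfolding sum.insert[OF insert.hyps] by (rule assms(4))
  qed (simp_all add: assms(3))
  show ?thesis using s[OF Sp_expand(2)[OF u X]] Sp_expand(3)[OF u X] by (simp only:)
qed

section \<open>Boundary maps given by the images of basis vectors, and their leading terms\<close>

lemma dd_add: "dd D (u + v) = dd D u + dd D v"
  by (auto simp: dd_def distrib_right sum.distrib)

lemma dd_act: "dd D (fun_act a u) = fun_act a (dd D u)"
  by (auto simp: dd_def fun_act_def sum_distrib_left mult.assoc)

lemma dd_zero: "dd D 0 = 0"
  by (auto simp: dd_def)

lemma dd_diff: "dd D (u - v) = dd D u - dd D v"
  unfolding sc_minus dd_add dd_act ..

lemma dd_bas:
  assumes "S \<subseteq> {..<n}"
  shows "dd D (bas M S) T = std M * D S T"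
proof -
  have "dd D (bas M S) T = (\<Sum>S'\<in>Pow {..<n}. if S' = S then std M * D S T else 0)"
    unfolding dd_def bas_def by (intro sum.cong) auto
  also have "\<dots> = std M * D S T" using assms by simp
  finally show ?thesis .
qed

lemma Adm_iff: "(M, S) \<in> Adm q \<longleftrightarrow> M \<in> MS \<and> S \<subseteq> {..<n} \<and> card S = q"
  by (simp add: Adm_def)

lemma Xd_iff: "(M, S) \<in> Xd \<beta> q \<longleftrightarrow> (M, S) \<in> Adm q \<and> (M + mset_set S = \<beta> \<or> size M + q < size \<beta>)"
  by (simp add: Xd_def)

lemma Xd_Adm: "Xd \<beta> q \<subseteq> Adm q"
  by (auto simp: Xd_def)

lemma Xd_mono: "\<beta>' = \<beta> \<or> size \<beta>' < size \<beta> \<Longrightarrow> Xd \<beta>' q \<subseteq> Xd \<beta> q"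
proof -
  assume b: "\<beta>' = \<beta> \<or> size \<beta>' < size \<beta>"
  have "size \<beta>' = size M + q" if "M + mset_set S = \<beta>'" "(M, S) \<in> Adm q" for M S
    using that unfolding Adm_iff by (metis size_mset_set size_union)
  thus ?thesis using b unfolding Xd_def by fastforce
qed

lemma size_deg: "(M, S) \<in> Adm q \<Longrightarrow> size (M + mset_set S) = size M + q"
  by (simp add: Adm_iff)

text \<open>What the induction maintains for the boundaries of basis vectors with
  \<open>q + 1\<close> elements: no term exceeds the multidegree of \<open>S\<close>, the
  coefficient for moving the largest letter of \<open>S\<close> into the monomial is 1, and
  boundaries are cycles. For \<open>q = 0\<close> the augmentation takes the place of the next
  boundary.\<close>

definition good :: "(nat set \<Rightarrow> nat set \<Rightarrow> 'a) \<Rightarrow> nat \<Rightarrow> bool" where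
  "good D q \<longleftrightarrow> (\<forall>S. S \<subseteq> {..<n} \<and> card S = Suc q \<longrightarrow>
     D S \<in> Sp (Xd (mset_set S) q) \<and> cf (D S (S - {Max S})) {#Max S#} = 1 \<and>
     (if q = 0 then \<epsilon> (D S {}) = 0 else dd D (D S) = 0))"

lemma good_supp:
  assumes "good D q" "(M, S) \<in> Adm (Suc q)" "cf (D S T) N \<noteq> 0"
  shows "(N, T) \<in> Xd (mset_set S) q" "size N \<le> 1"
proof -
  show X: "(N, T) \<in> Xd (mset_set S) q" using assms unfolding good_def Sp_def Adm_iff by blast
  have s: "size (mset_set S) = Suc q" using assms(2) by (simp add: Adm_iff)
  show "size N \<le> 1"
    using X s size_deg[of N T q] unfolding Xd_iff by (metis Suc_leI add_less_cancel_right less_Suc_eq_le One_nat_def add.commute add_Suc_right le_add1 linorder_not_less nat_add_left_cancel_less plus_1_eq_Suc less_or_eq_imp_le order_refl)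
qed

lemma bas_image_support:
  assumes D: "good D q" and MS: "(M, S) \<in> Adm (Suc q)" and N: "cf (dd D (bas M S) T) N \<noteq> 0"
  shows "\<exists>M'. (M', T) \<in> Xd (mset_set S) q \<and> size M' \<le> 1 \<and> (N = M + M' \<or> size N < size M + size M')"
proof -
  have M: "M \<in> MS" and S: "S \<subseteq> {..<n}" using MS by (auto simp: Adm_iff)
  obtain M' where M': "cf (D S T) M' \<noteq> 0" "N = M + M' \<or> size N < size M + size M'"
    using cf_mult_support[OF M, of "D S T" N] N unfolding dd_bas[OF S] by blast
  show ?thesis using good_supp[OF D MS M'(1)] M'(2) by blast
qed

lemma bas_image:
  assumes D: "good D q" and MS: "(M, S) \<in> Adm (Suc q)"
  shows "dd D (bas M S) \<in> Sp (Xd (M + mset_set S) q)"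
  unfolding Sp_def
proof (intro CollectI allI impI)
  fix N T assume N: "cf (dd D (bas M S) T) N \<noteq> 0"
  obtain M' where M': "(M', T) \<in> Xd (mset_set S) q" "size M' \<le> 1" "N = M + M' \<or> size N < size M + size M'"
    using bas_image_support[OF D MS N] by blast
  have "N \<in> MS" using N cf_outside by blast
  hence A: "(N, T) \<in> Adm q" using M'(1) by (simp add: Xd_iff Adm_iff)
  have s: "size (M + mset_set S) = size M + Suc q" by (rule size_deg[OF MS])
  have sS: "size (mset_set S) = Suc q" using MS by (simp add: Adm_iff)
  show "(N, T) \<in> Xd (M + mset_set S) q"
  proof (cases "N = M + M' \<and> M' + mset_set T = mset_set S")
    case True
    hence "N + mset_set T = M + mset_set S" by (metis add.assoc)
    thus ?thesis using A by (simp add: Xd_iff)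
  next
    case False
    have "size N + q < size M + Suc q"
    proof (cases "N = M + M'")
      case True
      hence "size M' + q < size (mset_set S)" using False M'(1) unfolding Xd_iff by blast
      thus ?thesis using True sS by simp
    next
      case False
      thus ?thesis using M' by linarith
    qed
    thus ?thesis using A s by (simp add: Xd_iff)
  qed
qed

lemma dd_image:
  assumes "good D q" "u \<in> Sp (Xd \<beta> (Suc q))"
  shows "dd D u \<in> Sp (Xd \<beta> q)"
proof (rule Sp_induct[OF assms(2) Xd_Adm, where P = "\<lambda>u. dd D u \<in> Sp (Xd \<beta> q)"])
  fix M S assume MS: "(M, S) \<in> Xd \<beta> (Suc q)"
  hence A: "(M, S) \<in> Adm (Suc q)" by (simp add: Xd_iff)
  have "M + mset_set S = \<beta> \<or> size (M + mset_set S) < size \<beta>"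
    using MS size_deg[OF A] by (simp only: Xd_iff)
  thus "dd D (bas M S) \<in> Sp (Xd \<beta> q)"
    by (rule Sp_mono[OF Xd_mono bas_image[OF assms(1) A]])
qed (simp_all add: dd_zero dd_add dd_act Sp_zero Sp_add Sp_scale)

text \<open>Equal multidegrees rule out all error terms and leave a coefficient of exactly one
  letter. A letter of \<open>S\<close> that is missing from \<open>T\<close> must be this
  one.\<close>

lemma lead:
  assumes D: "good D q" and MS: "(M, S) \<in> Adm (Suc q)" and NT: "(N, T) \<in> Adm q"
    and deg: "N + mset_set T = M + mset_set S" and nz: "cf (dd D (bas M S) T) N \<noteq> 0"
    and i: "i \<in> S" "i \<notin> T"
  shows "N = M + {#i#} \<and> T = S - {i}"
proof -
  obtain M' where M': "(M', T) \<in> Xd (mset_set S) q" "size M' \<le> 1" "N = M + M' \<or> size N < size M + size M'"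
    using bas_image_support[OF D MS nz] by blast
  have s: "size N + q = size M + Suc q" using size_deg[OF MS] size_deg[OF NT] deg by simp
  have N: "N = M + M'" using M'(2,3) s by linarith
  have fS: "finite S" "finite T" using MS NT by (auto simp: Adm_iff intro: finite_subset)
  have "M + (M' + mset_set T) = M + mset_set S" using deg unfolding N by (simp add: add.assoc)
  hence e: "M' + mset_set T = mset_set S" by simp
  have "i \<in># M' + mset_set T" unfolding e using i fS by simp
  hence "i \<in># M'" using i fS by simp
  moreover have "size M' = 1" using N s by simp
  ultimately have M'i: "M' = {#i#}" by (metis size_1_singleton_mset set_mset_single singletonD)
  have "insert i T = S"
    using arg_cong[OF e, of set_mset] fS unfolding M'i by simp
  thus ?thesis using N M'i i(2) by auto
qed

lemma lead_coeff:
  assumes D: "good D q" and MS: "(M, S) \<in> Adm (Suc q)"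
  shows "cf (dd D (bas M S) (S - {Max S})) (M + {#Max S#}) \<noteq> 0"
proof -
  have M: "M \<in> MS" and S: "S \<subseteq> {..<n}" "card S = Suc q" using MS by (auto simp: Adm_iff)
  have "S \<noteq> {}" "finite S" using S finite_subset by auto
  hence "Max S \<in> S" by simp
  hence m: "{#Max S#} \<in> MS" using S by auto
  have "cf (std M * D S (S - {Max S})) (M + {#Max S#}) = mc M {#Max S#} * cf (D S (S - {Max S})) {#Max S#}"
    by (subst cf_top[OF M, where t = 1]) (use good_supp(2)[OF D MS] in auto)
  moreover have "cf (D S (S - {Max S})) {#Max S#} = 1" using D S unfolding good_def by blast
  ultimately show ?thesis using mc(1)[OF M m] unfolding dd_bas[OF S(1)] by simp
qed

lemma TD_deg: "M + mset_set S = \<beta> \<Longrightarrow> (M, S) \<in> TD \<longleftrightarrow> \<beta> \<noteq> {#} \<and> Max (set_mset \<beta>) \<in> S"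
  by (auto simp: TD_def)

lemma TD_Max:
  assumes "(M, S) \<in> TD" "(M, S) \<in> Adm q"
  shows "Max S \<in> S" "Max (set_mset (M + mset_set S)) = Max S"
proof -
  have f: "finite S" using assms(2) by (auto simp: Adm_iff intro: finite_subset)
  let ?m = "Max (set_mset (M + mset_set S))"
  have m: "?m \<in> S" using assms(1) by (simp add: TD_def)
  moreover have "s \<le> ?m" if "s \<in> S" for s by (rule Max_ge) (use that f in auto)
  ultimately show "?m = Max S" using f by (metis Max_eqI)
  thus "Max S \<in> S" using m by simp
qed

text \<open>Reduction modulo boundaries to pairs in \<open>TZ\<close>. That \<open>w\<close> lies in
  \<open>TD\<close> and that both \<open>w\<close> and the remainder stay bounded by
  \<open>\<beta>\<close> is used again in \<open>good_step\<close>.\<close>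

definition elim :: "(nat set \<Rightarrow> nat set \<Rightarrow> 'a) \<Rightarrow> nat \<Rightarrow> nat multiset \<Rightarrow> (nat set \<Rightarrow> 'a) \<Rightarrow> bool" where
  "elim D q \<beta> u \<longleftrightarrow> (\<exists>w\<in>Sp (Xd \<beta> (Suc q) \<inter> TD). u - dd D w \<in> Sp (Xd \<beta> q \<inter> TZ))"

lemma elim_zero: "elim D q \<beta> 0"
  unfolding elim_def by (rule bexI[of _ 0]) (simp_all add: dd_zero Sp_zero)

lemma elim_add:
  assumes "elim D q \<beta> u" "elim D q \<beta> v"
  shows "elim D q \<beta> (u + v)"
proof -
  obtain w w' where w: "w \<in> Sp (Xd \<beta> (Suc q) \<inter> TD)" "u - dd D w \<in> Sp (Xd \<beta> q \<inter> TZ)"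
    and w': "w' \<in> Sp (Xd \<beta> (Suc q) \<inter> TD)" "v - dd D w' \<in> Sp (Xd \<beta> q \<inter> TZ)"
    using assms unfolding elim_def by blast
  have "u + v - dd D (w + w') = (u - dd D w) + (v - dd D w')" by (simp add: dd_add)
  thus ?thesis unfolding elim_def using Sp_add[OF w(1) w'(1)] Sp_add[OF w(2) w'(2)] by metis
qed

lemma elim_scale:
  assumes "elim D q \<beta> u"
  shows "elim D q \<beta> (sc c u)"
proof -
  obtain w where w: "w \<in> Sp (Xd \<beta> (Suc q) \<inter> TD)" "u - dd D w \<in> Sp (Xd \<beta> q \<inter> TZ)"
    using assms unfolding elim_def by blast
  have "sc c u - dd D (sc c w) = sc c (u - dd D w)"
    unfolding dd_act by (auto simp: fun_act_def right_diff_distrib)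
  thus ?thesis unfolding elim_def using Sp_scale[OF w(1)] Sp_scale[OF w(2)] by metis
qed

lemma elim_mono:
  assumes "elim D q \<beta>' u" "\<beta>' = \<beta> \<or> size \<beta>' < size \<beta>"
  shows "elim D q \<beta> u"
proof -
  obtain w where w: "w \<in> Sp (Xd \<beta>' (Suc q) \<inter> TD)" "u - dd D w \<in> Sp (Xd \<beta>' q \<inter> TZ)"
    using assms(1) unfolding elim_def by blast
  have "w \<in> Sp (Xd \<beta> (Suc q) \<inter> TD)" "u - dd D w \<in> Sp (Xd \<beta> q \<inter> TZ)"
    using w Xd_mono[OF assms(2)] by (auto elim!: Sp_mono[rotated])
  thus ?thesis unfolding elim_def by blast
qed

lemma elim_TZ: "(M, S) \<in> Xd \<beta> q \<Longrightarrow> (M, S) \<in> TZ \<Longrightarrow> elim D q \<beta> (bas M S)"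
  unfolding elim_def
  by (rule bexI[of _ 0]) (auto simp: dd_zero Sp_zero Xd_iff Adm_iff intro!: bas_Sp)

text \<open>
  A basis element whose multidegree has its largest letter \<open>i\<close> in the coefficient is
  the leading term of the boundary of the element obtained by moving \<open>i\<close> to the basis vector.
\<close>

lemma elim_bas:
  assumes D: "good D q"
  shows "(M, S) \<in> Adm q \<Longrightarrow> elim D q (M + mset_set S) (bas M S)"
proof (induction "size M" arbitrary: M S rule: less_induct)
  case less
  note A = less.prems
  define \<beta> where "\<beta> = M + mset_set S"
  have M: "M \<in> MS" and S: "S \<subseteq> {..<n}" "card S = q" using A by (auto simp: Adm_iff)
  have fS: "finite S" using S finite_subset by blast
  have set\<beta>: "set_mset \<beta> = set_mset M \<union> S" using fS by (simp add: \<beta>_def)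
  have XM: "(M, S) \<in> Xd \<beta> q" using A by (simp add: Xd_iff \<beta>_def)
  have "elim D q \<beta> (bas M S)"
  proof (cases "(M, S) \<in> TZ")
    case True
    thus ?thesis by (rule elim_TZ[OF XM])
  next
    case False
    define i where "i = Max (set_mset \<beta>)"
    have \<beta>0: "\<beta> \<noteq> {#}"
    proof
      assume "\<beta> = {#}"
      hence "M = {#}" "S = {}" using set\<beta> by auto
      thus False using False by (simp add: TZ_def)
    qed
    have iS: "i \<notin> S" using False \<beta>0 TD_deg[OF \<beta>_def[symmetric]] by (auto simp: TZ_def i_def)
    have "i \<in> set_mset \<beta>" unfolding i_def using \<beta>0 by (intro Max_in) auto
    hence iM: "i \<in># M" using iS set\<beta> by simp
    define M' where "M' = M - {#i#}"
    have MM: "M = M' + {#i#}" using iM by (simp add: M'_def)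
    have i: "i < n" using iM M by auto
    have A': "(M', insert i S) \<in> Adm (Suc q)" using M S i iS fS by (auto simp: Adm_iff MM)
    have deg: "M' + mset_set (insert i S) = \<beta>" using fS iS by (simp add: MM \<beta>_def)
    have TD': "(M', insert i S) \<in> TD" unfolding TD_deg[OF deg] using \<beta>0 by (simp add: i_def)
    have mx: "Max (insert i S) = i" using TD_Max(2)[OF TD' A'] unfolding deg i_def[symmetric] by simp
    define v where "v = dd D (bas M' (insert i S))"
    have vX: "v \<in> Sp (Xd \<beta> q)" using bas_image[OF D A'] unfolding v_def deg .
    define c where "c = cf (v S) M"
    have c: "c \<noteq> 0" using lead_coeff[OF D A'] iS unfolding mx c_def v_def MM by simp
    \<comment> \<open>Dividing by the coefficient \<open>c\<close> cancels the term
      \<open>(M, S)\<close> exactly.\<close>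
    define r where "r = bas M S - sc (1 / c) v"
    have "r \<in> Sp (Xd \<beta> q)" unfolding r_def by (intro Sp_diff Sp_scale vX bas_Sp M XM)
    hence rX: "(N, T) \<in> Xd \<beta> q" if "cf (r T) N \<noteq> 0" for N T using that unfolding Sp_def by blast
    have rc: "cf (r T) N = cf (bas M S T) N - 1 / c * cf (v T) N" for T N
      by (simp add: r_def fun_act_def cf_diff cf_scale)
    \<comment> \<open>A surviving term of full multidegree outside \<open>TZ\<close> would have
      \<open>i\<close> outside \<open>T\<close>, and by \<open>lead\<close> it would be the
      cancelled pair. All other terms have smaller total degree, hence a smaller monomial, and fall
      under the induction hypothesis.\<close>
    have "(N, T) \<in> Xd \<beta> q \<inter> (TZ \<union> {(N, T). size N + q < size \<beta>})" if nz: "cf (r T) N \<noteq> 0" for N T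
    proof (rule ccontr)
      assume "\<not> ?thesis"
      hence nTZ: "(N, T) \<notin> TZ" and sz: "\<not> size N + q < size \<beta>" using rX[OF nz] by auto
      have NA: "(N, T) \<in> Adm q" and dN: "N + mset_set T = \<beta>" using rX[OF nz] sz by (auto simp: Xd_iff)
      have iT: "i \<notin> T" using nTZ \<beta>0 TD_deg[OF dN] by (auto simp: TZ_def i_def)
      have ne: "(N, T) \<noteq> (M, S)"
      proof
        assume "(N, T) = (M, S)"
        hence "cf (r T) N = 1 - 1 / c * c" using M by (simp add: rc bas_coeff c_def)
        thus False using nz c by simp
      qed
      hence "cf (bas M S T) N = 0" unfolding bas_coeff[OF M] by (simp only: if_False)
      hence "cf (v T) N \<noteq> 0" using nz by (auto simp: rc)
      hence "N = M' + {#i#} \<and> T = insert i S - {i}"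
        unfolding v_def using deg dN by (intro lead[OF D A' NA _ _ _ iT]) simp_all
      thus False using ne MM iS by simp
    qed
    hence rS: "r \<in> Sp (Xd \<beta> q \<inter> (TZ \<union> {(N, T). size N + q < size \<beta>}))" unfolding Sp_def by blast
    have "elim D q \<beta> r"
    proof (rule Sp_induct[OF rS, where P = "elim D q \<beta>"])
      show "Xd \<beta> q \<inter> (TZ \<union> {(N, T). size N + q < size \<beta>}) \<subseteq> Adm q" using Xd_Adm by blast
      fix N T assume NT: "(N, T) \<in> Xd \<beta> q \<inter> (TZ \<union> {(N, T). size N + q < size \<beta>})"
      show "elim D q \<beta> (bas N T)"
      proof (cases "(N, T) \<in> TZ")
        case True
        thus ?thesis using NT by (intro elim_TZ) auto
      next
        case False
        have NA: "(N, T) \<in> Adm q" using NT by (simp add: Xd_iff)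
        have s: "size N + q < size \<beta>" using NT False by auto
        have "size N < size M" using s size_deg[OF A] by (simp add: \<beta>_def)
        hence "elim D q (N + mset_set T) (bas N T)" using NA by (rule less.hyps)
        thus ?thesis by (rule elim_mono) (use s size_deg[OF NA] in simp)
      qed
    qed (auto intro: elim_zero elim_add elim_scale)
    moreover have "elim D q \<beta> v"
      unfolding elim_def
    proof (rule bexI)
      show "bas M' (insert i S) \<in> Sp (Xd \<beta> (Suc q) \<inter> TD)"
        using A' deg TD' by (intro bas_Sp) (auto simp: Xd_iff Adm_iff)
      show "v - dd D (bas M' (insert i S)) \<in> Sp (Xd \<beta> q \<inter> TZ)" by (simp add: v_def Sp_zero)
    qed
    ultimately have "elim D q \<beta> (r + sc (1 / c) v)" by (intro elim_add elim_scale)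
    thus ?thesis by (simp add: r_def)
  qed
  thus ?case by (simp only: \<beta>_def)
qed

lemma elim_all:
  assumes D: "good D q" and u: "u \<in> Sp (Xd \<beta> q)"
  shows "elim D q \<beta> u"
proof (rule Sp_induct[OF u Xd_Adm, where P = "elim D q \<beta>"])
  fix M S assume MS: "(M, S) \<in> Xd \<beta> q"
  hence A: "(M, S) \<in> Adm q" by (simp add: Xd_iff)
  have "M + mset_set S = \<beta> \<or> size (M + mset_set S) < size \<beta>"
    using MS size_deg[OF A] by (simp only: Xd_iff)
  thus "elim D q \<beta> (bas M S)" by (rule elim_mono[OF elim_bas[OF D A]])
qed (auto intro: elim_zero elim_add elim_scale)

lemma good_dd_dd:
  assumes D: "good D (Suc q)" and u: "u \<in> Sp (Adm (Suc (Suc q)))"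
  shows "dd D (dd D u) = 0"
proof (rule Sp_induct[OF u order_refl, where P = "\<lambda>u. dd D (dd D u) = 0"])
  fix M S assume A: "(M, S) \<in> Adm (Suc (Suc q))"
  hence S: "S \<subseteq> {..<n}" by (simp add: Adm_iff)
  have "dd D (bas M S) = fun_act (std M) (D S)" using dd_bas[OF S, of D M] by (auto simp: fun_act_def)
  moreover have "dd D (D S) = 0" using D A unfolding good_def Adm_iff by auto
  ultimately show "dd D (dd D (bas M S)) = 0" by (simp only: dd_act fun_act_zero)
qed (simp_all only: dd_zero dd_add dd_act fun_act_zero add_0)

lemma good_eps_dd:
  assumes D: "good D 0" and u: "u \<in> Sp (Adm (Suc 0))"
  shows "\<epsilon> (dd D u {}) = 0"
proof (rule Sp_induct[OF u order_refl, where P = "\<lambda>u. \<epsilon> (dd D u {}) = 0"])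
  fix M S assume A: "(M, S) \<in> Adm (Suc 0)"
  hence S: "S \<subseteq> {..<n}" by (simp add: Adm_iff)
  have "\<epsilon> (D S {}) = 0" using D A unfolding good_def Adm_iff by auto
  thus "\<epsilon> (dd D (bas M S) {}) = 0" unfolding dd_bas[OF S] by (simp add: aug_mult)
qed (simp_all add: dd_zero dd_add dd_act fun_act_apply aug_zero aug_add aug_mult)

text \<open>For a pair in the support with a monomial of maximal size, the leading term of its
  boundary cannot cancel: by size, any other contribution would need the same multidegree, so its
  basis vector would contain the same largest letter, and \<open>lead\<close> then recovers the same
  pair.\<close>

lemma dd_injective:
  assumes D: "good D q" and u: "u \<in> Sp (Adm (Suc q) \<inter> TD)" and 0: "dd D u = 0"
  shows "u = 0"
proof (rule ccontr)
  assume u0: "u \<noteq> 0"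
  have XA: "Adm (Suc q) \<inter> TD \<subseteq> Adm (Suc q)" by blast
  define F where "F = {p. cf (u (snd p)) (fst p) \<noteq> 0}"
  note ex = Sp_expand[OF u XA, folded F_def]
  have "F \<noteq> {}"
  proof
    assume "F = {}"
    hence "u = 0" by (intro trans[OF ex(3)]) (simp only: sum.empty)
    thus False using u0 by blast
  qed
  hence "Max ((\<lambda>p. size (fst p)) ` F) \<in> (\<lambda>p. size (fst p)) ` F" using ex(1) by (intro Max_in) auto
  then obtain p0 where p0: "Max ((\<lambda>p. size (fst p)) ` F) = size (fst p0)" "p0 \<in> F" by (rule imageE)
  obtain M S where p0': "p0 = (M, S)" by (cases p0)
  have MS: "(M, S) \<in> F" using p0(2) p0' by simp
  have mx: "size M' \<le> size M" if "(M', S') \<in> F" for M' S'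
  proof -
    have "size M' \<in> (\<lambda>p. size (fst p)) ` F" using that by (intro image_eqI[of _ _ "(M', S')"]) simp_all
    hence "size M' \<le> size (fst p0)" unfolding p0(1)[symmetric] using ex(1) by (intro Max_ge) simp_all
    thus ?thesis by (simp add: p0')
  qed
  have A: "(M, S) \<in> Adm (Suc q)" and T: "(M, S) \<in> TD" using subsetD[OF ex(2) MS] by simp_all
  define i where "i = Max S"
  have iS: "i \<in> S" and im: "Max (set_mset (M + mset_set S)) = i" using TD_Max[OF T A] by (simp_all add: i_def)
  have fS: "finite S" using A by (auto simp: Adm_iff intro: finite_subset)
  define N R where "N = M + {#i#}" and "R = S - {i}"
  have NR: "(N, R) \<in> Adm q" using A iS fS by (auto simp: Adm_iff N_def R_def)
  have "insert i R = S" "i \<notin> R" "finite R" using iS fS by (auto simp: R_def)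
  hence "mset_set S = add_mset i (mset_set R)" by (metis mset_set.insert)
  hence deg: "N + mset_set R = M + mset_set S" by (simp add: N_def)
  have "cf (dd D u R) N = (\<Sum>p\<in>F. cf (u (snd p)) (fst p) * cf (dd D (bas (fst p) (snd p)) R) N)"
  proof -
    have ds: "dd D (\<Sum>p\<in>F. f p) = (\<Sum>p\<in>F. dd D (f p))" for f
      using ex(1) by (induction F rule: finite_induct) (simp_all only: sum.empty sum.insert dd_zero dd_add not_False_eq_True)
    have "dd D u = (\<Sum>p\<in>F. sc (cf (u (snd p)) (fst p)) (dd D (bas (fst p) (snd p))))"
      by (rule trans[OF arg_cong[OF ex(3)]]) (simp only: ds dd_act)
    thus ?thesis by (simp only: sum_fun_apply fun_act_def cf_sum cf_scale)
  qed
  also have "\<dots> = (\<Sum>p\<in>F. if p = (M, S) then cf (u S) M * cf (dd D (bas M S) R) N else 0)"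
  proof (intro sum.cong refl)
    fix p assume p: "p \<in> F"
    obtain M' S' where p': "p = (M', S')" by (cases p)
    have A': "(M', S') \<in> Adm (Suc q)" and T': "(M', S') \<in> TD" using subsetD[OF ex(2) p] by (simp_all add: p')
    have "p = (M, S)" if nz: "cf (dd D (bas M' S') R) N \<noteq> 0"
    proof -
      have "(N, R) \<in> Xd (M' + mset_set S') q" using bas_image[OF D A'] nz unfolding Sp_def by blast
      moreover have "size N + q = size M + Suc q" by (simp add: N_def)
      moreover have "size (M' + mset_set S') \<le> size M + Suc q" using mx[of M' S'] p size_deg[OF A'] by (simp add: p')
      moreover from calculation(2,3) have "\<not> size N + q < size (M' + mset_set S')" by linarith
      ultimately have d: "N + mset_set R = M' + mset_set S'" unfolding Xd_iff by blast
      have "i \<in> S'" using T' TD_deg[OF d[symmetric]] unfolding deg im by blast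
      hence e: "N = M' + {#i#} \<and> R = S' - {i}" by (rule lead[OF D A' NR d nz]) (simp add: R_def)
      have "S = S'" using e iS \<open>i \<in> S'\<close> unfolding R_def by (metis insert_Diff)
      moreover have "M = M'" using e by (simp add: N_def)
      ultimately show ?thesis by (simp add: p')
    qed
    thus "cf (u (snd p)) (fst p) * cf (dd D (bas (fst p) (snd p)) R) N =
        (if p = (M, S) then cf (u S) M * cf (dd D (bas M S) R) N else 0)"
      by (cases "p = (M, S)") (simp_all only: p' if_True if_False fst_conv snd_conv, auto)
  qed
  also have "\<dots> = cf (u S) M * cf (dd D (bas M S) R) N" using ex(1) MS by simp
  finally have "cf (u S) M * cf (dd D (bas M S) R) N = 0" by (simp add: 0 cf_zero)
  moreover have "cf (dd D (bas M S) R) N \<noteq> 0" using lead_coeff[OF D A] by (simp add: N_def R_def i_def)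
  ultimately show False using MS by (simp add: F_def)
qed

lemma TZ_level: "Adm (Suc q) \<inter> TZ = Adm (Suc q) \<inter> TD"
  by (auto simp: TZ_def Adm_iff)

text \<open>In position 0 only the unmatched pair is left, so \<open>u\<close> is a scalar, and the
  augmentation detects scalars.\<close>

lemma Sp_Adm_0:
  assumes u: "u \<in> Sp (Adm 0 \<inter> TZ)" and e: "\<epsilon> (u {}) = 0"
  shows "u = 0"
proof -
  have c0: "cf (u S) M = 0" if "(M, S) \<noteq> ({#}, {})" for M S
  proof (rule ccontr)
    assume "cf (u S) M \<noteq> 0"
    hence MS: "(M, S) \<in> Adm 0 \<inter> TZ" using u unfolding Sp_def by blast
    hence "S = {}" using finite_subset[of S "{..<n}"] by (auto simp: Adm_iff)
    thus False using MS that by (auto simp: TZ_def TD_def)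
  qed
  have "u {} = \<iota> (cf (u {}) {#}) * std {#}"
    using cf_expand[of "u {}" "{{#}}"] c0 by auto
  hence u0: "u {} = \<iota> (cf (u {}) {#})" by (simp add: std_def wd_Nil)
  hence "cf (u {}) {#} = 0" using e aug_iota by metis
  hence "cf (u S) M = cf 0 M" for S M using c0[of M S] by (cases "(M, S) = ({#}, {})") (auto simp: cf_zero)
  hence "u S = 0" for S by (intro cf_ext)
  thus ?thesis by auto
qed

text \<open>A cycle is reduced modulo boundaries to \<open>TZ\<close>, which in positive positions
  is \<open>TD\<close>; the remainder is a cycle there, hence zero by injectivity. The preimage
  found is again bounded by \<open>\<beta>\<close> and supported in \<open>TD\<close>.\<close>

lemma good_kernel_Suc:
  assumes "good D q" "good D (Suc q)" "u \<in> Sp (Xd \<beta> (Suc q))" "dd D u = 0"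
  shows "\<exists>w\<in>Sp (Xd \<beta> (Suc (Suc q)) \<inter> TD). u = dd D w"
proof -
  obtain w where w: "w \<in> Sp (Xd \<beta> (Suc (Suc q)) \<inter> TD)" "u - dd D w \<in> Sp (Xd \<beta> (Suc q) \<inter> TZ)"
    using elim_all[OF assms(2,3)] unfolding elim_def by blast
  have "w \<in> Sp (Adm (Suc (Suc q)))" by (rule Sp_mono[OF _ w(1)]) (use Xd_Adm in blast)
  hence "dd D (u - dd D w) = 0" using good_dd_dd[OF assms(2)] assms(4) by (simp add: dd_diff)
  moreover have "u - dd D w \<in> Sp (Adm (Suc q) \<inter> TD)"
    unfolding TZ_level[symmetric] by (rule Sp_mono[OF _ w(2)]) (use Xd_Adm in blast)
  ultimately have "u - dd D w = 0" using dd_injective[OF assms(1)] by blast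
  thus ?thesis using w(1) by auto
qed

lemma good_kernel_0:
  assumes "good D 0" "u \<in> Sp (Xd \<beta> 0)" "\<epsilon> (u {}) = 0"
  shows "\<exists>w\<in>Sp (Xd \<beta> (Suc 0) \<inter> TD). u = dd D w"
proof -
  obtain w where w: "w \<in> Sp (Xd \<beta> (Suc 0) \<inter> TD)" "u - dd D w \<in> Sp (Xd \<beta> 0 \<inter> TZ)"
    using elim_all[OF assms(1,2)] unfolding elim_def by blast
  have "w \<in> Sp (Adm (Suc 0))" by (rule Sp_mono[OF _ w(1)]) (use Xd_Adm in blast)
  hence "\<epsilon> (dd D w {}) = 0" by (rule good_eps_dd[OF assms(1)])
  moreover have "\<epsilon> ((u - dd D w) {} + dd D w {}) = \<epsilon> (u {})" by simp
  ultimately have "\<epsilon> ((u - dd D w) {}) = 0" using assms(3) unfolding aug_add by simp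
  moreover have "u - dd D w \<in> Sp (Adm 0 \<inter> TZ)"
    by (rule Sp_mono[OF _ w(2)]) (use Xd_Adm in blast)
  ultimately have "u - dd D w = 0" using Sp_Adm_0 by blast
  thus ?thesis using w(1) by auto
qed

lemma Sp_Adm: "Sp (Adm q) = {u. \<forall>T. T \<notin> {S. S \<subseteq> {..<n} \<and> card S = q} \<longrightarrow> u T = 0}"
proof (rule Set.set_eqI)
  fix u :: "nat set \<Rightarrow> 'a"
  have "u S = 0" if "u \<in> Sp (Adm q)" "\<not> (S \<subseteq> {..<n} \<and> card S = q)" for S
  proof (rule cf_ext)
    fix M
    have "(M, S) \<notin> Adm q" using that(2) unfolding Adm_iff by blast
    thus "cf (u S) M = cf 0 M" using that(1) unfolding Sp_def cf_zero by blast
  qed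
  moreover have "u \<in> Sp (Adm q)" if "\<And>T. T \<notin> {S. S \<subseteq> {..<n} \<and> card S = q} \<Longrightarrow> u T = 0"
    unfolding Sp_def
  proof (intro CollectI allI impI)
    fix M S assume nz: "cf (u S) M \<noteq> 0"
    hence "M \<in> MS" "u S \<noteq> 0" using cf_outside cf_zero by metis+
    thus "(M, S) \<in> Adm q" using that unfolding Adm_iff by blast
  qed
  ultimately show "u \<in> Sp (Adm q) \<longleftrightarrow> u \<in> {u. \<forall>T. T \<notin> {S. S \<subseteq> {..<n} \<and> card S = q} \<longrightarrow> u T = 0}" by blast
qed

lemma dd_cong:
  assumes "u \<in> Sp (Adm q)" "\<And>S. card S = q \<Longrightarrow> D S = D' S"
  shows "dd D u = dd D' u"
proof -
  have "u S * D S T = u S * D' S T" for S T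
    using assms unfolding Sp_Adm by (cases "card S = q") auto
  thus ?thesis by (simp add: dd_def)
qed

lemma good_cong:
  assumes D: "good D q" and eq: "\<And>S. card S \<le> Suc q \<Longrightarrow> D S = D' S"
  shows "good D' q"
  unfolding good_def
proof (intro allI impI)
  fix S assume S: "S \<subseteq> {..<n} \<and> card S = Suc q"
  hence d: "D S \<in> Sp (Xd (mset_set S) q)" "cf (D S (S - {Max S})) {#Max S#} = 1"
    "if q = 0 then \<epsilon> (D S {}) = 0 else dd D (D S) = 0" using D unfolding good_def by blast+
  have e: "D' S = D S" using S eq by simp
  have "dd D' (D S) = dd D (D S)"
    by (rule dd_cong[OF Sp_mono[OF Xd_Adm d(1)]]) (simp add: eq)
  thus "D' S \<in> Sp (Xd (mset_set S) q) \<and> cf (D' S (S - {Max S})) {#Max S#} = 1 \<and>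
     (if q = 0 then \<epsilon> (D' S {}) = 0 else dd D' (D' S) = 0)" using d unfolding e by simp
qed

text \<open>The boundary of \<open>S\<close> starts from its prescribed leading term, the letter
  \<open>i = Max S\<close> times the basis vector of \<open>S - {i}\<close>. The boundary of that
  term is a cycle one position lower (for \<open>q = 1\<close>, an element of augmentation zero),
  hence also the boundary of some \<open>w\<close> supported in \<open>TD\<close>; subtracting
  \<open>w\<close> gives a cycle.\<close>

lemma good_step:
  assumes D: "\<And>q'. q' < q \<Longrightarrow> good D q'" and S: "S \<subseteq> {..<n}" "card S = Suc q"
  shows "\<exists>d. d \<in> Sp (Xd (mset_set S) q) \<and> cf (d (S - {Max S})) {#Max S#} = 1 \<and>
    (if q = 0 then \<epsilon> (d {}) = 0 else dd D d = 0)"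
proof -
  define i where "i = Max S"
  define S' where "S' = S - {i}"
  have fS: "finite S" using S(1) finite_subset by blast
  have iS: "i \<in> S" unfolding i_def using fS S(2) by (intro Max_in) auto
  have cS': "card S' = q" using S(2) fS iS by (simp add: S'_def)
  have i: "{#i#} \<in> MS" using iS S(1) by auto
  have "insert i S' = S" "i \<notin> S'" "finite S'" using iS fS by (auto simp: S'_def)
  hence deg: "{#i#} + mset_set S' = mset_set S" by (metis mset_set.insert add_mset_add_single add.commute)
  have A: "({#i#}, S') \<in> Adm q" using i S(1) cS' by (auto simp: Adm_iff S'_def)
  have X: "({#i#}, S') \<in> Xd (mset_set S) q" using A deg by (simp add: Xd_iff)
  have sS: "size (mset_set S) = Suc q" using S(2) by simp
  let ?v = "bas {#i#} S'"
  have v: "?v \<in> Sp (Xd (mset_set S) q)" by (rule bas_Sp[OF i X])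
  show ?thesis
  proof (cases q)
    case 0
    hence S0: "S' = {}" using cS' \<open>finite S'\<close> by simp
    \<comment> \<open>The augmentation of the variable need not vanish, so its value is subtracted
      as a constant term.\<close>
    define d where "d = ?v - sc (\<epsilon> (?v {})) (bas {#} {})"
    have "({#}, {}) \<in> Xd (mset_set S) q" using sS 0 by (simp add: Xd_iff Adm_iff)
    hence "d \<in> Sp (Xd (mset_set S) q)" unfolding d_def by (intro Sp_diff Sp_scale v bas_Sp) auto
    moreover have "cf (d {}) {#i#} = 1"
      using i by (simp add: d_def fun_act_def cf_diff cf_scale bas_coeff S0)
    moreover have "\<epsilon> (d {}) = 0"
    proof -
      have "d {} + \<iota> (\<epsilon> (?v {})) = ?v {}" by (simp add: d_def fun_act_def bas_def[of "{#}"] std_def wd_Nil)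
      hence "\<epsilon> (d {}) + \<epsilon> (?v {}) = \<epsilon> (?v {})" by (metis aug_add aug_iota)
      thus ?thesis by simp
    qed
    ultimately show ?thesis
      unfolding i_def[symmetric] S'_def[symmetric] S0 using 0 by (intro exI[of _ d]) simp
  next
    case (Suc p)
    have Dp: "good D p" using D Suc by simp
    have vA: "?v \<in> Sp (Adm (Suc p))" using Sp_mono[OF Xd_Adm v] Suc by simp
    have y: "dd D ?v \<in> Sp (Xd (mset_set S) p)" using dd_image[OF Dp] v Suc by simp
    have "\<exists>w\<in>Sp (Xd (mset_set S) (Suc p) \<inter> TD). dd D ?v = dd D w"
    proof (cases p)
      case 0
      thus ?thesis using good_kernel_0[of D "dd D ?v"] good_eps_dd[of D ?v] Dp y vA by simp
    next
      case (Suc p')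
      thus ?thesis using good_kernel_Suc[of D p' "dd D ?v"] good_dd_dd[of D p' ?v] D[of p'] \<open>q = Suc p\<close> Dp y vA by simp
    qed
    then obtain w where w: "w \<in> Sp (Xd (mset_set S) (Suc p) \<inter> TD)" "dd D ?v = dd D w" by blast
    define d where "d = ?v - w"
    have "w \<in> Sp (Xd (mset_set S) q)" using Sp_mono[OF _ w(1)] Suc by blast
    hence "d \<in> Sp (Xd (mset_set S) q)" unfolding d_def by (intro Sp_diff v)
    moreover have "dd D d = 0" by (simp add: d_def dd_diff w(2))
    moreover have "cf (d S') {#i#} = 1"
    proof -
      \<comment> \<open>The leading pair has its largest letter in the monomial and so lies outside
        \<open>TD\<close>. Hence the correction \<open>w\<close> does not disturb the coefficient
        1.\<close>
      have "Max (set_mset (mset_set S)) = i" using fS by (simp add: i_def)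
      hence "({#i#}, S') \<notin> TD" using TD_deg[OF deg] \<open>i \<notin> S'\<close> by simp
      hence "cf (w S') {#i#} = 0" using w(1) unfolding Sp_def by blast
      thus ?thesis using i by (simp add: d_def cf_diff bas_coeff)
    qed
    ultimately show ?thesis using Suc by (auto simp: S'_def i_def)
  qed
qed

text \<open>The family is built by the cardinality of \<open>S\<close>; by \<open>good_cong\<close>
  a new level leaves the conditions on the earlier ones intact.\<close>

lemma good_exists: "\<exists>D. \<forall>q'<q. good D q'"
proof (induction q)
  case (Suc q)
  then obtain D where D: "\<And>q'. q' < q \<Longrightarrow> good D q'" by blast
  have "\<forall>S. \<exists>d. S \<subseteq> {..<n} \<and> card S = Suc q \<longrightarrow> d \<in> Sp (Xd (mset_set S) q) \<and> cf (d (S - {Max S})) {#Max S#} = 1 \<and>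
      (if q = 0 then \<epsilon> (d {}) = 0 else dd D d = 0)"
    using good_step[OF D] by meson
  then obtain d where d: "\<And>S. S \<subseteq> {..<n} \<and> card S = Suc q \<Longrightarrow> d S \<in> Sp (Xd (mset_set S) q) \<and>
      cf (d S (S - {Max S})) {#Max S#} = 1 \<and> (if q = 0 then \<epsilon> (d S {}) = 0 else dd D (d S) = 0)"
    by metis
  define D' where "D' S = (if card S = Suc q then d S else D S)" for S
  have "good D' q"
    unfolding good_def
  proof (intro allI impI)
    fix S assume S: "S \<subseteq> {..<n} \<and> card S = Suc q"
    have e: "D' S = d S" using S by (simp add: D'_def)
    have "dd D' (d S) = dd D (d S)"
      by (rule dd_cong[OF Sp_mono[OF Xd_Adm conjunct1[OF d[OF S]]]]) (simp add: D'_def)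
    thus "D' S \<in> Sp (Xd (mset_set S) q) \<and> cf (D' S (S - {Max S})) {#Max S#} = 1 \<and>
       (if q = 0 then \<epsilon> (D' S {}) = 0 else dd D' (D' S) = 0)" using d[OF S] unfolding e by simp
  qed
  moreover have "good D' q'" if "q' < q" for q'
    by (rule good_cong[OF D[OF that]]) (use that in \<open>simp add: D'_def\<close>)
  ultimately show ?case using less_Suc_eq by metis
qed simp

lemma Sp_bounded:
  assumes "u \<in> Sp (Adm q)"
  shows "\<exists>\<beta>. u \<in> Sp (Xd \<beta> q)"
proof -
  let ?F = "{p. cf (u (snd p)) (fst p) \<noteq> 0}"
  have "finite ((\<lambda>p. size (fst p)) ` ?F)" using Sp_expand(1)[OF assms order_refl] by simp
  then obtain k where k: "\<forall>j\<in>(\<lambda>p. size (fst p)) ` ?F. j < k" using finite_nat_set_iff_bounded by blast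
  \<comment> \<open>Only the size of this multiset matters: it makes every pair in the support
    strictly smaller. The letter 0 is arbitrary.\<close>
  have "u \<in> Sp (Xd (replicate_mset (k + q) 0) q)"
    unfolding Sp_def
  proof (intro CollectI allI impI)
    fix M S assume nz: "cf (u S) M \<noteq> 0"
    hence "size M \<in> (\<lambda>p. size (fst p)) ` ?F" by (intro image_eqI[of _ _ "(M, S)"]) simp_all
    hence "size M < k" using k by blast
    moreover have "(M, S) \<in> Adm q" using assms nz unfolding Sp_def by blast
    ultimately show "(M, S) \<in> Xd (replicate_mset (k + q) 0) q" by (simp add: Xd_iff)
  qed
  thus ?thesis by blast
qed

theorem pbw_resolution:
  "\<exists>Q :: ('a, 'k, nat set \<Rightarrow> 'a) resolution. free_resolution \<epsilon> Q \<and> (\<forall>i>n. obj Q i = {0})"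
proof -
  obtain D where D': "\<forall>q'<n. good D q'" using good_exists by blast
  \<comment> \<open>From \<open>q = n\<close> on there is no subset with \<open>q + 1\<close>
    elements, and the condition is vacuous.\<close>
  have D: "good D q" for q
  proof (cases "q < n")
    case False
    have "\<not> (S \<subseteq> {..<n} \<and> card S = Suc q)" for S using card_mono[of "{..<n}" S] False by auto
    thus ?thesis unfolding good_def by blast
  qed (use D' in blast)
  define O' where "O' q = {u :: nat set \<Rightarrow> 'a. \<forall>T. T \<notin> {S. S \<subseteq> {..<n} \<and> card S = q} \<longrightarrow> u T = 0}" for q
  have O'Sp: "O' q = Sp (Adm q)" for q unfolding Sp_Adm O'_def ..
  define Q :: "('a, 'k, nat set \<Rightarrow> 'a) resolution"
    where "Q = \<lparr>act = fun_act, obj = O', bd = (\<lambda>q. dd D), aug = (\<lambda>u. \<epsilon> (u {}))\<rparr>"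
  have sel: "act Q = fun_act" "obj Q = O'" "bd Q = (\<lambda>q. dd D)" "aug Q = (\<lambda>u. \<epsilon> (u {}))" by (simp_all add: Q_def)
  have im: "dd D u \<in> O' q" if u: "u \<in> O' (Suc q)" for u q
  proof -
    obtain \<beta> where "u \<in> Sp (Xd \<beta> (Suc q))" using Sp_bounded u unfolding O'Sp by blast
    hence "dd D u \<in> Sp (Xd \<beta> q)" by (rule dd_image[OF D])
    thus ?thesis unfolding O'Sp by (rule Sp_mono[OF Xd_Adm])
  qed
  have "free_resolution \<epsilon> Q"
    unfolding free_resolution_def sel
  proof (intro conjI allI)
    show "left_module (fun_act :: 'a \<Rightarrow> (nat set \<Rightarrow> 'a) \<Rightarrow> _)" by (rule left_module_fun_act)
    show "free_submodule fun_act (O' q)" for q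
      unfolding O'_def by (rule free_submodule_fun) simp
    show "linear_on fun_act (O' (Suc i)) fun_act (dd D)" for i
      unfolding linear_on_def using dd_add dd_act by blast
    show "linear_on fun_act (O' 0) (trivial_act \<epsilon>) (\<lambda>u. \<epsilon> (u {}))"
      unfolding linear_on_def trivial_act_def by (simp add: aug_add aug_mult fun_act_def)
    show "(\<lambda>u. \<epsilon> (u {})) ` O' 0 = UNIV"
    proof (intro equalityI subset_UNIV subsetI)
      fix c :: 'k
      have "(\<lambda>T. if T = {} then \<iota> c else 0) \<in> O' 0" by (auto simp: O'_def)
      thus "c \<in> (\<lambda>u. \<epsilon> (u {})) ` O' 0"
        by (intro image_eqI[of _ _ "\<lambda>T. if T = {} then \<iota> c else 0"]) (simp_all add: aug_iota)
    qed
    show "dd D ` O' (Suc 0) = {u \<in> O' 0. \<epsilon> (u {}) = 0}"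
    proof (intro equalityI subsetI)
      fix u assume "u \<in> dd D ` O' (Suc 0)"
      then obtain w where w: "w \<in> O' (Suc 0)" "u = dd D w" by blast
      thus "u \<in> {u \<in> O' 0. \<epsilon> (u {}) = 0}" using im[OF w(1)] good_eps_dd[OF D, of w] by (simp add: O'Sp)
    next
      fix u assume u: "u \<in> {u \<in> O' 0. \<epsilon> (u {}) = 0}"
      then obtain \<beta> where "u \<in> Sp (Xd \<beta> 0)" using Sp_bounded unfolding O'Sp by blast
      then obtain w where w: "w \<in> Sp (Xd \<beta> (Suc 0) \<inter> TD)" "u = dd D w"
        using good_kernel_0[OF D[of 0], of u \<beta>] u by blast
      have "w \<in> O' (Suc 0)" unfolding O'Sp by (rule Sp_mono[OF _ w(1)]) (use Xd_Adm in blast)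
      thus "u \<in> dd D ` O' (Suc 0)" using w(2) by blast
    qed
    show "dd D ` O' (Suc (Suc i)) = {u \<in> O' (Suc i). dd D u = 0}" for i
    proof (intro equalityI subsetI)
      fix u assume "u \<in> dd D ` O' (Suc (Suc i))"
      then obtain w where w: "w \<in> O' (Suc (Suc i))" "u = dd D w" by blast
      thus "u \<in> {u \<in> O' (Suc i). dd D u = 0}" using im[OF w(1)] good_dd_dd[OF D, of w i] by (simp add: O'Sp)
    next
      fix u assume u: "u \<in> {u \<in> O' (Suc i). dd D u = 0}"
      then obtain \<beta> where "u \<in> Sp (Xd \<beta> (Suc i))" using Sp_bounded unfolding O'Sp by blast
      then obtain w where w: "w \<in> Sp (Xd \<beta> (Suc (Suc i)) \<inter> TD)" "u = dd D w"
        using good_kernel_Suc[OF D[of i] D[of "Suc i"], of u \<beta>] u by blast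
      have "w \<in> O' (Suc (Suc i))" unfolding O'Sp by (rule Sp_mono[OF _ w(1)]) (use Xd_Adm in blast)
      thus "u \<in> dd D ` O' (Suc (Suc i))" using w(2) by blast
    qed
  qed
  moreover have "obj Q i = {0}" if "n < i" for i
  proof -
    have "\<not> (S \<subseteq> {..<n} \<and> card S = i)" for S using card_mono[of "{..<n}" S] that by auto
    hence "u = 0" if "u \<in> O' i" for u using that unfolding O'_def by (intro ext) simp
    moreover have "0 \<in> O' i" by (simp add: O'_def)
    ultimately show ?thesis unfolding sel by blast
  qed
  ultimately show ?thesis by blast
qed

end

subsection \<open>Power series with a polynomial inverse\<close>

text \<open>Each positive power in the bound forces a zero at 0 by continuity along
  \<open>1 / k\<close>; dividing the factor out lowers the exponent by one.\<close>

lemma poly_vanishing_order: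
  fixes p :: "real poly"
  assumes "\<And>k. 2 \<le> k \<Longrightarrow> \<bar>poly p (1 / real k)\<bar> \<le> K * (1 / real k) ^ n"
  shows "\<exists>r. p = Polynomial.monom 1 n * r"
  using assms
proof (induction n arbitrary: p)
  case 0
  show ?case by (intro exI[of _ p]) simp
next
  case (Suc n)
  obtain a p' where p: "p = pCons a p'" by (cases p)
  have l0: "(\<lambda>k. 1 / real k) \<longlonglongrightarrow> 0" by (rule lim_1_over_n)
  have "(\<lambda>k. poly p (1 / real k)) \<longlonglongrightarrow> poly p 0"
    by (rule isCont_tendsto_compose[OF _ l0]) simp
  moreover have "(\<lambda>k. poly p (1 / real k)) \<longlonglongrightarrow> 0"
  proof (rule tendsto_rabs_zero_cancel, rule tendsto_sandwich[where f = "\<lambda>_. 0" and h = "\<lambda>k. K * (1 / real k) ^ Suc n"])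
    show "\<forall>\<^sub>F k in sequentially. \<bar>poly p (1 / real k)\<bar> \<le> K * (1 / real k) ^ Suc n"
      using Suc.prems by (intro eventually_sequentiallyI[of 2])
    show "(\<lambda>k. K * (1 / real k) ^ Suc n) \<longlonglongrightarrow> 0"
      using tendsto_mult[OF tendsto_const[of K] tendsto_power[OF l0, of "Suc n"]] by simp
    show "(\<lambda>k. 0 :: real) \<longlonglongrightarrow> 0" by simp
  qed simp
  ultimately have a: "a = 0" using LIMSEQ_unique by (fastforce simp: p)
  have "\<bar>poly p' (1 / real k)\<bar> \<le> K * (1 / real k) ^ n" if k: "2 \<le> k" for k
  proof -
    have "\<bar>1 / real k\<bar> * \<bar>poly p' (1 / real k)\<bar> \<le> (1 / real k) * (K * (1 / real k) ^ n)"
      using Suc.prems[OF k] by (simp add: p a abs_mult[symmetric] ac_simps)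
    moreover have "0 < 1 / real k" using k by simp
    ultimately show ?thesis by (metis abs_of_pos mult_le_cancel_left_pos)
  qed
  from Suc.IH[OF this] obtain r where "p' = Polynomial.monom 1 n * r" by blast
  hence "p = Polynomial.monom 1 (Suc n) * r" by (simp add: p a monom_Suc)
  thus ?case by blast
qed

lemma summable_polynomial_growth:
  fixes h :: "nat \<Rightarrow> nat"
  assumes up: "\<And>p. h p \<le> (e * p + 1) ^ n" and t: "0 < t" "t < (1 :: real)"
  shows "summable (\<lambda>p. real (h p) * t ^ p)"
proof -
  \<comment> \<open>With \<open>t = u ^ (n + 1)\<close>, the factor \<open>u ^ p\<close> taken
    \<open>n\<close> times absorbs the polynomial growth, and one factor is left for a convergent
    geometric series.\<close>
  define u where "u = root (Suc n) t"
  have u: "0 < u" "u < 1" using t by (simp_all add: u_def)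
  have ut: "u ^ Suc n = t" unfolding u_def using t by (intro real_root_pow_pos2) auto
  have "(\<lambda>p. real p * u ^ p + u ^ p) \<longlonglongrightarrow> 0 + 0"
    using u by (intro tendsto_add powser_times_n_limit_0 LIMSEQ_realpow_zero) auto
  hence "Bseq (\<lambda>p. real p * u ^ p + u ^ p)" by (intro convergent_imp_Bseq convergentI)
  then obtain B where B: "0 < B" "\<And>p. norm (real p * u ^ p + u ^ p) \<le> B" unfolding Bseq_def by blast
  show ?thesis
  proof (rule summable_comparison_test')
    show "summable (\<lambda>p. ((real e + 1) * B) ^ n * u ^ p)"
      using u by (intro summable_mult summable_geometric) simp
    fix p
    have "real (e * p + 1) * u ^ p \<le> (real e + 1) * ((real p + 1) * u ^ p)"
      using u by (simp add: algebra_simps mult_right_mono)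
    also have "\<dots> \<le> (real e + 1) * B"
      using B(2)[of p] u by (intro mult_left_mono) (simp_all add: algebra_simps)
    finally have 1: "real (e * p + 1) * u ^ p \<le> (real e + 1) * B" .
    have tp: "t ^ p = (u ^ p) ^ n * u ^ p"
      unfolding ut[symmetric] by (simp add: power_mult[symmetric] power_add[symmetric] algebra_simps)
    have "real (h p) \<le> real (e * p + 1) ^ n" using up[of p] by (metis of_nat_le_iff of_nat_power)
    hence "real (h p) * t ^ p \<le> real (e * p + 1) ^ n * t ^ p" using t by (intro mult_right_mono) auto
    also have "\<dots> = (real (e * p + 1) * u ^ p) ^ n * u ^ p" unfolding tp power_mult_distrib by simp
    also have "\<dots> \<le> ((real e + 1) * B) ^ n * u ^ p"
      using 1 u by (intro mult_right_mono power_mono) auto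
    finally show "norm (real (h p) * t ^ p) \<le> ((real e + 1) * B) ^ n * u ^ p" using t by simp
  qed
qed

text \<open>The inverse of \<open>1 - 1 / k\<close> is \<open>1 + 1 / (k - 1)\<close>. Its
  \<open>k\<close>-th power is at most \<open>exp (k / (k - 1))\<close>, and the exponent is at most
  2 for \<open>k \<ge> 2\<close>.\<close>

lemma one_minus_inverse_power: "2 \<le> k \<Longrightarrow> exp (- 2) \<le> (1 - 1 / real k) ^ k"
proof -
  assume k: "2 \<le> k"
  define y where "y = 1 / (real k - 1)"
  have y: "0 < y" "1 - 1 / real k = 1 / (1 + y)" "real k * y \<le> 2"
    using k by (auto simp: y_def field_simps)
  have "(1 + y) ^ k \<le> exp y ^ k" using y by (intro power_mono) auto
  also have "\<dots> = exp (real k * y)" by (simp add: exp_of_nat_mult)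
  also have "\<dots> \<le> exp 2" using y by simp
  finally have "(1 + y) ^ k \<le> exp 2" .
  hence "1 / exp 2 \<le> 1 / (1 + y) ^ k" using y by (intro divide_left_mono) auto
  thus ?thesis unfolding y(2) by (simp add: exp_minus power_one_over inverse_eq_divide)
qed

text \<open>
  The inverse of the series is a polynomial of degree at most \<open>n\<close> which, by the lower bound on the growth,
  vanishes to order \<open>n\<close> at \<open>1\<close>.
\<close>

lemma alternating_inverse_series:
  fixes b h :: "nat \<Rightarrow> nat"
  assumes euler: "\<And>N. 0 < N \<Longrightarrow> (\<Sum>i\<le>N. (- 1) ^ i * int (b i * h (N - i))) = 0"
    and start: "b 0 = 1" "h 0 = 1"
    and vanish: "\<And>i. n < i \<Longrightarrow> b i = 0"
    and lower: "\<And>k. k ^ n \<le> (\<Sum>p\<le>C * k. h p)"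
    and upper: "\<And>p. h p \<le> (e * p + 1) ^ n"
  shows "b i = n choose i"
proof -
  \<comment> \<open>With the signs included, \<open>koszul_euler\<close> reads as a Cauchy product,
    and \<open>P\<close> is the inverse of the series of \<open>h\<close>.\<close>
  define q where "q i = (- 1) ^ i * real (b i)" for i
  define P where "P = (\<Sum>i\<le>n. Polynomial.monom (q i) i)"
  have cP: "Polynomial.coeff P i = q i" for i
    using vanish[of i] by (simp add: P_def Polynomial.coeff_sum q_def)
  have Pt: "poly P t = (\<Sum>i\<le>n. q i * t ^ i)" for t by (simp add: P_def poly_sum poly_monom)
  have conv: "(\<Sum>i\<le>N. q i * real (h (N - i))) = (if N = 0 then 1 else 0)" for N
  proof (cases "N = 0")
    case False
    have "(\<Sum>i\<le>N. q i * real (h (N - i))) = of_int (\<Sum>i\<le>N. (- 1) ^ i * int (b i * h (N - i)))"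
      by (simp add: q_def mult.assoc)
    also have "\<dots> = 0" using euler[of N] False by (simp only: of_int_0)
    finally show ?thesis using False by simp
  qed (simp add: q_def start)
  have prod: "poly P t * suminf (\<lambda>p. real (h p) * t ^ p) = 1" if t: "0 < t" "t < 1" for t
  proof -
    have q0: "q i * t ^ i = 0" if "i \<notin> {..n}" for i using vanish[of i] that by (simp add: q_def)
    have sq: "summable (\<lambda>i. norm (q i * t ^ i))"
      by (rule summable_finite[of "{..n}"]) (use q0 in auto)
    have sh: "summable (\<lambda>p. norm (real (h p) * t ^ p))"
      using summable_polynomial_growth[OF upper t] t by simp
    have "(\<lambda>N. \<Sum>i\<le>N. (q i * t ^ i) * (real (h (N - i)) * t ^ (N - i))) sums
        (suminf (\<lambda>i. q i * t ^ i) * suminf (\<lambda>p. real (h p) * t ^ p))"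
      by (rule Cauchy_product_sums[OF sq sh])
    moreover have "(\<Sum>i\<le>N. (q i * t ^ i) * (real (h (N - i)) * t ^ (N - i))) = (if N = 0 then 1 else 0)" for N
    proof -
      have "(\<Sum>i\<le>N. (q i * t ^ i) * (real (h (N - i)) * t ^ (N - i))) = (\<Sum>i\<le>N. q i * real (h (N - i)) * t ^ N)"
        by (intro sum.cong refl) (simp add: power_add[symmetric])
      thus ?thesis using conv[of N] by (simp add: sum_distrib_right[symmetric])
    qed
    ultimately have "(\<lambda>N. if N = 0 then 1 else (0 :: real)) sums (suminf (\<lambda>i. q i * t ^ i) * suminf (\<lambda>p. real (h p) * t ^ p))"
      by simp
    moreover have "(\<lambda>N. if N = 0 then 1 else (0 :: real)) sums 1" using sums_single[of 0 "\<lambda>_. 1 :: real"] by simp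
    ultimately have "suminf (\<lambda>i. q i * t ^ i) * suminf (\<lambda>p. real (h p) * t ^ p) = 1" by (rule sums_unique2)
    moreover have "suminf (\<lambda>i. q i * t ^ i) = poly P t"
      unfolding Pt by (rule suminf_finite) (use q0 in auto)
    ultimately show ?thesis by simp
  qed
  \<comment> \<open>Only the terms up to \<open>C * k\<close> are used. For them
    \<open>t ^ p \<ge> t ^ (C * k) \<ge> exp (- 2 * C)\<close>, so the lower bound on the partial
    sums makes the series at \<open>t\<close> at least a constant times \<open>k ^ n\<close>, and
    its inverse correspondingly small.\<close>
  have bound: "\<bar>poly P (1 - 1 / real k)\<bar> \<le> exp (2 * real C) * (1 / real k) ^ n" if k: "2 \<le> k" for k
  proof -
    define t where "t = 1 - 1 / real k"
    have t: "0 < t" "t < 1" using k by (simp_all add: t_def)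
    define H where "H = suminf (\<lambda>p. real (h p) * t ^ p)"
    have "exp (- (2 * real C)) = exp (- 2) ^ C" by (simp add: exp_of_nat_mult[symmetric] mult.commute)
    also have "\<dots> \<le> (t ^ k) ^ C" unfolding t_def by (intro power_mono one_minus_inverse_power k) simp
    finally have e: "exp (- (2 * real C)) \<le> t ^ (C * k)" by (simp only: power_mult[symmetric] mult.commute)
    have "exp (- (2 * real C)) * real k ^ n \<le> t ^ (C * k) * real (\<Sum>p\<le>C * k. h p)"
      using e lower[of k] t by (intro mult_mono) (simp_all flip: of_nat_power of_nat_sum)
    also have "\<dots> \<le> (\<Sum>p\<le>C * k. real (h p) * t ^ p)"
      unfolding of_nat_sum sum_distrib_left
      using t by (intro sum_mono) (simp add: mult.commute mult_left_mono power_decreasing)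
    also have "\<dots> \<le> H"
      unfolding H_def using t by (intro sum_le_suminf summable_polynomial_growth[OF upper]) auto
    finally have H: "exp (- (2 * real C)) * real k ^ n \<le> H" .
    have k0: "0 < exp (- (2 * real C)) * real k ^ n" using k by simp
    have H0: "0 < H" using H k0 by linarith
    have "poly P t * H = 1" unfolding H_def by (rule prod[OF t])
    hence "poly P t = 1 / H" using H0 by (simp add: field_simps)
    hence "\<bar>poly P t\<bar> = 1 / H" using H0 by simp
    also have "\<dots> \<le> 1 / (exp (- (2 * real C)) * real k ^ n)" using H k0 H0 by (intro divide_left_mono) auto
    also have "\<dots> = exp (2 * real C) * (1 / real k) ^ n" by (simp add: exp_minus field_simps power_one_over)
    finally show ?thesis by (simp add: t_def)
  qed
  \<comment> \<open>Substituting \<open>1 - X\<close> moves the point 1 to 0, where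
    \<open>poly_vanishing_order\<close> applies; the same substitution leads back.\<close>
  define R where "R = pcompose P [:1, - 1:]"
  obtain r where r: "R = Polynomial.monom 1 n * r"
    using poly_vanishing_order[of R "exp (2 * real C)" n] bound by (auto simp: R_def poly_pcompose)
  have P: "P = pcompose R [:1, - 1:]"
    unfolding R_def pcompose_assoc[symmetric] by (simp add: pcompose_pCons)
  have "Polynomial.degree P \<le> n" unfolding P_def by (intro degree_sum_le) (auto intro: Polynomial.degree_monom_le order_trans)
  hence "Polynomial.degree R \<le> n" by (simp add: R_def degree_pcompose)
  moreover have "R \<noteq> 0" using P cP[of 0] start by (auto simp: q_def)
  hence "Polynomial.degree R = n + Polynomial.degree r" unfolding r by (subst degree_mult_eq) (auto simp: Polynomial.degree_monom_eq)
  ultimately have "Polynomial.degree r = 0" by simp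
  then obtain c where c: "r = [:c:]" using degree_eq_zeroE by blast
  have "P = Polynomial.smult c ([:1, - 1:] ^ n)"
    by (rule poly_eq_poly_eq_iff[THEN iffD1], rule ext) (simp add: P r c poly_pcompose poly_monom)
  hence qi: "q i = c * Polynomial.coeff ([:1, - 1:] ^ n) i" for i using cP by simp
  \<comment> \<open>The degree bound has made the cofactor a constant; the constant coefficient
    \<open>b 0 = 1\<close> fixes it.\<close>
  have "c = 1" using qi[of 0] start by (simp add: q_def coeff_linear_poly_power)
  show ?thesis
  proof (cases "i \<le> n")
    case True
    have "(- 1) ^ i * real (b i) = real (n choose i) * (- 1) ^ i"
      using qi[of i] True \<open>c = 1\<close> by (simp add: q_def coeff_linear_poly_power)
    hence "real (b i) = real (n choose i)" by (simp add: mult.commute[of "(- 1) ^ i"])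
    thus ?thesis by simp
  next
    case False
    thus ?thesis using vanish[of i] by (simp add: binomial_eq_0)
  qed
qed

lemma coeff_binomial_fps: "fps_nth ((1 + fps_X :: 'r::comm_ring_1 fps) ^ n) i = of_nat (n choose i)"
proof (induction n arbitrary: i)
  case 0
  show ?case by (cases i) auto
next
  case (Suc n)
  show ?case using Suc by (cases i) (simp_all add: distrib_right fps_add_nth algebra_simps)
qed

subsection \<open>The growth of a Koszul skew PBW extension\<close>

locale koszul_pbw = koszul_presentation m I \<epsilon> \<phi> \<iota> + P: skew_pbw_algebra \<epsilon> \<iota> n x
  for m :: nat and I :: "'k::field free_algebra set" and \<epsilon> :: "'a::ring_1 \<Rightarrow> 'k" and \<phi> \<iota> n x
begin

definition Fil :: "nat \<Rightarrow> 'a set" where "Fil N = VA.span (\<Union>p\<le>N. G p)"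

lemma Fil_mono: "N \<le> N' \<Longrightarrow> Fil N \<subseteq> Fil N'"
  unfolding Fil_def by (rule VA.span_mono) fastforce

lemma Fil_zero: "0 \<in> Fil N"
  unfolding Fil_def by (rule VA.span_zero)

lemma Fil_add: "a \<in> Fil N \<Longrightarrow> b \<in> Fil N \<Longrightarrow> a + b \<in> Fil N"
  unfolding Fil_def by (rule VA.span_add)

lemma Fil_scale: "a \<in> Fil N \<Longrightarrow> \<iota> c * a \<in> Fil N"
  using VA.span_scale[of a "\<Union>p\<le>N. G p" c] unfolding Fil_def scale_alg_def .

lemma Fil_mult_G:
  assumes "a \<in> G p" "p \<le> N" "b \<in> Fil M"
  shows "a * b \<in> Fil (N + M)"
proof -
  have b: "b \<in> VA.span (\<Union>p\<le>M. G p)" using assms(3) unfolding Fil_def .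
  have "VA.subspace {b. a * b \<in> Fil (N + M)}"
    unfolding VA.subspace_def
    by (simp add: Fil_zero Fil_add Fil_scale distrib_left scale_alg_def P.mult_iota)
  moreover have "a * b' \<in> Fil (N + M)" if b': "b' \<in> (\<Union>p\<le>M. G p)" for b'
  proof -
    obtain p' where p': "p' \<le> M" "b' \<in> G p'" using b' by blast
    have "p + p' \<le> N + M" using assms(2) p'(1) by simp
    hence "a * b' \<in> (\<Union>p\<le>N + M. G p)" using G_mult[OF assms(1) p'(2)] by blast
    thus ?thesis unfolding Fil_def by (rule VA.span_base)
  qed
  ultimately show ?thesis by (rule VA.span_induct[OF b, where P = "\<lambda>b. a * b \<in> Fil (N + M)"])
qed

lemma Fil_mult:
  assumes "a \<in> Fil N" "b \<in> Fil M"
  shows "a * b \<in> Fil (N + M)"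
proof -
  have a: "a \<in> VA.span (\<Union>p\<le>N. G p)" using assms(1) unfolding Fil_def .
  have "VA.subspace {a. a * b \<in> Fil (N + M)}"
    unfolding VA.subspace_def
    by (simp add: Fil_zero Fil_add Fil_scale distrib_right scale_alg_def mult.assoc)
  moreover have "a' * b \<in> Fil (N + M)" if a': "a' \<in> (\<Union>p\<le>N. G p)" for a'
  proof -
    obtain p where "p \<le> N" "a' \<in> G p" using a' by blast
    thus ?thesis using assms(2) by (intro Fil_mult_G)
  qed
  ultimately show ?thesis by (rule VA.span_induct[OF a, where P = "\<lambda>a. a * b \<in> Fil (N + M)"])
qed

lemma Fil_exhaustive: "\<exists>N. a \<in> Fil N"
proof -
  obtain p where p: "p \<in> free_alg m" "\<phi> p = a" using phi_surj by blast
  obtain M where M: "p = (\<Sum>d<M. part d p)" by (rule sum_part)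
  have h: "part d p \<in> free_homogeneous m d" for d by (rule part_in_homogeneous[OF p(1)])
  have "a = \<phi> (\<Sum>d<M. part d p)" unfolding p(2)[symmetric] by (rule arg_cong[OF M])
  also have "\<dots> = (\<Sum>d<M. \<phi> (part d p))"
    by (rule phi_sum) (use h in \<open>auto simp: free_homogeneous_def\<close>)
  also have "\<dots> \<in> Fil M"
    unfolding Fil_def
  proof (intro VA.span_sum VA.span_base)
    fix d assume "d \<in> {..<M}"
    thus "\<phi> (part d p) \<in> (\<Union>p\<le>M. G p)" using h unfolding G_def by (intro UN_I[of d]) auto
  qed
  finally show ?thesis by blast
qed

lemma G_basis: "\<exists>B. finite B \<and> G d \<subseteq> VA.span B \<and> card B = hdim d"
proof -
  obtain B where B: "B \<subseteq> G d" "VA.independent B" "G d \<subseteq> VA.span B" "card B = VA.dim (G d)"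
    by (rule VA.basis_exists)
  have "B \<subseteq> VA.span ((\<lambda>v. \<phi> (mono v)) ` words m d)" using B(1) G_span by blast
  hence "finite B" using VA.independent_span_bound[OF finite_imageI[OF finite_words] B(2)] by blast
  thus ?thesis using B by (auto simp: hdim_def)
qed

lemma Fil_spanning: "\<exists>B. finite B \<and> Fil N \<subseteq> VA.span B \<and> card B \<le> (\<Sum>p\<le>N. hdim p)"
proof -
  obtain B where B: "\<And>d. finite (B d)" "\<And>d. G d \<subseteq> VA.span (B d)" "\<And>d. card (B d) = hdim d"
    using G_basis by metis
  let ?B = "\<Union>p\<le>N. B p"
  have "VA.span (B p) \<subseteq> VA.span ?B" if "p \<le> N" for p
    by (rule VA.span_mono) (use that in blast)
  hence "(\<Union>p\<le>N. G p) \<subseteq> VA.span ?B" using B(2) by blast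
  hence "Fil N \<subseteq> VA.span ?B" unfolding Fil_def by (intro VA.span_minimal VA.subspace_span)
  moreover have "card ?B \<le> (\<Sum>p\<le>N. hdim p)" using card_UN_le[of "{..N}" B] by (simp add: B(3))
  moreover have "finite ?B" using B(1) by blast
  ultimately show ?thesis by blast
qed

lemma std_inj: "inj_on P.std P.MS"
proof (rule inj_onI)
  fix M M' assume M: "M \<in> P.MS" "M' \<in> P.MS" "P.std M = P.std M'"
  have "P.cf (P.std M) M = 1" using P.cf_single[OF M(1), of 1] by (simp add: P.iota_one)
  moreover have "P.cf (P.std M') M = (if M = M' then 1 else 0)" using P.cf_single[OF M(2), of 1] by (simp add: P.iota_one)
  ultimately show "M = M'" using M(3) by (auto split: if_splits)
qed

lemma std_independent:
  assumes A: "finite A" "A \<subseteq> P.MS"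
  shows "VA.independent (P.std ` A)"
proof (rule VA.independent_if_scalars_zero)
  show "finite (P.std ` A)" using A by simp
  fix f z assume s: "(\<Sum>z\<in>P.std ` A. scale_alg (f z) z) = 0" and z: "z \<in> P.std ` A"
  obtain M where M: "M \<in> A" "z = P.std M" using z by blast
  have "(\<Sum>M\<in>A. \<iota> (f (P.std M)) * P.std M) = 0"
    using s sum.reindex[OF inj_on_subset[OF std_inj A(2)], of "\<lambda>z. scale_alg (f z) z"]
    by (simp add: scale_alg_def comp_def)
  hence "0 = P.cf (\<Sum>M\<in>A. \<iota> (f (P.std M)) * P.std M) M" by (simp only: P.cf_zero)
  also have "\<dots> = (\<Sum>M'\<in>A. if M = M' then f (P.std M) else 0)"
    unfolding P.cf_sum by (intro sum.cong refl) (use A in \<open>auto simp: P.cf_single\<close>)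
  also have "\<dots> = f z" using M A(1) by simp
  finally show "f z = 0" ..
qed

lemma wd_Fil:
  assumes d: "\<And>i. i < n \<Longrightarrow> x i \<in> Fil d"
  shows "set xs \<subseteq> {..<n} \<Longrightarrow> P.wd xs \<in> Fil (d * length xs)"
proof (induction xs)
  case Nil
  have "1 \<in> G 0"
    unfolding G_def using phi_one by (intro image_eqI[of _ _ 1]) (auto simp: free_homogeneous_iff free_alg_one lookup_one when_def)
  hence "1 \<in> Fil 0" unfolding Fil_def by (intro VA.span_base) simp
  thus ?case by (simp add: P.wd_Nil)
next
  case (Cons i xs)
  have "x i * P.wd xs \<in> Fil (d + d * length xs)" using Cons d by (intro Fil_mult) auto
  thus ?case by (simp add: P.wd_Cons)
qed

text \<open>The \<open>k ^ n\<close> standard monomials with all exponents below \<open>k\<close>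
  are independent. If \<open>d\<close> bounds the Koszul degrees occurring in the variables, they
  all lie in filtration degree \<open>d * n * k\<close>, whose dimension is at most the sum of the
  \<open>hdim p\<close>.\<close>

lemma hdim_lower: "\<exists>C. \<forall>k. k ^ n \<le> (\<Sum>p\<le>C * k. hdim p)"
proof -
  define d0 where "d0 i = (SOME N. x i \<in> Fil N)" for i
  have d0: "x i \<in> Fil (d0 i)" for i unfolding d0_def by (rule someI_ex[OF Fil_exhaustive])
  \<comment> \<open>The sum serves as a common bound for the degrees of the finitely many
    variables.\<close>
  define d where "d = (\<Sum>i<n. d0 i)"
  have d: "x i \<in> Fil d" if "i < n" for i
  proof -
    have "d0 i \<le> d" unfolding d_def using that by (intro member_le_sum) auto
    thus ?thesis using d0[of i] Fil_mono by blast
  qed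
  have "k ^ n \<le> (\<Sum>p\<le>(d * n) * k. hdim p)" for k
  proof -
    let ?L = "{\<alpha>. set \<alpha> \<subseteq> {..<k} \<and> length \<alpha> = n}"
    define A where "A = P.unexpo ` ?L"
    have inj: "inj_on P.unexpo ?L" by (rule inj_on_inverseI[of _ P.expo]) (simp add: P.expo_unexpo)
    have cA: "card A = k ^ n" unfolding A_def card_image[OF inj] using card_lists_length_eq[of "{..<k}" n] by simp
    have fA: "finite A" unfolding A_def using finite_lists_length_eq[of "{..<k}" n] by simp
    have AM: "A \<subseteq> P.MS" unfolding A_def using P.unexpo_MS by blast
    have "P.std M \<in> Fil ((d * n) * k)" if MA: "M \<in> A" for M
    proof -
      obtain \<alpha> where \<alpha>': "M = P.unexpo \<alpha>" "\<alpha> \<in> ?L" using MA unfolding A_def by (rule imageE)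
      hence \<alpha>: "set \<alpha> \<subseteq> {..<k}" "length \<alpha> = n" "M = P.unexpo \<alpha>" by simp_all
      have M: "set_mset M \<subseteq> {..<n}" using AM MA by blast
      have "size M = (\<Sum>j\<in>set_mset M. count M j)" by (simp add: size_multiset_overloaded_eq)
      also have "\<dots> \<le> (\<Sum>j\<in>{..<n}. count M j)" by (rule sum_mono2) (use M in auto)
      also have "\<dots> \<le> (\<Sum>j\<in>{..<n}. k)"
      proof (rule sum_mono)
        fix j assume j: "j \<in> {..<n}"
        hence "\<alpha> ! j \<in> set \<alpha>" using \<alpha>(2) by simp
        hence "\<alpha> ! j < k" using \<alpha>(1) by blast
        thus "count M j \<le> k" using j by (simp add: \<alpha>(3) P.count_unexpo)
      qed
      finally have "d * size M \<le> (d * n) * k" by simp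
      moreover have "P.std M \<in> Fil (d * size M)"
        using wd_Fil[OF d, of "sorted_list_of_multiset M"] M by (simp add: P.std_def P.size_sorted)
      ultimately show ?thesis using Fil_mono by blast
    qed
    hence sub: "P.std ` A \<subseteq> Fil ((d * n) * k)" by blast
    obtain B where B: "finite B" "Fil ((d * n) * k) \<subseteq> VA.span B" "card B \<le> (\<Sum>p\<le>(d * n) * k. hdim p)"
      using Fil_spanning by blast
    have "card (P.std ` A) \<le> card B"
      using VA.independent_span_bound[OF B(1) std_independent[OF fA AM]] sub B(2) by blast
    moreover have "card (P.std ` A) = k ^ n" using card_image[OF inj_on_subset[OF std_inj AM]] cA by simp
    ultimately show ?thesis using B(3) by simp
  qed
  thus ?thesis by blast
qed

section \<open>The upper bound for the growth, from the degree in the variables\<close>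

lemma low_mult:
  assumes "a \<in> P.low (Suc N)" "b \<in> P.low (Suc N')"
  shows "a * b \<in> P.low (Suc (N + N'))"
proof -
  have "a * b = (\<Sum>M | P.cf a M \<noteq> 0. \<iota> (P.cf a M) * (P.std M * b))"
    using arg_cong[OF P.cf_expand'[of a], of "\<lambda>z. z * b"] unfolding sum_distrib_right mult.assoc .
  also have "\<dots> \<in> P.low (Suc (N + N'))"
  proof (intro P.low_sum P.low_scale)
    fix M assume "M \<in> {M. P.cf a M \<noteq> 0}"
    hence nz: "P.cf a M \<noteq> 0" by simp
    have M: "M \<in> P.MS" "size M \<le> N" using P.cf_support_MS nz assms(1) unfolding P.low_def by (blast, auto)
    show "P.std M * b \<in> P.low (Suc (N + N'))"
      unfolding P.low_def
    proof (intro CollectI allI impI)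
      fix R assume "P.cf (P.std M * b) R \<noteq> 0"
      then obtain M' where M': "P.cf b M' \<noteq> 0" "R = M + M' \<or> size R < size M + size M'"
        using P.cf_mult_support[OF M(1)] by blast
      have "size M' < Suc N'" using assms(2) M'(1) unfolding P.low_def by simp
      thus "size R < Suc (N + N')" using M'(2) M(2) by auto
    qed
  qed
  finally show ?thesis .
qed

lemma low_exhaustive: "\<exists>N. a \<in> P.low (Suc N)"
proof -
  obtain k where "\<forall>j\<in>size ` {M. P.cf a M \<noteq> 0}. j < k"
    using finite_nat_set_iff_bounded P.cf_finite by (metis finite_imageI)
  hence "a \<in> P.low (Suc k)" unfolding P.low_def by (auto simp: less_Suc_eq)
  thus ?thesis by blast
qed

lemma low_card: "card {M \<in> P.MS. size M \<le> N} \<le> (N + 1) ^ n" "finite {M \<in> P.MS. size M \<le> N}"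
proof -
  let ?S = "{M \<in> P.MS. size M \<le> N}"
  let ?L = "{\<alpha>. set \<alpha> \<subseteq> {..<N + 1} \<and> length \<alpha> = n}"
  have inj: "inj_on P.expo ?S" by (rule inj_on_inverseI[of _ P.unexpo]) (simp add: P.unexpo_expo)
  have sub: "P.expo ` ?S \<subseteq> ?L"
  proof
    fix \<alpha> assume "\<alpha> \<in> P.expo ` ?S"
    then obtain M where M: "size M \<le> N" "\<alpha> = P.expo M" by blast
    have "count M i < N + 1" for i using M(1) count_le_size[of M i] by linarith
    thus "\<alpha> \<in> ?L" unfolding M(2) P.expo_def by auto
  qed
  have fin: "finite ?L" using finite_lists_length_eq[of "{..<N + 1}" n] by simp
  show "card ?S \<le> (N + 1) ^ n"
    using card_inj_on_le[OF inj sub fin] card_lists_length_eq[of "{..<N + 1}" n] by simp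
  show "finite ?S" using finite_imageD[OF finite_subset[OF sub fin] inj] .
qed

lemma low_span: "P.low (Suc N) \<subseteq> VA.span (P.std ` {M \<in> P.MS. size M \<le> N})"
proof
  fix a assume a: "a \<in> P.low (Suc N)"
  have "(\<Sum>M | P.cf a M \<noteq> 0. scale_alg (P.cf a M) (P.std M)) \<in> VA.span (P.std ` {M \<in> P.MS. size M \<le> N})"
  proof (intro VA.span_sum VA.span_scale VA.span_base imageI)
    fix M assume M: "M \<in> {M. P.cf a M \<noteq> 0}"
    thus "M \<in> {M \<in> P.MS. size M \<le> N}" using a P.cf_support_MS[of a] unfolding P.low_def by auto
  qed
  thus "a \<in> VA.span (P.std ` {M \<in> P.MS. size M \<le> N})" using P.cf_expand'[of a] by (simp add: scale_alg_def)
qed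

lemma low_subspace: "VA.subspace (P.low N)"
  unfolding VA.subspace_def scale_alg_def using P.low_zero P.low_add P.low_scale by blast

text \<open>The comparison runs in the opposite direction: the Koszul generators have bounded degree
  \<open>e\<close> in the variables, so products of \<open>p\<close> of them are spanned by standard
  monomials of size at most \<open>e * p\<close>, of which there are at most
  \<open>(e * p + 1) ^ n\<close>. The bound is needed for convergence on the interval from 0 to
  1.\<close>

lemma hdim_upper: "\<exists>e. \<forall>p. hdim p \<le> (e * p + 1) ^ n"
proof -
  let ?g = "\<lambda>i. \<phi> (mono (Word [i]))"
  define e0 where "e0 i = (SOME N. ?g i \<in> P.low (Suc N))" for i
  have e0: "?g i \<in> P.low (Suc (e0 i))" for i unfolding e0_def by (rule someI_ex[OF low_exhaustive])
  define e where "e = (\<Sum>i<m. e0 i)"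
  have g: "?g i \<in> P.low (Suc e)" if "i < m" for i
  proof -
    have "e0 i \<le> e" unfolding e_def using that by (intro member_le_sum) auto
    thus ?thesis using P.low_mono[OF _ e0[of i]] by simp
  qed
  have w: "\<phi> (mono (Word xs)) \<in> P.low (Suc (e * length xs))" if "set xs \<subseteq> {..<m}" for xs
    using that
  proof (induction xs)
    case Nil
    have "mono (Word []) = (1 :: 'k free_algebra)" by (simp add: mono_def zero_free_monoid_def[symmetric])
    moreover have "1 \<in> P.low (Suc 0)" using P.std_low[of "{#}" "Suc 0"] by (simp add: P.std_def P.wd_Nil)
    ultimately show ?case by (simp add: phi_one)
  next
    case (Cons i xs)
    have "mono (Word (i # xs)) = mono (Word [i]) * (mono (Word xs) :: 'k free_algebra)"
      unfolding mono_plus[symmetric] by (simp add: plus_free_monoid_def)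
    hence "\<phi> (mono (Word (i # xs))) = ?g i * \<phi> (mono (Word xs))"
      using Cons.prems by (simp add: phi_mult[OF free_alg_mono[OF mono_exists] free_alg_mono[OF mono_exists]])
    moreover have "?g i * \<phi> (mono (Word xs)) \<in> P.low (Suc (e + e * length xs))"
      using Cons g by (intro low_mult) auto
    ultimately show ?case by simp
  qed
  have "hdim p \<le> (e * p + 1) ^ n" for p
  proof -
    have "(\<lambda>v. \<phi> (mono v)) ` words m p \<subseteq> P.low (Suc (e * p))"
    proof
      fix a assume "a \<in> (\<lambda>v. \<phi> (mono v)) ` words m p"
      then obtain v where v: "v \<in> words m p" "a = \<phi> (mono v)" by blast
      thus "a \<in> P.low (Suc (e * p))" using w[of "letters v"] words_len[OF v(1)] by (simp add: words_def)
    qed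
    hence "G p \<subseteq> P.low (Suc (e * p))" using G_span VA.span_minimal[OF _ low_subspace] by blast
    hence "G p \<subseteq> VA.span (P.std ` {M \<in> P.MS. size M \<le> e * p})" using low_span by blast
    hence "hdim p \<le> card (P.std ` {M \<in> P.MS. size M \<le> e * p})"
      unfolding hdim_def by (rule VA.dim_le_card) (use low_card(2) in blast)
    also have "\<dots> \<le> card {M \<in> P.MS. size M \<le> e * p}" by (rule card_image_le[OF low_card(2)])
    also have "\<dots> \<le> (e * p + 1) ^ n" by (rule low_card(1))
    finally show ?thesis .
  qed
  thus ?thesis by blast
qed

text \<open>The two resolutions meet here: the one indexed by subsets forces
  \<open>kdim i = 0\<close> beyond \<open>n\<close>, the Koszul one supplies the Euler relation, and
  the growth bounds do the rest.\<close>

theorem kdim_binomial: "kdim i = n choose i"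
proof -
  obtain C where C: "\<And>k. k ^ n \<le> (\<Sum>p\<le>C * k. hdim p)" using hdim_lower by blast
  obtain e where e: "\<And>p. hdim p \<le> (e * p + 1) ^ n" using hdim_upper by blast
  obtain PR :: "('a, 'k, nat set \<Rightarrow> 'a) resolution" where PR: "free_resolution \<epsilon> PR" "\<And>i. n < i \<Longrightarrow> obj PR i = {0}"
    using P.pbw_resolution by blast
  have "aug_resolution \<epsilon> PR" by (intro aug_resolution.intro aug_resolution_axioms.intro augmented_axioms PR(1))
  hence van: "kdim i = 0" if "n < i" for i using Ext_koszul(4) PR(2)[OF that] by blast
  show ?thesis by (rule alternating_inverse_series[OF koszul_euler kdim_0 hdim_0 van C e])
qed

end

subsection \<open>The augmentation of a graded algebra\<close>

locale graded_over =
  fixes \<iota> :: "'k::field \<Rightarrow> 'a::ring_1" and H :: "nat \<Rightarrow> 'a set"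
  assumes hom: "ring_hom_1 \<iota>" and central: "\<iota> c * a = a * \<iota> c"
    and graded: "connected_graded (algebra_over \<iota>) H"
begin

lemma iota_add: "\<iota> (a + b) = \<iota> a + \<iota> b" and iota_mult: "\<iota> (a * b) = \<iota> a * \<iota> b" and iota_one: "\<iota> 1 = 1"
  using hom unfolding ring_hom_1_def by blast+

lemma iota_zero: "\<iota> 0 = 0"
  using iota_add[of 0 0] by simp

lemma iota_diff: "\<iota> (a - b) = \<iota> a - \<iota> b"
  using iota_add[of "a - b" b] by (simp add: algebra_simps)

lemma iota_eq_0: "\<iota> c = 0 \<Longrightarrow> c = 0"
proof (rule ccontr)
  assume "\<iota> c = 0" "c \<noteq> 0"
  hence "\<iota> 1 = 0" using iota_mult[of "inverse c" c] by simp
  thus False by (simp add: iota_one)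
qed

lemma abelian_over: "abelian_monoid (algebra_over \<iota>)"
  by (rule abelian_monoidI) (simp_all add: algebra_over_def ac_simps)

lemma finsum_over: "finite A \<Longrightarrow> (\<Oplus>\<^bsub>algebra_over \<iota>\<^esub>i\<in>A. h i) = (\<Sum>i\<in>A. h i)"
proof (induction A rule: finite_induct)
  case empty
  show ?case using abelian_monoid.finsum_empty[OF abelian_over] by (simp add: algebra_over_def)
next
  case (insert i A)
  show ?case
    using insert abelian_monoid.finsum_insert[OF abelian_over insert.hyps(1,2), of h]
    by (simp add: algebra_over_def)
qed

lemma component_subspace: "VectorSpace.subspace class_ring (H i) (algebra_over \<iota>)"
  using graded unfolding connected_graded_def by blast

lemma component_zero: "0 \<in> H i" and component_add: "a \<in> H i \<Longrightarrow> b \<in> H i \<Longrightarrow> a + b \<in> H i"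
  using component_subspace[of i] unfolding VectorSpace.subspace_def submodule_def
  by (auto simp: algebra_over_def class_ring_simps)

lemma component_mult: "a \<in> H i \<Longrightarrow> b \<in> H j \<Longrightarrow> a * b \<in> H (i + j)"
  using graded unfolding connected_graded_def by (simp add: algebra_over_def)

lemma component_0: "H 0 = range \<iota>"
  using graded unfolding connected_graded_def by (simp add: algebra_over_def)

lemma component_sum: "(\<And>i. i \<in> A \<Longrightarrow> f i \<in> H d) \<Longrightarrow> sum f A \<in> H d"
  by (induction A rule: infinite_finite_induct) (auto intro: component_zero component_add)

lemma decomposition_ex1:
  "\<exists>!h. (\<forall>i. h i \<in> H i) \<and> finite {i. h i \<noteq> 0} \<and> a = (\<Sum>i | h i \<noteq> 0. h i)"
proof -
  have "\<exists>!h. (\<forall>i. h i \<in> H i) \<and> finite {i. h i \<noteq> 0} \<and>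
      a = (\<Oplus>\<^bsub>algebra_over \<iota>\<^esub>i\<in>{i. h i \<noteq> 0}. h i)"
    using graded unfolding connected_graded_def by (simp add: algebra_over_def)
  moreover have "(\<forall>i. h i \<in> H i) \<and> finite {i. h i \<noteq> 0} \<and> a = (\<Oplus>\<^bsub>algebra_over \<iota>\<^esub>i\<in>{i. h i \<noteq> 0}. h i) \<longleftrightarrow>
      (\<forall>i. h i \<in> H i) \<and> finite {i. h i \<noteq> 0} \<and> a = (\<Sum>i | h i \<noteq> 0. h i)" for h
    using finsum_over[of "{i. h i \<noteq> 0}" h] by (cases "finite {i. h i \<noteq> 0}") simp_all
  ultimately show ?thesis by (simp only:)
qed

lemma decomposition: "\<exists>h N. (\<forall>i. h i \<in> H i) \<and> a = (\<Sum>i\<le>N. h i)"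
proof -
  obtain h where h: "\<forall>i. h i \<in> H i" "finite {i. h i \<noteq> 0}" "a = (\<Sum>i | h i \<noteq> 0. h i)"
    using decomposition_ex1[of a] by blast
  obtain N where N: "\<forall>i\<in>{i. h i \<noteq> 0}. i < N" using h(2) finite_nat_set_iff_bounded by blast
  have "a = (\<Sum>i\<le>N. h i)" unfolding h(3) using N by (intro sum.mono_neutral_left) auto
  thus ?thesis using h(1) by blast
qed

lemma component_direct:
  assumes "\<And>i. h i \<in> H i" "(\<Sum>i\<le>N. h i) = 0" "d \<le> N"
  shows "h d = 0"
proof -
  define g where "g i = (if i \<le> N then h i else 0)" for i
  have g: "\<forall>i. g i \<in> H i" using assms(1) component_zero by (simp add: g_def)
  have sub: "{i. g i \<noteq> 0} \<subseteq> {..N}" by (auto simp: g_def)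
  have "(\<Sum>i | g i \<noteq> 0. g i) = (\<Sum>i\<le>N. g i)" by (rule sum.mono_neutral_left) (use sub in auto)
  also have "\<dots> = 0" using assms(2) by (simp add: g_def)
  finally have gs: "0 = (\<Sum>i | g i \<noteq> 0. g i)" ..
  have "finite {i. g i \<noteq> 0}" using sub finite_subset by blast
  hence 1: "(\<forall>i. g i \<in> H i) \<and> finite {i. g i \<noteq> 0} \<and> 0 = (\<Sum>i | g i \<noteq> 0. g i)" using g gs by blast
  define D where "D h \<longleftrightarrow> (\<forall>i. h i \<in> H i) \<and> finite {i. h i \<noteq> 0} \<and> 0 = (\<Sum>i | h i \<noteq> 0. h i)" for h
  have "\<exists>!h. D h" unfolding D_def by (rule decomposition_ex1)
  moreover have "D g" unfolding D_def by (rule 1)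
  moreover have "D (\<lambda>i. 0)" unfolding D_def using component_zero by simp
  ultimately have "g = (\<lambda>i. 0)" by blast
  hence "g d = 0" by (rule fun_cong)
  thus ?thesis using assms(3) by (simp add: g_def)
qed

section \<open>The augmentation ideal of a connected grading and the augmentation map\<close>

definition positive :: "'a set" where
  "positive = {(\<Sum>p=1..N. h p) | (N::nat) h. \<forall>p. h p \<in> H p}"

lemma positiveI:
  assumes "a \<in> H (Suc d)"
  shows "a \<in> positive"
proof -
  have "a = (\<Sum>p=1..Suc d. if p = Suc d then a else 0)" by (simp add: sum.delta)
  moreover have "\<forall>p. (if p = Suc d then a else 0) \<in> H p" using assms component_zero by simp
  ultimately show ?thesis unfolding positive_def by blast
qed

lemma positive_add:
  assumes "a \<in> positive" "b \<in> positive"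
  shows "a + b \<in> positive"
proof -
  obtain N h where h: "a = (\<Sum>p=1..N. h p)" "\<forall>p. h p \<in> H p" using assms(1) unfolding positive_def by blast
  obtain N' h' where h': "b = (\<Sum>p=1..N'. h' p)" "\<forall>p. h' p \<in> H p" using assms(2) unfolding positive_def by blast
  define g where "g p = (if p \<le> N then h p else 0) + (if p \<le> N' then h' p else 0)" for p
  have "a = (\<Sum>p=1..max N N'. if p \<le> N then h p else 0)"
    unfolding h(1) by (rule sum.mono_neutral_cong_left) auto
  moreover have "b = (\<Sum>p=1..max N N'. if p \<le> N' then h' p else 0)"
    unfolding h'(1) by (rule sum.mono_neutral_cong_left) auto
  ultimately have "a + b = (\<Sum>p=1..max N N'. g p)" by (simp add: g_def sum.distrib)
  moreover have "\<forall>p. g p \<in> H p"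
    unfolding g_def using h(2) h'(2) component_zero by (intro allI component_add) simp_all
  ultimately show ?thesis unfolding positive_def by blast
qed

lemma positive_zero: "0 \<in> positive"
  using positiveI[OF component_zero] .

lemma positive_sum: "(\<And>i. i \<in> A \<Longrightarrow> f i \<in> positive) \<Longrightarrow> sum f A \<in> positive"
  by (induction A rule: infinite_finite_induct) (auto intro: positive_zero positive_add)

lemma positive_ideal:
  assumes "a \<in> positive"
  shows "b * a \<in> positive" "a * b \<in> positive"
proof -
  obtain N h where h: "a = (\<Sum>p=1..N. h p)" "\<forall>p. h p \<in> H p" using assms unfolding positive_def by blast
  obtain g M where g: "\<forall>i. g i \<in> H i" "b = (\<Sum>i\<le>M. g i)" using decomposition by blast
  have 1: "g i * h p \<in> positive" "h p * g i \<in> positive" if "p \<in> {1..N}" for i p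
  proof -
    obtain p' where p': "p = Suc p'" using \<open>p \<in> {1..N}\<close> by (cases p) auto
    show "g i * h p \<in> positive"
      by (rule positiveI[of _ "i + p'"]) (use component_mult[of "g i" i "h p" p] g(1) h(2) p' in simp)
    show "h p * g i \<in> positive"
      by (rule positiveI[of _ "p' + i"]) (use component_mult[of "h p" p "g i" i] g(1) h(2) p' in simp)
  qed
  show "b * a \<in> positive" unfolding h(1) g(2) sum_product by (intro positive_sum 1)
  show "a * b \<in> positive" unfolding h(1) g(2) sum_product by (intro positive_sum 1)
qed

lemma positive_iota: "\<iota> c \<in> positive \<Longrightarrow> c = 0"
proof -
  assume "\<iota> c \<in> positive"
  then obtain N h where h: "\<iota> c = (\<Sum>p=1..N. h p)" "\<forall>p. h p \<in> H p" unfolding positive_def by blast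
  define g where "g p = (if p = 0 then \<iota> (- c) else h p)" for p
  have "g p \<in> H p" for p using h(2) component_0 by (simp add: g_def)
  moreover have "(\<Sum>p\<le>N. g p) = 0"
  proof -
    have "(\<Sum>p\<le>N. g p) = g 0 + (\<Sum>p=1..N. g p)"
      by (simp add: atMost_atLeast0 sum.atLeast_Suc_atMost)
    also have "(\<Sum>p=1..N. g p) = \<iota> c" unfolding h(1) by (intro sum.cong refl) (simp add: g_def)
    also have "g 0 + \<iota> c = 0" using iota_add[of "- c" c] by (simp add: g_def iota_zero)
    finally show ?thesis .
  qed
  ultimately have "g 0 = 0" by (rule component_direct) simp
  hence "\<iota> (- c) = 0" by (simp add: g_def)
  hence "- c = 0" by (rule iota_eq_0)
  thus "c = 0" by simp
qed

abbreviation aug_map :: "'a \<Rightarrow> 'k" where "aug_map \<equiv> augmentation \<iota> H"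

lemma positive_diff: "a \<in> positive \<Longrightarrow> b \<in> positive \<Longrightarrow> a - b \<in> positive"
  using positive_add[of a "- 1 * b"] positive_ideal(1)[of b "- 1"] by simp

text \<open>The augmentation ideal meets the scalars only in zero, so the definite description in
  \<open>augmentation\<close> has one solution.\<close>

lemma augmentation_eq: "a - \<iota> c \<in> positive \<Longrightarrow> aug_map a = c"
  unfolding augmentation_def positive_def[symmetric]
proof (rule the_equality)
  fix c' assume c: "a - \<iota> c \<in> positive" "a - \<iota> c' \<in> positive"
  have "\<iota> (c - c') = (a - \<iota> c') - (a - \<iota> c)" by (simp add: iota_diff)
  hence "\<iota> (c - c') \<in> positive" using positive_diff[OF c(2,1)] by simp
  hence "c - c' = 0" by (rule positive_iota)
  thus "c' = c" by simp
qed

lemma augmentation_diff: "a - \<iota> (aug_map a) \<in> positive"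
proof -
  obtain h N where h: "\<forall>i. h i \<in> H i" "a = (\<Sum>i\<le>N. h i)" using decomposition by blast
  obtain c where c: "h 0 = \<iota> c" using h(1) component_0 by blast
  have "a = h 0 + (\<Sum>i=1..N. h i)"
    unfolding h(2) by (simp add: atMost_atLeast0 sum.atLeast_Suc_atMost)
  hence "a - \<iota> c = (\<Sum>i=1..N. h i)" using c by simp
  hence "a - \<iota> c \<in> positive" using h(1) unfolding positive_def by blast
  thus ?thesis using augmentation_eq[of a c] by simp
qed

lemma augmentation_iota: "aug_map (\<iota> c) = c"
  by (rule augmentation_eq) (simp add: positive_zero)

lemma augmentation_positive: "a \<in> positive \<Longrightarrow> aug_map a = 0"
  by (rule augmentation_eq) (simp add: iota_zero)

lemma augmented_augmentation: "augmented aug_map"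
proof
  fix a b
  have "(a + b) - \<iota> (aug_map a + aug_map b) = (a - \<iota> (aug_map a)) + (b - \<iota> (aug_map b))" by (simp add: iota_add)
  thus "aug_map (a + b) = aug_map a + aug_map b"
    using positive_add[OF augmentation_diff augmentation_diff, of a b] by (intro augmentation_eq) (simp only:)
  have "a * b - \<iota> (aug_map a * aug_map b) = (a - \<iota> (aug_map a)) * b + \<iota> (aug_map a) * (b - \<iota> (aug_map b))"
    by (simp add: iota_mult left_diff_distrib right_diff_distrib)
  moreover have "\<dots> \<in> positive" by (intro positive_add positive_ideal augmentation_diff)
  ultimately show "aug_map (a * b) = aug_map a * aug_map b" by (intro augmentation_eq) (simp only:)
  show "aug_map 1 = 1" using augmentation_iota[of 1] by (simp add: iota_one)
qed

text \<open>The generators have degree 1, so \<open>\<phi>\<close> sends words of length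
  \<open>d\<close> into \<open>H d\<close>. Directness of the given grading then makes the kernel
  homogeneous for word length.\<close>

lemma koszul_presentation_augmentation:
  assumes pres: "presentation \<iota> m \<phi>" and gen: "\<And>i. i < m \<Longrightarrow> \<phi> (free_gen i) \<in> H 1"
    and quad: "quadratic_ideal m {p \<in> free_alg m. \<phi> p = 0}"
    and dist: "distributive_lattice (koszul_lattice m {p \<in> free_alg m. \<phi> p = 0})"
  shows "koszul_presentation m {p \<in> free_alg m. \<phi> p = 0} aug_map \<phi> \<iota>"
proof -
  have phi_add: "\<phi> (p + q) = \<phi> p + \<phi> q" and phi_mult: "\<phi> (p * q) = \<phi> p * \<phi> q"
    if "p \<in> free_alg m" "q \<in> free_alg m" for p q using pres that unfolding presentation_def by blast+
  have phi_scalar: "\<phi> (free_scalar c) = \<iota> c" for c using pres unfolding presentation_def by blast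
  have phi_0: "\<phi> 0 = 0" using phi_add[OF free_alg_zero free_alg_zero] by simp
  have phi_sum: "\<phi> (sum f A) = (\<Sum>i\<in>A. \<phi> (f i))" if "\<And>i. i \<in> A \<Longrightarrow> f i \<in> free_alg m" for f and A :: "'i set"
    using that by (induction A rule: infinite_finite_induct) (auto simp: phi_0 phi_add free_alg_sum)
  have phi_1: "\<phi> 1 = 1" using phi_scalar[of 1] by (simp add: free_scalar_def iota_one)
  have word_alg: "(mono w :: 'k free_algebra) \<in> free_alg m" if "set (letters w) \<subseteq> {..<m}" for w
    by (rule free_alg_mono[of w m "len w"]) (use that in \<open>simp add: words_def\<close>)
  have word: "\<phi> (mono (Word xs)) \<in> H (length xs)" if "set xs \<subseteq> {..<m}" for xs
    using that
  proof (induction xs)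
    case Nil
    have "mono (Word []) = (1 :: 'k free_algebra)" by (simp add: mono_def zero_free_monoid_def[symmetric])
    thus ?case using component_0 iota_one by (auto simp: phi_1 intro: range_eqI[of _ _ 1])
  next
    case (Cons i xs)
    have "mono (Word (i # xs)) = mono (Word [i]) * (mono (Word xs) :: 'k free_algebra)"
      unfolding mono_plus[symmetric] by (simp add: plus_free_monoid_def)
    hence "\<phi> (mono (Word (i # xs))) = \<phi> (free_gen i) * \<phi> (mono (Word xs))"
      using Cons.prems
      by (simp add: phi_mult[OF word_alg word_alg]) (simp add: free_gen_def mono_def)
    moreover have "\<phi> (free_gen i) * \<phi> (mono (Word xs)) \<in> H (1 + length xs)"
      using Cons gen by (intro component_mult) auto
    ultimately show ?case by simp
  qed
  have hom_H: "\<phi> p \<in> H d" if p: "p \<in> free_homogeneous m d" for p d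
  proof -
    have "\<phi> p = \<phi> (\<Sum>v\<in>words m d. free_scalar (look p v) * mono v)"
      by (rule arg_cong[OF homogeneous_expand[OF p]])
    also have "\<dots> = (\<Sum>v\<in>words m d. \<phi> (free_scalar (look p v) * mono v))"
      by (rule phi_sum) (intro free_alg_mult free_alg_scalar free_alg_mono)
    also have "\<dots> = (\<Sum>v\<in>words m d. \<iota> (look p v) * \<phi> (mono v))"
      by (intro sum.cong refl) (simp add: phi_mult free_alg_scalar free_alg_mono phi_scalar)
    also have "\<dots> \<in> H d"
    proof (intro component_sum)
      fix v assume v: "v \<in> words m d"
      have "\<phi> (mono v) \<in> H d" using word[of "letters v"] words_len[OF v] v by (simp add: words_def)
      moreover have "\<iota> (look p v) \<in> H 0" using component_0 by blast
      ultimately show "\<iota> (look p v) * \<phi> (mono v) \<in> H d" using component_mult[of _ 0 _ d] by simp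
    qed
    finally show ?thesis .
  qed
  have parts: "\<phi> (part N p) = 0" if p: "p \<in> free_alg m" "\<phi> p = 0" for p N
  proof -
    obtain M where M: "p = (\<Sum>d<M. part d p)" by (rule sum_part)
    have h: "part d p \<in> free_homogeneous m d" for d by (rule part_in_homogeneous[OF p(1)])
    have ha: "part d p \<in> free_alg m" for d using h[of d] by (simp add: free_homogeneous_def)
    \<comment> \<open>The images of the parts of \<open>p\<close> lie in different degrees of
      \<open>H\<close> and add up to zero, so each of them is zero. From \<open>M\<close> on the
      family is padded with zeros.\<close>
    define g where "g d = (if d < M then \<phi> (part d p) else 0)" for d
    have gH: "g d \<in> H d" for d using hom_H[OF h] component_zero by (simp add: g_def)
    have "(\<Sum>d\<le>M. g d) = (\<Sum>d<M. \<phi> (part d p))" by (simp add: g_def lessThan_Suc_atMost[symmetric])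
    also have "\<dots> = \<phi> (\<Sum>d<M. part d p)" by (rule phi_sum[symmetric]) (rule ha)
    also have "\<dots> = 0" using M p(2) by simp
    finally have g0: "(\<Sum>d\<le>M. g d) = 0" .
    show ?thesis
    proof (cases "N < M")
      case True
      hence "g N = 0" by (intro component_direct[OF gH g0]) simp
      thus ?thesis using True by (simp add: g_def)
    next
      case False
      have "part N p = part N (\<Sum>d<M. part d p)" by (rule arg_cong[OF M])
      also have "\<dots> = 0"
        using False by (intro poly_mapping_eqI) (simp add: lookup_sum look_part)
      finally show ?thesis by (simp add: phi_0)
    qed
  qed
  show ?thesis
  proof (intro koszul_presentation.intro koszul_ideal.intro koszul_presentation_axioms.intro augmented_augmentation)
    show "free_ideal m {p \<in> free_alg m. \<phi> p = 0}"
      unfolding free_ideal_def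
      by (auto simp: phi_0 phi_add phi_mult free_alg_zero free_alg_add free_alg_mult)
    show "part N p \<in> {p \<in> free_alg m. \<phi> p = 0}" if "p \<in> {p \<in> free_alg m. \<phi> p = 0}" for p N
      using that parts part_in_homogeneous[of p m N] by (auto simp: free_homogeneous_def)
    show "\<exists>p\<in>free_alg m. \<phi> p = a" for a
      using pres unfolding presentation_def by (metis UNIV_I imageE)
    show "aug_map (\<phi> p) = 0" if "p \<in> free_homogeneous m 1" for p
      using positiveI[of "\<phi> p" 0] hom_H[OF that] by (intro augmentation_positive) simp
  qed (use quad dist phi_add phi_mult phi_scalar augmentation_iota in auto)
qed

end

theorem theorem4p10:
  fixes \<iota> :: "'k::field \<Rightarrow> 'a::ring_1"
    and n :: nat
    and x :: "nat \<Rightarrow> 'a"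
    and G :: "nat \<Rightarrow> 'a set"
    and Q :: "('a, 'k, 'p::ab_group_add) resolution"
  assumes "skew_PBW \<iota> n x"
    and "koszul_algebra \<iota> G"
    and "free_resolution (augmentation \<iota> G) Q"
  shows "(\<forall>i. vectorspace.fin_dim class_ring (Ext (augmentation \<iota> G) Q i)) \<and>
    (\<forall>H H'.
       connected_graded (yoneda_algebra (augmentation \<iota> G) Q) H \<and>
       fin_gen_degree_one (yoneda_algebra (augmentation \<iota> G) Q) H \<and>
       connected_graded (yoneda_algebra (augmentation \<iota> G) Q) H' \<and>
       fin_gen_degree_one (yoneda_algebra (augmentation \<iota> G) Q) H' \<longrightarrow>
       hilbert_series (yoneda_algebra (augmentation \<iota> G) Q) H =
       hilbert_series (yoneda_algebra (augmentation \<iota> G) Q) H') \<and>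
    poincare_series (augmentation \<iota> G) Q = (1 + fps_X) ^ n"
proof -
  interpret gr: graded_over \<iota> G
    by standard (use assms(2) in \<open>unfold koszul_algebra_def, blast+\<close>)
  let ?\<epsilon> = "augmentation \<iota> G"
  obtain m \<phi> where pres: "presentation \<iota> m \<phi>" "\<And>i. i < m \<Longrightarrow> \<phi> (free_gen i) \<in> G 1"
    "quadratic_ideal m {p \<in> free_alg m. \<phi> p = 0}"
    "distributive_lattice (koszul_lattice m {p \<in> free_alg m. \<phi> p = 0})"
    using assms(2) unfolding koszul_algebra_def by blast
  interpret kp: koszul_pbw m "{p \<in> free_alg m. \<phi> p = 0}" ?\<epsilon> \<phi> \<iota> n x
    by (intro koszul_pbw.intro skew_pbw_algebra.intro skew_pbw_algebra_axioms.intro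
        gr.koszul_presentation_augmentation pres gr.augmented_augmentation assms(1) gr.central gr.augmentation_iota)
  have Q: "aug_resolution ?\<epsilon> Q"
    by (intro aug_resolution.intro aug_resolution_axioms.intro gr.augmented_augmentation assms(3))
  interpret cr: central_resolution ?\<epsilon> Q \<iota>
    by (intro central_resolution.intro central_resolution_axioms.intro Q gr.augmentation_iota gr.central)
  \<comment> \<open>The bound is \<open>Suc n\<close> because Ext is still one-dimensional in degree
    \<open>n\<close>.\<close>
  have vanish: "cocycles ?\<epsilon> Q i \<subseteq> coboundaries ?\<epsilon> Q i" if "Suc n \<le> i" for i
    by (rule kp.Ext_koszul(3)[OF Q]) (use that in \<open>simp add: kp.kdim_binomial\<close>)
  have "hilbert_series (yoneda_algebra ?\<epsilon> Q) H = hilbert_series (yoneda_algebra ?\<epsilon> Q) H'"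
    if "connected_graded (yoneda_algebra ?\<epsilon> Q) H \<and> fin_gen_degree_one (yoneda_algebra ?\<epsilon> Q) H \<and>
      connected_graded (yoneda_algebra ?\<epsilon> Q) H' \<and> fin_gen_degree_one (yoneda_algebra ?\<epsilon> Q) H'" for H H'
    using that by (intro cr.yoneda_hilbert_series_unique[where N = "Suc n"] vanish) auto
  moreover have "poincare_series ?\<epsilon> Q = (1 + fps_X) ^ n"
    by (rule fps_ext) (simp add: poincare_series_def kp.Ext_koszul(2)[OF Q] kp.kdim_binomial coeff_binomial_fps)
  ultimately show ?thesis using kp.Ext_koszul(1)[OF Q] by blast
qed

end
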